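(* There is a deterministic MPC algorithm with sublinear memory that solves the $(\mathit{degree}+1)$-list-coloring problem on every graph $G$ with $n$ nodes, $m$ edges and maximum degree $\Delta$ and lists from a color space $[C]$ in $O(\log\Delta\cdot\log C+\log n)$ rounds. (In particular, if $C\le\mathrm{poly}(\Delta)$, the number of rounds is $O(\log^2\Delta+\log n)$.)
   Context: $[C]:=\{0,\dots,C-1\}$. In the $(\mathit{degree}+1)$-list-coloring problem, a graph $G=(V,E)$ and lists $L(v)\subseteq[C]$ with $|L(v)|=\deg(v)+1$ for $v\in V$ are given, and one must compute $\phi:V\to[C]$ with $\phi(v)\in L(v)$ for all $v\in V$ and $\phi(u)\neq\phi(v)$ for all $\{u,v\}\in E$. MPC model: there are $M=\tilde O((n+m)/S)$ machines, each with a memory of $S$ words, where a word has $O(\log n)$ bits, and $\tilde O$ hides $\mathrm{poly}\log n$ factors that can be chosen by the algorithm designer. Sublinear memory means that $S=\tilde O(n^{\alpha})$ for some constant $0<\alpha<1$; the constant $\alpha$ is given by the system and cannot be chosen by the algorithm designer (constants in the $O$-notation may depend on $\alpha$). Concretely, each machine has local memory $S=\Theta(n^\alpha)$ and there are $\Theta((m+n)/S)$ machines, where the constants in $\Theta(\cdot)$ can be chosen by the algorithm designer. The input is distributed adversarially: each edge $\{u,v\}$ is stored (as a pair of node identifiers) on some machine, and for each node $u$ and each $c\in L(u)$ the list entry $(\mathrm{Id}_u,c)$ is stored on some machine. Time proceeds in synchronous rounds; in each round every machine performs arbitrary local computation on its stored data and may send a (different) message to each other machine, such that the total size of all messages sent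 and of all messages received by a machine does not exceed its local memory. At the end, each machine outputs a part of the solution that fits in its memory, i.e., it is responsible for some of the nodes and outputs their colors; all nodes must be covered. The complexity is the number of rounds. Standing assumption: $C\le\mathrm{poly}(n)$, so that a color fits into $O(1)$ words. In asymptotic bounds, logarithmic factors are read as being at least $1$. *)

theory Defs
  imports Complex_Main
begin

section \<open>The (degree+1)-list-coloring problem\<close>

text \<open>Nodes are natural numbers: a node is its own identifier.\<close>

definition simple_graph :: "nat set \<Rightarrow> nat set set \<Rightarrow> bool" where
  "simple_graph V E \<longleftrightarrow> finite V \<and> (\<forall>e\<in>E. e \<subseteq> V \<and> card e = 2)"

definition degree :: "nat set set \<Rightarrow> nat \<Rightarrow> nat" where
  "degree E v = card {e \<in> E. v \<in> e}"

text \<open>The inserted \<open>0\<close> only matters for the graph without nodes.\<close>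

definition max_degree :: "nat set \<Rightarrow> nat set set \<Rightarrow> nat" where
  "max_degree V E = Max (insert 0 (degree E ` V))"

definition degree_plus_one_instance ::
    "nat set \<Rightarrow> nat set set \<Rightarrow> (nat \<Rightarrow> nat set) \<Rightarrow> nat \<Rightarrow> bool" where
  "degree_plus_one_instance V E L C \<longleftrightarrow> simple_graph V E \<and>
     (\<forall>v\<in>V. L v \<subseteq> {..<C} \<and> card (L v) = degree E v + 1)"

definition list_coloring ::
    "nat set \<Rightarrow> nat set set \<Rightarrow> (nat \<Rightarrow> nat set) \<Rightarrow> (nat \<Rightarrow> nat) \<Rightarrow> bool" where
  "list_coloring V E L \<phi> \<longleftrightarrow>
     (\<forall>v\<in>V. \<phi> v \<in> L v) \<and> (\<forall>u v. {u, v} \<in> E \<longrightarrow> \<phi> u \<noteq> \<phi> v)"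

text \<open>Logarithms in asymptotic bounds are read as being at least 1.\<close>

definition lg :: "nat \<Rightarrow> real" where
  "lg x = max 1 (log 2 (real x))"


section \<open>The MPC model\<close>

text \<open>
  Memories and messages are lists of words.  The functions of an algorithm are arbitrary
  (local computation is unrestricted), but they see only the index of the machine, its current
  memory and, for \<open>mpc_update\<close>, the messages just received, indexed by their sender;
  the empty message means that nothing is sent.  The value \<open>None\<close> of \<open>mpc_output\<close> means that the
  machine has not terminated yet.  Termination is thus decided by each machine on its own.
\<close>

type_synonym words = "nat list"

record mpc_algorithm =
  mpc_send :: "nat \<Rightarrow> words \<Rightarrow> nat \<Rightarrow> words"
  mpc_update :: "nat \<Rightarrow> words \<Rightarrow> (nat \<Rightarrow> words) \<Rightarrow> words"
  mpc_output :: "nat \<Rightarrow> words \<Rightarrow> (nat \<times> nat) list option"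

text \<open>
  \<open>mpc_message A mem i j\<close> is the message from \<open>i\<close> to \<open>j\<close> in a round that starts with the
  memories \<open>mem\<close>.  A terminated machine sends nothing and keeps its memory.
\<close>

definition mpc_message :: "mpc_algorithm \<Rightarrow> (nat \<Rightarrow> words) \<Rightarrow> nat \<Rightarrow> nat \<Rightarrow> words" where
  "mpc_message A mem i j =
     (if i = j \<or> mpc_output A i (mem i) \<noteq> None then [] else mpc_send A i (mem i) j)"

definition mpc_round :: "mpc_algorithm \<Rightarrow> nat \<Rightarrow> (nat \<Rightarrow> words) \<Rightarrow> (nat \<Rightarrow> words)" where
  "mpc_round A M mem = (\<lambda>i.
     if mpc_output A i (mem i) \<noteq> None then mem i
     else mpc_update A i (mem i) (\<lambda>j. if j < M then mpc_message A mem j i else []))"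

definition mpc_run :: "mpc_algorithm \<Rightarrow> nat \<Rightarrow> (nat \<Rightarrow> words) \<Rightarrow> nat \<Rightarrow> (nat \<Rightarrow> words)" where
  "mpc_run A M mem t = (mpc_round A M ^^ t) mem"

text \<open>In the following, \<open>M\<close> is the number of machines, \<open>S\<close> the number of words of a local memory
  and \<open>B\<close> the number of bits of a word.\<close>

definition memory_ok :: "nat \<Rightarrow> nat \<Rightarrow> nat \<Rightarrow> (nat \<Rightarrow> words) \<Rightarrow> bool" where
  "memory_ok M S B mem \<longleftrightarrow>
     (\<forall>i<M. length (mem i) \<le> S \<and> (\<forall>w\<in>set (mem i). w < 2 ^ B))"

definition traffic_ok :: "mpc_algorithm \<Rightarrow> nat \<Rightarrow> nat \<Rightarrow> nat \<Rightarrow> (nat \<Rightarrow> words) \<Rightarrow> bool" where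
  "traffic_ok A M S B mem \<longleftrightarrow>
     (\<forall>i<M. \<forall>j<M. \<forall>w\<in>set (mpc_message A mem i j). w < 2 ^ B) \<and>
     (\<forall>i<M. (\<Sum>j<M. length (mpc_message A mem i j)) \<le> S) \<and>
     (\<forall>i<M. (\<Sum>j<M. length (mpc_message A mem j i)) \<le> S)"

text \<open>
  The input items.  An edge is stored as an ordered pair in an arbitrary orientation.
  The first word of the encoding of an item says which kind of pair follows.
\<close>

datatype item = EdgeItem nat nat | ListItem nat nat

fun item_content :: "item \<Rightarrow> nat set + nat \<times> nat" where
  "item_content (EdgeItem u v) = Inl {u, v}"
| "item_content (ListItem u c) = Inr (u, c)"

fun item_words :: "item \<Rightarrow> words" where
  "item_words (EdgeItem u v) = [0, u, v]"
| "item_words (ListItem u c) = [1, u, c]"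

definition initial_memory :: "(nat \<Rightarrow> item list) \<Rightarrow> nat \<Rightarrow> words" where
  "initial_memory inp i = concat (map item_words (inp i))"

text \<open>Every edge and every list entry is stored exactly once, on some machine, such that the
  input on each machine fits into its memory.\<close>

definition input_placement ::
    "nat set \<Rightarrow> nat set set \<Rightarrow> (nat \<Rightarrow> nat set) \<Rightarrow> nat \<Rightarrow> nat \<Rightarrow> (nat \<Rightarrow> item list) \<Rightarrow> bool" where
  "input_placement V E L M S inp \<longleftrightarrow>
     (let items = map item_content (concat (map inp [0..<M]))
      in distinct items \<and> set items = E <+> Sigma V L) \<and>
     (\<forall>i<M. length (initial_memory inp i) \<le> S)"

text \<open>The outputs of all machines together must be the graph of a valid coloring; a pair of a
  node and a color takes two words of the memory.\<close>

definition mpc_final ::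
    "mpc_algorithm \<Rightarrow> nat set \<Rightarrow> nat set set \<Rightarrow> (nat \<Rightarrow> nat set) \<Rightarrow> nat \<Rightarrow> nat \<Rightarrow>
     (nat \<Rightarrow> words) \<Rightarrow> bool" where
  "mpc_final A V E L M S mem \<longleftrightarrow>
     (\<forall>i<M. \<exists>out. mpc_output A i (mem i) = Some out \<and> 2 * length out \<le> S) \<and>
     (\<exists>\<phi>. list_coloring V E L \<phi> \<and>
        (\<Union>i<M. set (the (mpc_output A i (mem i)))) = {(v, \<phi> v) | v. v \<in> V})"

text \<open>The first conjunct excludes resources too small to store the input, for which the
  second one would hold vacuously.\<close>

definition mpc_solves_within ::
    "mpc_algorithm \<Rightarrow> nat set \<Rightarrow> nat set set \<Rightarrow> (nat \<Rightarrow> nat set) \<Rightarrow> nat \<Rightarrow> nat \<Rightarrow> nat \<Rightarrow>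
     real \<Rightarrow> bool" where
  "mpc_solves_within A V E L M S B R \<longleftrightarrow>
     (\<exists>inp. input_placement V E L M S inp) \<and>
     (\<forall>inp. input_placement V E L M S inp \<longrightarrow>
       (\<exists>T. real T \<le> R \<and>
          (\<forall>t\<le>T. memory_ok M S B (mpc_run A M (initial_memory inp) t)) \<and>
          (\<forall>t<T. traffic_ok A M S B (mpc_run A M (initial_memory inp) t)) \<and>
          mpc_final A V E L M S (mpc_run A M (initial_memory inp) T)))"

text \<open>
  Sublinear memory: \<open>S = \<Theta>(n\<^sup>\<alpha>)\<close> words of \<open>O(log n)\<close> bits per machine and
  \<open>\<Theta>((m + n) / S)\<close> machines, where \<open>n\<close> is the number of nodes and \<open>m\<close> the number of edges.
\<close>

definition sublinear_resources ::
    "real \<Rightarrow> (nat \<Rightarrow> nat \<Rightarrow> nat) \<Rightarrow> (nat \<Rightarrow> nat) \<Rightarrow> (nat \<Rightarrow> nat) \<Rightarrow> bool" where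
  "sublinear_resources \<alpha> M S B \<longleftrightarrow>
     (\<exists>a>0. \<exists>b. \<forall>n\<ge>1. a * real n powr \<alpha> \<le> real (S n) \<and> real (S n) \<le> b * real n powr \<alpha>) \<and>
     (\<exists>a>0. \<exists>b. \<forall>n\<ge>1. \<forall>m.
        a * (real (m + n) / real (S n)) \<le> real (M n m) \<and>
        real (M n m) \<le> b * (real (m + n) / real (S n))) \<and>
     (\<exists>b. \<forall>n\<ge>1. real (B n) \<le> b * lg n)"

text \<open>
  \<open>A n m C\<close> is the algorithm run for \<open>n\<close> nodes, \<open>m\<close> edges and color space \<open>{..<C}\<close>; these are
  the only parameters known to all machines.
\<close>

definition mpc_colors_within ::
    "(nat \<Rightarrow> nat \<Rightarrow> nat \<Rightarrow> mpc_algorithm) \<Rightarrow> (nat \<Rightarrow> nat \<Rightarrow> nat) \<Rightarrow> (nat \<Rightarrow> nat) \<Rightarrow>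
     (nat \<Rightarrow> nat) \<Rightarrow> nat set \<Rightarrow> nat set set \<Rightarrow> (nat \<Rightarrow> nat set) \<Rightarrow> nat \<Rightarrow> real \<Rightarrow> bool" where
  "mpc_colors_within A M S B V E L C R \<longleftrightarrow>
     (let n = card V; m = card E
      in mpc_solves_within (A n m C) V E L (M n m) (S n) (B n) R)"

text \<open>\<open>x\<close> is at most a polynomial in \<open>y\<close>; any polynomial is dominated by one of this form, and
  it does not vanish at \<open>y = 0\<close>.\<close>

definition poly_bounded :: "nat \<Rightarrow> nat \<Rightarrow> nat \<Rightarrow> bool" where
  "poly_bounded p y x \<longleftrightarrow> x \<le> p * (y + 1) ^ p"

end

theory Submission
  imports Defs
begin

text \<open>
  In a phase every uncolored node picks a candidate color from a pairwise independent hash family;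
  the nodes without a conflicting neighbor of larger identifier keep it, and the expected number of
  conflicts is so small that a good seed colors at least a quarter of the uncolored nodes.  The seed is
  found by conditional expectations: it has \<open>O(log n)\<close> bits, and since the machines aggregate values in a
  tree of degree \<open>D = \<Theta>(n powr (\<alpha>/4))\<close>, a block of \<open>log D\<close> of its bits is fixed in \<open>O(1)\<close> rounds, so \<open>O(1)\<close> rounds suffice for all.

  A node whose list is spread over several machines fixes its candidate bit by bit, which costs
  \<open>O(log C)\<close> rounds per phase.  After \<open>O(log \<Delta>)\<close> such phases only \<open>O(n / \<Delta>\<^sup>2)\<close> nodes are left; if \<open>\<Delta> \<le> D\<close>, each of
  them moves with all that concerns it to a single machine, offers its free colors to its neighbors, and
  picks whole colors in \<open>O(1)\<close> rounds per phase, for \<open>O(log n)\<close> further phases.  If \<open>\<Delta> > D\<close>, then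
  \<open>log n = O(log \<Delta>)\<close> and the bitwise phases color all nodes.
\<close>

text \<open>A phase works because an uncolored node has more available colors than uncolored
  neighbors: the expected number of ordered conflicts is at most the number of uncolored nodes, and
  a conflict stops only its smaller endpoint. In the bitwise phase the controlled quantity is the
  sum over ordered conflicts \<open>(u, v)\<close> of the reciprocal weight of \<open>u\<close>. A
  bit drawn in proportion to the weights of the two halves does not increase it in expectation, and
  pairwise independence suffices because each summand concerns two nodes. The rounding errors of all
  bits must stay below 1/2, whence hash values of \<open>k\<close> bits with
  \<open>8 * q * card E \<le> 2 ^ k\<close>.

  Two stages are needed because log n bitwise phases would cost log n times log C rounds. Picking
  whole colors requires the available colors of all neighbors on one machine, about the square of
  the degree in words per node; hence the wait until so few nodes are left, and the restriction to
  small degrees.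

  Machines terminate on their own and must agree on the length of the program, which depends on the
  maximum degree. Therefore this number is computed first and kept in every header.\<close>

text \<open>Contents of memories and messages: \<open>Hdr\<close> program counter and maximum degree; \<open>IE\<close>, \<open>IL\<close> input
  items; \<open>Tk\<close> tokens of the sorting routine; \<open>Rv\<close> half edge with its machine, sent to the machine
  where the edge was placed; \<open>LI\<close> list entry; \<open>HE\<close> half edge with the machine of its reverse; \<open>NS\<close> node,
  prefix of its candidate color and status; \<open>NW\<close> node weights; \<open>TI\<close> data of a neighbor; \<open>SW\<close> registers
  of a scan; \<open>Seed\<close> prefix of the seed; \<open>FN\<close> first machine of a node; \<open>NR\<close> rank of a node; and, once each
  node resides on a single machine, \<open>BL\<close> list entry, \<open>BN\<close> neighbor with its machine, \<open>BY\<close> color of a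
  neighbor, \<open>BC\<close> own color, \<open>BX\<close> color available to a neighbor.\<close>

datatype w =
    Hdr nat nat
  | IE nat nat | IL nat nat
  | Tk nat nat nat nat nat
  | Rv nat nat nat
  | LI nat nat | HE nat nat nat
  | NS nat nat nat | NW nat nat nat
  | TI nat nat nat nat nat nat
  | SW nat nat nat nat nat
  | Seed nat
  | FN nat | NR nat nat
  | BL nat nat | BN nat nat nat | BY nat nat nat | BC nat nat | BX nat nat nat

text \<open>All constructors are padded to seven numbers, a tag and at most six arguments, so that
  at most \<open>X ^ 7\<close> words have all entries below \<open>X\<close>. Tags count as entries;
  they stay below 19, and \<open>20 \<le> X\<close> makes room for them.\<close>

fun fields :: "w \<Rightarrow> nat list" where
  "fields (Hdr a b) = [0, a, b, 0, 0, 0, 0]"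
| "fields (IE a b) = [1, a, b, 0, 0, 0, 0]"
| "fields (IL a b) = [2, a, b, 0, 0, 0, 0]"
| "fields (Tk a b c d e) = [3, a, b, c, d, e, 0]"
| "fields (Rv a b c) = [4, a, b, c, 0, 0, 0]"
| "fields (LI a b) = [5, a, b, 0, 0, 0, 0]"
| "fields (HE a b c) = [6, a, b, c, 0, 0, 0]"
| "fields (NS a b c) = [7, a, b, c, 0, 0, 0]"
| "fields (NW a b c) = [8, a, b, c, 0, 0, 0]"
| "fields (TI a b c d e f) = [9, a, b, c, d, e, f]"
| "fields (SW a b c d e) = [10, a, b, c, d, e, 0]"
| "fields (Seed a) = [11, a, 0, 0, 0, 0, 0]"
| "fields (FN a) = [12, a, 0, 0, 0, 0, 0]"
| "fields (NR a b) = [13, a, b, 0, 0, 0, 0]"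
| "fields (BL a b) = [14, a, b, 0, 0, 0, 0]"
| "fields (BN a b c) = [15, a, b, c, 0, 0, 0]"
| "fields (BY a b c) = [16, a, b, c, 0, 0, 0]"
| "fields (BC a b) = [17, a, b, 0, 0, 0, 0]"
| "fields (BX a b c) = [18, a, b, c, 0, 0, 0]"

lemma fields_inject: "fields a = fields b \<Longrightarrow> a = b"
  by (cases a; cases b) simp_all

section \<open>Coding of words as numbers\<close>

definition bwords :: "nat \<Rightarrow> w set" where
  "bwords X = {a. \<forall>x\<in>set (fields a). x < X}"

lemma finite_bwords: "finite (bwords X)" and card_bwords: "card (bwords X) \<le> X ^ 7"
proof -
  have *: "fields ` bwords X \<subseteq> {xs. set xs \<subseteq> {..<X} \<and> length xs = 7}"
  proof
    fix l assume "l \<in> fields ` bwords X"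
    then obtain a where "a \<in> bwords X" "l = fields a" by auto
    then show "l \<in> {xs. set xs \<subseteq> {..<X} \<and> length xs = 7}"
      by (cases a) (auto simp: bwords_def)
  qed
  have inj: "inj_on fields (bwords X)" by (meson fields_inject inj_onI)
  have fin: "finite {xs. set xs \<subseteq> {..<X} \<and> length xs = 7}" by (rule finite_lists_length_eq) simp
  show "finite (bwords X)" by (rule inj_on_finite[OF inj * fin])
  show "card (bwords X) \<le> X ^ 7"
    using card_inj_on_le[OF inj * fin] card_lists_length_eq[of "{..<X}" 7] by simp
qed

text \<open>Any injection will do, since local computation is unrestricted. The codes 0 and 1 stay
  free for the tags of raw input items.\<close>

definition coder :: "nat \<Rightarrow> w \<Rightarrow> nat" where
  "coder X = (SOME f. inj_on f (bwords X) \<and> f ` bwords X \<subseteq> {2..<X ^ 7 + 2})"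

lemma coder: "inj_on (coder X) (bwords X)" "coder X ` bwords X \<subseteq> {2..<X ^ 7 + 2}"
proof -
  obtain g where g: "bij_betw g (bwords X) {0..<card (bwords X)}"
    using ex_bij_betw_finite_nat[OF finite_bwords] by blast
  have "inj_on (\<lambda>a. g a + 2) (bwords X)" using g by (auto simp: bij_betw_def inj_on_def)
  moreover have "(\<lambda>a. g a + 2) ` bwords X \<subseteq> {2..<X ^ 7 + 2}"
  proof
    fix y assume "y \<in> (\<lambda>a. g a + 2) ` bwords X"
    then obtain a where a: "a \<in> bwords X" "y = g a + 2" by auto
    then have "g a < card (bwords X)" using g by (auto simp: bij_betw_def)
    then show "y \<in> {2..<X ^ 7 + 2}" using a card_bwords[of X] by auto
  qed
  ultimately have "\<exists>f. inj_on f (bwords X) \<and> f ` bwords X \<subseteq> {2..<X ^ 7 + 2}" by blast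
  from someI_ex[OF this] show "inj_on (coder X) (bwords X)" "coder X ` bwords X \<subseteq> {2..<X ^ 7 + 2}"
    unfolding coder_def by auto
qed

text \<open>A machine holds a set of words.  An instruction maps the index and the words of a machine to
  addressed words; what a machine wants to keep it sends to itself, for free.\<close>

type_synonym instr = "nat \<Rightarrow> w set \<Rightarrow> (nat \<times> w) set"
type_synonym config = "nat \<Rightarrow> w set"

definition deliver :: "nat \<Rightarrow> (nat \<Rightarrow> (nat \<times> w) set) \<Rightarrow> config" where
  "deliver M f = (\<lambda>i. {a. \<exists>j<M. (i, a) \<in> f j})"

definition sends_le :: "nat \<Rightarrow> nat \<Rightarrow> (nat \<Rightarrow> (nat \<times> w) set) \<Rightarrow> bool" where
  "sends_le M b f \<longleftrightarrow> (\<forall>j<M. finite (f j) \<and> card (f j) \<le> b)"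

text \<open>Equal words from different senders are separate parts of the traffic, hence a sum over
  the senders instead of the size of the delivered set.\<close>

definition receives_le :: "nat \<Rightarrow> nat \<Rightarrow> (nat \<Rightarrow> (nat \<times> w) set) \<Rightarrow> bool" where
  "receives_le M b f \<longleftrightarrow> (\<forall>i<M. (\<Sum>j<M. card {a. (i, a) \<in> f j}) \<le> b)"

definition words_in :: "nat \<Rightarrow> nat \<Rightarrow> (nat \<Rightarrow> (nat \<times> w) set) \<Rightarrow> bool" where
  "words_in M X f \<longleftrightarrow> (\<forall>j<M. snd ` f j \<subseteq> bwords X)"

definition flow_ok :: "nat \<Rightarrow> nat \<Rightarrow> nat \<Rightarrow> (nat \<Rightarrow> (nat \<times> w) set) \<Rightarrow> bool" where
  "flow_ok M X b f \<longleftrightarrow> sends_le M b f \<and> receives_le M b f \<and> words_in M X f"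

definition outs :: "instr \<Rightarrow> config \<Rightarrow> nat \<Rightarrow> (nat \<times> w) set" where
  "outs a \<sigma> = (\<lambda>j. a j (\<sigma> j))"

section \<open>Execution of instruction lists\<close>

primrec exec :: "nat \<Rightarrow> instr list \<Rightarrow> config \<Rightarrow> config" where
  "exec M [] \<sigma> = \<sigma>"
| "exec M (a # as) \<sigma> = exec M as (deliver M (outs a \<sigma>))"

primrec exec_ok :: "nat \<Rightarrow> nat \<Rightarrow> nat \<Rightarrow> instr list \<Rightarrow> config \<Rightarrow> bool" where
  "exec_ok M X b [] \<sigma> \<longleftrightarrow> True"
| "exec_ok M X b (a # as) \<sigma> \<longleftrightarrow> flow_ok M X b (outs a \<sigma>) \<and> exec_ok M X b as (deliver M (outs a \<sigma>))"

lemma exec_append: "exec M (as @ bs) \<sigma> = exec M bs (exec M as \<sigma>)"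
  by (induction as arbitrary: \<sigma>) auto

lemma exec_ok_append:
  "exec_ok M X b (as @ bs) \<sigma> \<longleftrightarrow> exec_ok M X b as \<sigma> \<and> exec_ok M X b bs (exec M as \<sigma>)"
  by (induction as arbitrary: \<sigma>) auto

section \<open>Translation of instruction lists into MPC algorithms\<close>

fun parse :: "words \<Rightarrow> item list" where
  "parse (t # a # b # ws) = (if t = 0 then EdgeItem a b else ListItem a b) # parse ws"
| "parse _ = []"

fun item_word :: "item \<Rightarrow> w" where
  "item_word (EdgeItem u v) = IE u v"
| "item_word (ListItem u c) = IL u c"

lemma parse_concat: "parse (concat (map item_words its)) = its"
proof (induction its)
  case (Cons a its)
  then show ?case by (cases a) auto
qed simp

text \<open>The second part of the program depends on \<open>d\<close>, which becomes known only at
  the end of the first part. Positions inside \<open>su\<close> yield the same instruction for every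
  \<open>d\<close>, so that the placeholder 0 is harmless until then.\<close>

definition fetch :: "instr list \<Rightarrow> (nat \<Rightarrow> instr list) \<Rightarrow> nat \<Rightarrow> nat \<Rightarrow> instr option" where
  "fetch su mn t d = (if t < length (su @ mn d) then Some ((su @ mn d) ! t) else None)"

definition pack :: "nat \<Rightarrow> w set \<Rightarrow> words" where
  "pack X A = sorted_list_of_set (coder X ` A)"

definition unpack :: "nat \<Rightarrow> words \<Rightarrow> w set" where
  "unpack X ws = {a \<in> bwords X. coder X a \<in> set ws}"

text \<open>Input items begin with \<open>0\<close> or \<open>1\<close> and codes are at least \<open>2\<close>, so the first word tells whether a
  memory is still the initial one.\<close>

definition header :: "nat \<Rightarrow> words \<Rightarrow> nat \<times> nat" where
  "header X ws = (if ws = [] \<or> hd ws < 2 then (0, 0)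
     else (SOME p. Hdr (fst p) (snd p) \<in> bwords X \<and> coder X (Hdr (fst p) (snd p)) = hd ws))"

definition contents :: "nat \<Rightarrow> words \<Rightarrow> w set" where
  "contents X ws = (if ws = [] \<or> hd ws < 2 then item_word ` set (parse ws) else unpack X (tl ws))"

text \<open>The first word of a memory is the code of a header, so each machine follows its position
  in the program without communication. All positions advance by one per round; hence the machines
  stay synchronous and terminate in the same round, once they agree on the value that
  \<open>par\<close> extracts when \<open>su\<close> is complete.\<close>

definition compile :: "nat \<Rightarrow> instr list \<Rightarrow> (nat \<Rightarrow> instr list) \<Rightarrow> (w set \<Rightarrow> nat) \<Rightarrow>
    (w set \<Rightarrow> (nat \<times> nat) set) \<Rightarrow> mpc_algorithm" where
  "compile X su mn par res = \<lparr>
     mpc_send = (\<lambda>i ws j. case header X ws of (t, d) \<Rightarrow>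
       (case fetch su mn t d of None \<Rightarrow> [] | Some a \<Rightarrow> pack X {x. (j, x) \<in> a i (contents X ws)})),
     mpc_update = (\<lambda>i ws ms. case header X ws of (t, d) \<Rightarrow>
       (case fetch su mn t d of None \<Rightarrow> [] | Some a \<Rightarrow>
         let s = {x. (i, x) \<in> a i (contents X ws)} \<union> (\<Union>j. unpack X (ms j));
             d' = (if Suc t = length su then par s else d)
         in coder X (Hdr (Suc t) d') # pack X s)),
     mpc_output = (\<lambda>i ws. case header X ws of (t, d) \<Rightarrow>
       (case fetch su mn t d of None \<Rightarrow> Some (SOME l. distinct l \<and> set l = res (contents X ws)) | Some a \<Rightarrow> None)) \<rparr>"

lemma unpack_pack:
  assumes "A \<subseteq> bwords X" shows "unpack X (pack X A) = A"
proof -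
  have "finite A" using assms finite_bwords finite_subset by blast
  then have "set (pack X A) = coder X ` A" by (simp add: pack_def)
  then show ?thesis using assms coder(1)[of X] unfolding unpack_def inj_on_def by auto
qed

lemma unpack_Nil [simp]: "unpack X [] = {}" by (simp add: unpack_def)

lemma length_pack:
  assumes "A \<subseteq> bwords X" shows "length (pack X A) = card A"
  using card_image[OF inj_on_subset[OF coder(1) assms]] by (simp add: pack_def)

lemma set_pack:
  assumes "A \<subseteq> bwords X" shows "set (pack X A) \<subseteq> {2..<X ^ 7 + 2}"
proof -
  have "finite A" using assms finite_bwords finite_subset by blast
  then show ?thesis using assms coder(2)[of X] by (auto simp: pack_def)
qed

lemma coder_ge2: "a \<in> bwords X \<Longrightarrow> 2 \<le> coder X a" "a \<in> bwords X \<Longrightarrow> coder X a < X ^ 7 + 2"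
  using coder(2)[of X] by fastforce+

lemma header_Hdr:
  assumes "Hdr t d \<in> bwords X" shows "header X (coder X (Hdr t d) # ws) = (t, d)"
proof -
  have "Hdr (fst p) (snd p) \<in> bwords X \<and> coder X (Hdr (fst p) (snd p)) = coder X (Hdr t d)
      \<longleftrightarrow> p = (t, d)" for p
  proof
    assume "Hdr (fst p) (snd p) \<in> bwords X \<and> coder X (Hdr (fst p) (snd p)) = coder X (Hdr t d)"
    then have "Hdr (fst p) (snd p) = Hdr t d"
      using coder(1)[of X] assms by (meson inj_onD)
    then show "p = (t, d)" by (cases p) simp
  qed (use assms in auto)
  then show ?thesis using coder_ge2[OF assms] by (simp add: header_def)
qed

lemma contents_Hdr:
  assumes "Hdr t d \<in> bwords X" "A \<subseteq> bwords X"
  shows "contents X (coder X (Hdr t d) # pack X A) = A"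
  using coder_ge2[OF assms(1)] unpack_pack[OF assms(2)] by (simp add: contents_def)

lemma raw_memory: "initial_memory inp i = [] \<or> hd (initial_memory inp i) < 2"
proof (cases "inp i")
  case (Cons a l)
  then show ?thesis by (cases a) (auto simp: initial_memory_def)
qed (simp add: initial_memory_def)

lemma header_raw: "header X (initial_memory inp i) = (0, 0)"
  and contents_raw: "contents X (initial_memory inp i) = item_word ` set (inp i)"
  using raw_memory[of inp i] by (auto simp: header_def contents_def initial_memory_def parse_concat)

section \<open>Correctness of the translation\<close>

lemma deliver_subset_univ:
  assumes "words_in M X f" shows "deliver M f i \<subseteq> bwords X"
  using assms unfolding words_in_def deliver_def by force

lemma exec_take_Suc:
  assumes "t < length P"
  shows "exec M (take (Suc t) P) \<sigma> = deliver M (outs (P ! t) (exec M (take t P) \<sigma>))"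
  using assms by (simp add: take_Suc_conv_app_nth exec_append)

lemma exec_ok_nth:
  assumes "exec_ok M X b P \<sigma>" "t < length P"
  shows "flow_ok M X b (outs (P ! t) (exec M (take t P) \<sigma>))"
proof -
  have "P = take t P @ P ! t # drop (Suc t) P" using assms(2) by (simp add: id_take_nth_drop)
  then show ?thesis using assms(1) by (metis exec_ok.simps(2) exec_ok_append)
qed

lemma card_deliver_le:
  assumes "receives_le M b f" "sends_le M b f" "i < M" shows "finite (deliver M f i) \<and> card (deliver M f i) \<le> b"
proof -
  have d: "deliver M f i = (\<Union>j<M. {a. (i, a) \<in> f j})" by (auto simp: deliver_def)
  have fin: "finite {a. (i, a) \<in> f j}" if "j < M" for j
  proof -
    have "finite (f j)" using assms(2) that by (simp add: sends_le_def)
    moreover have "{a. (i, a) \<in> f j} \<subseteq> snd ` f j" by force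
    ultimately show ?thesis using finite_subset by blast
  qed
  have "card (\<Union>j<M. {a. (i, a) \<in> f j}) \<le> (\<Sum>j<M. card {a. (i, a) \<in> f j})" by (rule card_UN_le) simp
  also have "\<dots> \<le> b" using assms by (simp add: receives_le_def)
  finally show ?thesis using d fin by auto
qed

lemma card_section_le:
  assumes "finite A" "finite J"
  shows "(\<Sum>j\<in>J. card {a. (j, a) \<in> A}) \<le> card A"
proof -
  have fin: "finite {a. (j, a) \<in> A}" for j
    by (rule finite_subset[OF _ finite_imageI[OF assms(1), of snd]]) force
  have "(\<Sum>j\<in>J. card {a. (j, a) \<in> A}) = card (SIGMA j:J. {a. (j, a) \<in> A})"
    using assms fin by simp
  also have "\<dots> \<le> card A" by (rule card_mono[OF assms(1)]) auto
  finally show ?thesis .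
qed

locale compiled_run =
  fixes M X b S B :: nat and su :: "instr list" and mn :: "nat \<Rightarrow> instr list"
    and par :: "w set \<Rightarrow> nat" and res :: "w set \<Rightarrow> (nat \<times> nat) set"
    and d :: nat and inp :: "nat \<Rightarrow> item list" and \<sigma>0 :: config and P :: "instr list"
  assumes su: "su \<noteq> []"
    and ok: "exec_ok M X b P \<sigma>0"
    and P_def: "P = su @ mn d"
    and par: "\<And>i. i < M \<Longrightarrow> par (exec M su \<sigma>0 i) = d"
    and X: "length P < X" "d < X"
    and B: "X ^ 7 + 2 \<le> 2 ^ B"
    and S: "b + 1 \<le> S"
    and \<sigma>0_def: "\<And>i. \<sigma>0 i = item_word ` set (inp i)"
    and \<sigma>0_univ: "\<And>i. i < M \<Longrightarrow> \<sigma>0 i \<subseteq> bwords X"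
    and raw_le: "\<And>i. i < M \<Longrightarrow> length (initial_memory inp i) \<le> S"
begin

definition "alg = compile X su mn par res"
definition "dd t = (if t < length su then 0 else d)"
definition "st t = exec M (take t P) \<sigma>0"
definition "run = mpc_run alg M (initial_memory inp)"

lemma Hdr_univ: "t \<le> length P \<Longrightarrow> Hdr t (dd t) \<in> bwords X"
  using X by (auto simp: bwords_def dd_def)

lemma run_Suc: "run (Suc t) = mpc_round alg M (run t)"
  by (simp add: run_def mpc_run_def)

lemma st_univ: "t \<le> length P \<Longrightarrow> i < M \<Longrightarrow> st t i \<subseteq> bwords X"
proof (cases t)
  case 0
  assume "i < M"
  then show ?thesis using 0 \<sigma>0_univ by (simp add: st_def)
next
  case (Suc s)
  assume "t \<le> length P" "i < M"
  then show ?thesis using Suc exec_ok_nth[OF ok, of s] exec_take_Suc[of s P M \<sigma>0]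
    by (simp add: st_def flow_ok_def deliver_subset_univ)
qed

lemma fetch_eq: "t < length P \<Longrightarrow> fetch su mn t (dd t) = Some (P ! t)"
  using P_def by (auto simp: fetch_def dd_def nth_append)

lemma fetch_end: "fetch su mn (length P) (dd (length P)) = None"
  using P_def by (simp add: fetch_def dd_def)

lemma step:
  assumes t: "t < length P"
    and IH: "\<And>i. i < M \<Longrightarrow> header X (run t i) = (t, dd t) \<and> contents X (run t i) = st t i"
  shows "\<And>i j. i < M \<Longrightarrow> mpc_message alg (run t) i j = (if i = j then [] else pack X {x. (j, x) \<in> (P ! t) i (st t i)})"
    and "\<And>i. i < M \<Longrightarrow> run (Suc t) i = coder X (Hdr (Suc t) (dd (Suc t))) # pack X (st (Suc t) i)"
proof -
  have out: "mpc_output alg i (run t i) = None" if "i < M" for i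
    using IH[OF that] fetch_eq[OF t] by (simp add: alg_def compile_def)
  show msg: "mpc_message alg (run t) i j = (if i = j then [] else pack X {x. (j, x) \<in> (P ! t) i (st t i)})"
    if "i < M" for i j
    using IH[OF that] fetch_eq[OF t] out[OF that] by (simp add: mpc_message_def alg_def compile_def)
  fix i assume i: "i < M"
  have fl: "words_in M X (outs (P ! t) (st t))"
    using exec_ok_nth[OF ok t] by (simp add: flow_ok_def st_def)
  then have sub: "{x. (k, x) \<in> (P ! t) j (st t j)} \<subseteq> bwords X" if "j < M" for j k
    using that by (force simp: words_in_def outs_def)
  have un: "unpack X (if j < M then mpc_message alg (run t) j i else [])
      = (if j < M \<and> j \<noteq> i then {x. (i, x) \<in> (P ! t) j (st t j)} else {})" for j
    using msg unpack_pack[OF sub] by auto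
  \<comment> \<open>The model has no messages from a machine to itself; the words that machine
    \<open>i\<close> keeps enter through the first set, which completes the delivery.\<close>
  have s: "{x. (i, x) \<in> (P ! t) i (st t i)} \<union> (\<Union>j. unpack X (if j < M then mpc_message alg (run t) j i else []))
      = st (Suc t) i"
    unfolding un using i exec_take_Suc[OF t, of M \<sigma>0] by (auto simp: st_def deliver_def outs_def split: if_splits)
  have p: "(if Suc t = length su then par (st (Suc t) i) else dd t) = dd (Suc t)"
  proof (cases "Suc t = length su")
    case True
    then have "take (Suc t) P = su" unfolding P_def by simp
    then have "st (Suc t) = exec M su \<sigma>0" unfolding st_def by simp
    then show ?thesis using True par[OF i] by (simp add: dd_def)
  qed (auto simp: dd_def)
  have "run (Suc t) i = mpc_update alg i (run t i) (\<lambda>j. if j < M then mpc_message alg (run t) j i else [])"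
    using out[OF i] by (simp add: run_Suc mpc_round_def)
  also have "\<dots> = coder X (Hdr (Suc t) (dd (Suc t))) # pack X (st (Suc t) i)"
    using IH[OF i] fetch_eq[OF t] s
    by (simp add: alg_def compile_def Let_def) (use p in \<open>auto split: if_splits\<close>)
  finally show "run (Suc t) i = coder X (Hdr (Suc t) (dd (Suc t))) # pack X (st (Suc t) i)" .
qed

lemma invariant:
  "t \<le> length P \<Longrightarrow> i < M \<Longrightarrow> header X (run t i) = (t, dd t) \<and> contents X (run t i) = st t i"
proof (induction t arbitrary: i)
  case 0
  have "run 0 i = initial_memory inp i" "st 0 i = item_word ` set (inp i)"
    unfolding run_def mpc_run_def st_def by (simp_all add: \<sigma>0_def)
  \<comment> \<open>A raw memory is read as position 0 with degree 0, and
    \<open>su \<noteq> []\<close> makes \<open>dd 0\<close> the same 0.\<close>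
  then show ?case using su header_raw contents_raw by (simp add: dd_def)
next
  case (Suc t)
  then show ?case using step(2)[of t i] header_Hdr[OF Hdr_univ[of "Suc t"]]
      contents_Hdr[OF Hdr_univ[of "Suc t"] st_univ[of "Suc t" i]] by simp
qed

lemma run_pos:
  "t < length P \<Longrightarrow> i < M \<Longrightarrow> run (Suc t) i = coder X (Hdr (Suc t) (dd (Suc t))) # pack X (st (Suc t) i)"
  using step(2)[of t] invariant by simp

lemma memory: "t \<le> length P \<Longrightarrow> memory_ok M S B (run t)"
proof (cases t)
  case 0
  have "w < 2 ^ B" if i: "i < M" and w: "w \<in> set (initial_memory inp i)" for i w
  proof -
    obtain it where it: "it \<in> set (inp i)" "w \<in> set (item_words it)"
      using w by (auto simp: initial_memory_def)
    \<comment> \<open>The identifiers and the color of a raw item are entries of its abstract word,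
      whose tag 1 or 2 also bounds the tag 0 or 1 of the item.\<close>
    have "item_word it \<in> bwords X" using \<sigma>0_univ[OF i] \<sigma>0_def[of i] it(1) by auto
    then have "w < X" using it(2) by (cases it) (auto simp: bwords_def)
    also have "X \<le> X ^ 7" using \<open>w < X\<close> by (simp add: self_le_power)
    finally show ?thesis using B by linarith
  qed
  then show ?thesis using 0 raw_le by (simp add: memory_ok_def run_def mpc_run_def)
next
  case (Suc s)
  assume t: "t \<le> length P"
  have "length (run t i) \<le> S \<and> (\<forall>w\<in>set (run t i). w < 2 ^ B)" if i: "i < M" for i
  proof -
    have fl: "flow_ok M X b (outs (P ! s) (st s))" using exec_ok_nth[OF ok, of s] t Suc by (simp add: st_def)
    have "st t = deliver M (outs (P ! s) (st s))" using exec_take_Suc[of s P M \<sigma>0] t Suc by (simp add: st_def)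
    then have "card (st t i) \<le> b" using card_deliver_le[of M b _ i] fl i by (simp add: flow_ok_def)
    \<comment> \<open>The header takes the word by which \<open>S\<close> exceeds
      \<open>b\<close>.\<close>
    then have "length (run t i) \<le> S"
      using run_pos[of s i] Suc t i S length_pack[OF st_univ[of t i]] by simp
    moreover have "w < 2 ^ B" if "w \<in> set (run t i)" for w
      using that run_pos[of s i] Suc t i set_pack[OF st_univ[of t i]] coder_ge2(2)[OF Hdr_univ[of t]] B by auto
    ultimately show ?thesis by blast
  qed
  then show ?thesis by (simp add: memory_ok_def)
qed

lemma traffic:
  assumes t: "t < length P" shows "traffic_ok alg M S B (run t)"
proof -
  have fl: "flow_ok M X b (outs (P ! t) (st t))" using exec_ok_nth[OF ok t] by (simp add: st_def)
  have msg: "mpc_message alg (run t) i j = (if i = j then [] else pack X {x. (j, x) \<in> (P ! t) i (st t i)})"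
    if "i < M" for i j using step(1)[OF t] invariant that t by simp
  have sub: "{x. (k, x) \<in> (P ! t) j (st t j)} \<subseteq> bwords X" if "j < M" for j k
    using fl that by (force simp: words_in_def outs_def flow_ok_def)
  have len: "length (mpc_message alg (run t) i j) \<le> card {x. (j, x) \<in> (P ! t) i (st t i)}" if "i < M" for i j
    using msg[OF that] length_pack[OF sub[OF that]] by simp
  have "w < 2 ^ B" if "i < M" "j < M" "w \<in> set (mpc_message alg (run t) i j)" for i j w
    using that msg[OF that(1)] set_pack[OF sub[OF that(1)]] B by (force split: if_splits)
  moreover have "(\<Sum>j<M. length (mpc_message alg (run t) i j)) \<le> S" if i: "i < M" for i
  proof -
    have "(\<Sum>j<M. length (mpc_message alg (run t) i j)) \<le> (\<Sum>j<M. card {x. (j, x) \<in> (P ! t) i (st t i)})"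
      using len[OF i] by (rule sum_mono)
    also have "\<dots> \<le> card ((P ! t) i (st t i))"
      using fl i by (intro card_section_le) (auto simp: flow_ok_def sends_le_def outs_def)
    also have "\<dots> \<le> S" using fl i S by (fastforce simp: flow_ok_def sends_le_def outs_def)
    finally show ?thesis .
  qed
  moreover have "(\<Sum>j<M. length (mpc_message alg (run t) j i)) \<le> S" if i: "i < M" for i
  proof -
    have "(\<Sum>j<M. length (mpc_message alg (run t) j i)) \<le> (\<Sum>j<M. card {x. (i, x) \<in> (P ! t) j (st t j)})"
      using len by (intro sum_mono) auto
    also have "\<dots> \<le> S" using fl i S by (fastforce simp: flow_ok_def receives_le_def outs_def)
    finally show ?thesis .
  qed
  ultimately show ?thesis by (simp add: traffic_ok_def)
qed

lemma final:
  assumes fin: "\<And>i. i < M \<Longrightarrow> finite (res (exec M P \<sigma>0 i)) \<and> 2 * card (res (exec M P \<sigma>0 i)) \<le> S"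
    and col: "list_coloring V E L \<phi>" "(\<Union>i<M. res (exec M P \<sigma>0 i)) = {(v, \<phi> v) | v. v \<in> V}"
  shows "mpc_final alg V E L M S (run (length P))"
proof -
  let ?T = "length P"
  define f where "f i = (SOME l. distinct l \<and> set l = res (exec M P \<sigma>0 i))" for i
  have out: "mpc_output alg i (run ?T i) = Some (f i)" if "i < M" for i
    using invariant[of ?T i] that fetch_end by (simp add: alg_def compile_def f_def st_def)
  have f: "distinct (f i) \<and> set (f i) = res (exec M P \<sigma>0 i)" if "i < M" for i
    unfolding f_def using fin[OF that] finite_distinct_list by (intro someI_ex[where P = "\<lambda>l. distinct l \<and> set l = _"]) blast
  have "2 * length (f i) \<le> S" if "i < M" for i
    using fin[OF that] f[OF that] distinct_card by metis
  moreover have "(\<Union>i<M. set (the (mpc_output alg i (run ?T i)))) = (\<Union>i<M. res (exec M P \<sigma>0 i))"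
    using out f by auto
  ultimately show ?thesis using out col unfolding mpc_final_def by auto
qed

end

subsection \<open>Flows\<close>

lemma flow_ok_Un:
  assumes "flow_ok M X a f" "flow_ok M X b g"
  shows "flow_ok M X (a + b) (\<lambda>j. f j \<union> g j)"
proof -
  have "finite (f j \<union> g j) \<and> card (f j \<union> g j) \<le> a + b" if "j < M" for j
    using assms that card_Un_le[of "f j" "g j"] by (fastforce simp: flow_ok_def sends_le_def)
  moreover have "(\<Sum>j<M. card {x. (i, x) \<in> f j \<union> g j}) \<le> a + b" if "i < M" for i
  proof -
    have "card {x. (i, x) \<in> f j \<union> g j} \<le> card {x. (i, x) \<in> f j} + card {x. (i, x) \<in> g j}" for j
      using card_Un_le[of "{x. (i, x) \<in> f j}" "{x. (i, x) \<in> g j}"] by (simp add: Collect_disj_eq)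
    then have "(\<Sum>j<M. card {x. (i, x) \<in> f j \<union> g j})
        \<le> (\<Sum>j<M. card {x. (i, x) \<in> f j}) + (\<Sum>j<M. card {x. (i, x) \<in> g j})"
      unfolding sum.distrib[symmetric] by (intro sum_mono)
    then show ?thesis using assms that unfolding flow_ok_def receives_le_def by fastforce
  qed
  moreover have "words_in M X (\<lambda>j. f j \<union> g j)"
    using assms by (simp add: flow_ok_def words_in_def image_Un)
  ultimately show ?thesis by (simp add: flow_ok_def sends_le_def receives_le_def)
qed

lemma flow_ok_mono: "flow_ok M X a f \<Longrightarrow> a \<le> b \<Longrightarrow> flow_ok M X b f"
  by (fastforce simp: flow_ok_def sends_le_def receives_le_def)

lemma flow_ok_cong: "flow_ok M X a f \<Longrightarrow> (\<And>j. j < M \<Longrightarrow> f j = g j) \<Longrightarrow> flow_ok M X a g"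
  by (simp add: flow_ok_def sends_le_def receives_le_def words_in_def)

lemma deliver_Un: "deliver M (\<lambda>j. f j \<union> g j) i = deliver M f i \<union> deliver M g i"
  by (auto simp: deliver_def)

definition keep :: "(nat \<Rightarrow> w set) \<Rightarrow> nat \<Rightarrow> (nat \<times> w) set" where
  "keep A = (\<lambda>j. Pair j ` A j)"

lemma flow_ok_keep:
  assumes "\<And>j. j < M \<Longrightarrow> finite (A j) \<and> card (A j) \<le> a \<and> A j \<subseteq> bwords X"
  shows "flow_ok M X a (keep A)"
proof -
  have "{x. (i, x) \<in> Pair j ` A j} = (if j = i then A i else {})" for i j by auto
  then have "card {x. (i, x) \<in> Pair j ` A j} = (if j = i then card (A i) else 0)" for i j by simp
  then have "(\<Sum>j<M. card {x. (i, x) \<in> Pair j ` A j}) \<le> a" if "i < M" for i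
    using assms that by simp
  moreover have "card (Pair j ` A j) \<le> a" if "j < M" for j
    using assms[OF that] card_image_le[of "A j" "Pair j"] by linarith
  moreover have "words_in M X (keep A)"
    using assms by (auto simp: words_in_def keep_def image_image)
  ultimately show ?thesis using assms
    by (simp add: flow_ok_def sends_le_def receives_le_def keep_def)
qed

lemma deliver_keep: "i < M \<Longrightarrow> deliver M (keep A) i = A i"
  by (auto simp: deliver_def keep_def)

text \<open>A round of transfers is given by a family of tokens with source, destination and
  content. Its load bounds then reduce to counting tokens per source and per destination; tokens
  with equal contents can only lower the traffic.\<close>

definition toks :: "'t set \<Rightarrow> ('t \<Rightarrow> nat) \<Rightarrow> ('t \<Rightarrow> nat) \<Rightarrow> ('t \<Rightarrow> w) \<Rightarrow> nat \<Rightarrow> (nat \<times> w) set" where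
  "toks T src dst wd = (\<lambda>j. (\<lambda>t. (dst t, wd t)) ` {t \<in> T. src t = j})"

lemma flow_ok_toks:
  assumes T: "finite T"
    and s: "\<And>j. j < M \<Longrightarrow> card {t \<in> T. src t = j} \<le> a"
    and d: "\<And>i. i < M \<Longrightarrow> card {t \<in> T. dst t = i} \<le> a"
    and w: "\<And>t. t \<in> T \<Longrightarrow> wd t \<in> bwords X"
  shows "flow_ok M X a (toks T src dst wd)"
proof -
  have "card (toks T src dst wd j) \<le> a" if "j < M" for j
    using s[OF that] card_image_le[of "{t \<in> T. src t = j}" "\<lambda>t. (dst t, wd t)"] T
    by (simp add: toks_def)
  moreover have "(\<Sum>j<M. card {x. (i, x) \<in> toks T src dst wd j}) \<le> a" if i: "i < M" for i
  proof -
    have "card {x. (i, x) \<in> toks T src dst wd j} \<le> card {t \<in> {t \<in> T. dst t = i}. src t = j}" for j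
    proof -
      have "{x. (i, x) \<in> toks T src dst wd j} = wd ` {t \<in> {t \<in> T. dst t = i}. src t = j}"
        by (auto simp: toks_def)
      moreover have "finite {t \<in> {t \<in> T. dst t = i}. src t = j}" using T by simp
      ultimately show ?thesis by (simp add: card_image_le)
    qed
    then have "(\<Sum>j<M. card {x. (i, x) \<in> toks T src dst wd j})
        \<le> (\<Sum>j<M. card {t \<in> {t \<in> T. dst t = i}. src t = j})" by (intro sum_mono)
    also have "\<dots> = card (\<Union>j<M. {t \<in> {t \<in> T. dst t = i}. src t = j})"
      using T by (subst card_UN_disjoint) auto
    also have "\<dots> \<le> card {t \<in> T. dst t = i}" using T by (intro card_mono) auto
    finally show ?thesis using d[OF i] by linarith
  qed
  ultimately show ?thesis using T w
    by (auto simp: flow_ok_def sends_le_def receives_le_def words_in_def toks_def)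
qed

lemma deliver_toks:
  assumes "\<And>t. t \<in> T \<Longrightarrow> src t < M"
  shows "deliver M (toks T src dst wd) i = wd ` {t \<in> T. dst t = i}"
  using assms by (auto simp: deliver_def toks_def)

text \<open>Configurations are compared below \<open>M\<close> only. A word may be delivered beyond
  \<open>M\<close>, but \<open>deliver M\<close> collects from machines below \<open>M\<close>, so
  nothing that happens there has an effect later.\<close>

definition reaches :: "nat \<Rightarrow> nat \<Rightarrow> nat \<Rightarrow> instr list \<Rightarrow> config \<Rightarrow> config \<Rightarrow> bool" where
  "reaches M X b P \<sigma> \<tau> \<longleftrightarrow> exec_ok M X b P \<sigma> \<and> (\<forall>i<M. exec M P \<sigma> i = \<tau> i)"

lemma deliver_cong: "(\<And>j. j < M \<Longrightarrow> f j = g j) \<Longrightarrow> deliver M f = deliver M g"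
  by (auto simp: deliver_def)

lemma exec_cong:
  assumes "\<And>i. i < M \<Longrightarrow> \<sigma> i = \<sigma>' i"
  shows "exec_ok M X b P \<sigma> \<longleftrightarrow> exec_ok M X b P \<sigma>'" "i < M \<Longrightarrow> exec M P \<sigma> i = exec M P \<sigma>' i"
proof -
  have "(exec_ok M X b P \<sigma> \<longleftrightarrow> exec_ok M X b P \<sigma>') \<and> (\<forall>i<M. exec M P \<sigma> i = exec M P \<sigma>' i)"
  proof (cases P)
    case (Cons a as)
    have eq: "outs a \<sigma> j = outs a \<sigma>' j" if "j < M" for j using assms that by (simp add: outs_def)
    have "deliver M (outs a \<sigma>) = deliver M (outs a \<sigma>')" by (rule deliver_cong) (rule eq)
    then show ?thesis using Cons eq
      by (simp add: flow_ok_def sends_le_def receives_le_def words_in_def)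
  qed (use assms in simp)
  then show "exec_ok M X b P \<sigma> \<longleftrightarrow> exec_ok M X b P \<sigma>'" "i < M \<Longrightarrow> exec M P \<sigma> i = exec M P \<sigma>' i" by auto
qed

lemma reaches_append:
  assumes "reaches M X b P \<sigma> \<tau>" "reaches M X b Q \<tau> \<rho>"
  shows "reaches M X b (P @ Q) \<sigma> \<rho>"
  using assms exec_cong[of M "exec M P \<sigma>" \<tau>] by (simp add: reaches_def exec_append exec_ok_append)

lemma reaches_Nil: "reaches M X b [] \<sigma> \<sigma>" by (simp add: reaches_def)

lemma reaches_instr:
  assumes "\<And>j. j < M \<Longrightarrow> a j (\<sigma> j) = f j" "flow_ok M X b f" "\<And>i. i < M \<Longrightarrow> deliver M f i = \<tau> i"
  shows "reaches M X b [a] \<sigma> \<tau>"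
  using assms flow_ok_cong[OF assms(2), of "outs a \<sigma>"] deliver_cong[of M "outs a \<sigma>" f]
  by (simp add: reaches_def outs_def)

lemma reaches_Cons:
  assumes "reaches M X b [a] \<sigma> \<tau>" "reaches M X b Q \<tau> \<rho>"
  shows "reaches M X b (a # Q) \<sigma> \<rho>"
  using reaches_append[OF assms] by simp

subsection \<open>Extremal runs\<close>

text \<open>For data sorted by key, a machine shares a key with other machines only if this key is the largest
  one before it or the smallest one behind it; hence sums over equal keys need extremal runs only.\<close>

definition ysum :: "(nat \<Rightarrow> nat \<Rightarrow> nat \<Rightarrow> nat) \<Rightarrow> nat set \<Rightarrow> nat \<Rightarrow> nat \<Rightarrow> nat" where
  "ysum y J k x = (\<Sum>j\<in>J. y j k x)"

definition runs :: "(nat \<Rightarrow> nat \<Rightarrow> bool) \<Rightarrow> (nat \<Rightarrow> nat \<Rightarrow> nat \<Rightarrow> nat) \<Rightarrow> nat set \<Rightarrow> (nat \<times> nat \<times> nat) set" where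
  "runs le y J = {(k, x, v). v = ysum y J k x \<and> v > 0 \<and> (\<forall>k' x'. ysum y J k' x' > 0 \<longrightarrow> le k k')}"

text \<open>The component \<open>d\<close> names the part from which an entry comes. Without it
  equal entries of different parts would collapse in the set instead of being added.\<close>

definition comb :: "(nat \<Rightarrow> nat \<Rightarrow> bool) \<Rightarrow> (nat \<times> nat \<times> nat \<times> nat) set \<Rightarrow> (nat \<times> nat \<times> nat) set" where
  "comb le A = {(k, x, v). (\<exists>d v. (d, k, x, v) \<in> A) \<and> (\<forall>d' k' x' v'. (d', k', x', v') \<in> A \<longrightarrow> le k k') \<and>
     v = (\<Sum>(d, v) \<in> {(d, v). (d, k, x, v) \<in> A}. v)}"

text \<open>Covers \<open>(\<le>)\<close> and \<open>(\<ge>)\<close> on the natural numbers at once.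
  Extremal elements are demanded of finite sets only, since infinite sets have no largest
  element.\<close>

definition good_order :: "(nat \<Rightarrow> nat \<Rightarrow> bool) \<Rightarrow> bool" where
  "good_order le \<longleftrightarrow> (\<forall>a b c. le a b \<longrightarrow> le b c \<longrightarrow> le a c) \<and> (\<forall>a b. le a b \<longrightarrow> le b a \<longrightarrow> a = b) \<and>
     (\<forall>K. finite K \<longrightarrow> K \<noteq> {} \<longrightarrow> (\<exists>k\<in>K. \<forall>k'\<in>K. le k k'))"

lemma good_order_le: "good_order (\<le>)"
  unfolding good_order_def
proof (intro conjI allI impI)
  fix K :: "nat set" assume "finite K" "K \<noteq> {}"
  then show "\<exists>k\<in>K. \<forall>k'\<in>K. k \<le> k'" by (intro bexI[of _ "Min K"]) auto
qed auto

lemma good_order_ge: "good_order (\<ge>)"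
  unfolding good_order_def
proof (intro conjI allI impI)
  fix K :: "nat set" assume "finite K" "K \<noteq> {}"
  then show "\<exists>k\<in>K. \<forall>k'\<in>K. k \<ge> k'" by (intro bexI[of _ "Max K"]) auto
qed auto

lemma sum_nat_pos_iff: "finite J \<Longrightarrow> (\<Sum>j\<in>J. f j) > (0::nat) \<longleftrightarrow> (\<exists>j\<in>J. f j > 0)"
  using sum_eq_0_iff[of J f] by (simp flip: neq0_conv)

lemma ysum_pos: "finite J \<Longrightarrow> ysum y J k x > 0 \<longleftrightarrow> (\<exists>j\<in>J. y j k x > 0)"
  by (simp add: ysum_def sum_nat_pos_iff)

lemma ysum_UN:
  assumes "finite I" "\<And>d. d \<in> I \<Longrightarrow> finite (J d)" "\<And>d e. d \<in> I \<Longrightarrow> e \<in> I \<Longrightarrow> d \<noteq> e \<Longrightarrow> J d \<inter> J e = {}"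
  shows "ysum y (\<Union>d\<in>I. J d) k x = (\<Sum>d\<in>I. ysum y (J d) k x)"
  unfolding ysum_def using assms by (intro sum.UNION_disjoint) auto

text \<open>A key that is extremal in the union is extremal in every part where it occurs, so that
  all contributions to its sum are found in the runs of the parts. Conversely, every occurring key
  is preceded by the extremal key of its part, so comparing with the runs alone detects the keys
  that are extremal overall. The bound \<open>N\<close> makes the set of keys of a part finite,
  which guarantees that an extremal key exists.\<close>

lemma comb_runs:
  assumes le: "good_order le" and I: "finite I" and J: "\<And>d. d \<in> I \<Longrightarrow> finite (J d)"
    and disj: "\<And>d e. d \<in> I \<Longrightarrow> e \<in> I \<Longrightarrow> d \<noteq> e \<Longrightarrow> J d \<inter> J e = {}"
    and K: "\<And>d j k x. d \<in> I \<Longrightarrow> j \<in> J d \<Longrightarrow> y j k x > 0 \<Longrightarrow> k < (N::nat)"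
  shows "comb le {(d, k, x, v). d \<in> I \<and> (k, x, v) \<in> runs le y (J d)} = runs le y (\<Union>d\<in>I. J d)"
proof -
  let ?U = "\<Union>d\<in>I. J d"
  let ?A = "{(d, k, x, v). d \<in> I \<and> (k, x, v) \<in> runs le y (J d)}"
  have tot: "ysum y ?U k x = (\<Sum>d\<in>I. ysum y (J d) k x)" for k x
    by (rule ysum_UN[OF I J disj])
  have tpos: "ysum y ?U k x > 0 \<longleftrightarrow> (\<exists>d\<in>I. ysum y (J d) k x > 0)" for k x
    unfolding tot using I by (simp add: sum_nat_pos_iff)
  have mem: "(d, k, x, v) \<in> ?A \<Longrightarrow> ysum y ?U k x > 0" for d k x v
    unfolding tpos runs_def by auto
  have ext: "\<exists>d k x v. (d, k, x, v) \<in> ?A \<and> le k k'" if pos: "ysum y ?U k' x' > 0" for k' x'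
  proof -
    obtain d where d: "d \<in> I" "ysum y (J d) k' x' > 0" using pos tpos by blast
    let ?K = "{k. \<exists>x. ysum y (J d) k x > 0}"
    have "?K \<subseteq> {..<N}" using K[OF d(1)] ysum_pos[OF J[OF d(1)]] by auto
    then have "finite ?K" using finite_subset by blast
    moreover have "?K \<noteq> {}" using d by auto
    moreover have "finite K \<Longrightarrow> K \<noteq> {} \<Longrightarrow> \<exists>k\<in>K. \<forall>k'\<in>K. le k k'" for K
      using le unfolding good_order_def by simp
    ultimately obtain k where k: "k \<in> ?K" "\<forall>k'\<in>?K. le k k'" by meson
    then obtain x where x: "ysum y (J d) k x > 0" by auto
    have "(k, x, ysum y (J d) k x) \<in> runs le y (J d)" using x k(2) unfolding runs_def by blast
    then have "(d, k, x, ysum y (J d) k x) \<in> ?A" using d(1) by blast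
    moreover have "le k k'" using k(2) d(2) by auto
    ultimately show ?thesis by blast
  qed
  have in_runs: "(d, k, x, v) \<in> ?A \<longleftrightarrow> d \<in> I \<and> v = ysum y (J d) k x \<and> v > 0"
    if ex: "\<forall>k' x'. ysum y ?U k' x' > 0 \<longrightarrow> le k k'" for d k x v
    using ex tpos unfolding runs_def by auto
  have val: "(\<Sum>(d, v) \<in> {(d, v). (d, k, x, v) \<in> ?A}. v) = ysum y ?U k x"
    if ex: "\<forall>k' x'. ysum y ?U k' x' > 0 \<longrightarrow> le k k'" for k x
  proof -
    have "{(d, v). (d, k, x, v) \<in> ?A} = (\<lambda>d. (d, ysum y (J d) k x)) ` {d \<in> I. ysum y (J d) k x > 0}"
      using in_runs[OF ex] by auto
    then have "(\<Sum>(d, v) \<in> {(d, v). (d, k, x, v) \<in> ?A}. v) = (\<Sum>d | d \<in> I \<and> ysum y (J d) k x > 0. ysum y (J d) k x)"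
      by (simp add: sum.reindex inj_on_def)
    also have "\<dots> = (\<Sum>d\<in>I. ysum y (J d) k x)" using I by (intro sum.mono_neutral_left) auto
    finally show ?thesis using tot by simp
  qed
  show ?thesis
  proof (rule set_eqI)
    fix p :: "nat \<times> nat \<times> nat"
    obtain k x v where p: "p = (k, x, v)" by (cases p)
    have ex_iff: "(\<forall>d' k' x' v'. (d', k', x', v') \<in> ?A \<longrightarrow> le k k')
       \<longleftrightarrow> (\<forall>k' x'. ysum y ?U k' x' > 0 \<longrightarrow> le k k')" (is "?a \<longleftrightarrow> ?b")
    proof
      assume a: ?a
      show ?b
      proof (intro allI impI)
        fix k' x' assume "ysum y ?U k' x' > 0"
        from ext[OF this] obtain d k2 x2 v2 where k2: "(d, k2, x2, v2) \<in> ?A" "le k2 k'" by blast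
        then have "le k k2" using a by blast
        then show "le k k'" using k2(2) le unfolding good_order_def by meson
      qed
    next
      assume b: ?b
      show ?a using b mem by blast
    qed
    show "p \<in> comb le ?A \<longleftrightarrow> p \<in> runs le y ?U"
    proof (cases "\<forall>k' x'. ysum y ?U k' x' > 0 \<longrightarrow> le k k'")
      case True
      have "p \<in> comb le ?A \<longleftrightarrow> (\<exists>d v. (d, k, x, v) \<in> ?A) \<and> v = ysum y ?U k x"
        unfolding comb_def p using ex_iff True val[OF True] by simp
      also have "(\<exists>d v. (d, k, x, v) \<in> ?A) \<longleftrightarrow> ysum y ?U k x > 0"
        unfolding in_runs[OF True] tpos by auto
      finally show ?thesis using True unfolding runs_def p by auto
    next
      case False
      then have "p \<notin> comb le ?A" unfolding comb_def p using ex_iff by simp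
      moreover have "p \<notin> runs le y ?U" unfolding runs_def p using False by simp
      ultimately show ?thesis by simp
    qed
  qed
qed

text \<open>A run has a single key and its values are determined, so its entries differ in the index
  alone. This is what keeps a register of the scan to \<open>D\<close> words.\<close>

lemma runs_card:
  assumes le: "good_order le" and J: "finite J" and D: "\<And>j k x. j \<in> J \<Longrightarrow> y j k x > 0 \<Longrightarrow> x < D"
  shows "finite (runs le y J) \<and> card (runs le y J) \<le> D"
proof -
  have inj: "inj_on (\<lambda>(k, x, v). x) (runs le y J)"
  proof (rule inj_onI)
    fix p q assume a: "p \<in> runs le y J" "q \<in> runs le y J" "(\<lambda>(k, x, v). x) p = (\<lambda>(k, x, v). x) q"
    obtain k x v k' v' where pq: "p = (k, x, v)" "q = (k', x, v')" using a(3) by (cases p; cases q) auto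
    then have "le k k'" "le k' k" using a unfolding runs_def by auto
    then have "k = k'" using le unfolding good_order_def by blast
    then show "p = q" using a pq unfolding runs_def by auto
  qed
  have sub: "(\<lambda>(k, x, v). x) ` runs le y J \<subseteq> {..<D}"
    using D ysum_pos[OF J] unfolding runs_def by auto
  show ?thesis using inj_on_finite[OF inj sub] card_inj_on_le[OF inj sub] by auto
qed

definition vl :: "(nat \<times> nat \<times> nat) set \<Rightarrow> nat \<Rightarrow> nat \<Rightarrow> nat" where
  "vl A k x = (\<Sum>v | (k, x, v) \<in> A. v)"

text \<open>If \<open>u\<close> precedes every occurring key, then either \<open>u\<close> is the
  key of the run or it does not occur at all; in the second case the empty sum in \<open>vl\<close>
  gives the correct value 0.\<close>

lemma vl_runs:
  assumes "\<And>k x'. ysum y J k x' > 0 \<Longrightarrow> le u k"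
  shows "vl (runs le y J) u x = ysum y J u x"
proof -
  have "{v. (u, x, v) \<in> runs le y J} = (if ysum y J u x > 0 then {ysum y J u x} else {})"
    using assms unfolding runs_def by auto
  then show ?thesis unfolding vl_def by auto
qed

lemma runs_mono_bound:
  assumes "(k, x, v) \<in> runs le y J" "J \<subseteq> J'" "finite J'"
  shows "v \<le> ysum y J' k x \<and> (\<exists>j\<in>J. y j k x > 0)"
proof -
  have v: "v = ysum y J k x" "v > 0" using assms(1) by (auto simp: runs_def)
  have "ysum y J k x \<le> ysum y J' k x" unfolding ysum_def by (rule sum_mono2[OF assms(3,2)]) simp
  then show ?thesis using v ysum_pos[of J y k x] assms finite_subset by auto
qed

subsection \<open>Prefix scans\<close>

definition nosw :: "w set \<Rightarrow> w set" where
  "nosw s = {a \<in> s. \<forall>r d k x v. a \<noteq> SW r d k x v}"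

definition lo :: "nat \<Rightarrow> nat \<Rightarrow> nat \<Rightarrow> bool" where
  "lo r = (if r = 0 \<or> r = 3 then (\<le>) else (\<ge>))"

definition rd :: "nat \<Rightarrow> w set \<Rightarrow> (nat \<times> nat \<times> nat) set" where
  "rd r s = comb (lo r) {(d, k, x, v). SW r d k x v \<in> s}"

definition sws :: "nat \<Rightarrow> nat \<Rightarrow> (nat \<times> nat \<times> nat) set \<Rightarrow> w set" where
  "sws r d A = (\<lambda>(k, x, v). SW r d k x v) ` A"

text \<open>Machines are numbered in base \<open>F\<close> with \<open>h\<close> digits. In level
  \<open>l\<close> the \<open>F\<close> machines that agree in all digits except digit
  \<open>l\<close> exchange their registers, as in a butterfly network, so that after
  \<open>h\<close> levels every machine has received the combined data of all. The same digits, in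
  base \<open>D\<close>, serve the radix sort.\<close>

definition digit :: "nat \<Rightarrow> nat \<Rightarrow> nat \<Rightarrow> nat" where
  "digit F l i = i div F ^ l mod F"

definition partner :: "nat \<Rightarrow> nat \<Rightarrow> nat \<Rightarrow> nat \<Rightarrow> nat" where
  "partner F l i d = (i div F ^ l div F * F + d) * F ^ l + i mod F ^ l"

definition block :: "nat \<Rightarrow> nat \<Rightarrow> nat \<Rightarrow> nat set" where
  "block F l i = {j. j div F ^ l = i div F ^ l}"

text \<open>Register 0 and 1 hold the runs with the smallest and the largest key in the current block of
  machines, register 2 the largest run before the machine, register 3 the smallest run behind it.\<close>

definition scan_msg :: "nat \<Rightarrow> nat \<Rightarrow> w set \<Rightarrow> nat \<Rightarrow> w set" where
  "scan_msg F e s d = sws 0 e (rd 0 s) \<union> sws 1 e (rd 1 s) \<union>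
     (if e < d then sws 2 (Suc e) (rd 1 s) else {}) \<union> (if d < e then sws 3 (Suc e) (rd 0 s) else {})"

definition scan_init :: "(nat \<Rightarrow> w set \<Rightarrow> nat \<Rightarrow> nat \<Rightarrow> nat) \<Rightarrow> instr" where
  "scan_init g i s = Pair i ` (nosw s \<union> sws 0 0 (runs (\<le>) (\<lambda>_. g i (nosw s)) {i})
     \<union> sws 1 0 (runs (\<ge>) (\<lambda>_. g i (nosw s)) {i}))"

text \<open>In registers 2 and 3 part 0 is the old content of the machine itself, which covers its
  own block; therefore a contribution of partner \<open>e\<close> carries the part number
  \<open>Suc e\<close> there. In registers 0 and 1 the machine is one of its own partners and needs
  no separate part.\<close>

definition scan_level :: "nat \<Rightarrow> nat \<Rightarrow> instr" where
  "scan_level F l i s = Pair i ` (nosw s \<union> sws 2 0 (rd 2 s) \<union> sws 3 0 (rd 3 s)) \<union>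
     (\<Union>d<F. Pair (partner F l i d) ` scan_msg F (digit F l i) s d)"

definition scan :: "nat \<Rightarrow> nat \<Rightarrow> (nat \<Rightarrow> w set \<Rightarrow> nat \<Rightarrow> nat \<Rightarrow> nat) \<Rightarrow> instr list" where
  "scan F h g = scan_init g # map (scan_level F) [0..<h]"

lemma SW_sws [simp]: "SW r' d' k x v \<in> sws r d A \<longleftrightarrow> r' = r \<and> d' = d \<and> (k, x, v) \<in> A"
  by (force simp: sws_def)

lemma SW_scan_msg: "SW r d k x v \<in> scan_msg F e s d' \<longleftrightarrow>
    (r = 0 \<and> d = e \<and> (k, x, v) \<in> rd 0 s) \<or> (r = 1 \<and> d = e \<and> (k, x, v) \<in> rd 1 s) \<or>
    (r = 2 \<and> d = Suc e \<and> e < d' \<and> (k, x, v) \<in> rd 1 s) \<or> (r = 3 \<and> d = Suc e \<and> d' < e \<and> (k, x, v) \<in> rd 0 s)"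
  by (auto simp: scan_msg_def)

lemma length_scan: "length (scan F h g) = Suc h" by (simp add: scan_def)

section \<open>Partners and blocks in base \<open>F\<close>\<close>

lemma partner_div: "F > 0 \<Longrightarrow> partner F l i d div F ^ l = i div F ^ l div F * F + d"
  by (simp add: partner_def)

lemma partner_mod: "F > 0 \<Longrightarrow> partner F l i d mod F ^ l = i mod F ^ l"
  by (simp add: partner_def)

lemma digit_partner: "F > 0 \<Longrightarrow> d < F \<Longrightarrow> digit F l (partner F l i d) = d"
  by (simp add: digit_def partner_div)

lemma partner_partner:
  "F > 0 \<Longrightarrow> d < F \<Longrightarrow> partner F l (partner F l i d) e = partner F l i e"
  unfolding partner_def[of F l "partner F l i d"] partner_mod partner_div by (simp add: partner_def)

lemma partner_digit: "F > 0 \<Longrightarrow> partner F l i (digit F l i) = i"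
  by (simp add: partner_def digit_def div_mult_mod_eq)

lemma digit_less: "F > 0 \<Longrightarrow> digit F l i < F"
  by (simp add: digit_def)

lemma partner_iff:
  assumes "F > 0" "d < F" shows "partner F l j d = i \<longleftrightarrow> d = digit F l i \<and> j \<in> partner F l i ` {..<F}"
proof
  assume a: "partner F l j d = i"
  have "j = partner F l i (digit F l j)"
    using partner_partner[OF assms, of l j "digit F l j"] partner_digit[OF assms(1)] a by simp
  moreover have "d = digit F l i" using a digit_partner[OF assms, of l j] by simp
  ultimately show "d = digit F l i \<and> j \<in> partner F l i ` {..<F}"
    using digit_less[OF assms(1)] by blast
next
  assume "d = digit F l i \<and> j \<in> partner F l i ` {..<F}"
  then show "partner F l j d = i" using assms partner_partner partner_digit by auto
qed

lemma block_Suc: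
  assumes "F > 0" shows "block F (Suc l) i = (\<Union>d<F. block F l (partner F l i d))"
proof -
  have "j div F ^ Suc l = i div F ^ Suc l \<longleftrightarrow> (\<exists>d<F. j div F ^ l = i div F ^ l div F * F + d)" for j
  proof -
    have "j div F ^ Suc l = j div F ^ l div F" "i div F ^ Suc l = i div F ^ l div F"
      by (simp_all add: mult.commute div_mult2_eq[symmetric])
    moreover have "a div F = b div F \<longleftrightarrow> (\<exists>d<F. a = b div F * F + d)" for a b
    proof
      assume "a div F = b div F"
      then have "a = b div F * F + a mod F" by (metis div_mult_mod_eq)
      then show "\<exists>d<F. a = b div F * F + d" using assms mod_less_divisor by blast
    qed auto
    ultimately show ?thesis by simp
  qed
  then show ?thesis by (auto simp: block_def partner_div[OF assms])
qed

lemma block_disjoint: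
  "F > 0 \<Longrightarrow> d \<noteq> e \<Longrightarrow> block F l (partner F l i d) \<inter> block F l (partner F l i e) = {}"
  by (auto simp: block_def partner_div)

lemma block_subset:
  assumes "F > 0" "l \<le> h" "i < F ^ h" shows "block F l i \<subseteq> {..<F ^ h}"
proof
  fix j assume "j \<in> block F l i"
  then have "j div F ^ l div F ^ (h - l) = i div F ^ l div F ^ (h - l)" by (simp add: block_def)
  then have "j div F ^ h = i div F ^ h"
    using assms(2) by (simp add: div_mult2_eq[symmetric] power_add[symmetric])
  then show "j \<in> {..<F ^ h}" using assms by (simp add: div_eq_0_iff)
qed

lemma self_block: "i \<in> block F l i" by (simp add: block_def)

text \<open>The blocks of two partners agree in all digits above \<open>l\<close>, so digit
  \<open>l\<close> decides the order between any of their machines.\<close>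

lemma block_cmp:
  assumes "F > 0" "j \<in> block F l (partner F l i d)" "d < F"
  shows "d < digit F l i \<Longrightarrow> j < i" "digit F l i < d \<Longrightarrow> i < j"
proof -
  let ?B = "F ^ l"
  have j: "j div ?B = i div ?B div F * F + d" using assms by (simp add: block_def partner_div)
  have i: "i div ?B = i div ?B div F * F + digit F l i" by (simp add: digit_def)
  show "j < i" if "d < digit F l i"
  proof (rule ccontr)
    assume "\<not> j < i"
    then have "i div ?B \<le> j div ?B" by (intro div_le_mono) simp
    then show False using i j that by linarith
  qed
  show "i < j" if "digit F l i < d"
  proof (rule ccontr)
    assume "\<not> i < j"
    then have "j div ?B \<le> i div ?B" by (intro div_le_mono) simp
    then show False using i j that by linarith
  qed
qed

text \<open>The index set repeats the part numbers of the messages: 0 for the own block, and a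
  successor \<open>Suc d\<close> for the block of partner \<open>d\<close>. Thus the union has the
  shape that \<open>comb_runs\<close> expects of register 2, and \<open>block_behind\<close> does
  the same for register 3.\<close>

lemma block_before:
  assumes "F > 0"
  shows "block F (Suc l) i \<inter> {..<i}
    = (\<Union>d<Suc (digit F l i). if d = 0 then block F l i \<inter> {..<i} else block F l (partner F l i (d - 1)))"
proof (rule set_eqI)
  fix j
  have F: "digit F l i < F" by (rule digit_less[OF assms])
  have self: "block F l (partner F l i (digit F l i)) = block F l i" by (simp add: partner_digit assms)
  show "j \<in> block F (Suc l) i \<inter> {..<i} \<longleftrightarrow>
     j \<in> (\<Union>d<Suc (digit F l i). if d = 0 then block F l i \<inter> {..<i} else block F l (partner F l i (d - 1)))"
  proof
    assume "j \<in> block F (Suc l) i \<inter> {..<i}"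
    then obtain d where d: "d < F" "j \<in> block F l (partner F l i d)" "j < i"
      using block_Suc[OF assms] by auto
    then consider "d = digit F l i" | "d < digit F l i" using block_cmp[OF assms d(2,1)] by fastforce
    then show "j \<in> (\<Union>d<Suc (digit F l i). if d = 0 then block F l i \<inter> {..<i} else block F l (partner F l i (d - 1)))"
    proof cases
      case 1
      then show ?thesis using d self by (intro UN_I[of 0]) auto
    next
      case 2
      then show ?thesis using d by (intro UN_I[of "Suc d"]) auto
    qed
  next
    assume "j \<in> (\<Union>d<Suc (digit F l i). if d = 0 then block F l i \<inter> {..<i} else block F l (partner F l i (d - 1)))"
    then obtain d where d: "d < Suc (digit F l i)"
      "j \<in> (if d = 0 then block F l i \<inter> {..<i} else block F l (partner F l i (d - 1)))" by blast
    show "j \<in> block F (Suc l) i \<inter> {..<i}"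
    proof (cases d)
      case 0
      then show ?thesis using d self F block_Suc[OF assms] by auto
    next
      case (Suc e)
      then have "j \<in> block F l (partner F l i e)" "e < digit F l i" using d by auto
      then show ?thesis using block_cmp(1)[OF assms, of j l i e] F block_Suc[OF assms] by auto
    qed
  qed
qed

lemma block_behind:
  assumes "F > 0"
  shows "block F (Suc l) i \<inter> {i<..}
    = (\<Union>d\<in>insert 0 {Suc (Suc (digit F l i))..<Suc F}. if d = 0 then block F l i \<inter> {i<..} else block F l (partner F l i (d - 1)))"
proof (rule set_eqI)
  fix j
  let ?I = "insert 0 {Suc (Suc (digit F l i))..<Suc F}"
  have F: "digit F l i < F" by (rule digit_less[OF assms])
  have self: "block F l (partner F l i (digit F l i)) = block F l i" by (simp add: partner_digit assms)
  show "j \<in> block F (Suc l) i \<inter> {i<..} \<longleftrightarrow>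
     j \<in> (\<Union>d\<in>?I. if d = 0 then block F l i \<inter> {i<..} else block F l (partner F l i (d - 1)))"
  proof
    assume "j \<in> block F (Suc l) i \<inter> {i<..}"
    then obtain d where d: "d < F" "j \<in> block F l (partner F l i d)" "i < j"
      using block_Suc[OF assms] by auto
    then consider "d = digit F l i" | "digit F l i < d" using block_cmp[OF assms d(2,1)] by fastforce
    then show "j \<in> (\<Union>d\<in>?I. if d = 0 then block F l i \<inter> {i<..} else block F l (partner F l i (d - 1)))"
    proof cases
      case 1
      then show ?thesis using d self by (intro UN_I[of 0]) auto
    next
      case 2
      then show ?thesis using d by (intro UN_I[of "Suc d"]) auto
    qed
  next
    assume "j \<in> (\<Union>d\<in>?I. if d = 0 then block F l i \<inter> {i<..} else block F l (partner F l i (d - 1)))"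
    then obtain d where d: "d \<in> ?I"
      "j \<in> (if d = 0 then block F l i \<inter> {i<..} else block F l (partner F l i (d - 1)))" by blast
    show "j \<in> block F (Suc l) i \<inter> {i<..}"
    proof (cases d)
      case 0
      then show ?thesis using d self F block_Suc[OF assms] by auto
    next
      case (Suc e)
      then have "j \<in> block F l (partner F l i e)" "digit F l i < e" "e < F" using d by auto
      then show ?thesis using block_cmp(2)[OF assms, of j l i e] F block_Suc[OF assms] by auto
    qed
  qed
qed

text \<open>Being partners in a level is an equivalence relation with classes of size
  \<open>F\<close>. So the senders to \<open>i\<close> are exactly its \<open>F\<close> partners,
  and each of them uses the one message meant for digit \<open>digit F l i\<close>.\<close>

lemma flow_ok_partner:
  assumes F: "F > 0"
    and A: "\<And>j d. j < M \<Longrightarrow> d < F \<Longrightarrow> finite (A j d) \<and> card (A j d) \<le> c \<and> A j d \<subseteq> bwords X"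
    and M: "\<And>i d. i < M \<Longrightarrow> d < F \<Longrightarrow> partner F l i d < M"
  shows "flow_ok M X (F * c) (\<lambda>j. \<Union>d<F. Pair (partner F l j d) ` A j d)" (is "flow_ok M X _ ?f")
proof -
  have "card (?f j) \<le> F * c \<and> finite (?f j)" if j: "j < M" for j
  proof -
    have "card (?f j) \<le> (\<Sum>d<F. card (Pair (partner F l j d) ` A j d))" by (rule card_UN_le) simp
    also have "\<dots> \<le> (\<Sum>d<F. c)"
      using A[OF j] by (intro sum_mono) (metis card_image_le lessThan_iff order_trans)
    finally show ?thesis using A[OF j] by simp
  qed
  moreover have "(\<Sum>j<M. card {a. (i, a) \<in> ?f j}) \<le> F * c" if i: "i < M" for i
  proof -
    have sec: "{a. (i, a) \<in> ?f j} = (if j \<in> partner F l i ` {..<F} then A j (digit F l i) else {})" for j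
    proof -
      have "{a. (i, a) \<in> ?f j} = (\<Union>d\<in>{d. d < F \<and> partner F l j d = i}. A j d)" by auto
      also have "{d. d < F \<and> partner F l j d = i}
          = (if j \<in> partner F l i ` {..<F} then {digit F l i} else {})"
        using partner_iff[OF F] digit_less[OF F] by auto
      finally show ?thesis by auto
    qed
    have "(\<Sum>j<M. card {a. (i, a) \<in> ?f j}) \<le> (\<Sum>j<M. if j \<in> partner F l i ` {..<F} then c else 0)"
      unfolding sec using A digit_less[OF F] by (intro sum_mono) auto
    also have "\<dots> = card ({..<M} \<inter> partner F l i ` {..<F}) * c"
      by (simp flip: sum.inter_restrict)
    also have "\<dots> \<le> F * c"
    proof -
      have "card ({..<M} \<inter> partner F l i ` {..<F}) \<le> card (partner F l i ` {..<F})" by (rule card_mono) auto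
      also have "\<dots> \<le> F" using card_image_le[of "{..<F}" "partner F l i"] by simp
      finally show ?thesis by simp
    qed
    finally show ?thesis .
  qed
  moreover have "words_in M X ?f"
    unfolding words_in_def
  proof (intro allI impI subsetI)
    fix j a assume "j < M" "a \<in> snd ` ?f j"
    then obtain d where "d < F" "a \<in> A j d" by auto
    then show "a \<in> bwords X" using A \<open>j < M\<close> by blast
  qed
  ultimately show ?thesis by (simp add: flow_ok_def sends_le_def receives_le_def)
qed

lemma partner_less:
  assumes "F > 0" "l < h" "i < F ^ h" "d < F" shows "partner F l i d < F ^ h"
proof -
  have "partner F l i d \<in> block F (Suc l) i"
    using assms self_block[of "partner F l i d" F l] block_Suc[OF assms(1), of l i] by blast
  then show ?thesis using block_subset[OF assms(1), of "Suc l" h i] assms by auto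
qed

text \<open>The bound on \<open>b\<close> consists of the \<open>a\<close> words of data, the two
  kept registers with \<open>D\<close> words each, and for each of the \<open>F\<close> partners
  three runs: registers 0 and 1, and a contribution to one of the registers 2 and 3.\<close>

locale scan_setting =
  fixes F h M X b D a :: nat
    and g :: "nat \<Rightarrow> w set \<Rightarrow> nat \<Rightarrow> nat \<Rightarrow> nat"
    and \<sigma> :: config and y :: "nat \<Rightarrow> nat \<Rightarrow> nat \<Rightarrow> nat"
  assumes F: "F > 0" and M: "M = F ^ h"
    and base: "\<And>i. i < M \<Longrightarrow> finite (\<sigma> i) \<and> card (\<sigma> i) \<le> a \<and> \<sigma> i \<subseteq> bwords X \<and> nosw (\<sigma> i) = \<sigma> i"
    and y: "\<And>j k x. j < M \<Longrightarrow> g j (\<sigma> j) k x = y j k x"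
    and supp: "\<And>j k x. j < M \<Longrightarrow> y j k x > 0 \<Longrightarrow> k < X \<and> x < D"
    and val: "\<And>k x. ysum y {..<M} k x < X"
    and X: "D \<le> X" "F < X" "20 \<le> X"
    and b: "a + 2 * D + 3 * F * D \<le> b"
begin

definition "good l \<tau> \<longleftrightarrow> (\<forall>i<M. nosw (\<tau> i) = \<sigma> i
   \<and> rd 0 (\<tau> i) = runs (\<le>) y (block F l i) \<and> rd 1 (\<tau> i) = runs (\<ge>) y (block F l i)
   \<and> rd 2 (\<tau> i) = runs (\<ge>) y (block F l i \<inter> {..<i}) \<and> rd 3 (\<tau> i) = runs (\<le>) y (block F l i \<inter> {i<..}))"

lemma comb_runs':
  assumes "good_order le" "finite I" "\<And>d. d \<in> I \<Longrightarrow> J d \<subseteq> {..<M}"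
    "\<And>d e. d \<in> I \<Longrightarrow> e \<in> I \<Longrightarrow> d \<noteq> e \<Longrightarrow> J d \<inter> J e = {}"
  shows "comb le {(d, k, x, v). d \<in> I \<and> (k, x, v) \<in> runs le y (J d)} = runs le y (\<Union>d\<in>I. J d)"
proof (rule comb_runs[OF assms(1,2)])
  show "finite (J d)" if "d \<in> I" for d using assms(3)[OF that] finite_subset by blast
  show "k < X" if "d \<in> I" "j \<in> J d" "y j k x > 0" for d j k x using assms(3)[OF that(1)] that supp by blast
qed (use assms(4) in blast)

lemma sws_bound:
  assumes le: "good_order le" and J: "J \<subseteq> {..<M}" and r: "r < X" "d < X"
  shows "finite (sws r d (runs le y J)) \<and> card (sws r d (runs le y J)) \<le> D
    \<and> sws r d (runs le y J) \<subseteq> bwords X"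
proof -
  have J': "finite J" using J finite_subset by blast
  have "finite (runs le y J) \<and> card (runs le y J) \<le> D"
    by (rule runs_card[OF le J']) (use J supp in blast)
  moreover have "SW r d k x v \<in> bwords X" if m: "(k, x, v) \<in> runs le y J" for k x v
  proof -
    have "v \<le> ysum y {..<M} k x" "\<exists>j\<in>J. y j k x > 0" using runs_mono_bound[OF m J] by auto
    then have "v < X" "k < X" "x < D" using val[of k x] J supp by (auto simp: less_le_trans)
    then show ?thesis using X r by (simp add: bwords_def)
  qed
  ultimately show ?thesis unfolding sws_def
    by (auto intro: order_trans[OF card_image_le])
qed

lemma init: "\<exists>\<tau>. reaches M X b [scan_init g] \<sigma> \<tau> \<and> good 0 \<tau>"
proof -
  define A where "A j = \<sigma> j \<union> sws 0 0 (runs (\<le>) y {j}) \<union> sws 1 0 (runs (\<ge>) y {j})" for j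
  have r: "runs le (\<lambda>_. g j (\<sigma> j)) {j} = runs le y {j}" if "j < M" for j le
    using y[OF that] by (simp add: runs_def ysum_def)
  have A: "finite (A j) \<and> card (A j) \<le> b \<and> A j \<subseteq> bwords X" if "j < M" for j
  proof -
    have b0: "finite (sws 0 0 (runs (\<le>) y {j})) \<and> card (sws 0 0 (runs (\<le>) y {j})) \<le> D \<and> sws 0 0 (runs (\<le>) y {j}) \<subseteq> bwords X"
      using that X by (intro sws_bound[OF good_order_le]) auto
    have b1: "finite (sws 1 0 (runs (\<ge>) y {j})) \<and> card (sws 1 0 (runs (\<ge>) y {j})) \<le> D \<and> sws 1 0 (runs (\<ge>) y {j}) \<subseteq> bwords X"
      using that X by (intro sws_bound[OF good_order_ge]) auto
    have "card (A j) \<le> card (\<sigma> j) + card (sws 0 0 (runs (\<le>) y {j})) + card (sws 1 0 (runs (\<ge>) y {j}))"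
      unfolding A_def by (meson add_right_mono card_Un_le order_trans)
    then show ?thesis using base[OF that] b0 b1 b unfolding A_def by simp
  qed
  have re: "reaches M X b [scan_init g] \<sigma> A"
  proof (rule reaches_instr)
    show "scan_init g j (\<sigma> j) = keep A j" if "j < M" for j
      using base[OF that] r[OF that] by (simp add: scan_init_def keep_def A_def)
    show "flow_ok M X b (keep A)" by (rule flow_ok_keep) (rule A)
    show "deliver M (keep A) i = A i" if "i < M" for i by (rule deliver_keep[OF that])
  qed
  have "good 0 A" unfolding good_def
  proof (intro allI impI conjI)
    fix i assume i: "i < M"
    have blk: "block F 0 i = {i}" by (auto simp: block_def)
    have ns: "nosw (\<sigma> i) = \<sigma> i" using base[OF i] by simp
    then have nosw': "\<And>r d k x v. SW r d k x v \<notin> \<sigma> i" unfolding nosw_def by blast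
    have nosws: "nosw (sws r d R) = {}" for r d R unfolding nosw_def sws_def by auto
    show "nosw (A i) = \<sigma> i"
    proof -
      have "nosw (A i) = nosw (\<sigma> i) \<union> nosw (sws 0 0 (runs (\<le>) y {i})) \<union> nosw (sws 1 0 (runs (\<ge>) y {i}))"
        unfolding A_def nosw_def by blast
      then show ?thesis using ns nosws by simp
    qed
    have c: "comb le {(d, k, x, v). d \<in> {0} \<and> (k, x, v) \<in> runs le y ((\<lambda>_. {i}) d)} = runs le y (\<Union>d\<in>{0::nat}. (\<lambda>_. {i}) d)"
      if "good_order le" for le using i by (intro comb_runs'[OF that]) auto
    have "{(d, k, x, v). SW 0 d k x v \<in> A i} = {(d, k, x, v). d \<in> {0} \<and> (k, x, v) \<in> runs (\<le>) y ((\<lambda>_. {i}) d)}"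
      using nosw' by (auto simp: A_def)
    then show "rd 0 (A i) = runs (\<le>) y (block F 0 i)"
      using c[OF good_order_le] blk by (simp add: rd_def lo_def)
    have "{(d, k, x, v). SW 1 d k x v \<in> A i} = {(d, k, x, v). d \<in> {0} \<and> (k, x, v) \<in> runs (\<ge>) y ((\<lambda>_. {i}) d)}"
      using nosw' by (auto simp: A_def)
    then show "rd 1 (A i) = runs (\<ge>) y (block F 0 i)"
      using c[OF good_order_ge] blk by (simp add: rd_def lo_def)
    have e: "{(d, k, x, v). SW 2 d k x v \<in> A i} = {}" "{(d, k, x, v). SW 3 d k x v \<in> A i} = {}"
      using nosw' by (auto simp: A_def)
    have ce: "comb le {} = {}" "runs le y {} = {}" for le by (auto simp: comb_def runs_def ysum_def)
    show "rd 2 (A i) = runs (\<ge>) y (block F 0 i \<inter> {..<i})" "rd 3 (A i) = runs (\<le>) y (block F 0 i \<inter> {i<..})"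
      unfolding rd_def e blk by (simp_all add: ce)
  qed
  then show ?thesis using re by blast
qed

lemma level:
  assumes good: "good l \<tau>" and l: "l < h"
  shows "\<exists>\<tau>'. reaches M X b [scan_level F l] \<tau> \<tau>' \<and> good (Suc l) \<tau>'"
proof -
  define A where "A j = \<sigma> j \<union> sws 2 0 (rd 2 (\<tau> j)) \<union> sws 3 0 (rd 3 (\<tau> j))" for j
  define msg where "msg j d = scan_msg F (digit F l j) (\<tau> j) d" for j d
  define f where "f j = keep A j \<union> (\<Union>d<F. Pair (partner F l j d) ` msg j d)" for j
  have blk: "block F l i \<subseteq> {..<M}" if "i < M" for i
    using block_subset[OF F, of l h i] that l M by simp
  have pl: "partner F l i d < M" if "i < M" "d < F" for i d
    using partner_less[OF F l] that M by simp
  have rds: "rd 0 (\<tau> i) = runs (\<le>) y (block F l i)" "rd 1 (\<tau> i) = runs (\<ge>) y (block F l i)"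
    "rd 2 (\<tau> i) = runs (\<ge>) y (block F l i \<inter> {..<i})" "rd 3 (\<tau> i) = runs (\<le>) y (block F l i \<inter> {i<..})"
    "nosw (\<tau> i) = \<sigma> i" if "i < M" for i
    using good that by (auto simp: good_def)
  have dF: "digit F l i < F" for i by (rule digit_less[OF F])
  have A: "finite (A j) \<and> card (A j) \<le> a + 2 * D \<and> A j \<subseteq> bwords X" if j: "j < M" for j
  proof -
    have b2: "finite (sws 2 0 (rd 2 (\<tau> j))) \<and> card (sws 2 0 (rd 2 (\<tau> j))) \<le> D \<and> sws 2 0 (rd 2 (\<tau> j)) \<subseteq> bwords X"
      unfolding rds(3)[OF j] using X blk[OF j] by (intro sws_bound[OF good_order_ge]) auto
    have b3: "finite (sws 3 0 (rd 3 (\<tau> j))) \<and> card (sws 3 0 (rd 3 (\<tau> j))) \<le> D \<and> sws 3 0 (rd 3 (\<tau> j)) \<subseteq> bwords X"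
      unfolding rds(4)[OF j] using X blk[OF j] by (intro sws_bound[OF good_order_le]) auto
    have "card (A j) \<le> card (\<sigma> j) + card (sws 2 0 (rd 2 (\<tau> j))) + card (sws 3 0 (rd 3 (\<tau> j)))"
      unfolding A_def by (meson add_right_mono card_Un_le order_trans)
    then show ?thesis using base[OF j] b2 b3 unfolding A_def by simp
  qed
  have msg: "finite (msg j d) \<and> card (msg j d) \<le> 3 * D \<and> msg j d \<subseteq> bwords X" if j: "j < M" and d: "d < F" for j d
  proof -
    let ?e = "digit F l j"
    have e: "?e < X" "Suc ?e < X" using dF[of j] X by auto
    have m: "finite (sws r e' (rd 0 (\<tau> j))) \<and> card (sws r e' (rd 0 (\<tau> j))) \<le> D \<and> sws r e' (rd 0 (\<tau> j)) \<subseteq> bwords X"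
        "finite (sws r e' (rd 1 (\<tau> j))) \<and> card (sws r e' (rd 1 (\<tau> j))) \<le> D \<and> sws r e' (rd 1 (\<tau> j)) \<subseteq> bwords X"
      if "r < 4" "e' < X" for r e'
      unfolding rds(1,2)[OF j] using that X blk[OF j]
      by (intro sws_bound[OF good_order_le] sws_bound[OF good_order_ge]; simp)+
    \<comment> \<open>A partner lies either behind the machine or before it, so at most one of these
      two sets is sent; this gives \<open>3 * D\<close> words per message.\<close>
    define T where "T = (if ?e < d then sws 2 (Suc ?e) (rd 1 (\<tau> j)) else {}) \<union> (if d < ?e then sws 3 (Suc ?e) (rd 0 (\<tau> j)) else {})"
    have T: "finite T \<and> card T \<le> D \<and> T \<subseteq> bwords X"
      unfolding T_def using m[of 2 "Suc ?e"] m[of 3 "Suc ?e"] e by (cases "?e < d") auto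
    have mT: "msg j d = sws 0 ?e (rd 0 (\<tau> j)) \<union> sws 1 ?e (rd 1 (\<tau> j)) \<union> T"
      by (simp add: msg_def scan_msg_def T_def Un_assoc)
    have "card (msg j d) \<le> card (sws 0 ?e (rd 0 (\<tau> j))) + card (sws 1 ?e (rd 1 (\<tau> j))) + card T"
      unfolding mT by (meson add_right_mono card_Un_le order_trans)
    then show ?thesis using m[of 0 ?e] m[of 1 ?e] e T unfolding mT by simp
  qed
  have fl: "flow_ok M X b f"
  proof -
    have "flow_ok M X (a + 2 * D) (keep A)" by (rule flow_ok_keep) (rule A)
    moreover have "flow_ok M X (F * (3 * D)) (\<lambda>j. \<Union>d<F. Pair (partner F l j d) ` msg j d)"
      by (rule flow_ok_partner[OF F]) (use msg pl in auto)
    ultimately have "flow_ok M X (a + 2 * D + F * (3 * D)) f"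
      unfolding f_def by (rule flow_ok_Un)
    then show ?thesis by (rule flow_ok_mono) (use b in \<open>simp add: mult.assoc mult.left_commute\<close>)
  qed
  define \<tau>' where "\<tau>' i = A i \<union> (\<Union>e<F. scan_msg F e (\<tau> (partner F l i e)) (digit F l i))" for i
  have del: "deliver M f i = \<tau>' i" if i: "i < M" for i
  proof -
    have "deliver M (\<lambda>j. \<Union>d<F. Pair (partner F l j d) ` msg j d) i
       = (\<Union>e<F. scan_msg F e (\<tau> (partner F l i e)) (digit F l i))" (is "?L = ?R")
    proof (rule set_eqI)
      fix w
      have "w \<in> ?L \<longleftrightarrow> (\<exists>j<M. \<exists>d<F. partner F l j d = i \<and> w \<in> msg j d)"
        unfolding deliver_def by auto
      also have "\<dots> \<longleftrightarrow> (\<exists>j<M. \<exists>d<F. d = digit F l i \<and> j \<in> partner F l i ` {..<F} \<and> w \<in> msg j d)"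
        by (simp add: partner_iff[OF F] conj_assoc cong: conj_cong)
      also have "\<dots> \<longleftrightarrow> (\<exists>j<M. j \<in> partner F l i ` {..<F} \<and> w \<in> msg j (digit F l i))"
        using dF[of i] by auto
      also have "\<dots> \<longleftrightarrow> (\<exists>e<F. w \<in> msg (partner F l i e) (digit F l i))" using pl[OF i] by auto
      also have "\<dots> \<longleftrightarrow> w \<in> ?R" unfolding msg_def using digit_partner[OF F] by auto
      finally show "w \<in> ?L \<longleftrightarrow> w \<in> ?R" .
    qed
    then show ?thesis unfolding f_def deliver_Un deliver_keep[OF i] \<tau>'_def by simp
  qed
  have re: "reaches M X b [scan_level F l] \<tau> \<tau>'"
  proof (rule reaches_instr[OF _ fl del])
    show "scan_level F l j (\<tau> j) = f j" if "j < M" for j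
      using rds(5)[OF that] by (simp add: scan_level_def f_def keep_def A_def msg_def)
  qed
  have "good (Suc l) \<tau>'" unfolding good_def
  proof (intro allI impI conjI)
    fix i assume i: "i < M"
    let ?g = "digit F l i"
    have blkS: "block F (Suc l) i \<subseteq> {..<M}" using block_subset[OF F, of "Suc l" h i] i l M by simp
    have "nosw (\<sigma> i) = \<sigma> i" using base[OF i] by simp
    then have nosw': "\<And>r d k x v. SW r d k x v \<notin> \<sigma> i" unfolding nosw_def by blast
    show "nosw (\<tau>' i) = \<sigma> i"
    proof -
      have "a \<in> nosw (\<tau>' i) \<longleftrightarrow> a \<in> \<sigma> i" for a
        using nosw' by (cases a) (auto simp: nosw_def \<tau>'_def A_def sws_def scan_msg_def split: if_splits)
      then show ?thesis by blast
    qed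
    have part: "SW 0 d k x v \<in> \<tau>' i \<longleftrightarrow> d < F \<and> (k, x, v) \<in> rd 0 (\<tau> (partner F l i d))"
        "SW 1 d k x v \<in> \<tau>' i \<longleftrightarrow> d < F \<and> (k, x, v) \<in> rd 1 (\<tau> (partner F l i d))"
        "SW 2 d k x v \<in> \<tau>' i \<longleftrightarrow> (if d = 0 then (k, x, v) \<in> rd 2 (\<tau> i)
            else d - 1 < ?g \<and> (k, x, v) \<in> rd 1 (\<tau> (partner F l i (d - 1))))"
        "SW 3 d k x v \<in> \<tau>' i \<longleftrightarrow> (if d = 0 then (k, x, v) \<in> rd 3 (\<tau> i)
            else ?g < d - 1 \<and> d - 1 < F \<and> (k, x, v) \<in> rd 0 (\<tau> (partner F l i (d - 1))))" for d k x v
    proof -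
      have mem: "SW r d k x v \<in> \<tau>' i \<longleftrightarrow> SW r d k x v \<in> A i \<or> (\<exists>e<F. SW r d k x v \<in> scan_msg F e (\<tau> (partner F l i e)) ?g)" for r
        by (auto simp: \<tau>'_def)
      have memA: "SW r d k x v \<in> A i \<longleftrightarrow> (r = 2 \<and> d = 0 \<and> (k, x, v) \<in> rd 2 (\<tau> i)) \<or> (r = 3 \<and> d = 0 \<and> (k, x, v) \<in> rd 3 (\<tau> i))" for r
        using nosw' by (auto simp: A_def)
      show "SW 0 d k x v \<in> \<tau>' i \<longleftrightarrow> d < F \<and> (k, x, v) \<in> rd 0 (\<tau> (partner F l i d))"
        "SW 1 d k x v \<in> \<tau>' i \<longleftrightarrow> d < F \<and> (k, x, v) \<in> rd 1 (\<tau> (partner F l i d))"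
        unfolding mem memA SW_scan_msg by auto
      show "SW 2 d k x v \<in> \<tau>' i \<longleftrightarrow> (if d = 0 then (k, x, v) \<in> rd 2 (\<tau> i)
            else d - 1 < ?g \<and> (k, x, v) \<in> rd 1 (\<tau> (partner F l i (d - 1))))"
        unfolding mem memA SW_scan_msg using dF[of i] by (cases d) auto
      show "SW 3 d k x v \<in> \<tau>' i \<longleftrightarrow> (if d = 0 then (k, x, v) \<in> rd 3 (\<tau> i)
            else ?g < d - 1 \<and> d - 1 < F \<and> (k, x, v) \<in> rd 0 (\<tau> (partner F l i (d - 1))))"
        unfolding mem memA SW_scan_msg using dF[of i] by (cases d) auto
    qed
    have sub: "block F l (partner F l i d) \<subseteq> {..<M}" if "d < F" for d using blk pl[OF i that] by simp
    note disj = block_disjoint[OF F]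
    have dj: "x \<in> block F l (partner F l i a) \<Longrightarrow> x \<in> block F l (partner F l i c) \<Longrightarrow> a = c" for x a c
      using disj[of a c l i] by blast
    have "{(d, k, x, v). SW 0 d k x v \<in> \<tau>' i}
        = {(d, k, x, v). d \<in> {..<F} \<and> (k, x, v) \<in> runs (\<le>) y (block F l (partner F l i d))}"
      using part(1) rds(1) pl[OF i] by auto
    then show "rd 0 (\<tau>' i) = runs (\<le>) y (block F (Suc l) i)"
      using comb_runs'[OF good_order_le, of "{..<F}" "\<lambda>d. block F l (partner F l i d)"] sub disj
        block_Suc[OF F, of l i] by (simp add: rd_def lo_def)
    have "{(d, k, x, v). SW 1 d k x v \<in> \<tau>' i}
        = {(d, k, x, v). d \<in> {..<F} \<and> (k, x, v) \<in> runs (\<ge>) y (block F l (partner F l i d))}"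
      using part(2) rds(2) pl[OF i] by auto
    then show "rd 1 (\<tau>' i) = runs (\<ge>) y (block F (Suc l) i)"
      using comb_runs'[OF good_order_ge, of "{..<F}" "\<lambda>d. block F l (partner F l i d)"] sub disj
        block_Suc[OF F, of l i] by (simp add: rd_def lo_def)
    have self: "block F l i = block F l (partner F l i ?g)" by (simp add: partner_digit F)
    let ?J = "\<lambda>d. if d = 0 then block F l i \<inter> {..<i} else block F l (partner F l i (d - 1))"
    have "{(d, k, x, v). SW 2 d k x v \<in> \<tau>' i} = {(d, k, x, v). d \<in> {..<Suc ?g} \<and> (k, x, v) \<in> runs (\<ge>) y (?J d)}"
      using part(3) rds(2) rds(3)[OF i] pl[OF i] dF[of i] by (auto split: if_splits)
    moreover have "comb (\<ge>) {(d, k, x, v). d \<in> {..<Suc ?g} \<and> (k, x, v) \<in> runs (\<ge>) y (?J d)}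
       = runs (\<ge>) y (\<Union>d\<in>{..<Suc ?g}. ?J d)"
    proof (rule comb_runs'[OF good_order_ge])
      show "?J d \<subseteq> {..<M}" if "d \<in> {..<Suc ?g}" for d
        using sub[of "d - 1"] that dF[of i] blk[OF i] by auto
      show "?J d \<inter> ?J e = {}" if "d \<in> {..<Suc ?g}" "e \<in> {..<Suc ?g}" "d \<noteq> e" for d e
        using that unfolding self by (cases d; cases e) (auto dest: dj)
    qed simp
    ultimately show "rd 2 (\<tau>' i) = runs (\<ge>) y (block F (Suc l) i \<inter> {..<i})"
      unfolding block_before[OF F] by (simp add: rd_def lo_def)
    let ?I = "insert 0 {Suc (Suc ?g)..<Suc F}"
    let ?J = "\<lambda>d. if d = 0 then block F l i \<inter> {i<..} else block F l (partner F l i (d - 1))"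
    have "{(d, k, x, v). SW 3 d k x v \<in> \<tau>' i} = {(d, k, x, v). d \<in> ?I \<and> (k, x, v) \<in> runs (\<le>) y (?J d)}"
      using part(4) rds(1) rds(4)[OF i] pl[OF i] dF[of i] by (auto split: if_splits)
    moreover have "comb (\<le>) {(d, k, x, v). d \<in> ?I \<and> (k, x, v) \<in> runs (\<le>) y (?J d)}
       = runs (\<le>) y (\<Union>d\<in>?I. ?J d)"
    proof (rule comb_runs'[OF good_order_le])
      show "?J d \<subseteq> {..<M}" if "d \<in> ?I" for d
        using sub[of "d - 1"] that blk[OF i] by (cases d) auto
      show "?J d \<inter> ?J e = {}" if "d \<in> ?I" "e \<in> ?I" "d \<noteq> e" for d e
        using that unfolding self by (cases d; cases e) (auto dest: dj)
    qed simp
    ultimately show "rd 3 (\<tau>' i) = runs (\<le>) y (block F (Suc l) i \<inter> {i<..})"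
      unfolding block_behind[OF F] by (simp add: rd_def lo_def)
  qed
  then show ?thesis using re by blast
qed

lemma levels: "l \<le> h \<Longrightarrow> \<exists>\<tau>. reaches M X b (scan_init g # map (scan_level F) [0..<l]) \<sigma> \<tau> \<and> good l \<tau>"
proof (induction l)
  case 0
  then show ?case using init by simp
next
  case (Suc l)
  then obtain \<tau> where \<tau>: "reaches M X b (scan_init g # map (scan_level F) [0..<l]) \<sigma> \<tau>" "good l \<tau>" by auto
  obtain \<tau>' where \<tau>': "reaches M X b [scan_level F l] \<tau> \<tau>'" "good (Suc l) \<tau>'"
    using level[OF \<tau>(2)] Suc by auto
  show ?case using reaches_append[OF \<tau>(1) \<tau>'(1)] \<tau>'(2) by auto
qed

theorem scan_correct:
  "\<exists>\<tau>. reaches M X b (scan F h g) \<sigma> \<tau> \<and> (\<forall>i<M. nosw (\<tau> i) = \<sigma> i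
   \<and> rd 0 (\<tau> i) = runs (\<le>) y {..<M} \<and> rd 1 (\<tau> i) = runs (\<ge>) y {..<M}
   \<and> rd 2 (\<tau> i) = runs (\<ge>) y {..<i} \<and> rd 3 (\<tau> i) = runs (\<le>) y {i<..<M})"
proof -
  obtain \<tau> where t: "reaches M X b (scan F h g) \<sigma> \<tau>" "good h \<tau>" using levels[of h] by (auto simp: scan_def)
  have blk: "block F h i = {..<M}" if "i < M" for i
  proof -
    have "block F h i \<subseteq> {..<M}" using block_subset[OF F, of h h i] that M by simp
    moreover have "j \<in> block F h i" if "j < M" for j
      using that \<open>i < M\<close> M by (simp add: block_def)
    ultimately show ?thesis by blast
  qed
  have "{..<M} \<inter> {..<i} = {..<i}" "{..<M} \<inter> {i<..} = {i<..<M}" if "i < M" for i using that by auto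
  then show ?thesis using t blk by (intro exI[of _ \<tau>]) (simp add: good_def)
qed

end

subsection \<open>Searching a seed by conditional expectations\<close>

definition noseed :: "w set \<Rightarrow> w set" where
  "noseed s = {a \<in> s. \<forall>q. a \<noteq> Seed q}"

definition getseed :: "w set \<Rightarrow> nat" where
  "getseed s = (THE q. Seed q \<in> s)"

definition argmin_below :: "(nat \<Rightarrow> nat) \<Rightarrow> nat \<Rightarrow> nat" where
  "argmin_below f D = (SOME d. d < D \<and> (\<forall>e<D. f d \<le> f e))"

text \<open>A seed is read as \<open>r\<close> digits in base \<open>D\<close>; division by
  \<open>D ^ (r - Suc t)\<close> leaves its first \<open>Suc t\<close> digits. Summing the cost over
  all seeds with a given prefix is the conditional expectation up to normalization. Summing over
  that many seeds is local computation, which the model does not charge. The key is always 0, and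
  the index of the scan is the next digit.\<close>

definition seed_cost :: "nat \<Rightarrow> nat \<Rightarrow> (nat \<Rightarrow> w set \<Rightarrow> nat \<Rightarrow> nat) \<Rightarrow> nat \<Rightarrow> nat \<Rightarrow> w set \<Rightarrow> nat \<Rightarrow> nat \<Rightarrow> nat" where
  "seed_cost D r c t i s k x = (if k = 0 \<and> x < D then
     (\<Sum>q | q < D ^ r \<and> q div D ^ (r - Suc t) = getseed s * D + x. c i (noseed s) q) else 0)"

definition seed_pick :: "nat \<Rightarrow> instr" where
  "seed_pick D i s = Pair i ` (noseed (nosw s) \<union>
     {Seed (getseed s * D + argmin_below (vl (rd 0 s) 0) D)})"

definition seed_search :: "nat \<Rightarrow> nat \<Rightarrow> nat \<Rightarrow> nat \<Rightarrow> (nat \<Rightarrow> w set \<Rightarrow> nat \<Rightarrow> nat) \<Rightarrow> instr list" where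
  "seed_search F h D r c = (\<lambda>i s. Pair i ` insert (Seed 0) s) #
     concat (map (\<lambda>t. scan F h (seed_cost D r c t) @ [seed_pick D]) [0..<r])"

lemma length_seed_search: "length (seed_search F h D r c) = Suc (r * (h + 2))"
proof -
  have "length (concat (map (\<lambda>t. scan F h (seed_cost D r c t) @ [seed_pick D]) [0..<t])) = t * (h + 2)" for t
    by (induction t) (auto simp: length_scan)
  then show ?thesis by (simp add: seed_search_def)
qed

lemma argmin_below:
  assumes "D > 0" shows "argmin_below f D < D" "e < D \<Longrightarrow> f (argmin_below f D) \<le> f e"
proof -
  have "\<exists>d\<in>{..<D}. \<forall>e\<in>{..<D}. f d \<le> f e"
    using assms ex_is_arg_min_if_finite[of "{..<D}" f] by (auto simp: is_arg_min_linorder)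
  then have "\<exists>d. d < D \<and> (\<forall>e<D. f d \<le> f e)" by auto
  from someI_ex[OF this] show "argmin_below f D < D" "e < D \<Longrightarrow> f (argmin_below f D) \<le> f e"
    unfolding argmin_below_def by auto
qed

text \<open>All machines read the same total costs from register 0, and the choice depends on these
  values alone. So they append the same digit without a broadcast.\<close>

lemma argmin_below_cong: "(\<And>d. d < D \<Longrightarrow> f d = g d) \<Longrightarrow> argmin_below f D = argmin_below g D"
  unfolding argmin_below_def by (metis (no_types, lifting))

lemma seed_split:
  fixes D :: nat
  assumes "D > 0" "t < r"
  shows "{s. s < D ^ r \<and> s div D ^ (r - t) = q} = (\<Union>d<D. {s. s < D ^ r \<and> s div D ^ (r - Suc t) = q * D + d})"
proof -
  have "r - t = Suc (r - Suc t)" using assms(2) by simp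
  then have *: "D ^ (r - t) = D ^ (r - Suc t) * D" by (simp only: power_Suc2)
  have "s div D ^ (r - t) = q \<longleftrightarrow> (\<exists>d<D. s div D ^ (r - Suc t) = q * D + d)" for s
  proof -
    have "a div D = q \<longleftrightarrow> (\<exists>d<D. a = q * D + d)" for a
    proof
      assume "a div D = q"
      then have "a = q * D + a mod D" by (metis div_mult_mod_eq)
      then show "\<exists>d<D. a = q * D + d" using assms mod_less_divisor by blast
    qed auto
    then show ?thesis unfolding * div_mult2_eq by simp
  qed
  then show ?thesis by auto
qed

text \<open>Among the \<open>D\<close> extensions of a prefix the cheapest one costs at most the
  average, so with \<open>t\<close> digits fixed the total over the remaining seeds, multiplied by
  \<open>D ^ t\<close>, never exceeds the total over all seeds. With all digits fixed a single seed
  remains, and its cost is at most the mean.\<close>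

theorem seed_search_correct:
  fixes c :: "nat \<Rightarrow> w set \<Rightarrow> nat \<Rightarrow> nat"
  assumes F: "F > 0" and M: "M = F ^ h" and D: "D > 0"
    and base: "\<And>i. i < M \<Longrightarrow> finite (\<sigma> i) \<and> card (\<sigma> i) \<le> a \<and> \<sigma> i \<subseteq> bwords X \<and> nosw (\<sigma> i) = \<sigma> i \<and> noseed (\<sigma> i) = \<sigma> i"
    and val: "(\<Sum>s<D ^ r. \<Sum>i<M. c i (\<sigma> i) s) < X"
    and X: "D ^ r \<le> X" "D \<le> X" "F < X" "20 \<le> X"
    and b: "Suc a + 2 * D + 3 * F * D \<le> b"
  shows "\<exists>q<D ^ r. reaches M X b (seed_search F h D r c) \<sigma> (\<lambda>i. insert (Seed q) (\<sigma> i)) \<and>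
    (\<Sum>i<M. c i (\<sigma> i) q) * D ^ r \<le> (\<Sum>s<D ^ r. \<Sum>i<M. c i (\<sigma> i) s)"
proof -
  define C where "C s = (\<Sum>i<M. c i (\<sigma> i) s)" for s
  define part where "part t q = {s. s < D ^ r \<and> s div D ^ (r - t) = q}" for t q
  have fin: "finite (part t q)" for t q by (simp add: part_def)
  define \<rho> where "\<rho> q = (\<lambda>i. insert (Seed q) (\<sigma> i))" for q
  have noSeed: "Seed q \<notin> \<sigma> i" if "i < M" for q i using base[OF that] unfolding noseed_def by blast
  have Dr: "q < X" if "q < D ^ r" for q using that X by simp
  have Dp: "D ^ t \<le> D ^ r" if "t \<le> r" for t using that D by (simp add: power_increasing)
  have base\<rho>: "finite (\<rho> q i) \<and> card (\<rho> q i) \<le> Suc a \<and> \<rho> q i \<subseteq> bwords X \<and> nosw (\<rho> q i) = \<rho> q i"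
    if "i < M" "q < X" for q i
  proof -
    have "nosw (\<rho> q i) = insert (Seed q) (nosw (\<sigma> i))" by (auto simp: \<rho>_def nosw_def)
    then show ?thesis using base[OF that(1)] that(2) X card_insert_le_m1[of "Suc a" "\<sigma> i" "Seed q"]
      by (auto simp: \<rho>_def bwords_def)
  qed
  have gs: "getseed (\<rho> q i) = q" "noseed (\<rho> q i) = \<sigma> i" if "i < M" for q i
    using noSeed[OF that] base[OF that] by (auto simp: getseed_def \<rho>_def noseed_def)
  have init: "reaches M X b [\<lambda>i s. Pair i ` insert (Seed 0) s] \<sigma> (\<rho> 0)"
  proof (rule reaches_instr)
    show "Pair j ` insert (Seed 0) (\<sigma> j) = keep (\<rho> 0) j" if "j < M" for j
      by (simp add: keep_def \<rho>_def)
    show "flow_ok M X b (keep (\<rho> 0))"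
      by (rule flow_ok_keep) (use base\<rho>[of _ 0] b X in fastforce)
    show "deliver M (keep (\<rho> 0)) i = \<rho> 0 i" if "i < M" for i by (rule deliver_keep[OF that])
  qed
  have step: "\<exists>q'. reaches M X b (scan F h (seed_cost D r c t) @ [seed_pick D]) (\<rho> q) (\<rho> q') \<and> q' < D ^ Suc t
      \<and> sum C (part (Suc t) q') * D \<le> sum C (part t q)"
    if t: "t < r" and q: "q < D ^ t" for t q
  proof -
    define y where "y j k x = (if k = 0 \<and> x < D then \<Sum>s\<in>part (Suc t) (q * D + x). c j (\<sigma> j) s else 0)" for j and k :: nat and x
    have ysum: "ysum y {..<M} k x = (if k = 0 \<and> x < D then sum C (part (Suc t) (q * D + x)) else 0)" for k x
      unfolding ysum_def y_def C_def by (auto intro: sum.swap)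
    have qX: "q < X" using q Dp[of t] t X by simp
    have "scan_setting F h M X b D (Suc a) (seed_cost D r c t) (\<rho> q) y"
    proof
      show "0 < F" "M = F ^ h" "D \<le> X" "F < X" "20 \<le> X" "Suc a + 2 * D + 3 * F * D \<le> b" by fact+
      show "finite (\<rho> q i) \<and> card (\<rho> q i) \<le> Suc a \<and> \<rho> q i \<subseteq> bwords X \<and> nosw (\<rho> q i) = \<rho> q i" if "i < M" for i
        by (rule base\<rho>[OF that qX])
      show "seed_cost D r c t j (\<rho> q j) k x = y j k x" if "j < M" for j k x
        unfolding seed_cost_def y_def part_def gs[OF that] by simp
      show "k < X \<and> x < D" if "0 < y j k x" for j k x
        using that X by (auto simp: y_def split: if_splits)
      show "ysum y {..<M} k x < X" for k x
      proof -
        have "sum C (part (Suc t) z) \<le> sum C {..<D ^ r}" for z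
          by (rule sum_mono2) (auto simp: part_def)
        then have "ysum y {..<M} k x \<le> sum C {..<D ^ r}" by (simp add: ysum)
        then show ?thesis using val unfolding C_def by linarith
      qed
    qed
    from scan_setting.scan_correct[OF this] obtain \<tau> where
      \<tau>: "reaches M X b (scan F h (seed_cost D r c t)) (\<rho> q) \<tau>"
      and n: "\<And>i. i < M \<Longrightarrow> nosw (\<tau> i) = \<rho> q i" and rd0: "\<And>i. i < M \<Longrightarrow> rd 0 (\<tau> i) = runs (\<le>) y {..<M}"
      by blast
    define tt where "tt x = sum C (part (Suc t) (q * D + x))" for x
    define d where "d = argmin_below tt D"
    have d: "d < D" "\<And>e. e < D \<Longrightarrow> tt d \<le> tt e" unfolding d_def using argmin_below[OF D] by auto
    define q' where "q' = q * D + d"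
    have q': "q' < D ^ Suc t"
    proof -
      have "q * D + d < (q + 1) * D" using d by simp
      also have "\<dots> \<le> D ^ t * D" using q by (intro mult_right_mono) auto
      finally show ?thesis by (simp add: q'_def mult.commute)
    qed
    have vl: "vl (rd 0 (\<tau> i)) 0 x = tt x" if "i < M" "x < D" for i x
      unfolding rd0[OF that(1)] using that(2)
      by (subst vl_runs) (auto simp: ysum tt_def split: if_splits)
    have pick: "argmin_below (vl (rd 0 (\<tau> i)) 0) D = d" if "i < M" for i
      unfolding d_def by (rule argmin_below_cong) (rule vl[OF that])
    have gs\<tau>: "getseed (\<tau> i) = q" "noseed (nosw (\<tau> i)) = \<sigma> i" if i: "i < M" for i
    proof -
      have "Seed z \<in> \<tau> i \<longleftrightarrow> Seed z \<in> nosw (\<tau> i)" for z by (auto simp: nosw_def)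
      then show "getseed (\<tau> i) = q" using gs[OF i, of q] unfolding getseed_def n[OF i] by simp
      show "noseed (nosw (\<tau> i)) = \<sigma> i" using gs[OF i, of q] n[OF i] by simp
    qed
    have "reaches M X b [seed_pick D] \<tau> (\<rho> q')"
    proof (rule reaches_instr)
      show "seed_pick D j (\<tau> j) = keep (\<rho> q') j" if "j < M" for j
        using gs\<tau>[OF that] pick[OF that] by (simp add: seed_pick_def keep_def \<rho>_def q'_def)
      have "q' < X" using q' Dp[of "Suc t"] t X by simp
      then show "flow_ok M X b (keep (\<rho> q'))"
        by (intro flow_ok_keep) (use base\<rho>[of _ q'] b in fastforce)
      show "deliver M (keep (\<rho> q')) i = \<rho> q' i" if "i < M" for i by (rule deliver_keep[OF that])
    qed
    then have "reaches M X b (scan F h (seed_cost D r c t) @ [seed_pick D]) (\<rho> q) (\<rho> q')"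
      using reaches_append[OF \<tau>] by blast
    moreover have "sum C (part (Suc t) q') * D \<le> sum C (part t q)"
    proof -
      have "sum C (part t q) = (\<Sum>d<D. sum C (part (Suc t) (q * D + d)))"
        unfolding part_def seed_split[OF D t] by (rule sum.UNION_disjoint) auto
      moreover have "(\<Sum>e<D. tt d) \<le> (\<Sum>e<D. tt e)" using d by (intro sum_mono) auto
      ultimately show ?thesis by (simp add: tt_def q'_def mult.commute)
    qed
    ultimately show ?thesis using q' by blast
  qed
  have "\<exists>q. reaches M X b ((\<lambda>i s. Pair i ` insert (Seed 0) s) #
       concat (map (\<lambda>t. scan F h (seed_cost D r c t) @ [seed_pick D]) [0..<t])) \<sigma> (\<rho> q)
      \<and> q < D ^ t \<and> sum C (part t q) * D ^ t \<le> sum C {..<D ^ r}" if "t \<le> r" for t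
    using that
  proof (induction t)
    case 0
    have "part 0 0 = {..<D ^ r}" by (auto simp: part_def)
    then show ?case using init by auto
  next
    case (Suc t)
    then obtain q where q: "reaches M X b ((\<lambda>i s. Pair i ` insert (Seed 0) s) #
       concat (map (\<lambda>t. scan F h (seed_cost D r c t) @ [seed_pick D]) [0..<t])) \<sigma> (\<rho> q)"
      "q < D ^ t" "sum C (part t q) * D ^ t \<le> sum C {..<D ^ r}" by auto
    obtain q' where q': "reaches M X b (scan F h (seed_cost D r c t) @ [seed_pick D]) (\<rho> q) (\<rho> q')"
      "q' < D ^ Suc t" "sum C (part (Suc t) q') * D \<le> sum C (part t q)" using step[of t q] q Suc.prems by auto
    have "sum C (part (Suc t) q') * D ^ Suc t \<le> sum C (part t q) * D ^ t"
      using mult_right_mono[OF q'(3), of "D ^ t"] by (simp add: mult.assoc)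
    then have "sum C (part (Suc t) q') * D ^ Suc t \<le> sum C {..<D ^ r}" using q(3) by (rule order_trans)
    then show ?case using q'(2) reaches_append[OF q(1) q'(1)] by (intro exI[of _ q'] conjI) simp_all
  qed
  from this[of r] obtain q where "reaches M X b (seed_search F h D r c) \<sigma> (\<rho> q)" "q < D ^ r"
    "sum C (part r q) * D ^ r \<le> sum C {..<D ^ r}" by (auto simp: seed_search_def)
  moreover from this have "part r q = {q}" by (auto simp: part_def)
  ultimately show ?thesis unfolding \<rho>_def C_def by auto
qed

subsection \<open>A pairwise independent hash family\<close>

text \<open>An odd factor is a unit modulo a power of two.\<close>

lemma affine_bij:
  fixes d y n :: nat
  assumes "odd d"
  shows "bij_betw (\<lambda>A. (y + A * d) mod 2 ^ n) {..<2 ^ n} {..<2 ^ n}"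
proof -
  have inj1: "A = B" if "A < 2 ^ n" "B \<le> A" "(y + A * d) mod 2 ^ n = (y + B * d) mod 2 ^ n" for A B
  proof -
    have "2 ^ n dvd (y + A * d) - (y + B * d)"
      using that mod_eq_dvd_iff_nat[of "y + B * d" "y + A * d" "2 ^ n"] by simp
    then have "2 ^ n dvd (A - B) * d" by (simp add: diff_mult_distrib)
    moreover have "coprime (2 ^ n) d" using assms by simp
    ultimately have "2 ^ n dvd A - B" by (simp add: coprime_dvd_mult_left_iff)
    then show "A = B" using that by (metis diff_is_0_eq diff_le_self dvd_imp_le le_antisym leD le_less_trans neq0_conv)
  qed
  have "inj_on (\<lambda>A. (y + A * d) mod 2 ^ n) {..<2 ^ n}"
    by (rule inj_onI) (metis inj1 lessThan_iff nat_le_linear)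
  moreover have "(\<lambda>A. (y + A * d) mod 2 ^ n) ` {..<2 ^ n} \<subseteq> {..<2 ^ n}" by auto
  ultimately show ?thesis
    using endo_inj_surj[of "{..<2 ^ n}" "\<lambda>A. (y + A * d) mod 2 ^ n"] by (simp add: bij_betw_def)
qed

lemma bij_betw_Collect_filter:
  assumes "bij_betw f {..<N} {..<K::nat}"
  shows "bij_betw f {A. A < N \<and> Q (f A)} {z. z < K \<and> Q z}"
proof -
  have "f ` {A. A < N \<and> Q (f A)} = {z \<in> f ` {..<N}. Q z}" by auto
  also have "\<dots> = {z. z < K \<and> Q z}" using bij_betw_imp_surj_on[OF assms] by auto
  finally have "f ` {A. A < N \<and> Q (f A)} = {z. z < K \<and> Q z}" .
  then show ?thesis using bij_betw_imp_inj_on[OF assms] unfolding bij_betw_def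
    by (auto intro: inj_on_subset)
qed

lemma card_div_eq:
  fixes a :: nat assumes "0 < p" "a < N" shows "card {z. z < N * p \<and> z div p = a} = p"
proof -
  have "{z. z < N * p \<and> z div p = a} = {a * p..<a * p + p}"
  proof (rule set_eqI)
    fix z
    have "a * p + p \<le> N * p" using mult_le_mono1[of "Suc a" N p] assms by simp
    moreover have "z div p = a \<longleftrightarrow> a * p \<le> z \<and> z < a * p + p"
    proof
      assume "z div p = a"
      then have "z = a * p + z mod p" using div_mult_mod_eq[of z p] by simp
      then show "a * p \<le> z \<and> z < a * p + p" using mod_less_divisor[OF assms(1), of z] by linarith
    qed (auto intro!: div_nat_eqI simp: mult.commute)
    ultimately show "z \<in> {z. z < N * p \<and> z div p = a} \<longleftrightarrow> z \<in> {a * p..<a * p + p}" by auto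
  qed
  then show ?thesis by simp
qed

text \<open>For odd \<open>d\<close> the map is a bijection modulo \<open>2 ^ n\<close>, and it
  remains to count the numbers with a given quotient. For even \<open>d\<close> the lowest bit of
  \<open>y + A * d\<close> does not depend on \<open>A\<close>, so \<open>d\<close>,
  \<open>y\<close> and the modulus can be halved; \<open>A\<close> and \<open>A + 2 ^ n'\<close>
  then behave alike, which doubles the count. At most \<open>m\<close> halvings occur, because
  \<open>2 ^ Suc m\<close> does not divide \<open>d\<close>.\<close>

lemma card_affine_div:
  fixes m n d y b :: nat
  assumes "\<not> 2 ^ Suc m dvd d" "m \<le> n" "b < 2 ^ (n - m)"
  shows "card {A. A < 2 ^ n \<and> (y + A * d) mod 2 ^ n div 2 ^ m = b} = 2 ^ m"
  using assms
proof (induction m arbitrary: n d y)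
  case m: (Suc m)
  show ?case
  proof (cases "odd d")
    case False
    then obtain d' where d: "d = 2 * d'" by auto
    obtain n' where n: "n = Suc n'" using m.prems by (cases n) auto
    define S where "S = {A. A < 2 ^ n' \<and> (y div 2 + A * d') mod 2 ^ n' div 2 ^ m = b}"
    have c: "card S = 2 ^ m" unfolding S_def
      by (rule m.IH) (use m.prems d n in auto)
    have key: "(y + A * d) mod 2 ^ n div 2 ^ Suc m = (y div 2 + A * d') mod 2 ^ n' div 2 ^ m" for A
    proof -
      have "(y + A * d) mod 2 ^ n div 2 = (y + A * d) div 2 mod 2 ^ n'"
        unfolding n by (simp add: mod_mult2_eq)
      also have "(y + A * d) div 2 = y div 2 + A * d'" unfolding d by (simp add: mult.left_commute)
      finally show ?thesis by (simp add: div_mult2_eq)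
    qed
    have per: "(y div 2 + (A + 2 ^ n') * d') mod 2 ^ n' = (y div 2 + A * d') mod 2 ^ n'" for A
      by (simp add: distrib_right flip: add.assoc)
    have "{A. A < 2 ^ n \<and> (y + A * d) mod 2 ^ n div 2 ^ Suc m = b} = S \<union> (\<lambda>A. A + 2 ^ n') ` S"
    proof (rule set_eqI)
      fix A
      show "A \<in> {A. A < 2 ^ n \<and> (y + A * d) mod 2 ^ n div 2 ^ Suc m = b} \<longleftrightarrow> A \<in> S \<union> (\<lambda>A. A + 2 ^ n') ` S"
      proof (cases "A < 2 ^ n'")
        case True
        then show ?thesis using key n by (auto simp: S_def)
      next
        case False
        then obtain B where B: "A = B + 2 ^ n'" by (metis le_add_diff_inverse2 not_less)
        then show ?thesis using key[of A] per[of B] n by (auto simp: S_def)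
      qed
    qed
    moreover have "card ((\<lambda>A. A + 2 ^ n') ` S) = card S" by (rule card_image) simp
    moreover have "S \<inter> (\<lambda>A. A + 2 ^ n') ` S = {}" by (auto simp: S_def)
    moreover have "finite S" by (simp add: S_def)
    ultimately show ?thesis using c by (simp add: card_Un_disjoint)
  next
    case True
    have "card {A. A < 2 ^ n \<and> (y + A * d) mod 2 ^ n div 2 ^ Suc m = b}
        = card {z. z < 2 ^ (n - Suc m) * 2 ^ Suc m \<and> z div 2 ^ Suc m = b}"
    proof (rule bij_betw_same_card)
      have "(2::nat) ^ (n - Suc m) * 2 ^ Suc m = 2 ^ n" using m.prems(2) by (simp only: power_add[symmetric]) simp
      then show "bij_betw (\<lambda>A. (y + A * d) mod 2 ^ n) {A. A < 2 ^ n \<and> (y + A * d) mod 2 ^ n div 2 ^ Suc m = b}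
          {z. z < 2 ^ (n - Suc m) * 2 ^ Suc m \<and> z div 2 ^ Suc m = b}"
        using bij_betw_Collect_filter[OF affine_bij[OF True, of y n]] by simp
    qed
    then show ?thesis using card_div_eq[of "2 ^ Suc m" b "2 ^ (n - Suc m)"] m.prems by simp
  qed
next
  case 0
  then have "odd d" by simp
  have "card {A. A < 2 ^ n \<and> (y + A * d) mod 2 ^ n div 2 ^ 0 = b} = card {b}"
  proof (rule bij_betw_same_card)
    show "bij_betw (\<lambda>A. (y + A * d) mod 2 ^ n) {A. A < 2 ^ n \<and> (y + A * d) mod 2 ^ n div 2 ^ 0 = b} {b}"
      using bij_betw_Collect_filter[OF affine_bij[OF \<open>odd d\<close>, of y n], of "\<lambda>z. z = b"] 0(3)
      by (simp add: Collect_conv_if conj_commute[of _ "_ = b"])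
  qed
  then show ?case by simp
qed

text \<open>The seed consists of the two coefficients of an affine map modulo \<open>2 ^ (2 * k)\<close>.  For different
  nodes below \<open>2 ^ k\<close> a common power of two in the difference affects the lower \<open>k\<close> bits only.\<close>

definition hash :: "nat \<Rightarrow> nat \<Rightarrow> nat \<Rightarrow> nat" where
  "hash k s u = (s div 2 ^ (2 * k) * u + s mod 2 ^ (2 * k)) mod 2 ^ (2 * k) div 2 ^ k"

lemma hash_less: "hash k s u < 2 ^ k"
  by (simp add: hash_def less_mult_imp_div_less mult_2 flip: power_add)

text \<open>The seed is replaced by the pair of the full value \<open>y\<close> at \<open>u\<close>
  and the slope \<open>A\<close>, a bijective change of coordinates. The value at \<open>v\<close>
  is then \<open>y + A * (v - u)\<close>: there are \<open>2 ^ k\<close> values \<open>y\<close>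
  with upper half \<open>a\<close>, and for each of them \<open>2 ^ k\<close> slopes that give
  \<open>b\<close>.\<close>

lemma card_hash_pair_less:
  assumes uv: "u < v" "v < 2 ^ k" and ab: "a < 2 ^ k" "b < 2 ^ k"
  shows "card {s. s < 2 ^ (4 * k) \<and> hash k s u = a \<and> hash k s v = b} = 2 ^ (2 * k)"
proof -
  define N :: nat where "N = 2 ^ (2 * k)"
  define p :: nat where "p = 2 ^ k"
  have N: "N = p * p" "(2::nat) ^ (4 * k) = N * N" "N > 0" "p > 0"
    unfolding N_def p_def by (simp_all flip: power_add)
  define d where "d = v - u"
  have d: "\<not> 2 ^ Suc k dvd d"
  proof
    assume "2 ^ Suc k dvd d"
    then have "2 ^ Suc k \<le> d" using uv by (intro dvd_imp_le) (auto simp: d_def)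
    then show False using uv by (simp add: d_def)
  qed
  let ?S = "{s. s < 2 ^ (4 * k) \<and> hash k s u = a \<and> hash k s v = b}"
  let ?T = "SIGMA y:{y. y < N \<and> y div p = a}. {A. A < N \<and> (y + A * d) mod N div p = b}"
  let ?g = "\<lambda>s. ((s div N * u + s mod N) mod N, s div N)"
  have shift: "((s div N * u + s mod N) mod N + s div N * d) mod N = (s div N * v + s mod N) mod N" for s
  proof -
    have "s div N * u + s mod N + s div N * d = s div N * v + s mod N"
      using uv by (simp add: d_def diff_mult_distrib2)
    then show ?thesis by (simp only: mod_add_left_eq)
  qed
  have "bij_betw ?g ?S ?T"
  proof (rule bij_betwI')
    fix s s' assume s: "s \<in> ?S" "s' \<in> ?S"
    show "?g s = ?g s' \<longleftrightarrow> s = s'"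
    proof
      assume eq: "?g s = ?g s'"
      then have A: "s div N = s' div N" by simp
      have e: "(s div N * u + s mod N) mod N = (s div N * u + s' mod N) mod N"
        using arg_cong[OF eq, of fst] A by simp
      have canc: "x = y" if "(w + x) mod N = (w + y) mod N" "x < N" "y < N" for w x y :: nat
      proof -
        have 1: "x = y" if "(w + x) mod N = (w + y) mod N" "x < N" "y \<le> x" for x y
        proof -
          have "N dvd x - y" using mod_eq_dvd_iff_nat[of "w + y" "w + x" N] that by simp
          then show ?thesis using that by (metis diff_is_0_eq diff_le_self dvd_imp_le le_antisym leD le_less_trans neq0_conv)
        qed
        show ?thesis
        proof (cases "y \<le> x")
          case True
          show ?thesis by (rule 1[OF that(1,2) True])
        next
          case False
          then have "x \<le> y" by simp
          from 1[OF that(1)[symmetric] that(3) this] show ?thesis by simp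
        qed
      qed
      have "s mod N = s' mod N" by (rule canc[OF e]) (use N(3) in \<open>simp_all add: mod_less_divisor\<close>)
      then show "s = s'" using A by (metis div_mult_mod_eq)
    qed simp
  next
    fix s assume s: "s \<in> ?S"
    then have "s div N < N" using N by (simp add: less_mult_imp_div_less)
    then show "?g s \<in> ?T" using s N(3) shift[of s] by (simp add: hash_def N_def p_def)
  next
    fix t assume "t \<in> ?T"
    then obtain y A where t: "t = (y, A)" "y < N" "y div p = a" "A < N" "(y + A * d) mod N div p = b" by auto
    \<comment> \<open>The factor \<open>N * A - 1 * A\<close> is the negative of \<open>A\<close>
      modulo \<open>N\<close>, written without negative numbers; thus \<open>B\<close> solves
      \<open>A * u + B = y\<close> modulo \<open>N\<close>.\<close>
    define B where "B = (y + (N * A - 1 * A) * u) mod N"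
    define s where "s = A * N + B"
    have B: "B < N" using N(3) by (simp add: B_def)
    then have s: "s div N = A" "s mod N = B" using N(3) by (simp_all add: s_def)
    have "(A * u + B) mod N = (A * u + (y + (N * A - 1 * A) * u)) mod N" by (simp add: B_def mod_add_right_eq)
    also have "A * u + (y + (N * A - 1 * A) * u) = y + N * (A * u)"
    proof -
      have "A \<le> N * A" using N(3) by simp
      then have "A * u \<le> N * A * u" by (rule mult_le_mono1)
      then have "A * u \<le> N * (A * u)" by (simp only: mult.assoc)
      then show ?thesis unfolding diff_mult_distrib mult.assoc mult_1 by linarith
    qed
    also have "\<dots> mod N = y" using t by simp
    finally have y: "(A * u + B) mod N = y" .
    have "s < N * N" using B t(4) mult_le_mono1[of "Suc A" N N] by (simp add: s_def)
    then have "s < 2 ^ (4 * k)" using N(2) by simp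
    moreover have g: "?g s = t" unfolding s y t(1) by (rule refl)
    moreover have "hash k s u = a" unfolding hash_def N_def[symmetric] p_def[symmetric] s using y t(3) by simp
    moreover have "hash k s v = b"
    proof -
      have "(s div N * v + s mod N) mod N = (y + A * d) mod N" using shift[of s] unfolding s y by (rule sym)
      then show ?thesis unfolding hash_def N_def[symmetric] p_def[symmetric] using t(5) by (simp only:)
    qed
    ultimately have "s \<in> ?S" by (intro CollectI conjI)
    with g[symmetric] show "\<exists>s\<in>?S. t = ?g s" by (rule bexI)
  qed
  then have "card ?S = card ?T" by (rule bij_betw_same_card)
  also have "\<dots> = (\<Sum>y | y < N \<and> y div p = a. card {A. A < N \<and> (y + A * d) mod N div p = b})" by simp
  also have "\<dots> = (\<Sum>y | y < N \<and> y div p = a. p)"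
    unfolding N_def p_def using card_affine_div[OF d, of "2 * k" b] ab by (intro sum.cong) auto
  also have "\<dots> = p * p" using card_div_eq[of p a p] ab N by (simp add: p_def)
  finally show ?thesis using N by (simp add: N_def)
qed

lemma card_hash_pair:
  assumes "u \<noteq> v" "u < 2 ^ k" "v < 2 ^ k" "a < 2 ^ k" "b < 2 ^ k"
  shows "card {s. s < 2 ^ (4 * k) \<and> hash k s u = a \<and> hash k s v = b} = 2 ^ (2 * k)"
proof (cases "u < v")
  case False
  then have "card {s. s < 2 ^ (4 * k) \<and> hash k s v = b \<and> hash k s u = a} = 2 ^ (2 * k)"
    using assms by (intro card_hash_pair_less) auto
  then show ?thesis by (simp add: conj_commute)
qed (use assms card_hash_pair_less in blast)

text \<open>If each choice of the node \<open>u\<close> has probability times gain at most \<open>\<kappa>\<close>, then so has the event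
  that a second node makes the same choice, whatever its distribution is.\<close>

lemma sum_match_le:
  fixes G :: "'x \<Rightarrow> real"
  assumes uv: "u \<noteq> v" "u < 2 ^ k" "v < 2 ^ k"
    and G: "\<And>x. card {z. z < 2 ^ k \<and> cu z = x} * G x \<le> 2 ^ k * \<kappa>"
  shows "(\<Sum>s<2 ^ (4 * k). if cu (hash k s u) = cv (hash k s v) then G (cu (hash k s u)) else 0)
     \<le> 2 ^ (4 * k) * \<kappa>"
proof -
  let ?P = "{..<2 ^ k} :: nat set"
  define f where "f = (\<lambda>(a, b). if cu a = cv b then G (cu a) else 0)"
  have "(\<Sum>s<2 ^ (4 * k). f (hash k s u, hash k s v))
     = (\<Sum>y\<in>?P \<times> ?P. \<Sum>s\<in>{s \<in> {..<2 ^ (4 * k)}. (hash k s u, hash k s v) = y}. f (hash k s u, hash k s v))"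
    by (rule sum.group[symmetric]) (use hash_less in auto)
  also have "\<dots> = (\<Sum>y\<in>?P \<times> ?P. 2 ^ (2 * k) * f y)"
  proof (intro sum.cong refl)
    fix y assume "y \<in> ?P \<times> ?P"
    then have "card {s \<in> {..<2 ^ (4 * k)}. (hash k s u, hash k s v) = y} = 2 ^ (2 * k)"
      using card_hash_pair[OF uv, of "fst y" "snd y"] by (cases y) (auto simp: conj_assoc)
    then show "(\<Sum>s\<in>{s \<in> {..<2 ^ (4 * k)}. (hash k s u, hash k s v) = y}. f (hash k s u, hash k s v)) = 2 ^ (2 * k) * f y"
      by (subst sum.cong[OF refl, where h = "\<lambda>_. f y"]) auto
  qed
  also have "\<dots> = 2 ^ (2 * k) * (\<Sum>a\<in>?P. \<Sum>b\<in>?P. f (a, b))"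
    unfolding sum_distrib_left[symmetric] sum.cartesian_product by simp
  also have "\<dots> = 2 ^ (2 * k) * (\<Sum>b\<in>?P. \<Sum>a\<in>?P. f (a, b))"
    by (rule arg_cong[OF sum.swap])
  also have "\<dots> \<le> 2 ^ (2 * k) * (\<Sum>b\<in>?P. 2 ^ k * \<kappa>)"
  proof (intro mult_left_mono sum_mono)
    fix b assume "b \<in> ?P"
    have "(\<Sum>a\<in>?P. f (a, b)) = (\<Sum>a\<in>{a\<in>?P. cu a = cv b}. G (cv b))"
      by (simp add: f_def sum.inter_filter[symmetric] cong: if_cong)
    then show "(\<Sum>a\<in>?P. f (a, b)) \<le> 2 ^ k * \<kappa>" using G[of "cv b"] by simp
  qed simp
  also have "\<dots> = 2 ^ (4 * k) * \<kappa>" by (simp flip: power_add)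
  finally show ?thesis by (simp add: f_def)
qed

text \<open>The extra 1 is where the rounding errors in the choice of bits and of whole colors come
  from.\<close>

lemma card_multiples_le:
  fixes a l W :: nat
  assumes "W > 0"
  shows "finite {z. a \<le> z * W \<and> z * W < a + l} \<and> real (card {z. a \<le> z * W \<and> z * W < a + l}) \<le> l / W + 1"
proof (cases "{z. a \<le> z * W \<and> z * W < a + l} = {}")
  case False
  let ?S = "{z. a \<le> z * W \<and> z * W < a + l}"
  define z0 where "z0 = (LEAST z. z \<in> ?S)"
  have z0: "z0 \<in> ?S" "\<And>z. z \<in> ?S \<Longrightarrow> z0 \<le> z"
  proof -
    show "z0 \<in> ?S" unfolding z0_def using False by (metis (mono_tags, lifting) LeastI_ex all_not_in_conv)
    show "\<And>z. z \<in> ?S \<Longrightarrow> z0 \<le> z" unfolding z0_def by (rule Least_le)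
  qed
  have sub: "?S \<subseteq> {z0..z0 + l div W}"
  proof
    fix z assume z: "z \<in> ?S"
    then have "(z - z0) * W \<le> l" using z0 z by (auto simp: diff_mult_distrib)
    then have "z - z0 \<le> l div W" using assms by (simp add: less_eq_div_iff_mult_less_eq)
    then show "z \<in> {z0..z0 + l div W}" using z0(2)[OF z] by auto
  qed
  have "card ?S \<le> l div W + 1" using card_mono[OF _ sub] by simp
  moreover have "real (l div W) \<le> l / W" by (rule of_nat_div_le_of_nat)
  ultimately have "real (card ?S) \<le> l / W + 1" by linarith
  moreover have "finite ?S" using sub finite_subset by blast
  ultimately show ?thesis by blast
next
  case True
  then show ?thesis unfolding True by simp
qed

subsection \<open>Partial colorings\<close>

text \<open>For a uniform \<open>z < P\<close>, the bit is \<open>1\<close> with probability \<open>w1 / (w0 + w1)\<close> up to rounding.\<close>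

definition choose_bit :: "nat \<Rightarrow> nat \<Rightarrow> nat \<Rightarrow> nat \<Rightarrow> nat" where
  "choose_bit P w0 w1 z = (if z * (w0 + w1) < P * w1 then 1 else 0)"

locale coloring_instance =
  fixes V :: "nat set" and E :: "nat set set" and L :: "nat \<Rightarrow> nat set" and C :: nat
  assumes inst: "degree_plus_one_instance V E L C"
begin

definition "nb u = {v. {u, v} \<in> E}"

text \<open>A status function \<open>f\<close> encodes a partial coloring: \<open>0\<close> means uncolored, \<open>Suc c\<close> means color \<open>c\<close>.\<close>

definition "unc f = {u \<in> V. f u = (0::nat)}"

definition "valid f \<longleftrightarrow> (\<forall>u\<in>V. \<forall>c. f u = Suc c \<longrightarrow> c \<in> L u) \<and> (\<forall>u\<in>V. \<forall>v\<in>nb u. f u \<noteq> 0 \<longrightarrow> f u \<noteq> f v)"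

definition "half_edges = (SIGMA u:V. nb u)"

lemma finV: "finite V" and edge: "e \<in> E \<Longrightarrow> e \<subseteq> V \<and> card e = 2"
  and L: "u \<in> V \<Longrightarrow> L u \<subseteq> {..<C} \<and> card (L u) = degree E u + 1"
  using inst by (auto simp: degree_plus_one_instance_def simple_graph_def)

lemma finL: "u \<in> V \<Longrightarrow> finite (L u)"
  using L finite_subset by blast

lemma finE: "finite E"
proof -
  have "E \<subseteq> Pow V" using edge by blast
  then show ?thesis using finV finite_subset by blast
qed

lemma nb_sym: "v \<in> nb u \<longleftrightarrow> u \<in> nb v"
  by (simp add: nb_def insert_commute)

lemma nbD: "v \<in> nb u \<Longrightarrow> u \<in> V \<and> v \<in> V \<and> u \<noteq> v"
  using edge[of "{u, v}"] by (auto simp: nb_def)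

lemma fin_nb: "finite (nb u)"
  using nbD finV finite_subset[of "nb u" V] by blast

lemma card_nb: "card (nb u) = degree E u"
proof -
  have "bij_betw (\<lambda>v. {u, v}) (nb u) {e \<in> E. u \<in> e}"
  proof (rule bij_betwI')
    fix x y assume "x \<in> nb u" "y \<in> nb u"
    then show "{u, x} = {u, y} \<longleftrightarrow> x = y" using nbD by (auto simp: doubleton_eq_iff)
  next
    fix e assume e: "e \<in> {e \<in> E. u \<in> e}"
    then obtain x y where "e = {x, y}" using edge card_2_iff by (metis mem_Collect_eq)
    then show "\<exists>v\<in>nb u. e = {u, v}" using e by (auto simp: nb_def insert_commute)
  qed (simp add: nb_def)
  then show ?thesis by (simp add: degree_def bij_betw_same_card)
qed

lemma fin_half: "finite half_edges"
  unfolding half_edges_def using finV fin_nb by blast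

lemma card_half: "card half_edges = 2 * card E"
proof -
  have "card half_edges = (\<Sum>e\<in>E. card {p \<in> half_edges. {fst p, snd p} = e})"
  proof -
    have "half_edges = (\<Union>e\<in>E. {p \<in> half_edges. {fst p, snd p} = e})"
      by (auto simp: half_edges_def nb_def)
    moreover have "card (\<Union>e\<in>E. {p \<in> half_edges. {fst p, snd p} = e}) = (\<Sum>e\<in>E. card {p \<in> half_edges. {fst p, snd p} = e})"
      using finE fin_half by (intro card_UN_disjoint) auto
    ultimately show ?thesis by simp
  qed
  also have "\<dots> = (\<Sum>e\<in>E. 2)"
  proof (rule sum.cong[OF refl])
    fix e assume e: "e \<in> E"
    then obtain x y where xy: "e = {x, y}" "x \<noteq> y" using edge card_2_iff by metis
    then have "{p \<in> half_edges. {fst p, snd p} = e} = {(x, y), (y, x)}"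
      using e edge[OF e] by (auto simp: half_edges_def nb_def doubleton_eq_iff insert_commute)
    then show "card {p \<in> half_edges. {fst p, snd p} = e} = 2" using xy by simp
  qed
  finally show ?thesis by simp
qed

lemma degree_le_max: "u \<in> V \<Longrightarrow> degree E u \<le> max_degree V E"
  unfolding max_degree_def using finV by (intro Max_ge) auto

lemma sum_card_list: "(\<Sum>u\<in>V. card (L u)) = 2 * card E + card V"
proof -
  have "(\<Sum>u\<in>V. card (L u)) = (\<Sum>u\<in>V. card (nb u) + 1)"
    using L card_nb by (intro sum.cong) auto
  also have "\<dots> = (\<Sum>u\<in>V. card (nb u)) + card V" by (simp only: sum.distrib card_eq_sum)
  also have "(\<Sum>u\<in>V. card (nb u)) = card half_edges"
    unfolding half_edges_def using finV fin_nb by simp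
  finally show ?thesis using card_half by simp
qed

lemma valid_0: "valid (\<lambda>_. 0)" and unc_0: "unc (\<lambda>_. 0) = V"
  by (simp_all add: valid_def unc_def)

lemma fin_unc: "finite (unc f)"
  using finV by (simp add: unc_def)

lemma list_coloring_of_status:
  assumes "valid f" "unc f = {}"
  shows "list_coloring V E L (\<lambda>u. f u - 1)"
  unfolding list_coloring_def
proof (intro conjI ballI allI impI)
  have nz: "f u \<noteq> 0" if "u \<in> V" for u using that assms(2) by (auto simp: unc_def)
  show "f v - 1 \<in> L v" if "v \<in> V" for v
    using assms(1) nz[OF that] that by (cases "f v") (auto simp: valid_def)
  fix u v assume "{u, v} \<in> E"
  then have v: "v \<in> nb u" by (simp add: nb_def)
  then have "f u \<noteq> f v" "f u \<noteq> 0" "f v \<noteq> 0" using assms(1) nz nbD[OF v] by (auto simp: valid_def)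
  then show "f u - 1 \<noteq> f v - 1" by (cases "f u"; cases "f v") auto
qed

text \<open>Candidates \<open>x\<close> are kept by the nodes without an uncolored conflicting neighbor of larger
  identifier.  Each conflicting edge then kills only one endpoint.\<close>

definition "conflicts f x = {(u, v). u \<in> unc f \<and> v \<in> nb u \<and> f v = 0 \<and> x u = (x v :: nat)}"

definition "killed f x u \<longleftrightarrow> (\<exists>v\<in>nb u. f v = 0 \<and> x u = x v \<and> u < v)"

definition "settle f x u = (if u \<in> V \<and> f u = 0 \<and> \<not> killed f x u then Suc (x u) else f u)"

lemma conflicts_sub: "conflicts f x \<subseteq> half_edges"
  by (auto simp: conflicts_def half_edges_def unc_def)

lemma fin_conflicts: "finite (conflicts f x)"
  using conflicts_sub fin_half finite_subset by blast

lemma unc_settle: "unc (settle f x) = {u \<in> unc f. killed f x u}"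
  by (auto simp: unc_def settle_def)

text \<open>A killed node \<open>u\<close> and a neighbor \<open>g u\<close> that kills it form the
  two ordered conflicts \<open>(u, g u)\<close> and \<open>(g u, u)\<close>. Pairs of the first kind
  increase and pairs of the second kind decrease, so none is counted twice.\<close>

lemma card_killed_le: "2 * card {u \<in> unc f. killed f x u} \<le> card (conflicts f x)"
proof -
  let ?K = "{u \<in> unc f. killed f x u}"
  define g where "g u = (SOME v. v \<in> nb u \<and> f v = 0 \<and> x u = x v \<and> u < v)" for u
  have g: "g u \<in> nb u \<and> f (g u) = 0 \<and> x u = x (g u) \<and> u < g u" if "u \<in> ?K" for u
  proof -
    have "\<exists>v. v \<in> nb u \<and> f v = 0 \<and> x u = x v \<and> u < v" using that by (auto simp: killed_def)
    from someI_ex[OF this] show ?thesis unfolding g_def .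
  qed
  let ?A = "(\<lambda>u. (u, g u)) ` ?K" and ?B = "(\<lambda>u. (g u, u)) ` ?K"
  have "card ?A = card ?K" "card ?B = card ?K" by (auto intro!: card_image inj_onI)
  moreover have "?A \<inter> ?B = {}"
  proof (rule ccontr)
    assume "?A \<inter> ?B \<noteq> {}"
    then obtain u w where "u \<in> ?K" "w \<in> ?K" "(u, g u) = (g w, w)" by blast
    then show False using g[of u] g[of w] by auto
  qed
  moreover have fin: "finite ?K" using fin_unc by simp
  moreover have "?A \<union> ?B \<subseteq> conflicts f x"
  proof
    fix p assume "p \<in> ?A \<union> ?B"
    then obtain u where u: "u \<in> ?K" "p = (u, g u) \<or> p = (g u, u)" by blast
    then show "p \<in> conflicts f x" using g[OF u(1)] nbD[of "g u" u] nb_sym[of u "g u"]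
      by (auto simp: conflicts_def unc_def)
  qed
  then have "card (?A \<union> ?B) \<le> card (conflicts f x)" by (rule card_mono[OF fin_conflicts])
  ultimately show ?thesis by (simp add: card_Un_disjoint)
qed

text \<open>Killed nodes number at most half of the conflicts. The slack 1/2, reserved for rounding,
  is at most half of the size of a nonempty set, and \<open>(1 + 1/2) / 2 = 3/4\<close>.\<close>

lemma settle_progress:
  assumes "real (card (conflicts f x)) \<le> card (unc f) + 1 / 2"
  shows "4 * card (unc (settle f x)) \<le> 3 * card (unc f)"
proof (cases "unc f = {}")
  case True
  then show ?thesis by (simp add: unc_settle)
next
  case False
  then have "card (unc f) \<ge> 1" using fin_unc by (simp add: Suc_leI card_gt_0_iff)
  moreover have "real (2 * card (unc (settle f x))) \<le> card (unc f) + 1 / 2"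
    using card_killed_le[of f x] assms unfolding unc_settle by linarith
  ultimately show ?thesis by linarith
qed

text \<open>Two neighbors colored in the same phase cannot agree, since the smaller one would have
  been killed; agreement with a node colored earlier is excluded by the assumption on
  \<open>x\<close>.\<close>

lemma valid_settle:
  assumes "valid f" and x: "\<And>u. u \<in> unc f \<Longrightarrow> x u \<in> L u \<and> (\<forall>v\<in>nb u. f v \<noteq> Suc (x u))"
  shows "valid (settle f x)"
  unfolding valid_def
proof (intro conjI ballI allI impI)
  fix u c assume u: "u \<in> V" "settle f x u = Suc c"
  then show "c \<in> L u" using assms(1) x[of u] by (auto simp: settle_def valid_def unc_def split: if_splits)
next
  fix u v assume u: "u \<in> V" and v: "v \<in> nb u" and nz: "settle f x u \<noteq> 0"
  have V: "v \<in> V" "u \<noteq> v" "u \<in> nb v" using nbD[OF v] v nb_sym by auto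
  show "settle f x u \<noteq> settle f x v"
  proof (cases "f u = 0")
    case True
    then have su: "settle f x u = Suc (x u)" "\<not> killed f x u" using nz by (auto simp: settle_def split: if_splits)
    have xu: "\<forall>w\<in>nb u. f w \<noteq> Suc (x u)" using x[of u] True u by (auto simp: unc_def)
    show ?thesis
    proof (cases "f v = 0 \<and> \<not> killed f x v")
      case t: True
      have "x u \<noteq> x v"
        using su(2) t v V True unfolding killed_def by (metis linorder_neqE_nat)
      then show ?thesis using su t V by (simp add: settle_def)
    next
      case False
      then have "settle f x v = f v" by (auto simp: settle_def)
      then show ?thesis using su xu v by (metis)
    qed
  next
    case False
    then have su: "settle f x u = f u" by (simp add: settle_def)
    have fu: "f u \<noteq> f v" using assms(1) u v False by (auto simp: valid_def)
    have "f u \<noteq> Suc (x v)" if "f v = 0" using x[of v] that V by (auto simp: unc_def)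
    then show ?thesis using su fu by (auto simp: settle_def)
  qed
qed

lemma settle_colored: "f u \<noteq> 0 \<Longrightarrow> settle f x u = f u"
  by (simp add: settle_def)

subsection \<open>A phase that fixes the colors bit by bit\<close>

text \<open>Plain counts that can be added over machines, since the list of a node and the colors of
  its neighbors need not lie on the same machine. Counting colored neighbors instead of lost colors
  subtracts too much if a color is used twice or is not in the list, but the initial surplus of
  \<open>degree + 1\<close> colors pays for one subtraction per neighbor.\<close>

definition "wpos b u x = card {c \<in> L u. c div 2 ^ b = x}"
definition "wneg f b u x = card {v \<in> nb u. \<exists>c. f v = Suc c \<and> c div 2 ^ b = x}"
definition "weight f b u x = wpos b u x - wneg f b u x"

definition "node_bit k f b x u z = choose_bit (2 ^ k) (weight f b u (2 * x u)) (weight f b u (2 * x u + 1)) z"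

definition "refine k f b x s u = 2 * x u + node_bit k f b x u (hash k s u)"

text \<open>The potential after the step, scaled by \<open>2 ^ k\<close> and rounded down in each
  summand, because scans add natural numbers only.\<close>

definition "step_cost k f b x s = (\<Sum>(u, v) \<in> conflicts f x.
   if node_bit k f b x u (hash k s u) = node_bit k f b x v (hash k s v)
   then 2 ^ k div weight f b u (refine k f b x s u) else 0)"

text \<open>\<open>u\<close> has at least \<open>weight f b u (x u)\<close> available colors with prefix \<open>x u\<close>, so that the potential bounds
  the expected number of conflicts of a random completion.\<close>

definition "potential f b x = (\<Sum>(u, v) \<in> conflicts f x. 1 / real (weight f b u (x u)))"

lemma div_pow_Suc: "(c::nat) div 2 ^ Suc b = x \<longleftrightarrow> c div 2 ^ b = 2 * x \<or> c div 2 ^ b = 2 * x + 1"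
proof -
  have "c div 2 ^ Suc b = c div 2 ^ b div 2" by (simp only: power_Suc2 div_mult2_eq)
  then show ?thesis by auto
qed

text \<open>Both counts split exactly into the two halves. The inequality comes from truncated
  subtraction and has the useful direction: the halves together are worth at least the
  whole.\<close>

lemma weight_Suc:
  assumes "u \<in> V"
  shows "weight f (Suc b) u x \<le> weight f b u (2 * x) + weight f b u (2 * x + 1)"
proof -
  have p: "wpos (Suc b) u x = wpos b u (2 * x) + wpos b u (2 * x + 1)"
  proof -
    have "{c \<in> L u. c div 2 ^ Suc b = x} = {c \<in> L u. c div 2 ^ b = 2 * x} \<union> {c \<in> L u. c div 2 ^ b = 2 * x + 1}"
      unfolding div_pow_Suc by auto
    then show ?thesis unfolding wpos_def using finL[OF assms] by (simp only:) (rule card_Un_disjoint; auto)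
  qed
  have n: "wneg f (Suc b) u x = wneg f b u (2 * x) + wneg f b u (2 * x + 1)"
  proof -
    have "{v \<in> nb u. \<exists>c. f v = Suc c \<and> c div 2 ^ Suc b = x}
       = {v \<in> nb u. \<exists>c. f v = Suc c \<and> c div 2 ^ b = 2 * x} \<union> {v \<in> nb u. \<exists>c. f v = Suc c \<and> c div 2 ^ b = 2 * x + 1}"
      unfolding div_pow_Suc by auto
    then show ?thesis unfolding wneg_def using fin_nb by (simp only:) (rule card_Un_disjoint; auto)
  qed
  show ?thesis unfolding weight_def p n by simp
qed

lemma weight_le: "u \<in> V \<Longrightarrow> weight f b u x \<le> card (L u)"
  unfolding weight_def wpos_def using finL card_mono[of "L u" "{c \<in> L u. c div 2 ^ b = x}"] by fastforce

text \<open>With \<open>W = w0 + w1\<close> and \<open>w\<close> the weight belonging to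
  \<open>e\<close>, the bit \<open>e\<close> is taken by at most \<open>P * w / W + 1\<close> values
  of \<open>z\<close>. Multiplied by \<open>P / w\<close> this gives
  \<open>P * P / W + P / w\<close>, so the chosen weight cancels: the expected reciprocal weight of
  one outcome depends on the parent only.\<close>

lemma bit_count:
  assumes "w0 + w1 > 0" "P > 0"
  shows "real (card {z. z < P \<and> choose_bit P w0 w1 z = e}) * real (P div (if e = 0 then w0 else w1)) \<le> P * (P / (w0 + w1) + 1)"
proof -
  let ?W = "w0 + w1"
  have key: "real (card {z. z < P \<and> choose_bit P w0 w1 z = e}) * real (P div w) \<le> P * (P / ?W + 1)"
    if sub: "{z. z < P \<and> choose_bit P w0 w1 z = e} \<subseteq> {z. a \<le> z * ?W \<and> z * ?W < a + P * w}" for a w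
  \<comment> \<open>For \<open>w = 0\<close> the convention \<open>P div 0 = 0\<close> makes the
    left-hand side vanish.\<close>
  proof (cases "w = 0")
    case False
    have "real (card {z. z < P \<and> choose_bit P w0 w1 z = e}) \<le> real (P * w) / ?W + 1"
      using card_multiples_le[OF assms(1), of a "P * w"] card_mono[OF _ sub] by (meson of_nat_mono order_trans)
    moreover have "real (P div w) \<le> P / w" by (rule of_nat_div_le_of_nat)
    ultimately have "real (card {z. z < P \<and> choose_bit P w0 w1 z = e}) * real (P div w) \<le> (real (P * w) / ?W + 1) * (P / w)"
      by (intro mult_mono) auto
    also have "\<dots> = P * (P / ?W + 1 / w)" using False by (simp add: field_simps)
    also have "\<dots> \<le> P * (P / ?W + 1)" using False by (intro mult_left_mono) (auto simp: field_simps)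
    finally show ?thesis .
  qed simp
  consider "e = 0" | "e = 1" | "e > 1" by linarith
  then show ?thesis
  proof cases
    case 1
    have "{z. z < P \<and> choose_bit P w0 w1 z = e} \<subseteq> {z. P * w1 \<le> z * ?W \<and> z * ?W < P * w1 + P * w0}"
    proof
      fix z assume z: "z \<in> {z. z < P \<and> choose_bit P w0 w1 z = e}"
      then have "z * ?W < P * ?W" using assms(1) by (intro mult_strict_right_mono) auto
      then show "z \<in> {z. P * w1 \<le> z * ?W \<and> z * ?W < P * w1 + P * w0}"
        using z 1 by (auto simp: choose_bit_def distrib_left split: if_splits)
    qed
    then show ?thesis using key[of "P * w1" w0] 1 by simp
  next
    case 2
    have "{z. z < P \<and> choose_bit P w0 w1 z = e} \<subseteq> {z. 0 \<le> z * ?W \<and> z * ?W < 0 + P * w1}"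
      using 2 by (auto simp: choose_bit_def split: if_splits)
    then show ?thesis using key[of 0 w1] 2 by simp
  next
    case 3
    then have "{z. z < P \<and> choose_bit P w0 w1 z = e} = {}" by (auto simp: choose_bit_def)
    then show ?thesis unfolding \<open>{z. z < P \<and> choose_bit P w0 w1 z = e} = {}\<close> by simp
  qed
qed

text \<open>The comparison in \<open>choose_bit\<close> is strict, so the bit is never 1 if
  \<open>w1 = 0\<close>; and if \<open>w0 = 0\<close>, then \<open>z < P\<close> makes it 1. Hence a
  prefix with available colors never leads to one without.\<close>

lemma bit_weight_pos:
  assumes "w0 + w1 > 0" "z < P" shows "0 < (if choose_bit P w0 w1 z = 0 then w0 else w1)"
proof -
  have "z * (w0 + w1) < P * (w0 + w1)" using assms by (intro mult_strict_right_mono) auto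
  then show ?thesis by (cases "w0 = 0"; cases "w1 = 0") (auto simp: choose_bit_def)
qed

lemma node_bit_cases: "node_bit k f b x u z = 0 \<or> node_bit k f b x u z = 1"
  by (simp add: node_bit_def choose_bit_def)

lemma weight_refine:
  "weight f b u (refine k f b x s u) = (if node_bit k f b x u (hash k s u) = 0
     then weight f b u (2 * x u) else weight f b u (2 * x u + 1))"
  using node_bit_cases[of k f b x u "hash k s u"] by (auto simp: refine_def)

lemma conflicts_refine:
  "conflicts f (refine k f b x s) = {(u, v) \<in> conflicts f x.
     node_bit k f b x u (hash k s u) = node_bit k f b x v (hash k s v)}"
proof -
  have "2 * a + e = 2 * c + e' \<longleftrightarrow> a = c \<and> e = e'" if "e = 0 \<or> e = 1" "e' = 0 \<or> e' = (1::nat)" for a c e e' :: nat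
    using that by presburger
  then show ?thesis using node_bit_cases by (auto simp: conflicts_def refine_def)
qed

definition "alive f b x \<longleftrightarrow> (\<forall>u\<in>unc f. weight f b u (x u) > 0)"

lemma alive_refine:
  assumes "alive f (Suc b) x" shows "alive f b (refine k f b x s)"
  unfolding alive_def
proof
  fix u assume u: "u \<in> unc f"
  have "0 < weight f (Suc b) u (x u)" using assms u by (simp add: alive_def)
  moreover have "u \<in> V" using u by (simp add: unc_def)
  ultimately have "0 < weight f b u (2 * x u) + weight f b u (2 * x u + 1)"
    using weight_Suc[of u f b "x u"] by linarith
  from bit_weight_pos[OF this hash_less[of k s u]]
  show "0 < weight f b u (refine k f b x s u)" unfolding weight_refine node_bit_def .
qed

text \<open>\<open>sum_match_le\<close> applies to every ordered conflict, with the rounded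
  reciprocal weight of the half chosen by \<open>u\<close> as gain and \<open>bit_count\<close> as
  its hypothesis. The additive 1 per conflict sums up to at most \<open>2 * card E\<close>.\<close>

lemma sum_step_cost:
  assumes alive: "alive f (Suc b) x" and V: "\<And>u. u \<in> V \<Longrightarrow> u < 2 ^ k"
  shows "(\<Sum>s<2 ^ (4 * k). real (step_cost k f b x s))
    \<le> 2 ^ (4 * k) * (2 ^ k * potential f (Suc b) x + 2 * card E)"
proof -
  have one: "(\<Sum>s<2 ^ (4 * k). real (if node_bit k f b x u (hash k s u) = node_bit k f b x v (hash k s v)
     then 2 ^ k div weight f b u (refine k f b x s u) else 0)) \<le> 2 ^ (4 * k) * (2 ^ k / weight f (Suc b) u (x u) + 1)"
    if uv: "(u, v) \<in> conflicts f x" for u v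
  proof -
    let ?w0 = "weight f b u (2 * x u)" and ?w1 = "weight f b u (2 * x u + 1)"
    define G where "G e = real (2 ^ k div (if e = (0::nat) then ?w0 else ?w1))" for e
    have V': "u \<in> V" "v \<in> V" "u \<noteq> v" "u \<in> unc f" using uv nbD by (auto simp: conflicts_def unc_def)
    have w: "0 < weight f (Suc b) u (x u)" using alive V' by (simp add: alive_def)
    then have w01: "0 < ?w0 + ?w1" using weight_Suc[OF V'(1), of f b "x u"] by linarith
    have "(\<Sum>s<2 ^ (4 * k). if node_bit k f b x u (hash k s u) = node_bit k f b x v (hash k s v)
       then G (node_bit k f b x u (hash k s u)) else 0) \<le> 2 ^ (4 * k) * (2 ^ k / (?w0 + ?w1) + 1)"
    proof (rule sum_match_le)
      show "u \<noteq> v" "u < 2 ^ k" "v < 2 ^ k" using V' V by auto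
      show "card {z. z < 2 ^ k \<and> node_bit k f b x u z = e} * G e \<le> 2 ^ k * (2 ^ k / real (?w0 + ?w1) + 1)" for e
        using bit_count[OF w01, of "2 ^ k" e] by (simp add: node_bit_def G_def)
    qed
    also have "\<dots> \<le> 2 ^ (4 * k) * (2 ^ k / weight f (Suc b) u (x u) + 1)"
      using w weight_Suc[OF V'(1), of f b "x u"]
      by (intro mult_left_mono add_mono divide_left_mono mult_pos_pos) auto
    finally have fin: "(\<Sum>s<2 ^ (4 * k). if node_bit k f b x u (hash k s u) = node_bit k f b x v (hash k s v)
       then G (node_bit k f b x u (hash k s u)) else 0) \<le> 2 ^ (4 * k) * (2 ^ k / weight f (Suc b) u (x u) + 1)" .
    have "real (if node_bit k f b x u (hash k s u) = node_bit k f b x v (hash k s v)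
       then 2 ^ k div weight f b u (refine k f b x s u) else 0)
      = (if node_bit k f b x u (hash k s u) = node_bit k f b x v (hash k s v)
       then G (node_bit k f b x u (hash k s u)) else 0)" for s
      unfolding G_def weight_refine by (cases "node_bit k f b x u (hash k s u) = node_bit k f b x v (hash k s v)") simp_all
    then show ?thesis using fin by simp
  qed
  have "(\<Sum>s<2 ^ (4 * k). real (step_cost k f b x s)) = (\<Sum>(u, v)\<in>conflicts f x. \<Sum>s<2 ^ (4 * k).
     real (if node_bit k f b x u (hash k s u) = node_bit k f b x v (hash k s v)
     then 2 ^ k div weight f b u (refine k f b x s u) else 0))"
    unfolding step_cost_def of_nat_sum case_prod_unfold by (rule sum.swap)
  also have "\<dots> \<le> (\<Sum>(u, v)\<in>conflicts f x. 2 ^ (4 * k) * (2 ^ k / weight f (Suc b) u (x u) + 1))"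
    using one by (intro sum_mono) auto
  also have "\<dots> = 2 ^ (4 * k) * (2 ^ k * potential f (Suc b) x + card (conflicts f x))"
    by (simp add: potential_def case_prod_unfold sum_distrib_left sum.distrib distrib_left)
  also have "\<dots> \<le> 2 ^ (4 * k) * (2 ^ k * potential f (Suc b) x + 2 * card E)"
    using card_mono[OF fin_half conflicts_sub, of f x] card_half by simp
  finally show ?thesis .
qed

text \<open>The error \<open>4 * card E / 2 ^ k\<close> has two equal parts: the rounding in the
  distribution of the bits, and the rounding down of the summands of
  \<open>step_cost\<close>.\<close>

lemma potential_refine:
  assumes alive: "alive f (Suc b) x" and V: "\<And>u. u \<in> V \<Longrightarrow> u < 2 ^ k"
    and s: "step_cost k f b x s * 2 ^ (4 * k) \<le> (\<Sum>s<2 ^ (4 * k). step_cost k f b x s)"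
  shows "potential f b (refine k f b x s) \<le> potential f (Suc b) x + 4 * card E / 2 ^ k"
proof -
  let ?x = "refine k f b x s"
  have "real (step_cost k f b x s * 2 ^ (4 * k)) \<le> real (\<Sum>s<2 ^ (4 * k). step_cost k f b x s)"
    using s by (rule of_nat_mono)
  then have "real (step_cost k f b x s) * 2 ^ (4 * k) \<le> (\<Sum>s<2 ^ (4 * k). real (step_cost k f b x s))" by simp
  also note sum_step_cost[OF alive V]
  finally have "2 ^ (4 * k) * real (step_cost k f b x s) \<le> 2 ^ (4 * k) * (2 ^ k * potential f (Suc b) x + 2 * card E)"
    by (simp only: mult.commute)
  then have c: "real (step_cost k f b x s) \<le> 2 ^ k * potential f (Suc b) x + 2 * card E" by simp
  have sc: "step_cost k f b x s = (\<Sum>(u, v)\<in>conflicts f ?x. 2 ^ k div weight f b u (?x u))"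
    unfolding step_cost_def conflicts_refine case_prod_unfold prod.collapse
    by (rule sum.inter_filter[OF fin_conflicts, symmetric])
  have "2 ^ k * potential f b ?x = (\<Sum>(u, v)\<in>conflicts f ?x. 2 ^ k / real (weight f b u (?x u)))"
    by (simp add: potential_def sum_distrib_left case_prod_unfold)
  also have "\<dots> \<le> (\<Sum>(u, v)\<in>conflicts f ?x. real (2 ^ k div weight f b u (?x u)) + 1)"
  proof (intro sum_mono, clarify)
    fix u v
    have *: "real n / real w \<le> real (n div w) + 1" for n w :: nat
    proof -
      have "real (n mod w) / real w \<le> 1" by (cases "w = 0") (simp_all add: divide_le_eq_1 less_imp_le)
      then show ?thesis using of_nat_of_nat_div_aux[of n w, where ?'a = real] by linarith
    qed
    have "real (2 ^ k) / real (weight f b u (?x u)) \<le> real (2 ^ k div weight f b u (?x u)) + 1" by (rule *)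
    then show "2 ^ k / real (weight f b u (?x u)) \<le> real (2 ^ k div weight f b u (?x u)) + 1" by simp
  qed
  also have "\<dots> = real (step_cost k f b x s) + card (conflicts f ?x)"
    unfolding sc by (simp add: sum.distrib case_prod_unfold)
  also have "\<dots> \<le> 2 ^ k * potential f (Suc b) x + 4 * card E"
    using c card_mono[OF fin_half conflicts_sub, of f ?x] card_half by simp
  finally show ?thesis by (simp add: field_simps)
qed

lemma card_nb_split:
  fixes f :: "nat \<Rightarrow> nat"
  shows "card (nb u) = card {v \<in> nb u. f v = 0} + card {v \<in> nb u. f v \<noteq> 0}"
proof -
  have "card ({v \<in> nb u. f v = 0} \<union> {v \<in> nb u. f v \<noteq> 0}) = card {v \<in> nb u. f v = 0} + card {v \<in> nb u. f v \<noteq> 0}"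
    by (rule card_Un_disjoint) (auto simp: fin_nb)
  moreover have "{v \<in> nb u. f v = 0} \<union> {v \<in> nb u. f v \<noteq> 0} = nb u" by auto
  ultimately show ?thesis by simp
qed

text \<open>Since \<open>C \<le> 2 ^ q\<close>, all colors share the prefix 0 at level
  \<open>q\<close>. Of the \<open>degree + 1\<close> list entries at most one is lost per colored
  neighbor.\<close>

lemma start_weight:
  assumes "u \<in> V" "C \<le> 2 ^ q"
  shows "weight f q u 0 \<ge> card {v \<in> nb u. f v = 0} + 1"
proof -
  have "{c \<in> L u. c div 2 ^ q = 0} = L u" using L[OF assms(1)] assms(2) by auto
  then have "wpos q u 0 = card (nb u) + 1" using L[OF assms(1)] card_nb by (simp add: wpos_def)
  moreover note card_nb_split[of u f]
  moreover have "wneg f q u 0 \<le> card {v \<in> nb u. f v \<noteq> 0}"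
    unfolding wneg_def using fin_nb by (intro card_mono) auto
  ultimately show ?thesis unfolding weight_def by linarith
qed

lemma alive_start: "C \<le> 2 ^ q \<Longrightarrow> alive f q (\<lambda>_. 0)"
  unfolding alive_def using start_weight[of _ q f] by (auto simp: unc_def intro: less_le_trans)

lemma conflicts_sum:
  fixes h :: "nat \<Rightarrow> real"
  shows "(\<Sum>(u, v) \<in> conflicts f (\<lambda>_. 0). h u) = (\<Sum>u\<in>unc f. card {v \<in> nb u. f v = 0} * h u)"
proof -
  have "conflicts f (\<lambda>_. 0) = (SIGMA u:unc f. {v \<in> nb u. f v = 0})" by (auto simp: conflicts_def)
  moreover have "(\<Sum>u\<in>unc f. \<Sum>v\<in>{v \<in> nb u. f v = 0}. h u) = (\<Sum>(u, v)\<in>(SIGMA u:unc f. {v \<in> nb u. f v = 0}). h u)"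
    by (rule sum.Sigma) (simp_all add: fin_unc fin_nb)
  ultimately have "(\<Sum>(u, v) \<in> conflicts f (\<lambda>_. 0). h u) = (\<Sum>u\<in>unc f. \<Sum>v\<in>{v \<in> nb u. f v = 0}. h u)" by simp
  then show ?thesis by simp
qed

lemma potential_start:
  assumes "C \<le> 2 ^ q" shows "potential f q (\<lambda>_. 0) \<le> card (unc f)"
proof -
  have "potential f q (\<lambda>_. 0) = (\<Sum>u\<in>unc f. card {v \<in> nb u. f v = 0} * (1 / real (weight f q u 0)))"
    unfolding potential_def by (rule conflicts_sum)
  also have "\<dots> \<le> (\<Sum>u\<in>unc f. 1)"
  proof (rule sum_mono)
    fix u assume "u \<in> unc f"
    then have "weight f q u 0 \<ge> card {v \<in> nb u. f v = 0} + 1" using start_weight assms by (simp add: unc_def)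
    then show "card {v \<in> nb u. f v = 0} * (1 / real (weight f q u 0)) \<le> 1" by (simp add: divide_le_eq_1)
  qed
  finally show ?thesis by simp
qed

text \<open>When no bits are missing, a prefix is a color and \<open>wpos\<close> is at most 1, so a
  positive weight leaves no room for a neighbor of this color. The reciprocal weights become 1,
  which is why the potential turns into the number of conflicts.\<close>

lemma alive_end:
  assumes "alive f 0 x" "u \<in> unc f"
  shows "weight f 0 u (x u) = 1" "x u \<in> L u" "\<forall>v\<in>nb u. f v \<noteq> Suc (x u)"
proof -
  have w: "0 < weight f 0 u (x u)" using assms by (simp add: alive_def)
  have "{c \<in> L u. c div 2 ^ 0 = x u} = (if x u \<in> L u then {x u} else {})" by auto
  then have p: "wpos 0 u (x u) = (if x u \<in> L u then 1 else 0)" by (simp add: wpos_def)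
  then show "x u \<in> L u" using w by (auto simp: weight_def split: if_splits)
  then have n: "wneg f 0 u (x u) = 0" using w p by (simp add: weight_def)
  then show "weight f 0 u (x u) = 1" using p \<open>x u \<in> L u\<close> by (simp add: weight_def)
  have "{v \<in> nb u. \<exists>c. f v = Suc c \<and> c div 2 ^ 0 = x u} = {}"
    using n fin_nb by (simp add: wneg_def)
  then show "\<forall>v\<in>nb u. f v \<noteq> Suc (x u)" by auto
qed

lemma potential_end:
  assumes "alive f 0 x" shows "potential f 0 x = card (conflicts f x)"
proof -
  have "potential f 0 x = (\<Sum>(u, v)\<in>conflicts f x. 1)"
    unfolding potential_def
  proof (rule sum.cong[OF refl])
    fix p assume p: "p \<in> conflicts f x"
    obtain u v where uv: "p = (u, v)" by (cases p)
    then have "weight f 0 u (x u) = 1" using p by (intro alive_end(1)[OF assms]) (simp add: conflicts_def)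
    then show "(case p of (u, v) \<Rightarrow> 1 / real (weight f 0 u (x u))) = (case p of (u, v) \<Rightarrow> 1)" using uv by simp
  qed
  then show ?thesis by (simp add: case_prod_unfold)
qed

end

subsection \<open>A phase that picks whole colors\<close>

text \<open>Scaling the hash value to an index splits the \<open>P\<close> values into intervals of
  nearly equal length, so each color is picked by at most \<open>P / card A + 1\<close> of
  them.\<close>

definition pick :: "nat set \<Rightarrow> nat \<Rightarrow> nat \<Rightarrow> nat" where
  "pick A P z = sorted_list_of_set A ! (z * card A div P)"

lemma pick_index: "A \<noteq> {} \<Longrightarrow> finite A \<Longrightarrow> z < P \<Longrightarrow> z * card A div P < card A"
  by (simp add: less_mult_imp_div_less card_gt_0_iff mult.commute)

lemma pick_in:
  assumes "finite A" "A \<noteq> {}" "z < P" shows "pick A P z \<in> A"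
proof -
  have "pick A P z \<in> set (sorted_list_of_set A)"
    unfolding pick_def using pick_index[OF assms(2,1,3)] assms(1) by (intro nth_mem) simp
  then show ?thesis using assms(1) by simp
qed

lemma pick_count:
  assumes "finite A" "A \<noteq> {}" "P > 0"
  shows "real (card {z. z < P \<and> pick A P z = c}) \<le> P * (1 / card A + 1 / P)"
proof -
  let ?n = "card A"
  have n: "?n > 0" using assms by (simp add: card_gt_0_iff)
  have "\<exists>i. {z. z < P \<and> pick A P z = c} \<subseteq> {z. i * P \<le> z * ?n \<and> z * ?n < i * P + P}"
  proof (cases "\<exists>z0<P. pick A P z0 = c")
    case True
    then obtain z0 where z0: "z0 < P" "pick A P z0 = c" by blast
    have "z * ?n div P = z0 * ?n div P" if "z < P" "pick A P z = c" for z
    proof -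
      have "distinct (sorted_list_of_set A)" "length (sorted_list_of_set A) = ?n" using assms(1) by simp_all
      then show ?thesis
        using that z0 pick_index[OF assms(2,1) that(1)] pick_index[OF assms(2,1) z0(1)]
        unfolding pick_def by (metis nth_eq_iff_index_eq)
    qed
    then have "{z. z < P \<and> pick A P z = c} \<subseteq> {z. z0 * ?n div P * P \<le> z * ?n \<and> z * ?n < z0 * ?n div P * P + P}"
    proof (intro subsetI CollectI)
      fix z assume "z \<in> {z. z < P \<and> pick A P z = c}"
      then have "z * ?n div P = z0 * ?n div P" using \<open>\<And>z. z < P \<Longrightarrow> pick A P z = c \<Longrightarrow> z * ?n div P = z0 * ?n div P\<close> by blast
      then show "z0 * ?n div P * P \<le> z * ?n \<and> z * ?n < z0 * ?n div P * P + P"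
        using div_times_less_eq_dividend[of "z * ?n" P] dividend_less_div_times[OF assms(3), of "z * ?n"]
        by (simp add: add.commute)
    qed
    then show ?thesis by blast
  qed auto
  then obtain i where sub: "{z. z < P \<and> pick A P z = c} \<subseteq> {z. i * P \<le> z * ?n \<and> z * ?n < i * P + P}" by blast
  have "real (card {z. z < P \<and> pick A P z = c}) \<le> P / ?n + 1"
    using card_multiples_le[OF n, of "i * P" P] card_mono[OF _ sub] by (meson of_nat_mono order_trans)
  then show ?thesis using assms(3) by (simp add: distrib_left)
qed

context coloring_instance
begin

definition "avail f u = {c \<in> L u. \<forall>v\<in>nb u. f v \<noteq> Suc c}"

definition "cand k f s u = pick (avail f u) (2 ^ k) (hash k s u)"

lemma fin_avail: "u \<in> V \<Longrightarrow> finite (avail f u)"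
  using finL by (simp add: avail_def)

lemma card_avail:
  assumes "u \<in> V" shows "card (avail f u) \<ge> card {v \<in> nb u. f v = 0} + 1"
proof -
  let ?B = "(\<lambda>v. f v - 1) ` {v \<in> nb u. f v \<noteq> 0}"
  have "L u - ?B \<subseteq> avail f u" by (force simp: avail_def image_iff)
  then have "card (L u - ?B) \<le> card (avail f u)" using fin_avail[OF assms] by (rule card_mono[rotated])
  moreover have "card (L u) \<le> card (L u - ?B) + card ?B"
    using diff_card_le_card_Diff[of ?B "L u"] fin_nb by simp
  moreover have "card ?B \<le> card {v \<in> nb u. f v \<noteq> 0}" by (rule card_image_le) (simp add: fin_nb)
  moreover have "card (nb u) = card {v \<in> nb u. f v = 0} + card {v \<in> nb u. f v \<noteq> 0}" by (rule card_nb_split)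
  ultimately show ?thesis using L[OF assms] card_nb[of u] by linarith
qed

lemma avail_ne: "u \<in> V \<Longrightarrow> avail f u \<noteq> {}"
  using card_avail[of u f] by auto

lemma cand_avail: "u \<in> V \<Longrightarrow> cand k f s u \<in> avail f u"
  unfolding cand_def by (intro pick_in fin_avail avail_ne hash_less)

text \<open>\<open>sum_match_le\<close> with constant gain 1: by \<open>pick_count\<close> a
  conflict with a fixed neighbor has probability at most
  \<open>1 / card (avail f u) + 1 / 2 ^ k\<close>, and by \<open>card_avail\<close> the first terms
  sum to at most 1 for each node.\<close>

lemma sum_pick_cost:
  assumes V: "\<And>u. u \<in> V \<Longrightarrow> u < 2 ^ k"
  shows "(\<Sum>s<2 ^ (4 * k). real (card (conflicts f (cand k f s))))
    \<le> 2 ^ (4 * k) * (card (unc f) + 2 * card E / 2 ^ k)"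
proof -
  let ?C = "conflicts f (\<lambda>_. 0)"
  have one: "(\<Sum>s<2 ^ (4 * k). if cand k f s u = cand k f s v then 1 else 0 :: real)
      \<le> 2 ^ (4 * k) * (1 / card (avail f u) + 1 / 2 ^ k)" if "(u, v) \<in> ?C" for u v
  proof -
    have uv: "u \<noteq> v" "u \<in> V" "v \<in> V" using that nbD by (auto simp: conflicts_def unc_def)
    have "(\<Sum>s<2 ^ (4 * k). if pick (avail f u) (2 ^ k) (hash k s u) = pick (avail f v) (2 ^ k) (hash k s v)
        then (\<lambda>_. 1) (pick (avail f u) (2 ^ k) (hash k s u)) else 0) \<le> 2 ^ (4 * k) * (1 / card (avail f u) + 1 / 2 ^ k)"
    proof (rule sum_match_le)
      show "real (card {z. z < 2 ^ k \<and> pick (avail f u) (2 ^ k) z = x}) * 1 \<le> 2 ^ k * (1 / card (avail f u) + 1 / 2 ^ k)" for x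
        using pick_count[OF fin_avail[OF uv(2), of f] avail_ne[OF uv(2)], of "2 ^ k" x] by simp
    qed (use uv V in auto)
    then show ?thesis by (simp add: cand_def)
  qed
  have "card (conflicts f (cand k f s)) = (\<Sum>(u, v)\<in>?C. if cand k f s u = cand k f s v then 1 else 0)" for s
  proof -
    have "conflicts f (cand k f s) = {p \<in> ?C. cand k f s (fst p) = cand k f s (snd p)}"
      by (auto simp: conflicts_def)
    then show ?thesis
      using sum.inter_filter[OF fin_conflicts, of "\<lambda>_. 1::nat" f "\<lambda>_. 0" "\<lambda>p. cand k f s (fst p) = cand k f s (snd p)"]
      by (simp add: case_prod_unfold)
  qed
  then have "(\<Sum>s<2 ^ (4 * k). real (card (conflicts f (cand k f s))))
     = (\<Sum>s<2 ^ (4 * k). \<Sum>(u, v)\<in>?C. if cand k f s u = cand k f s v then 1 else 0 :: real)"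
    by (simp add: case_prod_unfold if_distrib[of real] cong: if_cong)
  also have "\<dots> = (\<Sum>(u, v)\<in>?C. \<Sum>s<2 ^ (4 * k). if cand k f s u = cand k f s v then 1 else 0 :: real)"
    unfolding case_prod_unfold by (rule sum.swap)
  also have "\<dots> \<le> (\<Sum>(u, v)\<in>?C. 2 ^ (4 * k) * (1 / card (avail f u) + 1 / 2 ^ k))"
    using one by (intro sum_mono) auto
  also have "\<dots> = 2 ^ (4 * k) * ((\<Sum>(u, v)\<in>?C. 1 / card (avail f u)) + card ?C / 2 ^ k)"
    by (simp add: case_prod_unfold sum_distrib_left sum.distrib distrib_left)
  also have "\<dots> \<le> 2 ^ (4 * k) * (card (unc f) + 2 * card E / 2 ^ k)"
  proof -
    have "(\<Sum>(u, v)\<in>?C. 1 / card (avail f u)) = (\<Sum>u\<in>unc f. card {v \<in> nb u. f v = 0} * (1 / card (avail f u)))"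
      by (rule conflicts_sum)
    also have "\<dots> \<le> (\<Sum>u\<in>unc f. 1)"
    proof (rule sum_mono)
      fix u assume "u \<in> unc f"
      then have "card (avail f u) \<ge> card {v \<in> nb u. f v = 0} + 1" using card_avail by (simp add: unc_def)
      then show "card {v \<in> nb u. f v = 0} * (1 / real (card (avail f u))) \<le> 1" by (simp add: divide_le_eq_1)
    qed
    finally have "(\<Sum>(u, v)\<in>?C. 1 / card (avail f u)) \<le> card (unc f)" by simp
    moreover have "real (card ?C) / 2 ^ k \<le> 2 * card E / 2 ^ k"
      using card_mono[OF fin_half conflicts_sub, of f "\<lambda>_. 0"] card_half by (intro divide_right_mono) auto
    ultimately show ?thesis by (intro mult_left_mono add_mono) auto
  qed
  finally show ?thesis .
qed

lemma pick_phase: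
  assumes V: "\<And>u. u \<in> V \<Longrightarrow> u < 2 ^ k" and E: "4 * card E \<le> 2 ^ k" and f: "valid f"
    and s: "card (conflicts f (cand k f s)) * 2 ^ (4 * k) \<le> (\<Sum>s<2 ^ (4 * k). card (conflicts f (cand k f s)))"
  shows "valid (settle f (cand k f s))" "4 * card (unc (settle f (cand k f s))) \<le> 3 * card (unc f)"
proof -
  have "real (card (conflicts f (cand k f s)) * 2 ^ (4 * k)) \<le> real (\<Sum>s<2 ^ (4 * k). card (conflicts f (cand k f s)))"
    using s by (rule of_nat_mono)
  then have "2 ^ (4 * k) * real (card (conflicts f (cand k f s))) \<le> (\<Sum>s<2 ^ (4 * k). real (card (conflicts f (cand k f s))))"
    by (simp add: mult.commute)
  also note sum_pick_cost[OF V]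
  finally have "real (card (conflicts f (cand k f s))) \<le> card (unc f) + 2 * card E / 2 ^ k" by simp
  also have "2 * card E / 2 ^ k \<le> (1 / 2 :: real)"
  proof -
    have "real (4 * card E) \<le> real (2 ^ k)" using E by (rule of_nat_mono)
    then show ?thesis by (simp add: field_simps)
  qed
  finally show "4 * card (unc (settle f (cand k f s))) \<le> 3 * card (unc f)" by (intro settle_progress) simp
  show "valid (settle f (cand k f s))"
  proof (rule valid_settle[OF f])
    fix u assume "u \<in> unc f"
    then show "cand k f s u \<in> L u \<and> (\<forall>v\<in>nb u. f v \<noteq> Suc (cand k f s u))"
      using cand_avail[of u k f s] by (auto simp: unc_def avail_def)
  qed
qed

text \<open>\<open>x b\<close> is the prefix when \<open>b\<close> bits are still missing. Each bit
  adds at most \<open>4 * card E / 2 ^ k\<close> to the potential, so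
  \<open>8 * q * card E \<le> 2 ^ k\<close> keeps the total error at 1/2, the slack of
  \<open>settle_progress\<close>.\<close>

lemma bit_phase:
  assumes V: "\<And>u. u \<in> V \<Longrightarrow> u < 2 ^ k" and E: "8 * q * card E \<le> 2 ^ k" and C: "C \<le> 2 ^ q" and f: "valid f"
    and start: "x q = (\<lambda>_. 0)"
    and step: "\<And>b. b < q \<Longrightarrow> \<exists>s. x b = refine k f b (x (Suc b)) s \<and>
       step_cost k f b (x (Suc b)) s * 2 ^ (4 * k) \<le> (\<Sum>s<2 ^ (4 * k). step_cost k f b (x (Suc b)) s)"
  shows "valid (settle f (x 0))" "4 * card (unc (settle f (x 0))) \<le> 3 * card (unc f)"
proof -
  have inv: "alive f (q - t) (x (q - t)) \<and> potential f (q - t) (x (q - t)) \<le> card (unc f) + t * (4 * card E / 2 ^ k)"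
    if "t \<le> q" for t
    using that
  proof (induction t)
    case 0
    then show ?case using start alive_start[OF C] potential_start[OF C] by simp
  next
    case (Suc t)
    define b where "b = q - Suc t"
    have b: "b < q" "q - t = Suc b" using Suc.prems by (auto simp: b_def)
    obtain s where s: "x b = refine k f b (x (Suc b)) s"
       "step_cost k f b (x (Suc b)) s * 2 ^ (4 * k) \<le> (\<Sum>s<2 ^ (4 * k). step_cost k f b (x (Suc b)) s)"
      using step[OF b(1)] by blast
    have IH: "alive f (Suc b) (x (Suc b))" "potential f (Suc b) (x (Suc b)) \<le> card (unc f) + t * (4 * card E / 2 ^ k)"
      using Suc b by auto
    have "alive f b (x b)" using alive_refine[OF IH(1)] s(1) by simp
    moreover have "potential f b (x b) \<le> card (unc f) + Suc t * (4 * card E / 2 ^ k)"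
    proof -
      have "real (Suc t) * (4 * card E / 2 ^ k) = t * (4 * card E / 2 ^ k) + 4 * card E / 2 ^ k"
        by (simp only: of_nat_Suc distrib_right mult_1)
      then show ?thesis using potential_refine[OF IH(1) V s(2)] IH(2) unfolding s(1) by linarith
    qed
    ultimately show ?case by (simp add: b_def)
  qed
  have al: "alive f 0 (x 0)" and pot: "potential f 0 (x 0) \<le> card (unc f) + q * (4 * card E / 2 ^ k)"
    using inv[of q] by auto
  have "q * (4 * card E / 2 ^ k) \<le> (1 / 2 :: real)"
  proof -
    have "real (8 * q * card E) \<le> real (2 ^ k)" using E by (rule of_nat_mono)
    then show ?thesis by (simp add: field_simps)
  qed
  then have "real (card (conflicts f (x 0))) \<le> card (unc f) + 1 / 2" using pot potential_end[OF al] by linarith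
  then show "4 * card (unc (settle f (x 0))) \<le> 3 * card (unc f)" by (rule settle_progress)
  show "valid (settle f (x 0))" by (rule valid_settle[OF f]) (use alive_end[OF al] in blast)
qed

end

subsection \<open>The bitwise phase on distributed blocks\<close>

text \<open>The list entries \<open>LI u c\<close> and the half edges \<open>HE u v a\<close> (with \<open>a\<close> the machine of the reverse
  half edge) are distributed such that the entries of each node lie on consecutive machines; each of
  these machines knows the status \<open>NS u x f\<close> of the node, where \<open>x\<close> is the prefix of its candidate color.\<close>

definition items :: "w set \<Rightarrow> w set" where
  "items s = {a \<in> s. (\<exists>u c. a = LI u c) \<or> (\<exists>u v m. a = HE u v m)}"

definition stat :: "w set \<Rightarrow> w set" where
  "stat s = {a \<in> s. (\<exists>u c. a = LI u c) \<or> (\<exists>u v m. a = HE u v m) \<or> (\<exists>u x f. a = NS u x f)}"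

text \<open>A half edge knows the machine of its reverse, so data of a node reaches the machines
  that hold the half edges of its neighbors towards it in one round, with one word per half
  edge.\<close>

definition exchange :: "(w set \<Rightarrow> nat \<Rightarrow> nat) \<Rightarrow> (w set \<Rightarrow> nat \<Rightarrow> nat) \<Rightarrow> nat \<Rightarrow> w set \<Rightarrow> (nat \<times> w) set" where
  "exchange p0 p1 i s = {(a, TI v u x f (p0 s u) (p1 s u)) | u v a x f. HE u v a \<in> s \<and> NS u x f \<in> s}"

text \<open>The entries of a node lie on this machine, on earlier ones and on later ones. In a
  sorted layout registers 2 and 3 show the contributions of the latter two for every node that is
  present here.\<close>

definition block_sum :: "(nat \<Rightarrow> w set \<Rightarrow> nat \<Rightarrow> nat \<Rightarrow> nat) \<Rightarrow> nat \<Rightarrow> w set \<Rightarrow> nat \<Rightarrow> nat \<Rightarrow> nat" where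
  "block_sum g i s u x = g i (nosw s) u x + vl (rd 2 s) u x + vl (rd 3 s) u x"

definition share :: instr where
  "share i s = Pair i ` stat s \<union> exchange (\<lambda>_ _. 0) (\<lambda>_ _. 0) i s"

definition prefix :: "w set \<Rightarrow> nat \<Rightarrow> nat" where
  "prefix s u = (THE x. \<exists>f. NS u x f \<in> s)"

text \<open>Indices 0 and 1 count list entries by their next bit, indices 2 and 3 do so for the
  colors of neighbors. Four indices for one key are the reason for \<open>D \<ge> 4\<close>.\<close>

definition bit_counts :: "nat \<Rightarrow> nat \<Rightarrow> w set \<Rightarrow> nat \<Rightarrow> nat \<Rightarrow> nat" where
  "bit_counts b i s u e = (if e < 2 then card {c. LI u c \<in> s \<and> c div 2 ^ b = 2 * prefix s u + e}
     else if e < 4 then card {v. \<exists>x c. TI u v x (Suc c) 0 0 \<in> s \<and> c div 2 ^ b = 2 * prefix s u + (e - 2)} else 0)"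

definition weight_of :: "nat \<Rightarrow> nat \<Rightarrow> nat \<Rightarrow> w set \<Rightarrow> nat \<Rightarrow> nat" where
  "weight_of b e i s u = block_sum (bit_counts b) i s u e - block_sum (bit_counts b) i s u (e + 2)"

text \<open>The cost of a seed on a half edge depends on the bits of both endpoints. With the
  weights of the neighbor at hand a machine can evaluate both bits for all seeds without further
  communication.\<close>

definition share_weights :: "nat \<Rightarrow> instr" where
  "share_weights b i s = Pair i ` (stat s \<union> {NW u (weight_of b 0 i s u) (weight_of b 1 i s u) | u x f. NS u x f \<in> s})
     \<union> exchange (weight_of b 0 i) (weight_of b 1 i) i s"

definition bit_cost :: "nat \<Rightarrow> nat \<Rightarrow> w set \<Rightarrow> nat \<Rightarrow> nat" where
  "bit_cost k i s q = (\<Sum>(u, v, w) \<in> {(u, v, w). \<exists>x w0 w1 v0 v1. NS u x 0 \<in> s \<and> NW u w0 w1 \<in> s \<and> TI u v x 0 v0 v1 \<in> s \<and>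
      choose_bit (2 ^ k) w0 w1 (hash k q u) = choose_bit (2 ^ k) v0 v1 (hash k q v) \<and>
      w = (if choose_bit (2 ^ k) w0 w1 (hash k q u) = 0 then w0 else w1)}. 2 ^ k div w)"

definition append_bit :: "nat \<Rightarrow> instr" where
  "append_bit k i s = Pair i ` (items s \<union>
     {NS u (2 * x + choose_bit (2 ^ k) w0 w1 (hash k (getseed s) u)) f | u x f w0 w1. NS u x f \<in> s \<and> NW u w0 w1 \<in> s})"

definition kill_counts :: "nat \<Rightarrow> w set \<Rightarrow> nat \<Rightarrow> nat \<Rightarrow> nat" where
  "kill_counts i s u e = (if e = 0 then card {v. \<exists>x. NS u x 0 \<in> s \<and> TI u v x 0 0 0 \<in> s \<and> u < v} else 0)"

definition settle_nodes :: instr where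
  "settle_nodes i s = Pair i ` (items s \<union>
     {NS u 0 (if f = 0 \<and> block_sum kill_counts i s u 0 = 0 then Suc x else f) | u x f. NS u x f \<in> s})"

definition bit_step :: "nat \<Rightarrow> nat \<Rightarrow> nat \<Rightarrow> nat \<Rightarrow> nat \<Rightarrow> nat \<Rightarrow> instr list" where
  "bit_step F h D r k b = share # scan F h (bit_counts b) @ share_weights b #
     seed_search F h D r (bit_cost k) @ [append_bit k]"

text \<open>The parameter of \<open>bit_step\<close> is the number of bits still missing after the
  step, so the steps run from \<open>q - 1\<close> down to 0. The last lines decide which candidates
  are kept.\<close>

definition bit_phase_prog :: "nat \<Rightarrow> nat \<Rightarrow> nat \<Rightarrow> nat \<Rightarrow> nat \<Rightarrow> nat \<Rightarrow> instr list" where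
  "bit_phase_prog F h D r k q = concat (map (bit_step F h D r k) (rev [0..<q])) @
     share # scan F h kill_counts @ [settle_nodes]"

lemma length_bit_phase_prog:
  "length (bit_phase_prog F h D r k q) = q * (5 + h + r * (h + 2)) + (3 + h)"
proof -
  have "length (bit_step F h D r k b) = 5 + h + r * (h + 2)" for b
    by (simp add: bit_step_def length_scan length_seed_search)
  then have "length (concat (map (bit_step F h D r k) (rev [0..<q]))) = q * (5 + h + r * (h + 2))"
    by (simp add: length_concat comp_def sum_list_triv)
  then show ?thesis by (simp add: bit_phase_prog_def length_scan)
qed

text \<open>\<open>sorted\<close> compares nodes of different machines only, and implies that two
  machines have at most one node in common. In the bound on \<open>b\<close> the
  \<open>4 * Q\<close> words are the items, the states of the nodes, their weights and the data of
  the neighbors, and the successor is for the seed; the rest is the overhead of a scan.\<close>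

locale layout = coloring_instance V E L C
  for V E L C +
  fixes lL lH :: "nat \<Rightarrow> nat \<Rightarrow> nat" and M Q F h D r k q X b :: nat
  assumes lL: "u \<in> V \<Longrightarrow> c \<in> L u \<Longrightarrow> lL u c < M"
    and lH: "(u, v) \<in> half_edges \<Longrightarrow> lH u v < M"
    and load: "i < M \<Longrightarrow> card {(u, c) \<in> Sigma V L. lL u c = i} + card {(u, v) \<in> half_edges. lH u v = i} \<le> Q"
    and sorted: "i < j \<Longrightarrow> u \<in> V \<Longrightarrow> v \<in> V \<Longrightarrow> (\<exists>c\<in>L u. lL u c = i) \<or> (\<exists>w\<in>nb u. lH u w = i) \<Longrightarrow>
        (\<exists>c\<in>L v. lL v c = j) \<or> (\<exists>w\<in>nb v. lH v w = j) \<Longrightarrow> u \<le> v"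
    and F: "F > 0" and M: "M = F ^ h" and D: "D \<ge> 4" and Dr: "D ^ r = 2 ^ (4 * k)"
    and Cq: "C \<le> 2 ^ q"
    and X: "F < X" "D \<le> X" "D ^ r \<le> X" "20 \<le> X" "M \<le> X" "C < X" "2 ^ q < X" "card V < X"
      "D ^ r * (2 * card E * 2 ^ k) < X"
    and VX: "u \<in> V \<Longrightarrow> u < X" "u \<in> V \<Longrightarrow> u < 2 ^ k"
    and Ek: "8 * q * card E \<le> 2 ^ k" "4 * card E \<le> 2 ^ k"
    and b: "Suc (4 * Q) + 2 * D + 3 * F * D \<le> b"
begin

section \<open>Contents of the machines in the bitwise phase\<close>

definition "keys i = {u \<in> V. (\<exists>c\<in>L u. lL u c = i) \<or> (\<exists>w\<in>nb u. lH u w = i)}"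

definition "hes i = {(u, v) \<in> half_edges. lH u v = i}"

definition "static i = (\<lambda>(u, c). LI u c) ` {(u, c) \<in> Sigma V L. lL u c = i} \<union> (\<lambda>(u, v). HE u v (lH v u)) ` hes i"

definition "cfg f x i = static i \<union> (\<lambda>u. NS u (x u) (f u)) ` keys i"

definition "infos x f p0 p1 i = (\<lambda>(u, v). TI u v (x v) (f v) (p0 v) (p1 v)) ` hes i"

definition "small (f :: nat \<Rightarrow> nat) \<longleftrightarrow> (\<forall>u\<in>V. f u < X)"

lemma fin_hes: "finite (hes i)"
  unfolding hes_def using fin_half by (rule rev_finite_subset) auto

lemma fin_Sigma: "finite (Sigma V L)"
  using finV finL by blast

lemma fin_list_items: "finite {(u, c) \<in> Sigma V L. lL u c = i}"
  using fin_Sigma by (rule rev_finite_subset) auto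

lemma card_hes: "i < M \<Longrightarrow> card (hes i) \<le> Q"
  using load[of i] by (simp add: hes_def)

lemma keys_image: "keys i = fst ` {(u, c) \<in> Sigma V L. lL u c = i} \<union> fst ` hes i"
  by (force simp: keys_def hes_def half_edges_def)

lemma fin_keys: "finite (keys i)" and keysV: "u \<in> keys i \<Longrightarrow> u \<in> V"
  using finV by (auto simp: keys_def)

lemma card_keys: "i < M \<Longrightarrow> card (keys i) \<le> Q"
proof -
  assume i: "i < M"
  have "card (keys i) \<le> card (fst ` {(u, c) \<in> Sigma V L. lL u c = i}) + card (fst ` hes i)"
    unfolding keys_image by (rule card_Un_le)
  also have "\<dots> \<le> card {(u, c) \<in> Sigma V L. lL u c = i} + card (hes i)"
    by (intro add_mono card_image_le fin_list_items fin_hes)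
  finally show ?thesis using load[OF i] by (simp add: hes_def)
qed

lemma cX: "u \<in> V \<Longrightarrow> c \<in> L u \<Longrightarrow> c < X"
  using L X(6) by (meson lessThan_iff less_trans subsetD)

lemma heV: "(u, v) \<in> half_edges \<Longrightarrow> u \<in> V \<and> v \<in> V \<and> v \<in> nb u \<and> (v, u) \<in> half_edges"
  using nbD nb_sym by (auto simp: half_edges_def)

lemma static_bound:
  assumes "i < M" shows "finite (static i) \<and> card (static i) \<le> Q \<and> static i \<subseteq> bwords X"
proof -
  have "card (static i) \<le> card ((\<lambda>(u, c). LI u c) ` {(u, c) \<in> Sigma V L. lL u c = i}) + card ((\<lambda>(u, v). HE u v (lH v u)) ` hes i)"
    unfolding static_def by (rule card_Un_le)
  also have "\<dots> \<le> card {(u, c) \<in> Sigma V L. lL u c = i} + card (hes i)"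
    by (intro add_mono card_image_le fin_list_items fin_hes)
  finally have "card (static i) \<le> Q" using load[OF assms] by (simp add: hes_def)
  moreover have "finite (static i)" using fin_list_items fin_hes by (simp add: static_def)
  moreover have "static i \<subseteq> bwords X"
  proof
    fix a assume "a \<in> static i"
    then consider u c where "a = LI u c" "u \<in> V" "c \<in> L u" | u v where "a = HE u v (lH v u)" "(u, v) \<in> half_edges"
      by (auto simp: static_def hes_def)
    then show "a \<in> bwords X"
    proof cases
      case 1
      then show ?thesis using VX(1) cX X by (simp add: bwords_def)
    next
      case 2
      then have "lH v u < X" using lH heV X(5) by (meson less_le_trans)
      then show ?thesis using 2 heV[of u v] VX(1) X by (simp add: bwords_def)
    qed
  qed
  ultimately show ?thesis by blast
qed

lemma cfg_bound:
  assumes i: "i < M" and x: "small x" and f: "small f"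
  shows "finite (cfg f x i) \<and> card (cfg f x i) \<le> 2 * Q \<and> cfg f x i \<subseteq> bwords X"
proof -
  have "card ((\<lambda>u. NS u (x u) (f u)) ` keys i) \<le> Q"
    using card_image_le[OF fin_keys] card_keys[OF i] by (rule order_trans)
  moreover have "(\<lambda>u. NS u (x u) (f u)) ` keys i \<subseteq> bwords X"
    using x f VX(1) keysV X by (auto simp: small_def bwords_def)
  ultimately show ?thesis using static_bound[OF i] fin_keys card_Un_le[of "static i" "(\<lambda>u. NS u (x u) (f u)) ` keys i"]
    unfolding cfg_def by auto
qed

lemma infos_bound:
  assumes i: "i < M" and s: "small x" "small f" "small p0" "small p1"
  shows "finite (infos x f p0 p1 i) \<and> card (infos x f p0 p1 i) \<le> Q \<and> infos x f p0 p1 i \<subseteq> bwords X"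
proof -
  have "card (infos x f p0 p1 i) \<le> Q"
    unfolding infos_def using card_image_le[OF fin_hes] card_hes[OF i] by (rule order_trans)
  moreover have "infos x f p0 p1 i \<subseteq> bwords X"
  proof
    fix a assume "a \<in> infos x f p0 p1 i"
    then obtain u v where a: "a = TI u v (x v) (f v) (p0 v) (p1 v)" "(u, v) \<in> half_edges"
      by (auto simp: infos_def hes_def)
    then show "a \<in> bwords X" using s heV[OF a(2)] VX(1) X by (simp add: small_def bwords_def)
  qed
  ultimately show ?thesis using fin_hes by (simp add: infos_def)
qed

lemma static_iff:
  "LI u c \<in> static i \<longleftrightarrow> u \<in> V \<and> c \<in> L u \<and> lL u c = i"
  "HE u v a \<in> static i \<longleftrightarrow> (u, v) \<in> hes i \<and> a = lH v u"
  "NS u y z \<notin> static i" "TI u v y z z1 z2 \<notin> static i" "NW u y z \<notin> static i"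
  "SW d1 d2 d3 d4 d5 \<notin> static i" "Seed d1 \<notin> static i" "FN u \<notin> static i" "NR u y \<notin> static i"
  by (auto simp: static_def)

lemma cfg_iff:
  "LI u c \<in> cfg f x i \<longleftrightarrow> u \<in> V \<and> c \<in> L u \<and> lL u c = i"
  "HE u v a \<in> cfg f x i \<longleftrightarrow> (u, v) \<in> hes i \<and> a = lH v u"
  "NS u y z \<in> cfg f x i \<longleftrightarrow> u \<in> keys i \<and> y = x u \<and> z = f u"
  "TI u v y z z1 z2 \<notin> cfg f x i" "NW u y z \<notin> cfg f x i"
  "SW d1 d2 d3 d4 d5 \<notin> cfg f x i" "Seed d1 \<notin> cfg f x i" "FN u \<notin> cfg f x i" "NR u y \<notin> cfg f x i"
  by (auto simp: cfg_def static_iff)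

lemma infos_iff:
  "TI u v y z z1 z2 \<in> infos x f p0 p1 i \<longleftrightarrow> (u, v) \<in> hes i \<and> y = x v \<and> z = f v \<and> z1 = p0 v \<and> z2 = p1 v"
  "LI u c \<notin> infos x f p0 p1 i" "HE u v a \<notin> infos x f p0 p1 i" "NS u y z \<notin> infos x f p0 p1 i"
  "NW u y z \<notin> infos x f p0 p1 i" "SW d1 d2 d3 d4 d5 \<notin> infos x f p0 p1 i" "Seed d1 \<notin> infos x f p0 p1 i"
  "FN u \<notin> infos x f p0 p1 i" "NR u y \<notin> infos x f p0 p1 i"
  by (auto simp: infos_def)

lemma cfg_cases: "a \<in> cfg f x i \<Longrightarrow> (\<exists>u c. a = LI u c) \<or> (\<exists>u v m. a = HE u v m) \<or> (\<exists>u y z. a = NS u y z)"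
  by (auto simp: cfg_def static_def)

lemma infos_cases: "a \<in> infos x f p0 p1 i \<Longrightarrow> \<exists>u v d1 d2 d3 d4. a = TI u v d1 d2 d3 d4"
  by (auto simp: infos_def)

lemma hes_keys: "(u, v) \<in> hes i \<Longrightarrow> u \<in> keys i"
  by (auto simp: hes_def keys_def half_edges_def)

lemma keys_unique: "i < j \<Longrightarrow> u \<in> keys i \<Longrightarrow> v \<in> keys j \<Longrightarrow> u \<le> v"
  using sorted by (auto simp: keys_def)

definition "twin x f p0 p1 = toks half_edges (\<lambda>(u, v). lH u v) (\<lambda>(u, v). lH v u)
   (\<lambda>(u, v). TI v u (x u) (f u) (p0 u) (p1 u))"

lemma twin_deliver: "deliver M (twin x f p0 p1) i = infos x f p0 p1 i"
proof -
  have "deliver M (twin x f p0 p1) i = (\<lambda>(u, v). TI v u (x u) (f u) (p0 u) (p1 u)) ` {t \<in> half_edges. (\<lambda>(u, v). lH v u) t = i}"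
    unfolding twin_def by (rule deliver_toks) (use lH in auto)
  also have "\<dots> = infos x f p0 p1 i"
    unfolding infos_def hes_def using heV by (force simp: image_iff)
  finally show ?thesis .
qed

text \<open>Reversal is an involution on the half edges: what machine \<open>i\<close> receives
  corresponds to the half edges stored on \<open>i\<close> again. So the load bound limits both
  directions.\<close>

lemma twin_flow:
  assumes s: "small x" "small f" "small p0" "small p1"
  shows "flow_ok M X Q (twin x f p0 p1)"
  unfolding twin_def
proof (rule flow_ok_toks[OF fin_half])
  show "card {t \<in> half_edges. (case t of (u, v) \<Rightarrow> lH u v) = j} \<le> Q" if "j < M" for j
    using card_hes[OF that] by (simp add: hes_def case_prod_unfold)
  show "card {t \<in> half_edges. (case t of (u, v) \<Rightarrow> lH v u) = i} \<le> Q" if "i < M" for i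
  proof -
    have "{t \<in> half_edges. (case t of (u, v) \<Rightarrow> lH v u) = i} = prod.swap ` hes i"
      using heV by (force simp: hes_def image_iff)
    then show ?thesis using card_image_le[OF fin_hes, of prod.swap i] card_hes[OF that] by simp
  qed
  show "(case t of (u, v) \<Rightarrow> TI v u (x u) (f u) (p0 u) (p1 u)) \<in> bwords X" if "t \<in> half_edges" for t
    using that heV s VX(1) X by (cases t) (force simp: small_def bwords_def)
qed

lemma exchange_eq:
  assumes j: "j < M" and s: "\<And>u v a. HE u v a \<in> s \<longleftrightarrow> (u, v) \<in> hes j \<and> a = lH v u"
     "\<And>u y z. NS u y z \<in> s \<longleftrightarrow> u \<in> keys j \<and> y = x u \<and> z = f u"
    and p: "\<And>u. u \<in> keys j \<Longrightarrow> p0' s u = p0 u \<and> p1' s u = p1 u"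
  shows "exchange p0' p1' j s = twin x f p0 p1 j"
proof -
  have "exchange p0' p1' j s = {(lH v u, TI v u (x u) (f u) (p0 u) (p1 u)) | u v. (u, v) \<in> hes j}"
    unfolding exchange_def s using p hes_keys by fastforce
  also have "\<dots> = twin x f p0 p1 j" by (force simp: twin_def toks_def hes_def)
  finally show ?thesis .
qed

lemma stat_cfg: "stat (cfg f x i \<union> A) = cfg f x i \<union> stat A"
  unfolding stat_def using cfg_cases by blast

lemma items_cfg: "items (cfg f x i \<union> A) = static i \<union> items A"
  by (auto simp: items_def cfg_def static_def)

lemma share_correct:
  assumes s: "small x" "small f"
  shows "reaches M X b [share] (cfg f x) (\<lambda>i. cfg f x i \<union> infos x f (\<lambda>_. 0) (\<lambda>_. 0) i)"
proof (rule reaches_instr)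
  have z: "small (\<lambda>_. 0)" using X by (simp add: small_def)
  show "share j (cfg f x j) = keep (cfg f x) j \<union> twin x f (\<lambda>_. 0) (\<lambda>_. 0) j" if "j < M" for j
  proof -
    have "stat (cfg f x j) = cfg f x j" using stat_cfg[of f x j "{}"] by (simp add: stat_def)
    moreover have "exchange (\<lambda>_ _. 0) (\<lambda>_ _. 0) j (cfg f x j) = twin x f (\<lambda>_. 0) (\<lambda>_. 0) j"
      by (rule exchange_eq[OF that]) (auto simp: cfg_iff)
    ultimately show ?thesis by (simp add: share_def keep_def)
  qed
  have "flow_ok M X (2 * Q + Q) (\<lambda>j. keep (cfg f x) j \<union> twin x f (\<lambda>_. 0) (\<lambda>_. 0) j)"
    by (intro flow_ok_Un flow_ok_keep twin_flow z s) (use cfg_bound s in blast)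
  then show "flow_ok M X b (\<lambda>j. keep (cfg f x) j \<union> twin x f (\<lambda>_. 0) (\<lambda>_. 0) j)"
    by (rule flow_ok_mono) (use b in simp)
  show "deliver M (\<lambda>j. keep (cfg f x) j \<union> twin x f (\<lambda>_. 0) (\<lambda>_. 0) j) i = cfg f x i \<union> infos x f (\<lambda>_. 0) (\<lambda>_. 0) i"
    if "i < M" for i unfolding deliver_Un deliver_keep[OF that] twin_deliver ..
qed

lemma sum_located:
  assumes "finite T" "\<And>t. t \<in> T \<Longrightarrow> l t < M"
  shows "(\<Sum>j<M. card {t \<in> T. l t = j}) = card T"
proof -
  have "T = (\<Union>j<M. {t \<in> T. l t = j})" using assms(2) by auto
  moreover have "card (\<Union>j<M. {t \<in> T. l t = j}) = (\<Sum>j<M. card {t \<in> T. l t = j})"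
    using assms(1) by (intro card_UN_disjoint) auto
  ultimately show ?thesis by simp
qed

text \<open>By sortedness a key on an earlier machine is at most every key here, and a key on a
  later machine is at least every key here. This is the hypothesis of \<open>vl_runs\<close> for
  register 2 and for register 3, so the extremal runs suffice.\<close>

lemma block_scan:
  assumes base: "\<And>i. i < M \<Longrightarrow> finite (\<sigma> i) \<and> card (\<sigma> i) \<le> 3 * Q \<and> \<sigma> i \<subseteq> bwords X \<and> nosw (\<sigma> i) = \<sigma> i"
    and g: "\<And>j u e. j < M \<Longrightarrow> g j (\<sigma> j) u e > 0 \<Longrightarrow> u \<in> keys j \<and> e < 4"
    and val: "\<And>u e. (\<Sum>j<M. g j (\<sigma> j) u e) < X"
  shows "\<exists>\<tau>. reaches M X b (scan F h g) \<sigma> \<tau> \<and> (\<forall>i<M. nosw (\<tau> i) = \<sigma> i \<and>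
     (\<forall>u\<in>keys i. \<forall>e. block_sum g i (\<tau> i) u e = (\<Sum>j<M. g j (\<sigma> j) u e)) \<and>
     (\<forall>u e. vl (rd 2 (\<tau> i)) u e > 0 \<longrightarrow> (\<exists>j<i. g j (\<sigma> j) u e > 0)) \<and>
     (\<forall>u\<in>keys i. \<forall>e. vl (rd 2 (\<tau> i)) u e = (\<Sum>j<i. g j (\<sigma> j) u e)))"
proof -
  define y where "y j u e = (if j < M then g j (\<sigma> j) u e else 0)" for j u e
  have "scan_setting F h M X b D (3 * Q) g \<sigma> y"
  proof
    show "u < X \<and> e < D" if "j < M" "0 < y j u e" for j u e
      using g[of j u e] that keysV VX(1) D by (auto simp: y_def)
    show "ysum y {..<M} u e < X" for u e using val[of u e] by (simp add: ysum_def y_def)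
  qed (use F M X b base in \<open>auto simp: y_def\<close>)
  from scan_setting.scan_correct[OF this] obtain \<tau> where \<tau>: "reaches M X b (scan F h g) \<sigma> \<tau>"
    and n: "\<And>i. i < M \<Longrightarrow> nosw (\<tau> i) = \<sigma> i" and r2: "\<And>i. i < M \<Longrightarrow> rd 2 (\<tau> i) = runs (\<ge>) y {..<i}"
    and r3: "\<And>i. i < M \<Longrightarrow> rd 3 (\<tau> i) = runs (\<le>) y {i<..<M}"
    by blast
  have pos: "ysum y J u e > 0 \<longleftrightarrow> (\<exists>j\<in>J. y j u e > 0)" if "finite J" for J u e
    by (rule ysum_pos[OF that])
  have v2: "vl (rd 2 (\<tau> i)) u e = (\<Sum>j<i. g j (\<sigma> j) u e)" if i: "i < M" and u: "u \<in> keys i" for i u e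
  proof -
    have "vl (rd 2 (\<tau> i)) u e = ysum y {..<i} u e"
      unfolding r2[OF i]
    proof (rule vl_runs)
      fix k' x' assume "0 < ysum y {..<i} k' x'"
      then obtain j where "j < i" "y j k' x' > 0" using pos[of "{..<i}"] by auto
      then have "k' \<in> keys j" using g[of j k' x'] i by (auto simp: y_def)
      then show "u \<ge> k'" using keys_unique[OF \<open>j < i\<close> _ u] by simp
    qed
    then show ?thesis using i by (simp add: ysum_def y_def)
  qed
  have v3: "vl (rd 3 (\<tau> i)) u e = (\<Sum>j\<in>{i<..<M}. g j (\<sigma> j) u e)" if i: "i < M" and u: "u \<in> keys i" for i u e
  proof -
    have "vl (rd 3 (\<tau> i)) u e = ysum y {i<..<M} u e"
      unfolding r3[OF i]
    proof (rule vl_runs)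
      fix k' x' assume "0 < ysum y {i<..<M} k' x'"
      then obtain j where j: "i < j" "j < M" "y j k' x' > 0" using pos[of "{i<..<M}"] by auto
      then have "k' \<in> keys j" using g[of j k' x'] by (auto simp: y_def)
      then show "u \<le> k'" using keys_unique[OF j(1) u] by simp
    qed
    then show ?thesis by (simp add: ysum_def y_def)
  qed
  have v2': "\<exists>j<i. g j (\<sigma> j) u e > 0" if i: "i < M" and p: "vl (rd 2 (\<tau> i)) u e > 0" for i u e
  proof -
    have "{v. (u, e, v) \<in> runs (\<ge>) y {..<i}} \<noteq> {}"
    proof
      assume "{v. (u, e, v) \<in> runs (\<ge>) y {..<i}} = {}"
      then have "vl (rd 2 (\<tau> i)) u e = 0" unfolding r2[OF i] vl_def by (simp only: sum.empty)
      then show False using p by simp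
    qed
    then have "ysum y {..<i} u e > 0" by (auto simp: runs_def)
    then show ?thesis using pos[of "{..<i}" u e] i by (auto simp: y_def)
  qed
  have "block_sum g i (\<tau> i) u e = (\<Sum>j<M. g j (\<sigma> j) u e)" if i: "i < M" and u: "u \<in> keys i" for i u e
  proof -
    have "{..<M} = insert i ({..<i} \<union> {i<..<M})" using i by auto
    then have "(\<Sum>j<M. g j (\<sigma> j) u e) = g i (\<sigma> i) u e + (\<Sum>j\<in>{..<i} \<union> {i<..<M}. g j (\<sigma> j) u e)" by simp
    also have "(\<Sum>j\<in>{..<i} \<union> {i<..<M}. g j (\<sigma> j) u e) = (\<Sum>j<i. g j (\<sigma> j) u e) + (\<Sum>j\<in>{i<..<M}. g j (\<sigma> j) u e)"
      by (rule sum.union_disjoint) auto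
    finally show ?thesis unfolding block_sum_def n[OF i] v2[OF i u] v3[OF i u] by simp
  qed
  then show ?thesis using \<tau> n v2 v2' by blast
qed

lemma node_sums:
  assumes u: "u \<in> V"
  shows "(\<Sum>j<M. card {c. u \<in> V \<and> c \<in> L u \<and> lL u c = j \<and> R c}) = card {c \<in> L u. R c}"
    "(\<Sum>j<M. card {v. (u, v) \<in> hes j \<and> R' v}) = card {v \<in> nb u. R' v}"
proof -
  have "(\<Sum>j<M. card {c \<in> {c \<in> L u. R c}. lL u c = j}) = card {c \<in> L u. R c}"
    using finL[OF u] lL[OF u] by (intro sum_located) auto
  moreover have "{c. u \<in> V \<and> c \<in> L u \<and> lL u c = j \<and> R c} = {c \<in> {c \<in> L u. R c}. lL u c = j}" for j
    using u by auto
  ultimately show "(\<Sum>j<M. card {c. u \<in> V \<and> c \<in> L u \<and> lL u c = j \<and> R c}) = card {c \<in> L u. R c}" by simp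
  have "(\<Sum>j<M. card {v \<in> {v \<in> nb u. R' v}. lH u v = j}) = card {v \<in> nb u. R' v}"
    using fin_nb lH u by (intro sum_located) (auto simp: half_edges_def)
  moreover have "{v. (u, v) \<in> hes j \<and> R' v} = {v \<in> {v \<in> nb u. R' v}. lH u v = j}" for j
    using u by (auto simp: hes_def half_edges_def)
  ultimately show "(\<Sum>j<M. card {v. (u, v) \<in> hes j \<and> R' v}) = card {v \<in> nb u. R' v}" by simp
qed

lemma share_base:
  assumes i: "i < M" and s: "small x" "small f"
  shows "finite (cfg f x i \<union> infos x f (\<lambda>_. 0) (\<lambda>_. 0) i) \<and> card (cfg f x i \<union> infos x f (\<lambda>_. 0) (\<lambda>_. 0) i) \<le> 3 * Q
    \<and> cfg f x i \<union> infos x f (\<lambda>_. 0) (\<lambda>_. 0) i \<subseteq> bwords X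
    \<and> nosw (cfg f x i \<union> infos x f (\<lambda>_. 0) (\<lambda>_. 0) i) = cfg f x i \<union> infos x f (\<lambda>_. 0) (\<lambda>_. 0) i"
proof -
  have z: "small (\<lambda>_. 0)" using X by (simp add: small_def)
  have "nosw (cfg f x i \<union> infos x f (\<lambda>_. 0) (\<lambda>_. 0) i) = cfg f x i \<union> infos x f (\<lambda>_. 0) (\<lambda>_. 0) i"
    unfolding nosw_def using cfg_iff(6) infos_iff(6) by blast
  then show ?thesis
    using cfg_bound[OF i s] infos_bound[OF i s z z] card_Un_le[of "cfg f x i" "infos x f (\<lambda>_. 0) (\<lambda>_. 0) i"] by auto
qed

lemma prefix_cfg: "u \<in> keys j \<Longrightarrow> prefix (cfg f x j \<union> infos x' f' p0 p1 j) u = x u"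
  by (simp add: prefix_def cfg_iff infos_iff)

lemma weight_small: "small (\<lambda>u. weight f b' u (y u))"
proof -
  have "weight f b' u (y u) < X" if "u \<in> V" for u
  proof -
    have "weight f b' u (y u) \<le> card (L u)" by (rule weight_le[OF that])
    also have "\<dots> \<le> C" using L[OF that] card_mono[of "{..<C}" "L u"] by simp
    finally show ?thesis using X by simp
  qed
  then show ?thesis by (simp add: small_def)
qed

lemma bit_scan:
  assumes s: "small x" "small f"
  shows "\<exists>\<tau>. reaches M X b (share # scan F h (bit_counts b')) (cfg f x) \<tau> \<and>
    (\<forall>i<M. nosw (\<tau> i) = cfg f x i \<union> infos x f (\<lambda>_. 0) (\<lambda>_. 0) i \<and>
      (\<forall>u\<in>keys i. weight_of b' 0 i (\<tau> i) u = weight f b' u (2 * x u) \<and>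
        weight_of b' 1 i (\<tau> i) u = weight f b' u (2 * x u + 1)))"
proof -
  let ?\<sigma> = "\<lambda>i. cfg f x i \<union> infos x f (\<lambda>_. 0) (\<lambda>_. 0) i"
  have g: "bit_counts b' j (?\<sigma> j) u e = (if e < 2 then card {c. u \<in> V \<and> c \<in> L u \<and> lL u c = j \<and> c div 2 ^ b' = 2 * x u + e}
     else if e < 4 then card {v. (u, v) \<in> hes j \<and> (\<exists>c. f v = Suc c \<and> c div 2 ^ b' = 2 * x u + (e - 2))} else 0)"
    for j u e
  proof -
    have p: "prefix (?\<sigma> j) u = x u" if "u \<in> keys j" using that by (rule prefix_cfg)
    have "{c. LI u c \<in> ?\<sigma> j \<and> c div 2 ^ b' = 2 * prefix (?\<sigma> j) u + e}
        = {c. u \<in> V \<and> c \<in> L u \<and> lL u c = j \<and> c div 2 ^ b' = 2 * x u + e}"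
    proof (cases "u \<in> keys j")
      case True
      then show ?thesis using p by (auto simp: cfg_iff infos_iff)
    next
      case False
      then show ?thesis by (auto simp: cfg_iff infos_iff keys_def)
    qed
    moreover have "{v. \<exists>xa c. TI u v xa (Suc c) 0 0 \<in> ?\<sigma> j \<and> c div 2 ^ b' = 2 * prefix (?\<sigma> j) u + (e - 2)}
        = {v. (u, v) \<in> hes j \<and> (\<exists>c. f v = Suc c \<and> c div 2 ^ b' = 2 * x u + (e - 2))}"
    proof (cases "u \<in> keys j")
      case True
      show ?thesis unfolding p[OF True] by (auto simp: cfg_iff infos_iff) metis
    next
      case False
      then show ?thesis using hes_keys by (auto simp: cfg_iff infos_iff)
    qed
    ultimately show ?thesis unfolding bit_counts_def by (simp only:)
  qed
  have tot: "(\<Sum>j<M. bit_counts b' j (?\<sigma> j) u e) = (if u \<notin> V then 0 else if e < 2 then wpos b' u (2 * x u + e)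
     else if e < 4 then wneg f b' u (2 * x u + (e - 2)) else 0)" for u e
  proof (cases "u \<in> V")
    case True
    then show ?thesis unfolding g wpos_def wneg_def using node_sums[OF True] by simp
  next
    case False
    then have "(u, v) \<notin> hes j" for v j using heV by (auto simp: hes_def)
    then show ?thesis unfolding g using False by simp
  qed
  have val: "(\<Sum>j<M. bit_counts b' j (?\<sigma> j) u e) < X" for u e
  proof (cases "u \<in> V")
    case True
    have "wpos b' u z \<le> card (L u)" for z unfolding wpos_def using finL[OF True] by (intro card_mono) auto
    moreover have "wneg f b' u z \<le> card (nb u)" for z unfolding wneg_def using fin_nb by (intro card_mono) auto
    moreover have "card (L u) < X" using L[OF True] card_mono[of "{..<C}" "L u"] X(6) by simp
    moreover have "card (nb u) < X" using \<open>card (L u) < X\<close> L[OF True] card_nb by simp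
    ultimately show ?thesis unfolding tot using X(4) by (auto intro: le_less_trans)
  qed (use tot X in simp)
  have "\<exists>\<tau>. reaches M X b (scan F h (bit_counts b')) ?\<sigma> \<tau> \<and> (\<forall>i<M. nosw (\<tau> i) = ?\<sigma> i \<and>
     (\<forall>u\<in>keys i. \<forall>e. block_sum (bit_counts b') i (\<tau> i) u e = (\<Sum>j<M. bit_counts b' j (?\<sigma> j) u e)) \<and>
     (\<forall>u e. vl (rd 2 (\<tau> i)) u e > 0 \<longrightarrow> (\<exists>j<i. bit_counts b' j (?\<sigma> j) u e > 0)) \<and>
     (\<forall>u\<in>keys i. \<forall>e. vl (rd 2 (\<tau> i)) u e = (\<Sum>j<i. bit_counts b' j (?\<sigma> j) u e)))"
  proof (rule block_scan)
    show "u \<in> keys j \<and> e < 4" if p: "0 < bit_counts b' j (?\<sigma> j) u e" for j u e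
    proof -
      have e: "e < 4" using p unfolding g by (auto split: if_splits)
      have "u \<in> keys j"
      proof (rule ccontr)
        assume n: "u \<notin> keys j"
        then have e1: "{c. u \<in> V \<and> c \<in> L u \<and> lL u c = j \<and> c div 2 ^ b' = 2 * x u + e} = {}" by (auto simp: keys_def)
        have e2: "{v. (u, v) \<in> hes j \<and> (\<exists>c. f v = Suc c \<and> c div 2 ^ b' = 2 * x u + (e - 2))} = {}" using n hes_keys by blast
        show False using p unfolding g e1 e2 by (simp split: if_splits)
      qed
      then show ?thesis using e by simp
    qed
  qed (use share_base[OF _ s] val in auto)
  then obtain \<tau> where \<tau>: "reaches M X b (scan F h (bit_counts b')) ?\<sigma> \<tau>" "\<And>i. i < M \<Longrightarrow> nosw (\<tau> i) = ?\<sigma> i"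
     "\<And>i u e. i < M \<Longrightarrow> u \<in> keys i \<Longrightarrow> block_sum (bit_counts b') i (\<tau> i) u e = (\<Sum>j<M. bit_counts b' j (?\<sigma> j) u e)"
    by blast
  have "weight_of b' 0 i (\<tau> i) u = weight f b' u (2 * x u) \<and> weight_of b' 1 i (\<tau> i) u = weight f b' u (2 * x u + 1)"
    if "i < M" "u \<in> keys i" for i u
    using \<tau>(3)[OF that] keysV[OF that(2)] unfolding weight_of_def tot weight_def by simp
  then show ?thesis using \<tau> reaches_Cons[OF share_correct[OF s] \<tau>(1)] by blast
qed

end

section \<open>Correctness of the bitwise phase\<close>

context layout
begin

definition "node_weights w0 w1 i = (\<lambda>u. NW u (w0 u) (w1 u)) ` keys i"

definition "cfgw f x w0 w1 i = cfg f x i \<union> node_weights w0 w1 i \<union> infos x f w0 w1 i"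

lemma cfgw_iff:
  "LI u c \<in> cfgw f x w0 w1 i \<longleftrightarrow> u \<in> V \<and> c \<in> L u \<and> lL u c = i"
  "HE u v a \<in> cfgw f x w0 w1 i \<longleftrightarrow> (u, v) \<in> hes i \<and> a = lH v u"
  "NS u y z \<in> cfgw f x w0 w1 i \<longleftrightarrow> u \<in> keys i \<and> y = x u \<and> z = f u"
  "NW u y z \<in> cfgw f x w0 w1 i \<longleftrightarrow> u \<in> keys i \<and> y = w0 u \<and> z = w1 u"
  "TI u v y z z1 z2 \<in> cfgw f x w0 w1 i \<longleftrightarrow> (u, v) \<in> hes i \<and> y = x v \<and> z = f v \<and> z1 = w0 v \<and> z2 = w1 v"
  "SW d1 d2 d3 d4 d5 \<notin> cfgw f x w0 w1 i" "Seed d1 \<notin> cfgw f x w0 w1 i"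
  by (auto simp: cfgw_def cfg_iff infos_iff node_weights_def)

lemma cfgw_bound:
  assumes i: "i < M" and s: "small x" "small f" "small w0" "small w1"
  shows "finite (cfgw f x w0 w1 i) \<and> card (cfgw f x w0 w1 i) \<le> 4 * Q \<and> cfgw f x w0 w1 i \<subseteq> bwords X
    \<and> nosw (cfgw f x w0 w1 i) = cfgw f x w0 w1 i \<and> noseed (cfgw f x w0 w1 i) = cfgw f x w0 w1 i"
proof -
  have "card (node_weights w0 w1 i) \<le> Q"
    unfolding node_weights_def using card_image_le[OF fin_keys] card_keys[OF i] by (rule order_trans)
  moreover have "node_weights w0 w1 i \<subseteq> bwords X"
    using s VX(1) keysV X by (auto simp: node_weights_def small_def bwords_def)
  moreover have "finite (node_weights w0 w1 i)" using fin_keys by (simp add: node_weights_def)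
  moreover have "card (cfgw f x w0 w1 i) \<le> card (cfg f x i) + card (node_weights w0 w1 i) + card (infos x f w0 w1 i)"
    unfolding cfgw_def by (meson add_right_mono card_Un_le order_trans)
  moreover have "nosw (cfgw f x w0 w1 i) = cfgw f x w0 w1 i" "noseed (cfgw f x w0 w1 i) = cfgw f x w0 w1 i"
    unfolding nosw_def noseed_def using cfgw_iff(6,7) by blast+
  ultimately show ?thesis using cfg_bound[OF i s(1,2)] infos_bound[OF i s] unfolding cfgw_def by auto
qed

lemma nosw_stat: "stat (nosw s) = stat s" "items (nosw s) = items s"
  "HE u v a \<in> nosw s \<longleftrightarrow> HE u v a \<in> s" "NS u y z \<in> nosw s \<longleftrightarrow> NS u y z \<in> s"
  by (auto simp: stat_def items_def nosw_def)

lemma stat_share: "stat (cfg f x i \<union> infos x' f' p0 p1 i) = cfg f x i"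
  unfolding stat_cfg using infos_cases by (fastforce simp: stat_def)

lemma items_share: "items (cfg f x i \<union> infos x' f' p0 p1 i) = static i"
  unfolding items_cfg using infos_cases by (fastforce simp: items_def)

lemma share_weights_correct:
  assumes s: "small x" "small f" "small w0" "small w1"
    and n: "\<And>i. i < M \<Longrightarrow> nosw (\<tau> i) = cfg f x i \<union> infos x f (\<lambda>_. 0) (\<lambda>_. 0) i"
    and w: "\<And>i u. i < M \<Longrightarrow> u \<in> keys i \<Longrightarrow> weight_of b' 0 i (\<tau> i) u = w0 u \<and> weight_of b' 1 i (\<tau> i) u = w1 u"
  shows "reaches M X b [share_weights b'] \<tau> (cfgw f x w0 w1)"
proof (rule reaches_instr)
  let ?A = "\<lambda>i. cfg f x i \<union> node_weights w0 w1 i"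
  have he: "HE u v a \<in> \<tau> j \<longleftrightarrow> (u, v) \<in> hes j \<and> a = lH v u" if "j < M" for u v a j
    using n[OF that] nosw_stat(3)[of u v a "\<tau> j"] by (simp add: cfg_iff infos_iff)
  have ns: "NS u y z \<in> \<tau> j \<longleftrightarrow> u \<in> keys j \<and> y = x u \<and> z = f u" if "j < M" for u y z j
    using n[OF that] nosw_stat(4)[of u y z "\<tau> j"] by (simp add: cfg_iff infos_iff)
  show "share_weights b' j (\<tau> j) = keep ?A j \<union> twin x f w0 w1 j" if j: "j < M" for j
  proof -
    have "stat (\<tau> j) = cfg f x j" using n[OF j] nosw_stat(1)[of "\<tau> j"] stat_share by simp
    moreover have "exchange (weight_of b' 0 j) (weight_of b' 1 j) j (\<tau> j) = twin x f w0 w1 j"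
      by (rule exchange_eq[OF j]) (use he ns w j in auto)
    moreover have "{NW u (weight_of b' 0 j (\<tau> j) u) (weight_of b' 1 j (\<tau> j) u) | u x f. NS u x f \<in> \<tau> j} = node_weights w0 w1 j"
      unfolding ns[OF j] node_weights_def using w[OF j] by (auto simp: image_iff)
    ultimately show ?thesis by (simp add: share_weights_def keep_def)
  qed
  have "finite (?A j) \<and> card (?A j) \<le> 4 * Q - Q \<and> ?A j \<subseteq> bwords X" if j: "j < M" for j
  proof -
    have "card (node_weights w0 w1 j) \<le> Q"
      unfolding node_weights_def using card_image_le[OF fin_keys] card_keys[OF j] by (rule order_trans)
    moreover have "card (?A j) \<le> card (cfg f x j) + card (node_weights w0 w1 j)" by (rule card_Un_le)
    ultimately have "card (?A j) \<le> 4 * Q - Q" using cfg_bound[OF j s(1,2)] by linarith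
    then show ?thesis using cfgw_bound[OF j s] unfolding cfgw_def by auto
  qed
  then have "flow_ok M X (4 * Q - Q + Q) (\<lambda>j. keep ?A j \<union> twin x f w0 w1 j)"
    by (intro flow_ok_Un flow_ok_keep twin_flow s)
  then show "flow_ok M X b (\<lambda>j. keep ?A j \<union> twin x f w0 w1 j)"
    by (rule flow_ok_mono) (use b in simp)
  show "deliver M (\<lambda>j. keep ?A j \<union> twin x f w0 w1 j) i = cfgw f x w0 w1 i" if "i < M" for i
    unfolding deliver_Un deliver_keep[OF that] twin_deliver cfgw_def ..
qed

text \<open>An ordered conflict \<open>(u, v)\<close> is charged on the machine of its half edge
  \<open>lH u v\<close> and nowhere else, so the local costs add up to \<open>step_cost\<close>. The
  weights received with the half edge reproduce the bit of \<open>v\<close>.\<close>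

lemma bit_cost_eq:
  assumes w: "w0 = (\<lambda>u. weight f b' u (2 * x u))" "w1 = (\<lambda>u. weight f b' u (2 * x u + 1))"
  shows "(\<Sum>i<M. bit_cost k i (cfgw f x w0 w1 i) s) = step_cost k f b' x s"
proof -
  define R where "R = {p \<in> conflicts f x. node_bit k f b' x (fst p) (hash k s (fst p)) = node_bit k f b' x (snd p) (hash k s (snd p))}"
  have nbit: "choose_bit (2 ^ k) (w0 u) (w1 u) z = node_bit k f b' x u z" for u z
    by (simp add: node_bit_def w)
  have fR: "finite R" unfolding R_def using fin_conflicts by simp
  have one: "bit_cost k i (cfgw f x w0 w1 i) s = (\<Sum>p\<in>{p \<in> R. (\<lambda>(u, v). lH u v) p = i}. 2 ^ k div weight f b' (fst p) (refine k f b' x s (fst p)))"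
    for i
  proof -
    have "{(u, v, w). \<exists>y v0 v1 v0' v1'. NS u y 0 \<in> cfgw f x w0 w1 i \<and> NW u v0 v1 \<in> cfgw f x w0 w1 i
        \<and> TI u v y 0 v0' v1' \<in> cfgw f x w0 w1 i \<and>
        choose_bit (2 ^ k) v0 v1 (hash k s u) = choose_bit (2 ^ k) v0' v1' (hash k s v) \<and>
        w = (if choose_bit (2 ^ k) v0 v1 (hash k s u) = 0 then v0 else v1)}
      = (\<lambda>p. (fst p, snd p, weight f b' (fst p) (refine k f b' x s (fst p)))) ` {p \<in> R. (\<lambda>(u, v). lH u v) p = i}" (is "?L = ?R")
    proof (rule set_eqI)
      fix t :: "nat \<times> nat \<times> nat"
      obtain u v w' where t: "t = (u, v, w')" by (cases t)
      have "t \<in> ?L \<longleftrightarrow> (u, v) \<in> hes i \<and> f u = 0 \<and> f v = 0 \<and> x u = x v \<and>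
          node_bit k f b' x u (hash k s u) = node_bit k f b' x v (hash k s v) \<and>
          w' = weight f b' u (refine k f b' x s u)"
        unfolding t cfgw_iff weight_refine using hes_keys by (auto simp: nbit w[symmetric]) (auto simp: w)
      also have "\<dots> \<longleftrightarrow> t \<in> ?R"
        unfolding t R_def by (auto simp: image_iff conflicts_def unc_def hes_def half_edges_def)
      finally show "t \<in> ?L \<longleftrightarrow> t \<in> ?R" .
    qed
    then show ?thesis unfolding bit_cost_def
      by (simp add: sum.reindex inj_on_def prod_eq_iff)
  qed
  have "(\<Sum>i<M. bit_cost k i (cfgw f x w0 w1 i) s) = (\<Sum>p\<in>R. 2 ^ k div weight f b' (fst p) (refine k f b' x s (fst p)))"
    unfolding one
  proof (rule sum.group[OF fR])
    show "(\<lambda>(u, v). lH u v) ` R \<subseteq> {..<M}"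
      using lH conflicts_sub by (force simp: R_def)
  qed simp
  also have "\<dots> = step_cost k f b' x s"
    unfolding step_cost_def R_def case_prod_unfold by (rule sum.inter_filter[OF fin_conflicts])
  finally show ?thesis .
qed

lemma append_bit_correct:
  assumes w: "w0 = (\<lambda>u. weight f b' u (2 * x u))" "w1 = (\<lambda>u. weight f b' u (2 * x u + 1))"
    and s: "small f" "small (refine k f b' x s)"
  shows "reaches M X b [append_bit k] (\<lambda>i. insert (Seed s) (cfgw f x w0 w1 i)) (cfg f (refine k f b' x s))"
proof (rule reaches_instr)
  show "append_bit k j (insert (Seed s) (cfgw f x w0 w1 j)) = keep (cfg f (refine k f b' x s)) j" if "j < M" for j
  proof -
    have gs: "getseed (insert (Seed s) (cfgw f x w0 w1 j)) = s"
      unfolding getseed_def using cfgw_iff(7) by auto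
    have "items (insert (Seed s) (cfgw f x w0 w1 j)) = static j"
      using infos_cases by (auto simp: items_def cfgw_def cfg_def node_weights_def static_def infos_def)
    moreover have "{NS u (2 * y + choose_bit (2 ^ k) v0 v1 (hash k s u)) z | u y z v0 v1.
        NS u y z \<in> insert (Seed s) (cfgw f x w0 w1 j) \<and> NW u v0 v1 \<in> insert (Seed s) (cfgw f x w0 w1 j)}
      = (\<lambda>u. NS u (refine k f b' x s u) (f u)) ` keys j"
      by (auto simp: cfgw_iff refine_def node_bit_def w image_iff)
    ultimately show ?thesis unfolding append_bit_def gs keep_def cfg_def by simp
  qed
  show "flow_ok M X b (keep (cfg f (refine k f b' x s)))"
    by (rule flow_ok_mono[OF flow_ok_keep[of _ _ "2 * Q"]]) (use cfg_bound s b in auto)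
  show "deliver M (keep (cfg f (refine k f b' x s))) i = cfg f (refine k f b' x s) i" if "i < M" for i
    by (rule deliver_keep[OF that])
qed

lemma refine_less: "x u < 2 ^ m \<Longrightarrow> refine k f b' x s u < 2 ^ Suc m"
  using node_bit_cases[of k f b' x u "hash k s u"] by (auto simp: refine_def)

lemma bounded_small: "(\<And>u. u \<in> V \<Longrightarrow> x u < 2 ^ m) \<Longrightarrow> m \<le> q \<Longrightarrow> small x"
  using X(7) power_increasing[of m q "2::nat"] unfolding small_def
  by (meson less_le_trans less_trans one_le_numeral)

lemma bit_step_correct:
  assumes f: "small f" and x: "\<And>u. u \<in> V \<Longrightarrow> x u < 2 ^ m" and m: "m < q"
  shows "\<exists>s. reaches M X b (bit_step F h D r k b') (cfg f x) (cfg f (refine k f b' x s)) \<and>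
    step_cost k f b' x s * 2 ^ (4 * k) \<le> (\<Sum>s<2 ^ (4 * k). step_cost k f b' x s)"
proof -
  have sx: "small x" using bounded_small[OF x] m by simp
  define w0 w1 where w: "w0 = (\<lambda>u. weight f b' u (2 * x u))" "w1 = (\<lambda>u. weight f b' u (2 * x u + 1))"
  have sw: "small w0" "small w1" unfolding w by (rule weight_small)+
  obtain \<tau> where \<tau>: "reaches M X b (share # scan F h (bit_counts b')) (cfg f x) \<tau>"
    "\<And>i. i < M \<Longrightarrow> nosw (\<tau> i) = cfg f x i \<union> infos x f (\<lambda>_. 0) (\<lambda>_. 0) i"
    "\<And>i u. i < M \<Longrightarrow> u \<in> keys i \<Longrightarrow> weight_of b' 0 i (\<tau> i) u = w0 u \<and> weight_of b' 1 i (\<tau> i) u = w1 u"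
    using bit_scan[OF sx f, of b'] unfolding w by blast
  have r1: "reaches M X b ((share # scan F h (bit_counts b')) @ [share_weights b']) (cfg f x) (cfgw f x w0 w1)"
    by (rule reaches_append[OF \<tau>(1) share_weights_correct[OF sx f sw \<tau>(2,3)]])
  have cost_le: "step_cost k f b' x s \<le> 2 * card E * 2 ^ k" for s
  proof -
    have "step_cost k f b' x s \<le> (\<Sum>p\<in>conflicts f x. 2 ^ k)"
      unfolding step_cost_def case_prod_unfold by (intro sum_mono) auto
    also have "\<dots> \<le> 2 * card E * 2 ^ k"
      using card_mono[OF fin_half conflicts_sub, of f x] card_half by simp
    finally show ?thesis .
  qed
  have "(\<Sum>s<D ^ r. \<Sum>i<M. bit_cost k i (cfgw f x w0 w1 i) s) \<le> (\<Sum>s<D ^ r. 2 * card E * 2 ^ k)"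
    unfolding bit_cost_eq[OF w] by (intro sum_mono cost_le)
  also have "\<dots> < X" using X(9) by simp
  finally have "(\<Sum>s<D ^ r. \<Sum>i<M. bit_cost k i (cfgw f x w0 w1 i) s) < X" .
  then obtain s where s: "s < D ^ r" "reaches M X b (seed_search F h D r (bit_cost k)) (cfgw f x w0 w1) (\<lambda>i. insert (Seed s) (cfgw f x w0 w1 i))"
    "(\<Sum>i<M. bit_cost k i (cfgw f x w0 w1 i) s) * D ^ r \<le> (\<Sum>s<D ^ r. \<Sum>i<M. bit_cost k i (cfgw f x w0 w1 i) s)"
    using seed_search_correct[OF F M, where D = D and \<sigma> = "cfgw f x w0 w1" and a = "4 * Q" and X = X and r = r
        and c = "bit_cost k" and b = b] D X b cfgw_bound[OF _ sx f sw]
    by auto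
  have rx: "small (refine k f b' x s)"
  proof (rule bounded_small)
    show "refine k f b' x s u < 2 ^ Suc m" if "u \<in> V" for u by (rule refine_less) (rule x[OF that])
  qed (use m in simp)
  have "reaches M X b (bit_step F h D r k b') (cfg f x) (cfg f (refine k f b' x s))"
    using reaches_append[OF reaches_append[OF r1 s(2)] append_bit_correct[OF w f rx]]
    by (simp add: bit_step_def)
  then show ?thesis using s(3) unfolding bit_cost_eq[OF w] Dr by blast
qed

lemma valid_small: "valid f \<Longrightarrow> small f"
  unfolding small_def
proof
  fix u assume "valid f" "u \<in> V"
  then show "f u < X"
  proof (cases "f u")
    case (Suc c)
    then have "c \<in> L u" using \<open>valid f\<close> \<open>u \<in> V\<close> by (simp add: valid_def)
    then have "c < C" using L[OF \<open>u \<in> V\<close>] by auto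
    then show ?thesis using Suc X(6) by simp
  qed (use X in simp)
qed

lemma settle_correct:
  assumes f: "small f" and x: "\<And>u. u \<in> V \<Longrightarrow> x u < 2 ^ q"
  shows "reaches M X b (share # scan F h kill_counts @ [settle_nodes]) (cfg f x) (cfg (settle f x) (\<lambda>_. 0))"
proof -
  have sx: "small x" by (rule bounded_small[OF x]) auto
  have ss: "small (settle f x)" using f x X(7) by (fastforce simp: small_def settle_def)
  have s0: "small (\<lambda>_. 0)" using X by (simp add: small_def)
  let ?\<sigma> = "\<lambda>i. cfg f x i \<union> infos x f (\<lambda>_. 0) (\<lambda>_. 0) i"
  have g: "kill_counts j (?\<sigma> j) u e = (if e = 0 then card {v. (u, v) \<in> hes j \<and> f u = 0 \<and> f v = 0 \<and> x u = x v \<and> u < v} else 0)" for j u e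
  proof -
    have "{v. \<exists>y. NS u y 0 \<in> ?\<sigma> j \<and> TI u v y 0 0 0 \<in> ?\<sigma> j \<and> u < v}
      = {v. (u, v) \<in> hes j \<and> f u = 0 \<and> f v = 0 \<and> x u = x v \<and> u < v}"
      using hes_keys by (auto simp: cfg_iff infos_iff)
    then show ?thesis unfolding kill_counts_def by (simp only:)
  qed
  have tot: "(\<Sum>j<M. kill_counts j (?\<sigma> j) u e) = (if e = 0 \<and> u \<in> V then card {v \<in> nb u. f u = 0 \<and> f v = 0 \<and> x u = x v \<and> u < v} else 0)" for u e
  proof (cases "u \<in> V")
    case True
    then show ?thesis unfolding g using node_sums(2)[OF True] by simp
  next
    case False
    then have "(u, v) \<notin> hes j" for v j using heV by (auto simp: hes_def)
    then show ?thesis unfolding g using False by simp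
  qed
  have "\<exists>\<tau>. reaches M X b (scan F h kill_counts) ?\<sigma> \<tau> \<and> (\<forall>i<M. nosw (\<tau> i) = ?\<sigma> i \<and>
     (\<forall>u\<in>keys i. \<forall>e. block_sum kill_counts i (\<tau> i) u e = (\<Sum>j<M. kill_counts j (?\<sigma> j) u e)) \<and>
     (\<forall>u e. vl (rd 2 (\<tau> i)) u e > 0 \<longrightarrow> (\<exists>j<i. kill_counts j (?\<sigma> j) u e > 0)) \<and>
     (\<forall>u\<in>keys i. \<forall>e. vl (rd 2 (\<tau> i)) u e = (\<Sum>j<i. kill_counts j (?\<sigma> j) u e)))"
  proof (rule block_scan)
    show "u \<in> keys j \<and> e < 4" if p: "0 < kill_counts j (?\<sigma> j) u e" for j u e
    proof -
      have "{v. (u, v) \<in> hes j \<and> f u = 0 \<and> f v = 0 \<and> x u = x v \<and> u < v} \<noteq> {}" "e = 0"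
        using p unfolding g by (auto split: if_splits simp: card_gt_0_iff)
      then show ?thesis using hes_keys by auto
    qed
    show "(\<Sum>j<M. kill_counts j (?\<sigma> j) u e) < X" for u e
    proof -
      have "card {v \<in> nb u. f u = 0 \<and> f v = 0 \<and> x u = x v \<and> u < v} \<le> card V"
        using finV nbD by (intro card_mono) auto
      then show ?thesis unfolding tot using X(4,8) by simp
    qed
  qed (use share_base[OF _ sx f] in auto)
  then obtain \<tau> where \<tau>: "reaches M X b (scan F h kill_counts) ?\<sigma> \<tau>" "\<And>i. i < M \<Longrightarrow> nosw (\<tau> i) = ?\<sigma> i"
     "\<And>i u. i < M \<Longrightarrow> u \<in> keys i \<Longrightarrow> block_sum kill_counts i (\<tau> i) u 0 = (\<Sum>j<M. kill_counts j (?\<sigma> j) u 0)"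
    by blast
  have "reaches M X b [settle_nodes] \<tau> (cfg (settle f x) (\<lambda>_. 0))"
  proof (rule reaches_instr)
    show "settle_nodes j (\<tau> j) = keep (cfg (settle f x) (\<lambda>_. 0)) j" if j: "j < M" for j
    proof -
      have ns: "NS u y z \<in> \<tau> j \<longleftrightarrow> u \<in> keys j \<and> y = x u \<and> z = f u" for u y z
        using \<tau>(2)[OF j] nosw_stat(4)[of u y z "\<tau> j"] by (simp add: cfg_iff infos_iff)
      have "items (\<tau> j) = static j" using \<tau>(2)[OF j] nosw_stat(2)[of "\<tau> j"] items_share by simp
      moreover have st: "(if f u = 0 \<and> block_sum kill_counts j (\<tau> j) u 0 = 0 then Suc (x u) else f u) = settle f x u"
        if u: "u \<in> keys j" for u
      proof -
        have "finite {v \<in> nb u. f u = 0 \<and> f v = 0 \<and> x u = x v \<and> u < v}" using fin_nb by simp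
        then have "block_sum kill_counts j (\<tau> j) u 0 = 0 \<longleftrightarrow> \<not> killed f x u" if "f u = 0"
          using \<tau>(3)[OF j u] keysV[OF u] that unfolding tot killed_def by auto
        then show ?thesis using keysV[OF u] by (auto simp: settle_def)
      qed
      have "{NS u 0 (if z = 0 \<and> block_sum kill_counts j (\<tau> j) u 0 = 0 then Suc y else z) | u y z. NS u y z \<in> \<tau> j}
         = (\<lambda>u. NS u 0 (settle f x u)) ` keys j"
      proof -
        have "{NS u 0 (if z = 0 \<and> block_sum kill_counts j (\<tau> j) u 0 = 0 then Suc y else z) | u y z. NS u y z \<in> \<tau> j}
          = (\<lambda>u. NS u 0 (if f u = 0 \<and> block_sum kill_counts j (\<tau> j) u 0 = 0 then Suc (x u) else f u)) ` keys j"
          unfolding ns by auto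
        also have "\<dots> = (\<lambda>u. NS u 0 (settle f x u)) ` keys j" by (rule image_cong) (simp_all only: st)
        finally show ?thesis .
      qed
      then show ?thesis using \<open>items (\<tau> j) = static j\<close> unfolding settle_nodes_def keep_def cfg_def by simp
    qed
    show "flow_ok M X b (keep (cfg (settle f x) (\<lambda>_. 0)))"
      by (rule flow_ok_mono[OF flow_ok_keep[of _ _ "2 * Q"]]) (use cfg_bound[OF _ s0 ss] b in auto)
    show "deliver M (keep (cfg (settle f x) (\<lambda>_. 0))) i = cfg (settle f x) (\<lambda>_. 0) i" if "i < M" for i
      by (rule deliver_keep[OF that])
  qed
  from reaches_append[OF reaches_Cons[OF share_correct[OF sx f] \<tau>(1)] this]
  show ?thesis by simp
qed

theorem bit_phase_correct:
  assumes f: "valid f"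
  shows "\<exists>f'. reaches M X b (bit_phase_prog F h D r k q) (cfg f (\<lambda>_. 0)) (cfg f' (\<lambda>_. 0)) \<and>
    valid f' \<and> 4 * card (unc f') \<le> 3 * card (unc f)"
proof -
  have sf: "small f" by (rule valid_small[OF f])
  \<comment> \<open>Correctness of a step only asserts that some suitable seed exists. Choosing one
    for every step turns the run into a definite sequence of prefixes.\<close>
  define nxt where "nxt b' x = refine k f b' x (SOME s. reaches M X b (bit_step F h D r k b') (cfg f x) (cfg f (refine k f b' x s)) \<and>
    step_cost k f b' x s * 2 ^ (4 * k) \<le> (\<Sum>s<2 ^ (4 * k). step_cost k f b' x s))" for b' x
  define seq where "seq = rec_nat (\<lambda>_. 0) (\<lambda>t x. nxt (q - Suc t) x)"
  have seq: "seq 0 = (\<lambda>_. 0)" "\<And>t. seq (Suc t) = nxt (q - Suc t) (seq t)" by (simp_all add: seq_def)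
  have nxt: "\<exists>s. nxt b' x = refine k f b' x s \<and> reaches M X b (bit_step F h D r k b') (cfg f x) (cfg f (nxt b' x)) \<and>
    step_cost k f b' x s * 2 ^ (4 * k) \<le> (\<Sum>s<2 ^ (4 * k). step_cost k f b' x s)"
    if x: "\<And>u. u \<in> V \<Longrightarrow> x u < 2 ^ m" and m: "m < q" for b' x m
  proof -
    have "\<exists>s. reaches M X b (bit_step F h D r k b') (cfg f x) (cfg f (refine k f b' x s)) \<and>
      step_cost k f b' x s * 2 ^ (4 * k) \<le> (\<Sum>s<2 ^ (4 * k). step_cost k f b' x s)"
      by (rule bit_step_correct[OF sf _ m]) (rule x)
    note sm = someI_ex[OF this]
    show ?thesis unfolding nxt_def by (rule exI, rule conjI, rule refl, rule sm)
  qed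
  have bd: "seq t u < 2 ^ t" if "t \<le> q" "u \<in> V" for t u
    using that
  proof (induction t arbitrary: u)
    case 0
    then show ?case by (simp add: seq)
  next
    case (Suc t)
    obtain s where "nxt (q - Suc t) (seq t) = refine k f (q - Suc t) (seq t) s"
      using nxt[of "seq t" t "q - Suc t"] Suc by auto
    then show ?case using refine_less[of "seq t" u t f "q - Suc t" s] Suc by (simp add: seq)
  qed
  have run: "reaches M X b (concat (map (bit_step F h D r k) (rev [q - t..<q]))) (cfg f (\<lambda>_. 0)) (cfg f (seq t))" if "t \<le> q" for t
    using that
  proof (induction t)
    case 0
    then show ?case by (simp add: seq reaches_Nil)
  next
    case (Suc t)
    have "[q - Suc t..<q] = (q - Suc t) # [q - t..<q]"
      using Suc.prems by (subst upt_conv_Cons) (auto simp: Suc_diff_Suc)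
    moreover have "reaches M X b (bit_step F h D r k (q - Suc t)) (cfg f (seq t)) (cfg f (seq (Suc t)))"
      using nxt[of "seq t" t "q - Suc t"] bd[of t] Suc.prems by (auto simp: seq)
    ultimately show ?case using reaches_append Suc by fastforce
  qed
  \<comment> \<open>\<open>seq\<close> counts the bits already fixed, while \<open>bit_phase\<close>
    counts the missing ones.\<close>
  define x where "x b' = seq (q - b')" for b'
  have step: "\<exists>s. x b' = refine k f b' (x (Suc b')) s \<and>
       step_cost k f b' (x (Suc b')) s * 2 ^ (4 * k) \<le> (\<Sum>s<2 ^ (4 * k). step_cost k f b' (x (Suc b')) s)" if "b' < q" for b'
  proof -
    have "q - b' = Suc (q - Suc b')" "q - Suc (q - Suc b') = b'" using that by auto
    then have "x b' = nxt b' (x (Suc b'))" unfolding x_def by (metis seq(2))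
    then show ?thesis using nxt[of "x (Suc b')" "q - Suc b'" b'] bd[of "q - Suc b'"] that by (auto simp: x_def)
  qed
  have x0: "x q = (\<lambda>_. 0)" by (simp add: x_def seq)
  note ph = bit_phase[OF VX(2) Ek(1) Cq f x0 step]
  have "reaches M X b (concat (map (bit_step F h D r k) (rev [0..<q]))) (cfg f (\<lambda>_. 0)) (cfg f (x 0))"
    using run[of q] by (simp add: x_def)
  moreover have "reaches M X b (share # scan F h kill_counts @ [settle_nodes]) (cfg f (x 0)) (cfg (settle f (x 0)) (\<lambda>_. 0))"
    by (rule settle_correct[OF sf]) (use bd[of q] in \<open>auto simp: x_def\<close>)
  ultimately have "reaches M X b (bit_phase_prog F h D r k q) (cfg f (\<lambda>_. 0)) (cfg (settle f (x 0)) (\<lambda>_. 0))"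
    unfolding bit_phase_prog_def by (rule reaches_append)
  then show ?thesis using ph by blast
qed

end

subsection \<open>Moving each uncolored node to a single machine\<close>

definition presence :: "nat \<Rightarrow> w set \<Rightarrow> nat \<Rightarrow> nat \<Rightarrow> nat" where
  "presence i s u e = (if e = 0 \<and> (\<exists>x f. NS u x f \<in> s) then 1 else 0)"

text \<open>Ranks must count a node once although several machines may hold it; an empty entry of
  register 2 shows that no earlier machine does.\<close>

definition mark_first :: instr where
  "mark_first i s = Pair i ` (stat s \<union> {FN u | u x f. NS u x f \<in> s \<and> vl (rd 2 s) u 0 = 0})"

definition count_first :: "nat \<Rightarrow> w set \<Rightarrow> nat \<Rightarrow> nat \<Rightarrow> nat" where
  "count_first i s k e = (if k = 0 \<and> e = 0 then card {u. FN u \<in> s \<and> (\<exists>x. NS u x 0 \<in> s)} else 0)"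

text \<open>A node that does not start on this machine is the largest one that starts earlier, and its own
  contribution to the prefix sum has to be removed.\<close>

definition rank_of :: "w set \<Rightarrow> nat \<Rightarrow> nat" where
  "rank_of s u = vl (rd 2 s) 0 0 + card {u'. FN u' \<in> s \<and> (\<exists>x. NS u' x 0 \<in> s) \<and> u' < u}
     - (if FN u \<notin> s \<and> (\<exists>x. NS u x 0 \<in> s) then 1 else 0)"

definition share_rank :: instr where
  "share_rank i s = Pair i ` (stat s \<union> {NR u (rank_of s u) | u x f. NS u x f \<in> s}) \<union> exchange rank_of (\<lambda>_ _. 0) i s"

text \<open>Only uncolored nodes move. A colored node stays as a record for the output, and all that
  it can still influence, namely the colors available to its neighbors, travels as
  \<open>BY\<close>. The new machine of a neighbor is computed from its rank, which arrived with the
  last exchange.\<close>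

definition scatter :: "nat \<Rightarrow> instr" where
  "scatter R i s = Pair i ` {NS u x f | u x f. NS u x f \<in> s \<and> f \<noteq> 0} \<union>
     {(\<rho> div R, BL u c) | u c x \<rho>. LI u c \<in> s \<and> NS u x 0 \<in> s \<and> NR u \<rho> \<in> s} \<union>
     {(\<rho> div R, BN u v (\<rho>' div R)) | u v \<rho> \<rho>' x y z. NS u x 0 \<in> s \<and> NR u \<rho> \<in> s \<and> TI u v y 0 \<rho>' z \<in> s} \<union>
     {(\<rho> div R, BY u v c) | u v c \<rho> \<rho>' x y z. NS u x 0 \<in> s \<and> NR u \<rho> \<in> s \<and> TI u v y (Suc c) \<rho>' z \<in> s}"

definition spread_prog :: "nat \<Rightarrow> nat \<Rightarrow> nat \<Rightarrow> instr list" where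
  "spread_prog F h R = scan F h presence @ mark_first # scan F h count_first @ [share_rank, scatter R]"

lemma length_spread_prog: "length (spread_prog F h R) = 2 * h + 5"
  by (simp add: spread_prog_def length_scan)

text \<open>A moved node has a budget of \<open>(dm + 2) * (dm + 2)\<close> words. The list, the
  links, the used colors and the own color take at most \<open>3 * dm + 2\<close> of them, the
  colors offered by at most \<open>dm\<close> neighbors take \<open>dm * (dm + 1)\<close>.\<close>

locale spread = layout +
  fixes R dm :: nat and f0 :: "nat \<Rightarrow> nat"
  assumes R: "R > 0" and MX: "M < X"
    and dm: "u \<in> V \<Longrightarrow> degree E u \<le> dm"
    and RQ: "R * ((dm + 2) * (dm + 2)) \<le> Q"
    and f0: "valid f0" and few: "card (unc f0) \<le> M * R"
begin

section \<open>Ranks and new machines of the uncolored nodes\<close>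

definition "rank u = card {u' \<in> unc f0. u' < u}"
definition "home u = rank u div R"
definition "homed i = {u \<in> unc f0. home u = i}"
definition "firsts i = {u \<in> keys i. \<forall>j<i. u \<notin> keys j}"

lemma uncV: "u \<in> unc f \<Longrightarrow> u \<in> V" by (simp add: unc_def)

lemma rank_less: "u \<in> unc f0 \<Longrightarrow> rank u < card (unc f0)"
  unfolding rank_def using fin_unc by (intro psubset_card_mono) auto

lemma rank_inj: "inj_on rank (unc f0)"
proof (rule inj_onI)
  have *: "rank u < rank v" if "u \<in> unc f0" "u < v" for u v
    unfolding rank_def using fin_unc that by (intro psubset_card_mono) auto
  show "u = v" if "u \<in> unc f0" "v \<in> unc f0" "rank u = rank v" for u v
    using *[of u v] *[of v u] that by (metis less_irrefl linorder_neqE_nat)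
qed

lemma home_less: "u \<in> unc f0 \<Longrightarrow> home u < M"
  using rank_less[of u] few R by (simp add: home_def less_mult_imp_div_less)

lemma fin_homed: "finite (homed i)"
  using fin_unc by (simp add: homed_def)

lemma card_homed: "card (homed i) \<le> R"
proof -
  have "rank ` homed i \<subseteq> {i * R..<i * R + R}"
  proof
    fix n assume "n \<in> rank ` homed i"
    then have "n div R = i" by (auto simp: homed_def home_def)
    then show "n \<in> {i * R..<i * R + R}"
      using R div_times_less_eq_dividend[of n R] dividend_less_div_times[OF R, of n] by (auto simp: add.commute)
  qed
  moreover have "inj_on rank (homed i)" using rank_inj by (rule inj_on_subset) (auto simp: homed_def)
  ultimately show ?thesis using card_inj_on_le[of rank "homed i" "{i * R..<i * R + R}"] by simp
qed

lemma card_Sigma_homed: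
  assumes "\<And>u. u \<in> unc f0 \<Longrightarrow> finite (B u) \<and> card (B u) \<le> K"
  shows "finite (Sigma (homed i) B) \<and> card (Sigma (homed i) B) \<le> R * K"
proof -
  have f: "finite (B u) \<and> card (B u) \<le> K" if "u \<in> homed i" for u using assms that by (simp add: homed_def)
  have "card (Sigma (homed i) B) = (\<Sum>u\<in>homed i. card (B u))" using f fin_homed by simp
  also have "\<dots> \<le> (\<Sum>u\<in>homed i. K)" using f by (intro sum_mono) auto
  also have "\<dots> \<le> R * K" using card_homed by simp
  finally show ?thesis using f fin_homed by auto
qed

lemma card_nb_dm: "u \<in> V \<Longrightarrow> card (nb u) \<le> dm" and card_L_dm: "u \<in> V \<Longrightarrow> card (L u) \<le> dm + 1"
  using dm[of u] L[of u] card_nb[of u] by auto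

lemma sf0: "small f0" by (rule valid_small[OF f0])
lemma s0: "small (\<lambda>_. 0)" using X by (simp add: small_def)

lemma keys_ex: "u \<in> V \<Longrightarrow> \<exists>j<M. u \<in> keys j"
proof -
  assume u: "u \<in> V"
  then have "L u \<noteq> {}" using L[OF u] by auto
  then obtain c where "c \<in> L u" by blast
  then show ?thesis using u lL[OF u] by (auto simp: keys_def)
qed

lemma first_ex: "u \<in> V \<Longrightarrow> \<exists>j<M. u \<in> firsts j"
proof -
  assume "u \<in> V"
  then obtain j where j: "j < M" "u \<in> keys j" using keys_ex by blast
  define j0 where "j0 = (LEAST j. u \<in> keys j)"
  have "u \<in> keys j0" unfolding j0_def by (rule LeastI[of "\<lambda>j. u \<in> keys j", OF j(2)])
  moreover have "j0 \<le> j" unfolding j0_def by (rule Least_le) (rule j(2))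
  moreover have "\<forall>j'<j0. u \<notin> keys j'" unfolding j0_def using not_less_Least by blast
  ultimately show ?thesis using j by (intro exI[of _ j0]) (simp add: firsts_def)
qed

lemma first_unique: "u \<in> firsts i \<Longrightarrow> u \<in> firsts j \<Longrightarrow> i = j"
  by (metis (mono_tags, lifting) firsts_def linorder_neqE_nat mem_Collect_eq)

lemma fin_firsts: "finite (firsts i)"
  using fin_keys by (simp add: firsts_def)

lemma rank_eq:
  assumes i: "i < M" and u: "u \<in> keys i"
  shows "rank u = (\<Sum>j<i. card (firsts j \<inter> unc f0)) + card {u' \<in> firsts i \<inter> unc f0. u' < u}
    - (if u \<notin> firsts i \<and> u \<in> unc f0 then 1 else 0)"
proof -
  let ?A = "\<Union>j<i. firsts j \<inter> unc f0" and ?B = "{u' \<in> firsts i \<inter> unc f0. u' < u}"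
  have cA: "card ?A = (\<Sum>j<i. card (firsts j \<inter> unc f0))"
    using first_unique fin_firsts by (intro card_UN_disjoint) auto
  have fin: "finite ?A" "finite ?B" using fin_firsts by auto
  have nA: "j < i \<Longrightarrow> v \<in> firsts j \<Longrightarrow> v \<notin> firsts i" for j v using first_unique[of v j i] by auto
  have dis: "?A \<inter> ?B = {}" using nA by auto
  \<comment> \<open>By sortedness all nodes that start on earlier machines are at most
    \<open>u\<close>, and no node smaller than \<open>u\<close> starts on a later one. Only
    \<open>u\<close> itself has to be taken out.\<close>
  have eq: "{u' \<in> unc f0. u' < u} = (?A \<union> ?B) - {u}"
  proof (rule set_eqI)
    fix u'
    show "u' \<in> {u' \<in> unc f0. u' < u} \<longleftrightarrow> u' \<in> (?A \<union> ?B) - {u}"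
    proof
      assume a: "u' \<in> {u' \<in> unc f0. u' < u}"
      then obtain j where j: "j < M" "u' \<in> firsts j" using first_ex[OF uncV[of u' f0]] by auto
      have "\<not> i < j" using keys_unique[of i j u u'] u j a by (auto simp: firsts_def)
      then show "u' \<in> (?A \<union> ?B) - {u}" using a j by (cases "j = i") auto
    next
      assume a: "u' \<in> (?A \<union> ?B) - {u}"
      show "u' \<in> {u' \<in> unc f0. u' < u}"
      proof (cases "u' \<in> ?B")
        case False
        then obtain j where j: "j < i" "u' \<in> firsts j" "u' \<in> unc f0" using a by auto
        then have "u' \<le> u" using keys_unique[OF j(1) _ u] by (simp add: firsts_def)
        then show ?thesis using a j by auto
      qed auto
    qed
  qed
  have mem: "u \<in> ?A \<union> ?B \<longleftrightarrow> u \<notin> firsts i \<and> u \<in> unc f0"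
  proof
    assume "u \<in> ?A \<union> ?B"
    then show "u \<notin> firsts i \<and> u \<in> unc f0" using nA by auto
  next
    assume a: "u \<notin> firsts i \<and> u \<in> unc f0"
    then obtain j where j: "j < M" "u \<in> firsts j" using first_ex[OF uncV[of u f0]] by auto
    have "\<not> i < j" using u j by (auto simp: firsts_def)
    moreover have "j \<noteq> i" using a j by auto
    ultimately show "u \<in> ?A \<union> ?B" using j a by auto
  qed
  have "rank u = card (?A \<union> ?B) - (if u \<in> ?A \<union> ?B then 1 else 0)"
    unfolding rank_def eq using fin by (simp add: card_Diff_singleton_if)
  then show ?thesis unfolding mem card_Un_disjoint[OF fin dis] cA .
qed

definition "cfgf i = cfg f0 (\<lambda>_. 0) i \<union> FN ` firsts i"

lemma cfgf_iff:
  "LI u c \<in> cfgf i \<longleftrightarrow> u \<in> V \<and> c \<in> L u \<and> lL u c = i"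
  "HE u v a \<in> cfgf i \<longleftrightarrow> (u, v) \<in> hes i \<and> a = lH v u"
  "NS u y z \<in> cfgf i \<longleftrightarrow> u \<in> keys i \<and> y = 0 \<and> z = f0 u"
  "FN u \<in> cfgf i \<longleftrightarrow> u \<in> firsts i" "SW d1 d2 d3 d4 d5 \<notin> cfgf i"
  by (auto simp: cfgf_def cfg_iff)

lemma cfgf_bound:
  assumes i: "i < M"
  shows "finite (cfgf i) \<and> card (cfgf i) \<le> 3 * Q \<and> cfgf i \<subseteq> bwords X \<and> nosw (cfgf i) = cfgf i"
proof -
  have "card (FN ` firsts i) \<le> card (keys i)"
    using card_image_le[OF fin_firsts, of FN i] card_mono[OF fin_keys, of "firsts i" i] by (auto simp: firsts_def)
  then have "card (FN ` firsts i) \<le> Q" using card_keys[OF i] by linarith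
  moreover have "FN ` firsts i \<subseteq> bwords X" using VX(1) keysV X by (auto simp: firsts_def bwords_def)
  moreover have "nosw (cfgf i) = cfgf i" unfolding nosw_def using cfgf_iff(5) by blast
  ultimately show ?thesis using cfg_bound[OF i s0 sf0] fin_firsts card_Un_le[of "cfg f0 (\<lambda>_. 0) i" "FN ` firsts i"]
    unfolding cfgf_def by auto
qed

lemma mark_correct:
  "reaches M X b (scan F h presence @ [mark_first]) (cfg f0 (\<lambda>_. 0)) cfgf"
proof -
  let ?\<sigma> = "cfg f0 (\<lambda>_. 0)"
  have g: "presence j (?\<sigma> j) u e = (if e = 0 \<and> u \<in> keys j then 1 else 0)" for j u e
    by (simp add: presence_def cfg_iff)
  have "\<exists>\<tau>. reaches M X b (scan F h presence) ?\<sigma> \<tau> \<and> (\<forall>i<M. nosw (\<tau> i) = ?\<sigma> i \<and>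
     (\<forall>u\<in>keys i. \<forall>e. block_sum presence i (\<tau> i) u e = (\<Sum>j<M. presence j (?\<sigma> j) u e)) \<and>
     (\<forall>u e. vl (rd 2 (\<tau> i)) u e > 0 \<longrightarrow> (\<exists>j<i. presence j (?\<sigma> j) u e > 0)) \<and>
     (\<forall>u\<in>keys i. \<forall>e. vl (rd 2 (\<tau> i)) u e = (\<Sum>j<i. presence j (?\<sigma> j) u e)))"
  proof (rule block_scan)
    show "finite (?\<sigma> i) \<and> card (?\<sigma> i) \<le> 3 * Q \<and> ?\<sigma> i \<subseteq> bwords X \<and> nosw (?\<sigma> i) = ?\<sigma> i" if "i < M" for i
    proof -
      have "nosw (?\<sigma> i) = ?\<sigma> i" unfolding nosw_def using cfg_iff(6) by blast
      then show ?thesis using cfg_bound[OF that s0 sf0] by auto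
    qed
    show "(\<Sum>j<M. presence j (?\<sigma> j) u e) < X" for u e
    proof -
      have "(\<Sum>j<M. presence j (?\<sigma> j) u e) \<le> (\<Sum>j<M. 1)" unfolding g by (intro sum_mono) auto
      then show ?thesis using MX by simp
    qed
  qed (auto simp: g split: if_splits)
  then obtain \<tau> where \<tau>: "reaches M X b (scan F h presence) ?\<sigma> \<tau>" "\<And>i. i < M \<Longrightarrow> nosw (\<tau> i) = ?\<sigma> i"
     "\<And>i u. i < M \<Longrightarrow> u \<in> keys i \<Longrightarrow> vl (rd 2 (\<tau> i)) u 0 = (\<Sum>j<i. presence j (?\<sigma> j) u 0)" by blast
  have "reaches M X b [mark_first] \<tau> cfgf"
  proof (rule reaches_instr)
    show "mark_first j (\<tau> j) = keep cfgf j" if j: "j < M" for j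
    proof -
      have ns: "NS u y z \<in> \<tau> j \<longleftrightarrow> u \<in> keys j \<and> y = 0 \<and> z = f0 u" for u y z
        using \<tau>(2)[OF j] nosw_stat(4)[of u y z "\<tau> j"] by (simp add: cfg_iff)
      have "stat (\<tau> j) = ?\<sigma> j" using \<tau>(2)[OF j] nosw_stat(1)[of "\<tau> j"] stat_cfg[of f0 "\<lambda>_. 0" j "{}"]
        by (simp add: stat_def)
      moreover have "vl (rd 2 (\<tau> j)) u 0 = 0 \<longleftrightarrow> (\<forall>j'<j. u \<notin> keys j')" if "u \<in> keys j" for u
        unfolding \<tau>(3)[OF j that] g by auto
      then have "{FN u | u x f. NS u x f \<in> \<tau> j \<and> vl (rd 2 (\<tau> j)) u 0 = 0} = FN ` firsts j"
        unfolding ns firsts_def by auto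
      ultimately show ?thesis by (simp add: mark_first_def keep_def cfgf_def)
    qed
    show "flow_ok M X b (keep cfgf)"
      by (rule flow_ok_mono[OF flow_ok_keep[of _ _ "3 * Q"]]) (use cfgf_bound b in auto)
    show "deliver M (keep cfgf) i = cfgf i" if "i < M" for i by (rule deliver_keep[OF that])
  qed
  then show ?thesis by (rule reaches_append[OF \<tau>(1)])
qed

definition "cfgr i = cfg f0 (\<lambda>_. 0) i \<union> (\<lambda>u. NR u (rank u)) ` keys i \<union> infos (\<lambda>_. 0) f0 rank (\<lambda>_. 0) i"

lemma cfgr_iff:
  "LI u c \<in> cfgr i \<longleftrightarrow> u \<in> V \<and> c \<in> L u \<and> lL u c = i"
  "NS u y z \<in> cfgr i \<longleftrightarrow> u \<in> keys i \<and> y = 0 \<and> z = f0 u"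
  "NR u \<rho> \<in> cfgr i \<longleftrightarrow> u \<in> keys i \<and> \<rho> = rank u"
  "TI u v y z z1 z2 \<in> cfgr i \<longleftrightarrow> (u, v) \<in> hes i \<and> y = 0 \<and> z = f0 v \<and> z1 = rank v \<and> z2 = 0"
  by (auto simp: cfgr_def cfg_iff infos_iff)

lemma rank_correct: "reaches M X b (scan F h count_first @ [share_rank]) cfgf cfgr"
proof -
  define y where "y j k' e = (if k' = 0 \<and> e = 0 then card (firsts j \<inter> unc f0) else 0)" for j k' e :: nat
  have g: "count_first j (cfgf j) k' e = y j k' e" for j k' e
  proof -
    have "{u. FN u \<in> cfgf j \<and> (\<exists>x. NS u x 0 \<in> cfgf j)} = firsts j \<inter> unc f0"
      by (auto simp: cfgf_iff firsts_def unc_def keysV)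
    then show ?thesis by (simp add: count_first_def y_def)
  qed
  have sum_le: "(\<Sum>j<M. card (firsts j \<inter> unc f0)) \<le> card V"
  proof -
    have "(\<Sum>j<M. card (firsts j \<inter> unc f0)) = card (\<Union>j<M. firsts j \<inter> unc f0)"
      using first_unique fin_firsts by (intro card_UN_disjoint[symmetric]) auto
    also have "\<dots> \<le> card V" using finV uncV by (intro card_mono) auto
    finally show ?thesis .
  qed
  have "scan_setting F h M X b D (3 * Q) count_first cfgf y"
  proof
    show "k' < X \<and> e < D" if "j < M" "0 < y j k' e" for j k' e
      using that X D by (auto simp: y_def split: if_splits)
    show "ysum y {..<M} k' e < X" for k' e
      using sum_le X(4,8) by (cases "k' = 0 \<and> e = 0") (auto simp: ysum_def y_def)
  qed (use F M X b cfgf_bound g in auto)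
  from scan_setting.scan_correct[OF this] obtain \<tau> where \<tau>: "reaches M X b (scan F h count_first) cfgf \<tau>"
    and n: "\<And>i. i < M \<Longrightarrow> nosw (\<tau> i) = cfgf i" and r2: "\<And>i. i < M \<Longrightarrow> rd 2 (\<tau> i) = runs (\<ge>) y {..<i}" by blast
  have vl2: "vl (rd 2 (\<tau> i)) 0 0 = (\<Sum>j<i. card (firsts j \<inter> unc f0))" if "i < M" for i
  proof -
    have "vl (runs (\<ge>) y {..<i}) 0 0 = ysum y {..<i} 0 0"
    proof (rule vl_runs)
      fix k' x' assume "0 < ysum y {..<i} k' x'"
      then show "0 \<ge> k'" by (cases "k' = 0") (simp_all add: ysum_def y_def)
    qed
    then show ?thesis unfolding r2[OF that] by (simp add: ysum_def y_def)
  qed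
  have sr: "small rank"
    unfolding small_def
  proof
    fix u
    have "rank u \<le> card V" unfolding rank_def using finV uncV by (intro card_mono) auto
    then show "rank u < X" using X(8) by simp
  qed
  let ?A = "\<lambda>i. cfg f0 (\<lambda>_. 0) i \<union> (\<lambda>u. NR u (rank u)) ` keys i"
  have "reaches M X b [share_rank] \<tau> cfgr"
  proof (rule reaches_instr)
    show "share_rank j (\<tau> j) = keep ?A j \<union> twin (\<lambda>_. 0) f0 rank (\<lambda>_. 0) j" if j: "j < M" for j
    proof -
      have he: "HE u v a \<in> \<tau> j \<longleftrightarrow> (u, v) \<in> hes j \<and> a = lH v u" for u v a
        using n[OF j] nosw_stat(3)[of u v a "\<tau> j"] by (simp add: cfgf_iff)
      have ns: "NS u y z \<in> \<tau> j \<longleftrightarrow> u \<in> keys j \<and> y = 0 \<and> z = f0 u" for u y z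
        using n[OF j] nosw_stat(4)[of u y z "\<tau> j"] by (simp add: cfgf_iff)
      have fn: "FN u \<in> \<tau> j \<longleftrightarrow> u \<in> firsts j" for u
        using n[OF j] cfgf_iff(4)[of u j] by (auto simp: nosw_def)
      have "stat (cfgf j) = cfg f0 (\<lambda>_. 0) j" unfolding cfgf_def stat_cfg by (auto simp: stat_def)
      then have st: "stat (\<tau> j) = cfg f0 (\<lambda>_. 0) j" using n[OF j] nosw_stat(1)[of "\<tau> j"] by simp
      have rk: "rank_of (\<tau> j) u = rank u" if u: "u \<in> keys j" for u
      proof -
        have "{u'. FN u' \<in> \<tau> j \<and> (\<exists>x. NS u' x 0 \<in> \<tau> j) \<and> u' < u} = {u' \<in> firsts j \<inter> unc f0. u' < u}"
          unfolding fn ns by (auto simp: firsts_def unc_def keysV)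
        moreover have "FN u \<notin> \<tau> j \<and> (\<exists>x. NS u x 0 \<in> \<tau> j) \<longleftrightarrow> u \<notin> firsts j \<and> u \<in> unc f0"
          unfolding fn ns using u keysV by (auto simp: unc_def)
        ultimately show ?thesis unfolding rank_of_def rank_eq[OF j u] vl2[OF j] by simp
      qed
      have "exchange rank_of (\<lambda>_ _. 0) j (\<tau> j) = twin (\<lambda>_. 0) f0 rank (\<lambda>_. 0) j"
        by (rule exchange_eq[OF j]) (use he ns rk in auto)
      moreover have "{NR u (rank_of (\<tau> j) u) | u x f. NS u x f \<in> \<tau> j} = (\<lambda>u. NR u (rank u)) ` keys j"
        unfolding ns using rk by (auto simp: image_iff)
      ultimately show ?thesis by (simp add: share_rank_def keep_def st)
    qed
    have A: "finite (?A j) \<and> card (?A j) \<le> 3 * Q \<and> ?A j \<subseteq> bwords X" if j: "j < M" for j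
    proof -
      have "card ((\<lambda>u. NR u (rank u)) ` keys j) \<le> Q" using card_image_le[OF fin_keys] card_keys[OF j] by (rule order_trans)
      moreover have "(\<lambda>u. NR u (rank u)) ` keys j \<subseteq> bwords X"
        using sr VX(1) keysV X by (auto simp: small_def bwords_def)
      ultimately show ?thesis
        using cfg_bound[OF j s0 sf0] fin_keys card_Un_le[of "cfg f0 (\<lambda>_. 0) j" "(\<lambda>u. NR u (rank u)) ` keys j"] by auto
    qed
    then have "flow_ok M X (3 * Q + Q) (\<lambda>j. keep ?A j \<union> twin (\<lambda>_. 0) f0 rank (\<lambda>_. 0) j)"
      by (intro flow_ok_Un flow_ok_keep twin_flow s0 sf0 sr)
    then show "flow_ok M X b (\<lambda>j. keep ?A j \<union> twin (\<lambda>_. 0) f0 rank (\<lambda>_. 0) j)"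
      by (rule flow_ok_mono) (use b in simp)
    show "deliver M (\<lambda>j. keep ?A j \<union> twin (\<lambda>_. 0) f0 rank (\<lambda>_. 0) j) i = cfgr i" if "i < M" for i
      unfolding deliver_Un deliver_keep[OF that] twin_deliver cfgr_def ..
  qed
  then show ?thesis by (rule reaches_append[OF \<tau>])
qed

definition "finished i = (\<lambda>u. NS u 0 (f0 u)) ` {u \<in> keys i. f0 u \<noteq> 0}"
definition "entries i = (\<lambda>(u, c). BL u c) ` Sigma (homed i) L"
definition "links i = (\<lambda>(u, v). BN u v (home v)) ` (SIGMA u:homed i. {v \<in> nb u. v \<in> unc f0})"
definition "used g i = (\<lambda>(u, v). BY u v (g v - 1)) ` (SIGMA u:homed i. {v \<in> nb u. g v \<noteq> 0})"
definition "decided g i = (\<lambda>u. BC u (g u - 1)) ` {u \<in> homed i. g u \<noteq> 0}"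

definition "cfgb g i = finished i \<union> entries i \<union> links i \<union> used g i \<union> decided g i"

lemma cfgb_iff:
  "NS u y z \<in> cfgb g i \<longleftrightarrow> u \<in> keys i \<and> y = 0 \<and> z = f0 u \<and> z \<noteq> 0"
  "BL u c \<in> cfgb g i \<longleftrightarrow> u \<in> homed i \<and> c \<in> L u"
  "BN u v a \<in> cfgb g i \<longleftrightarrow> u \<in> homed i \<and> v \<in> nb u \<and> v \<in> unc f0 \<and> a = home v"
  "BY u v c \<in> cfgb g i \<longleftrightarrow> u \<in> homed i \<and> v \<in> nb u \<and> g v = Suc c"
  "BC u c \<in> cfgb g i \<longleftrightarrow> u \<in> homed i \<and> g u = Suc c"
  "BX u v c \<notin> cfgb g i" "SW d1 d2 d3 d4 d5 \<notin> cfgb g i" "Seed d1 \<notin> cfgb g i"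
  by (auto simp: cfgb_def finished_def entries_def links_def used_def decided_def image_iff)

lemma cfgb_bound:
  assumes i: "i < M" and g: "small g"
  shows "finite (cfgb g i) \<and> card (cfgb g i) \<le> Q + R * (3 * dm + 2) \<and> cfgb g i \<subseteq> bwords X"
proof -
  have fk: "finite {u \<in> keys i. f0 u \<noteq> 0}" "finite {u \<in> homed i. g u \<noteq> 0}" using fin_keys fin_homed by auto
  have c1: "card (finished i) \<le> Q"
  proof -
    have "card (finished i) \<le> card {u \<in> keys i. f0 u \<noteq> 0}" unfolding finished_def by (rule card_image_le[OF fk(1)])
    also have "\<dots> \<le> card (keys i)" using fin_keys by (intro card_mono) auto
    finally show ?thesis using card_keys[OF i] by simp
  qed
  have L': "finite (Sigma (homed i) L) \<and> card (Sigma (homed i) L) \<le> R * (dm + 1)"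
    using finL card_L_dm uncV by (intro card_Sigma_homed) auto
  have nbs: "finite (SIGMA u:homed i. {v \<in> nb u. P v}) \<and> card (SIGMA u:homed i. {v \<in> nb u. P v}) \<le> R * dm" for P
  proof (rule card_Sigma_homed)
    fix u assume "u \<in> unc f0"
    then have "card (nb u) \<le> dm" using card_nb_dm uncV by blast
    moreover have "card {v \<in> nb u. P v} \<le> card (nb u)" using fin_nb by (intro card_mono) auto
    ultimately show "finite {v \<in> nb u. P v} \<and> card {v \<in> nb u. P v} \<le> dm" using fin_nb by auto
  qed
  have c2: "card (entries i) \<le> R * (dm + 1)" unfolding entries_def using card_image_le L' by (meson order_trans)
  have c3: "card (links i) \<le> R * dm" unfolding links_def using card_image_le nbs by (meson order_trans)
  have c4: "card (used g i) \<le> R * dm" unfolding used_def using card_image_le nbs by (meson order_trans)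
  have c5: "card (decided g i) \<le> R"
  proof -
    have "card (decided g i) \<le> card {u \<in> homed i. g u \<noteq> 0}" unfolding decided_def by (rule card_image_le[OF fk(2)])
    also have "\<dots> \<le> card (homed i)" using fin_homed by (intro card_mono) auto
    finally show ?thesis using card_homed[of i] by simp
  qed
  have "card (cfgb g i) \<le> card (finished i) + card (entries i) + card (links i) + card (used g i) + card (decided g i)"
    unfolding cfgb_def by (meson add_right_mono card_Un_le order_trans)
  then have card: "card (cfgb g i) \<le> Q + R * (3 * dm + 2)" using c1 c2 c3 c4 c5 by (simp add: algebra_simps)
  have fin: "finite (cfgb g i)"
    unfolding cfgb_def finished_def entries_def links_def used_def decided_def using fk L' nbs by simp
  have "cfgb g i \<subseteq> bwords X"
  proof
    fix a assume "a \<in> cfgb g i"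
    then consider u where "a = NS u 0 (f0 u)" "u \<in> keys i" | u c where "a = BL u c" "u \<in> homed i" "c \<in> L u"
      | u v where "a = BN u v (home v)" "u \<in> homed i" "v \<in> unc f0"
      | u v where "a = BY u v (g v - 1)" "u \<in> homed i" "v \<in> nb u"
      | u where "a = BC u (g u - 1)" "u \<in> homed i"
      unfolding cfgb_def finished_def entries_def links_def used_def decided_def by auto
    then show "a \<in> bwords X"
    proof cases
      case 1
      then show ?thesis using sf0 keysV VX(1) X by (auto simp: small_def bwords_def)
    next
      case 2
      then have "u \<in> V" using uncV by (auto simp: homed_def)
      then show ?thesis using 2 VX(1) cX X by (auto simp: bwords_def)
    next
      case 3
      then have "home v < X" using home_less MX by (meson less_trans)
      then show ?thesis using 3 VX(1) uncV X by (auto simp: homed_def bwords_def)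
    next
      case 4
      then have "g v < X" "v < X" using g nbD VX(1) by (auto simp: small_def)
      then show ?thesis using 4 VX(1) uncV X by (auto simp: homed_def bwords_def)
    next
      case 5
      then have "g u < X" using g uncV by (auto simp: small_def homed_def)
      then show ?thesis using 5 VX(1) uncV X by (auto simp: homed_def bwords_def)
    qed
  qed
  then show ?thesis using fin card by simp
qed

lemma scatter_correct: "reaches M X b [scatter R] cfgr (cfgb f0)"
proof (rule reaches_instr)
  let ?T1 = "Sigma (unc f0) L"
  let ?T2 = "SIGMA u:unc f0. {v \<in> nb u. v \<in> unc f0}"
  let ?T3 = "SIGMA u:unc f0. {v \<in> nb u. f0 v \<noteq> 0}"
  let ?t1 = "toks ?T1 (\<lambda>(u, c). lL u c) (\<lambda>(u, c). home u) (\<lambda>(u, c). BL u c)"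
  let ?t2 = "toks ?T2 (\<lambda>(u, v). lH u v) (\<lambda>(u, v). home u) (\<lambda>(u, v). BN u v (home v))"
  let ?t3 = "toks ?T3 (\<lambda>(u, v). lH u v) (\<lambda>(u, v). home u) (\<lambda>(u, v). BY u v (f0 v - 1))"
  have he: "(u, v) \<in> hes j \<longleftrightarrow> u \<in> V \<and> v \<in> nb u \<and> lH u v = j" for u v j by (auto simp: hes_def half_edges_def)
  show "scatter R j (cfgr j) = keep finished j \<union> ?t1 j \<union> ?t2 j \<union> ?t3 j" if "j < M" for j
  proof -
    have e0: "{NS u x f | u x f. NS u x f \<in> cfgr j \<and> f \<noteq> 0} = finished j"
      unfolding cfgr_iff finished_def by auto
    have e1: "{(\<rho> div R, BL u c) | u c x \<rho>. LI u c \<in> cfgr j \<and> NS u x 0 \<in> cfgr j \<and> NR u \<rho> \<in> cfgr j} = ?t1 j"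
    proof -
      have "{(\<rho> div R, BL u c) | u c x \<rho>. LI u c \<in> cfgr j \<and> NS u x 0 \<in> cfgr j \<and> NR u \<rho> \<in> cfgr j}
         = {(home u, BL u c) | u c. u \<in> V \<and> c \<in> L u \<and> lL u c = j \<and> f0 u = 0}"
        unfolding cfgr_iff home_def by (auto simp: keys_def)
      then show ?thesis by (auto simp: toks_def unc_def image_iff)
    qed
    have e2: "{(\<rho> div R, BN u v (\<rho>' div R)) | u v \<rho> \<rho>' x y z. NS u x 0 \<in> cfgr j \<and> NR u \<rho> \<in> cfgr j \<and> TI u v y 0 \<rho>' z \<in> cfgr j} = ?t2 j"
    proof -
      have "{(\<rho> div R, BN u v (\<rho>' div R)) | u v \<rho> \<rho>' x y z. NS u x 0 \<in> cfgr j \<and> NR u \<rho> \<in> cfgr j \<and> TI u v y 0 \<rho>' z \<in> cfgr j}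
         = {(home u, BN u v (home v)) | u v. (u, v) \<in> hes j \<and> f0 u = 0 \<and> f0 v = 0}"
        unfolding cfgr_iff home_def using hes_keys by fastforce
      also have "\<dots> = ?t2 j"
        unfolding he toks_def unc_def using nbD by (auto simp: image_iff)
      finally show ?thesis .
    qed
    have e3: "{(\<rho> div R, BY u v c) | u v c \<rho> \<rho>' x y z. NS u x 0 \<in> cfgr j \<and> NR u \<rho> \<in> cfgr j \<and> TI u v y (Suc c) \<rho>' z \<in> cfgr j} = ?t3 j"
    proof -
      have "{(\<rho> div R, BY u v c) | u v c \<rho> \<rho>' x y z. NS u x 0 \<in> cfgr j \<and> NR u \<rho> \<in> cfgr j \<and> TI u v y (Suc c) \<rho>' z \<in> cfgr j}
         = {(home u, BY u v (f0 v - 1)) | u v. (u, v) \<in> hes j \<and> f0 u = 0 \<and> f0 v \<noteq> 0}"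
      proof (intro set_eqI iffI)
        fix t assume "t \<in> {(\<rho> div R, BY u v c) | u v c \<rho> \<rho>' x y z. NS u x 0 \<in> cfgr j \<and> NR u \<rho> \<in> cfgr j \<and> TI u v y (Suc c) \<rho>' z \<in> cfgr j}"
        then obtain u v c where "t = (home u, BY u v c)" "(u, v) \<in> hes j" "f0 u = 0" "f0 v = Suc c"
          by (auto simp: cfgr_iff home_def)
        then show "t \<in> {(home u, BY u v (f0 v - 1)) | u v. (u, v) \<in> hes j \<and> f0 u = 0 \<and> f0 v \<noteq> 0}" by auto
      next
        fix t assume "t \<in> {(home u, BY u v (f0 v - 1)) | u v. (u, v) \<in> hes j \<and> f0 u = 0 \<and> f0 v \<noteq> 0}"
        then obtain u v where t: "t = (home u, BY u v (f0 v - 1))" "(u, v) \<in> hes j" "f0 u = 0" "f0 v \<noteq> 0" by auto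
        then have "NS u 0 0 \<in> cfgr j" "NR u (rank u) \<in> cfgr j" "TI u v 0 (Suc (f0 v - 1)) (rank v) 0 \<in> cfgr j"
          using hes_keys[OF t(2)] by (simp_all add: cfgr_iff)
        then show "t \<in> {(\<rho> div R, BY u v c) | u v c \<rho> \<rho>' x y z. NS u x 0 \<in> cfgr j \<and> NR u \<rho> \<in> cfgr j \<and> TI u v y (Suc c) \<rho>' z \<in> cfgr j}"
          unfolding t(1) home_def by blast
      qed
      also have "\<dots> = ?t3 j"
        unfolding he toks_def unc_def by (auto simp: image_iff)
      finally show ?thesis .
    qed
    show ?thesis unfolding scatter_def e0 e1 e2 e3 keep_def ..
  qed
  have small_nb: "finite {v \<in> nb u. P v} \<and> card {v \<in> nb u. P v} \<le> dm" if "u \<in> unc f0" for u P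
  proof -
    have "card {v \<in> nb u. P v} \<le> card (nb u)" using fin_nb by (intro card_mono) auto
    then show ?thesis using card_nb_dm[of u] uncV[OF that] fin_nb by auto
  qed
  have fT: "finite ?T1" "finite ?T2" "finite ?T3" using fin_unc finL uncV fin_nb by auto
  have dst: "card {t \<in> Sigma (unc f0) B. (case t of (u, c) \<Rightarrow> home u) = i} \<le> Q"
    if B: "\<And>u. u \<in> unc f0 \<Longrightarrow> finite (B u) \<and> card (B u) \<le> dm + 1" for B :: "nat \<Rightarrow> nat set" and i
  proof -
    have "{t \<in> Sigma (unc f0) B. (case t of (u, c) \<Rightarrow> home u) = i} = Sigma (homed i) B"
      by (auto simp: homed_def)
    then have "card {t \<in> Sigma (unc f0) B. (case t of (u, c) \<Rightarrow> home u) = i} \<le> R * (dm + 1)"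
      using card_Sigma_homed[where B = B and K = "dm + 1" and i = i] B by simp
    also have "\<dots> \<le> R * ((dm + 2) * (dm + 2))" by (intro mult_le_mono2) (simp add: algebra_simps)
    finally show ?thesis using RQ by simp
  qed
  have src: "card {t \<in> (SIGMA u:unc f0. {v \<in> nb u. P v}). (case t of (u, v) \<Rightarrow> lH u v) = j} \<le> Q" if "j < M" for P j
  proof -
    have "{t \<in> (SIGMA u:unc f0. {v \<in> nb u. P v}). (case t of (u, v) \<Rightarrow> lH u v) = j} \<subseteq> hes j"
      by (auto simp: he uncV)
    then show ?thesis using card_mono[OF fin_hes] card_hes[OF that] by (meson order_trans)
  qed
  have fl1: "flow_ok M X Q ?t1"
  proof (rule flow_ok_toks[OF fT(1)])
    show "card {t \<in> ?T1. (case t of (u, c) \<Rightarrow> lL u c) = j} \<le> Q" if "j < M" for j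
    proof -
      have "{t \<in> ?T1. (case t of (u, c) \<Rightarrow> lL u c) = j} \<subseteq> {(u, c) \<in> Sigma V L. lL u c = j}" using uncV by auto
      then have "card {t \<in> ?T1. (case t of (u, c) \<Rightarrow> lL u c) = j} \<le> card {(u, c) \<in> Sigma V L. lL u c = j}"
        by (rule card_mono[OF fin_list_items])
      then show ?thesis using load[OF that] by linarith
    qed
    show "card {t \<in> ?T1. (case t of (u, c) \<Rightarrow> home u) = i} \<le> Q" for i
      using finL card_L_dm uncV by (intro dst) auto
    show "(case t of (u, c) \<Rightarrow> BL u c) \<in> bwords X" if tT: "t \<in> ?T1" for t
    proof -
      obtain u c where t: "t = (u, c)" "u \<in> unc f0" "c \<in> L u" using tT by auto
      then have "u < X" "c < X" using uncV[OF t(2)] VX(1) cX by blast+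
      then show ?thesis using t X by (simp add: bwords_def)
    qed
  qed
  have fl2: "flow_ok M X Q ?t2"
  proof (rule flow_ok_toks[OF fT(2)])
    show "card {t \<in> ?T2. (case t of (u, v) \<Rightarrow> home u) = i} \<le> Q" for i
      using small_nb by (intro dst) (auto intro: le_SucI)
    show "(case t of (u, v) \<Rightarrow> BN u v (home v)) \<in> bwords X" if tT: "t \<in> ?T2" for t
    proof -
      obtain u v where t: "t = (u, v)" "u \<in> unc f0" "v \<in> unc f0" using tT by auto
      then have "home v < X" using home_less MX by (meson less_trans)
      then show ?thesis using t VX(1) uncV X by (auto simp: bwords_def)
    qed
  qed (rule src)
  have fl3: "flow_ok M X Q ?t3"
  proof (rule flow_ok_toks[OF fT(3)])
    show "card {t \<in> ?T3. (case t of (u, v) \<Rightarrow> home u) = i} \<le> Q" for i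
      using small_nb by (intro dst) (auto intro: le_SucI)
    show "(case t of (u, v) \<Rightarrow> BY u v (f0 v - 1)) \<in> bwords X" if tT: "t \<in> ?T3" for t
    proof -
      obtain u v where t: "t = (u, v)" "u \<in> unc f0" "v \<in> nb u" using tT by auto
      then have "v \<in> V" "f0 v < X" using nbD sf0 by (auto simp: small_def)
      then show ?thesis using t VX(1) uncV X by (auto simp: bwords_def)
    qed
  qed (rule src)
  have fl0: "flow_ok M X Q (keep finished)"
  proof (rule flow_ok_keep)
    fix j assume j: "j < M"
    have "card (finished j) \<le> card {u \<in> keys j. f0 u \<noteq> 0}" unfolding finished_def using fin_keys by (intro card_image_le) simp
    also have "\<dots> \<le> card (keys j)" using fin_keys by (intro card_mono) auto
    finally have "card (finished j) \<le> Q" using card_keys[OF j] by simp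
    moreover have "finished j \<subseteq> bwords X" using sf0 keysV VX(1) X by (auto simp: finished_def small_def bwords_def)
    ultimately show "finite (finished j) \<and> card (finished j) \<le> Q \<and> finished j \<subseteq> bwords X"
      using fin_keys by (simp add: finished_def)
  qed
  show "flow_ok M X b (\<lambda>j. keep finished j \<union> ?t1 j \<union> ?t2 j \<union> ?t3 j)"
    by (rule flow_ok_mono[OF flow_ok_Un[OF flow_ok_Un[OF flow_ok_Un[OF fl0 fl1] fl2] fl3]]) (use b in simp)
  show "deliver M (\<lambda>j. keep finished j \<union> ?t1 j \<union> ?t2 j \<union> ?t3 j) i = cfgb f0 i" if i: "i < M" for i
  proof -
    have d1: "deliver M ?t1 i = entries i"
    proof -
      have "deliver M ?t1 i = (\<lambda>(u, c). BL u c) ` {t \<in> ?T1. (case t of (u, c) \<Rightarrow> home u) = i}"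
        by (rule deliver_toks) (use lL uncV in auto)
      also have "{t \<in> ?T1. (case t of (u, c) \<Rightarrow> home u) = i} = Sigma (homed i) L" by (auto simp: homed_def)
      finally show ?thesis by (simp add: entries_def)
    qed
    have lH': "lH u v < M" if "u \<in> unc f0" "v \<in> nb u" for u v using lH that uncV by (auto simp: half_edges_def)
    have d2: "deliver M ?t2 i = links i"
    proof -
      have "deliver M ?t2 i = (\<lambda>(u, v). BN u v (home v)) ` {t \<in> ?T2. (case t of (u, c) \<Rightarrow> home u) = i}"
        by (rule deliver_toks) (use lH' in auto)
      also have "{t \<in> ?T2. (case t of (u, c) \<Rightarrow> home u) = i} = (SIGMA u:homed i. {v \<in> nb u. v \<in> unc f0})" by (auto simp: homed_def)
      finally show ?thesis by (simp add: links_def)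
    qed
    have d3: "deliver M ?t3 i = used f0 i"
    proof -
      have "deliver M ?t3 i = (\<lambda>(u, v). BY u v (f0 v - 1)) ` {t \<in> ?T3. (case t of (u, c) \<Rightarrow> home u) = i}"
        by (rule deliver_toks) (use lH' in auto)
      also have "{t \<in> ?T3. (case t of (u, c) \<Rightarrow> home u) = i} = (SIGMA u:homed i. {v \<in> nb u. f0 v \<noteq> 0})" by (auto simp: homed_def)
      finally show ?thesis by (simp add: used_def)
    qed
    have d4: "decided f0 i = {}" by (auto simp: decided_def homed_def unc_def)
    show ?thesis unfolding deliver_Un deliver_keep[OF i] d1 d2 d3 cfgb_def d4 by simp
  qed
qed

theorem spread_correct: "reaches M X b (spread_prog F h R) (cfg f0 (\<lambda>_. 0)) (cfgb f0)"
  using reaches_append[OF reaches_append[OF mark_correct rank_correct] scatter_correct]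
  by (simp add: spread_prog_def)

end

subsection \<open>The phase that picks whole colors\<close>

text \<open>A resident node is recognized by its list, which is never empty because it has
  \<open>degree + 1\<close> entries.\<close>

definition open_node :: "w set \<Rightarrow> nat \<Rightarrow> bool" where
  "open_node s u \<longleftrightarrow> (\<exists>c. BL u c \<in> s) \<and> (\<forall>c. BC u c \<notin> s)"

definition free_colors :: "w set \<Rightarrow> nat \<Rightarrow> nat set" where
  "free_colors s u = {c. BL u c \<in> s \<and> (\<forall>v. BY u v c \<notin> s)}"

definition offered :: "w set \<Rightarrow> nat \<Rightarrow> nat \<Rightarrow> nat set" where
  "offered s u v = {c. BX u v c \<in> s}"

text \<open>A machine has to know the candidate of a neighbor for every seed, and this candidate
  depends on the whole set of colors available to the neighbor. Sending that set along every edge is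
  the step whose volume is quadratic in the degree.\<close>

definition offer :: instr where
  "offer i s = Pair i ` s \<union> {(a, BX v u c) | u v a c. BN u v a \<in> s \<and> open_node s u \<and> c \<in> free_colors s u}"

definition pick_cost :: "nat \<Rightarrow> nat \<Rightarrow> w set \<Rightarrow> nat \<Rightarrow> nat" where
  "pick_cost k i s q = card {(u, v). (\<exists>a. BN u v a \<in> s) \<and> open_node s u \<and> offered s u v \<noteq> {} \<and>
     pick (free_colors s u) (2 ^ k) (hash k q u) = pick (offered s u v) (2 ^ k) (hash k q v)}"

definition winner :: "nat \<Rightarrow> w set \<Rightarrow> nat \<Rightarrow> nat \<Rightarrow> bool" where
  "winner k s u c \<longleftrightarrow> open_node s u \<and> c = pick (free_colors s u) (2 ^ k) (hash k (getseed s) u) \<and>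
     (\<forall>v. offered s u v \<noteq> {} \<longrightarrow> u < v \<longrightarrow> pick (offered s u v) (2 ^ k) (hash k (getseed s) v) \<noteq> c)"

definition decide :: "nat \<Rightarrow> instr" where
  "decide k i s = Pair i ` ({a \<in> s. (\<forall>u v c. a \<noteq> BX u v c) \<and> (\<forall>q. a \<noteq> Seed q)} \<union> {BC u c | u c. winner k s u c})
     \<union> {(a, BY v u c) | u v a c. BN u v a \<in> s \<and> winner k s u c}"

definition pick_phase_prog :: "nat \<Rightarrow> nat \<Rightarrow> nat \<Rightarrow> nat \<Rightarrow> nat \<Rightarrow> instr list" where
  "pick_phase_prog F h D r k = offer # seed_search F h D r (pick_cost k) @ [decide k]"

lemma length_pick_phase_prog: "length (pick_phase_prog F h D r k) = r * (h + 2) + 3"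
  by (simp add: pick_phase_prog_def length_seed_search)

section \<open>Correctness of the phase that picks whole colors\<close>

context spread
begin

text \<open>The records of the nodes colored before the move are never rewritten and show
  \<open>f0\<close> forever, so later colorings must agree with it.\<close>

definition "extends g \<longleftrightarrow> (\<forall>u. f0 u \<noteq> 0 \<longrightarrow> g u = f0 u)"

definition "offers g i = (\<lambda>(u, v, c). BX u v c) ` (SIGMA u:homed i. SIGMA v:{v \<in> nb u. v \<in> unc g}. avail g v)"

definition "cfgo g i = cfgb g i \<union> offers g i"

lemma cfgo_iff:
  "NS u y z \<in> cfgo g i \<longleftrightarrow> u \<in> keys i \<and> y = 0 \<and> z = f0 u \<and> z \<noteq> 0"
  "BL u c \<in> cfgo g i \<longleftrightarrow> u \<in> homed i \<and> c \<in> L u"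
  "BN u v a \<in> cfgo g i \<longleftrightarrow> u \<in> homed i \<and> v \<in> nb u \<and> v \<in> unc f0 \<and> a = home v"
  "BY u v c \<in> cfgo g i \<longleftrightarrow> u \<in> homed i \<and> v \<in> nb u \<and> g v = Suc c"
  "BC u c \<in> cfgo g i \<longleftrightarrow> u \<in> homed i \<and> g u = Suc c"
  "BX u v c \<in> cfgo g i \<longleftrightarrow> u \<in> homed i \<and> v \<in> nb u \<and> v \<in> unc g \<and> c \<in> avail g v"
  "SW d1 d2 d3 d4 d5 \<notin> cfgo g i" "Seed d1 \<notin> cfgo g i"
  by (auto simp: cfgo_def cfgb_iff offers_def image_iff)

lemma homedV: "u \<in> homed i \<Longrightarrow> u \<in> V \<and> u \<in> unc f0"
  using uncV by (auto simp: homed_def)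

lemma homed_unc: "extends g \<Longrightarrow> u \<in> homed i \<and> g u = 0 \<longleftrightarrow> u \<in> unc g \<and> home u = i"
  by (auto simp: homed_def unc_def extends_def)

lemma L_ne: "u \<in> V \<Longrightarrow> L u \<noteq> {}"
  using L[of u] by auto

lemma open_cfgb: "open_node (cfgb g i) u \<longleftrightarrow> u \<in> homed i \<and> g u = 0"
proof -
  have "(\<forall>c. g u \<noteq> Suc c) \<longleftrightarrow> g u = 0" by (cases "g u") auto
  moreover have "\<exists>c. c \<in> L u" if "u \<in> homed i" using L_ne[of u] homedV[OF that] by auto
  ultimately show ?thesis by (auto simp: open_node_def cfgb_iff)
qed

lemma open_cfgo: "open_node (cfgo g i) u \<longleftrightarrow> u \<in> homed i \<and> g u = 0"
  using open_cfgb[of g i u] by (simp add: open_node_def cfgb_iff cfgo_iff)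

lemma free_cfg: "u \<in> homed i \<Longrightarrow> free_colors (cfgb g i) u = avail g u"
   "u \<in> homed i \<Longrightarrow> free_colors (cfgo g i) u = avail g u"
  by (auto simp: free_colors_def cfgb_iff cfgo_iff avail_def)

lemma offered_cfgo:
  "offered (cfgo g i) u v = (if u \<in> homed i \<and> v \<in> nb u \<and> v \<in> unc g then avail g v else {})"
  by (auto simp: offered_def cfgo_iff)

text \<open>An uncolored node always has an available color, so an empty offer tells that the
  neighbor has been colored; no separate status is transmitted.\<close>

lemma offered_ne:
  "offered (cfgo g i) u v \<noteq> {} \<longleftrightarrow> u \<in> homed i \<and> v \<in> nb u \<and> v \<in> unc g"
  unfolding offered_cfgo using avail_ne uncV by auto

lemma unc_sub: "extends g \<Longrightarrow> unc g \<subseteq> unc f0"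
  by (auto simp: extends_def unc_def)

lemma avail_dm: "u \<in> V \<Longrightarrow> finite (avail g u) \<and> card (avail g u) \<le> dm + 1"
  using fin_avail[of u g] card_mono[OF finL, of u "avail g u"] card_L_dm[of u] by (fastforce simp: avail_def)

lemma card_nb_sub: "u \<in> V \<Longrightarrow> finite {v \<in> nb u. P v} \<and> card {v \<in> nb u. P v} \<le> dm"
  using card_nb_dm[of u] fin_nb card_mono[OF fin_nb, of "{v \<in> nb u. P v}" u] by fastforce

lemma offers_index:
  "finite (SIGMA u:homed i. SIGMA v:{v \<in> nb u. v \<in> unc g}. avail g v) \<and>
   card (SIGMA u:homed i. SIGMA v:{v \<in> nb u. v \<in> unc g}. avail g v) \<le> R * (dm * (dm + 1))"
proof (rule card_Sigma_homed)
  fix u assume "u \<in> unc f0"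
  then have n: "finite {v \<in> nb u. v \<in> unc g} \<and> card {v \<in> nb u. v \<in> unc g} \<le> dm" by (intro card_nb_sub uncV)
  have a: "finite (avail g v) \<and> card (avail g v) \<le> dm + 1" if "v \<in> {v \<in> nb u. v \<in> unc g}" for v
    using that avail_dm uncV by blast
  have "card (SIGMA v:{v \<in> nb u. v \<in> unc g}. avail g v) = (\<Sum>v\<in>{v \<in> nb u. v \<in> unc g}. card (avail g v))"
    using n a by (intro card_SigmaI) auto
  also have "\<dots> \<le> (\<Sum>v\<in>{v \<in> nb u. v \<in> unc g}. dm + 1)" using a by (intro sum_mono) auto
  also have "\<dots> \<le> dm * (dm + 1)" using n mult_le_mono1[of "card {v \<in> nb u. v \<in> unc g}" dm "dm + 1"] by simp
  finally show "finite (SIGMA v:{v \<in> nb u. v \<in> unc g}. avail g v) \<and> card (SIGMA v:{v \<in> nb u. v \<in> unc g}. avail g v) \<le> dm * (dm + 1)"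
    using n a by auto
qed

lemma sizes: "R * (3 * dm + 2) + R * (dm * (dm + 1)) \<le> Q"
proof -
  have "R * (3 * dm + 2) + R * (dm * (dm + 1)) = R * (3 * dm + 2 + dm * (dm + 1))" by (simp add: distrib_left)
  also have "\<dots> \<le> R * ((dm + 2) * (dm + 2))" by (intro mult_le_mono2) (simp add: algebra_simps)
  finally show ?thesis using RQ by simp
qed

lemma cfgo_bound:
  assumes i: "i < M" and g: "small g"
  shows "finite (cfgo g i) \<and> card (cfgo g i) \<le> 4 * Q \<and> cfgo g i \<subseteq> bwords X
    \<and> nosw (cfgo g i) = cfgo g i \<and> noseed (cfgo g i) = cfgo g i"
proof -
  have "card (offers g i) \<le> R * (dm * (dm + 1))"
    unfolding offers_def using card_image_le offers_index by (meson order_trans)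
  moreover have "card (cfgo g i) \<le> card (cfgb g i) + card (offers g i)" unfolding cfgo_def by (rule card_Un_le)
  ultimately have "card (cfgo g i) \<le> 4 * Q" using cfgb_bound[OF i g] sizes by linarith
  moreover have "offers g i \<subseteq> bwords X"
  proof
    fix a assume "a \<in> offers g i"
    then obtain u v c where a: "a = BX u v c" "u \<in> homed i" "v \<in> nb u" "v \<in> unc g" "c \<in> avail g v"
      by (auto simp: offers_def)
    then have "u \<in> V" "v \<in> V" "c \<in> L v" using nbD by (auto simp: avail_def)
    then have "u < X" "v < X" "c < X" using VX(1) cX by blast+
    then show "a \<in> bwords X" using a X by (simp add: bwords_def)
  qed
  moreover have "nosw (cfgo g i) = cfgo g i" "noseed (cfgo g i) = cfgo g i"
    unfolding nosw_def noseed_def using cfgo_iff(7,8) by blast+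
  moreover have "finite (offers g i)" unfolding offers_def using offers_index by blast
  ultimately show ?thesis using cfgb_bound[OF i g] unfolding cfgo_def by auto
qed

lemma offer_correct:
  assumes g: "valid g" "extends g"
  shows "reaches M X b [offer] (cfgb g) (cfgo g)"
proof (rule reaches_instr)
  have sg: "small g" by (rule valid_small[OF g(1)])
  let ?T = "SIGMA u:unc g. SIGMA v:{v \<in> nb u. v \<in> unc f0}. avail g u"
  let ?t = "toks ?T (\<lambda>(u, v, c). home u) (\<lambda>(u, v, c). home v) (\<lambda>(u, v, c). BX v u c)"
  have U: "u \<in> unc g \<Longrightarrow> u \<in> unc f0" for u using unc_sub[OF g(2)] by blast
  show "offer j (cfgb g j) = keep (cfgb g) j \<union> ?t j" if "j < M" for j
  proof -
    have "{(a, BX v u c) | u v a c. BN u v a \<in> cfgb g j \<and> open_node (cfgb g j) u \<and> c \<in> free_colors (cfgb g j) u}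
       = {(home v, BX v u c) | u v c. u \<in> homed j \<and> g u = 0 \<and> v \<in> nb u \<and> v \<in> unc f0 \<and> c \<in> avail g u}"
      unfolding cfgb_iff open_cfgb using free_cfg(1) by auto
    also have "\<dots> = ?t j"
    proof -
      have "u \<in> homed j \<and> g u = 0 \<longleftrightarrow> u \<in> unc g \<and> home u = j" for u
        using U by (auto simp: homed_def unc_def)
      then show ?thesis unfolding toks_def by (force simp: image_iff)
    qed
    finally show ?thesis by (simp add: offer_def keep_def)
  qed
  have fT: "finite ?T" using fin_unc fin_nb fin_avail uncV by (intro finite_SigmaI) auto
  have fl: "flow_ok M X Q ?t"
  proof (rule flow_ok_toks[OF fT])
    show "card {t \<in> ?T. (case t of (u, v, c) \<Rightarrow> home u) = j} \<le> Q" for j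
    proof -
      have "{t \<in> ?T. (case t of (u, v, c) \<Rightarrow> home u) = j} \<subseteq> (SIGMA u:homed j. {v \<in> nb u. v \<in> unc f0} \<times> avail g u)"
        using U by (auto simp: homed_def)
      moreover have S: "finite (SIGMA u:homed j. {v \<in> nb u. v \<in> unc f0} \<times> avail g u) \<and>
         card (SIGMA u:homed j. {v \<in> nb u. v \<in> unc f0} \<times> avail g u) \<le> R * (dm * (dm + 1))"
      proof (rule card_Sigma_homed)
        fix u assume "u \<in> unc f0"
        then show "finite ({v \<in> nb u. v \<in> unc f0} \<times> avail g u) \<and> card ({v \<in> nb u. v \<in> unc f0} \<times> avail g u) \<le> dm * (dm + 1)"
          using card_nb_sub[OF uncV, of u f0 "\<lambda>v. v \<in> unc f0"] avail_dm[OF uncV, of u f0 g]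
            mult_le_mono[of "card {v \<in> nb u. v \<in> unc f0}" dm "card (avail g u)" "dm + 1"]
          by (simp add: card_cartesian_product)
      qed
      ultimately have "card {t \<in> ?T. (case t of (u, v, c) \<Rightarrow> home u) = j} \<le> R * (dm * (dm + 1))"
        using card_mono by (meson order_trans)
      then show ?thesis using sizes by linarith
    qed
    show "card {t \<in> ?T. (case t of (u, v, c) \<Rightarrow> home v) = i} \<le> Q" for i
    proof -
      have "{t \<in> ?T. (case t of (u, v, c) \<Rightarrow> home v) = i} \<subseteq> (\<lambda>(v, u, c). (u, v, c)) ` (SIGMA u:homed i. SIGMA v:{v \<in> nb u. v \<in> unc g}. avail g v)"
        using nb_sym by (force simp: homed_def image_iff)
      then have "card {t \<in> ?T. (case t of (u, v, c) \<Rightarrow> home v) = i}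
          \<le> card ((\<lambda>(v, u, c). (u, v, c)) ` (SIGMA u:homed i. SIGMA v:{v \<in> nb u. v \<in> unc g}. avail g v))"
        using offers_index by (intro card_mono) auto
      also have "\<dots> \<le> card (SIGMA u:homed i. SIGMA v:{v \<in> nb u. v \<in> unc g}. avail g v)"
        using offers_index by (intro card_image_le) auto
      finally show ?thesis using offers_index[of i g] sizes by linarith
    qed
    show "(case t of (u, v, c) \<Rightarrow> BX v u c) \<in> bwords X" if tT: "t \<in> ?T" for t
    proof -
      obtain u v c where t: "t = (u, v, c)" "u \<in> unc g" "v \<in> unc f0" "c \<in> avail g u" using tT by auto
      then have "u \<in> V" "v \<in> V" "c \<in> L u" using uncV by (auto simp: avail_def)
      then have "u < X" "v < X" "c < X" using VX(1) cX by auto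
      then show ?thesis using t X by (simp add: bwords_def)
    qed
  qed
  have "flow_ok M X (2 * Q + Q) (\<lambda>j. keep (cfgb g) j \<union> ?t j)"
  proof (rule flow_ok_Un[OF flow_ok_keep fl])
    fix j assume "j < M"
    then show "finite (cfgb g j) \<and> card (cfgb g j) \<le> 2 * Q \<and> cfgb g j \<subseteq> bwords X"
      using cfgb_bound[OF _ sg, of j] sizes by auto
  qed
  then show "flow_ok M X b (\<lambda>j. keep (cfgb g) j \<union> ?t j)" by (rule flow_ok_mono) (use b in simp)
  show "deliver M (\<lambda>j. keep (cfgb g) j \<union> ?t j) i = cfgo g i" if i: "i < M" for i
  proof -
    have "deliver M ?t i = (\<lambda>(u, v, c). BX v u c) ` {t \<in> ?T. (case t of (u, v, c) \<Rightarrow> home v) = i}"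
      by (rule deliver_toks) (use home_less U in auto)
    also have "\<dots> = offers g i"
    proof (rule set_eqI)
      fix w
      have "w \<in> (\<lambda>(u, v, c). BX v u c) ` {t \<in> ?T. (case t of (u, v, c) \<Rightarrow> home v) = i}
        \<longleftrightarrow> (\<exists>u v c. w = BX v u c \<and> u \<in> unc g \<and> v \<in> nb u \<and> v \<in> unc f0 \<and> c \<in> avail g u \<and> home v = i)"
        by (auto simp: image_iff)
      also have "\<dots> \<longleftrightarrow> w \<in> offers g i"
        unfolding offers_def using nb_sym by (auto simp: image_iff homed_def)
      finally show "w \<in> (\<lambda>(u, v, c). BX v u c) ` {t \<in> ?T. (case t of (u, v, c) \<Rightarrow> home v) = i} \<longleftrightarrow> w \<in> offers g i" .
    qed
    finally show ?thesis unfolding deliver_Un deliver_keep[OF i] cfgo_def by simp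
  qed
qed

text \<open>Each ordered conflict is counted on the machine of its first node only.\<close>

lemma pick_cost_eq:
  assumes g: "extends g"
  shows "(\<Sum>i<M. pick_cost k i (cfgo g i) s) = card (conflicts g (cand k g s))"
proof -
  have "pick_cost k i (cfgo g i) s = card {p \<in> conflicts g (cand k g s). (\<lambda>(u, v). home u) p = i}" for i
  proof -
    have "{(u, v). (\<exists>a. BN u v a \<in> cfgo g i) \<and> open_node (cfgo g i) u \<and> offered (cfgo g i) u v \<noteq> {} \<and>
        pick (free_colors (cfgo g i) u) (2 ^ k) (hash k s u) = pick (offered (cfgo g i) u v) (2 ^ k) (hash k s v)}
      = {p \<in> conflicts g (cand k g s). (\<lambda>(u, v). home u) p = i}"
    proof (rule set_eqI)
      fix p :: "nat \<times> nat"
      obtain u v where p: "p = (u, v)" by (cases p)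
      have hu: "u \<in> homed i \<and> g u = 0 \<longleftrightarrow> u \<in> unc g \<and> home u = i"
        by (rule homed_unc[OF g])
      have vv: "v \<in> nb u \<and> v \<in> unc g \<longleftrightarrow> v \<in> nb u \<and> g v = 0" using nbD by (auto simp: unc_def)
      have "p \<in> {(u, v). (\<exists>a. BN u v a \<in> cfgo g i) \<and> open_node (cfgo g i) u \<and> offered (cfgo g i) u v \<noteq> {} \<and>
          pick (free_colors (cfgo g i) u) (2 ^ k) (hash k s u) = pick (offered (cfgo g i) u v) (2 ^ k) (hash k s v)}
        \<longleftrightarrow> (u \<in> homed i \<and> g u = 0) \<and> (v \<in> nb u \<and> v \<in> unc g) \<and> v \<in> unc f0 \<and>
          pick (free_colors (cfgo g i) u) (2 ^ k) (hash k s u) = pick (offered (cfgo g i) u v) (2 ^ k) (hash k s v)"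
        unfolding p cfgo_iff open_cfgo offered_ne by auto
      also have "\<dots> \<longleftrightarrow> (u \<in> homed i \<and> g u = 0) \<and> (v \<in> nb u \<and> v \<in> unc g) \<and> cand k g s u = cand k g s v"
        using free_cfg(2)[of u i g] offered_cfgo[of g i u v] unc_sub[OF g] by (auto simp: cand_def)
      also have "\<dots> \<longleftrightarrow> p \<in> {p \<in> conflicts g (cand k g s). (\<lambda>(u, v). home u) p = i}"
        unfolding hu vv p by (auto simp: conflicts_def)
      finally show "p \<in> {(u, v). (\<exists>a. BN u v a \<in> cfgo g i) \<and> open_node (cfgo g i) u \<and> offered (cfgo g i) u v \<noteq> {} \<and>
          pick (free_colors (cfgo g i) u) (2 ^ k) (hash k s u) = pick (offered (cfgo g i) u v) (2 ^ k) (hash k s v)}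
        \<longleftrightarrow> p \<in> {p \<in> conflicts g (cand k g s). (\<lambda>(u, v). home u) p = i}" .
    qed
    then show ?thesis by (simp add: pick_cost_def)
  qed
  then have "(\<Sum>i<M. pick_cost k i (cfgo g i) s) = (\<Sum>i<M. card {p \<in> conflicts g (cand k g s). (\<lambda>(u, v). home u) p = i})"
    by simp
  also have "\<dots> = card (conflicts g (cand k g s))"
    using fin_conflicts home_less unc_sub[OF g] by (intro sum_located) (auto simp: conflicts_def)
  finally show ?thesis .
qed

lemma winner_iff:
  assumes g: "extends g"
  shows "winner k (insert (Seed s) (cfgo g i)) u c \<longleftrightarrow>
    u \<in> homed i \<and> g u = 0 \<and> settle g (cand k g s) u = Suc c"
proof -
  let ?s = "insert (Seed s) (cfgo g i)"
  have gs: "getseed ?s = s" unfolding getseed_def using cfgo_iff(8) by auto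
  have eq: "open_node ?s u = open_node (cfgo g i) u" "free_colors ?s u = free_colors (cfgo g i) u"
     "offered ?s u v = offered (cfgo g i) u v" for u v
    by (auto simp: open_node_def free_colors_def offered_def)
  have "winner k ?s u c \<longleftrightarrow> (u \<in> homed i \<and> g u = 0) \<and> c = cand k g s u \<and>
     (\<forall>v. v \<in> nb u \<and> v \<in> unc g \<longrightarrow> u < v \<longrightarrow> cand k g s v \<noteq> c)"
  proof (cases "u \<in> homed i")
    case True
    then show ?thesis unfolding winner_def eq gs open_cfgo offered_ne
      using free_cfg(2)[of u i g] offered_cfgo[of g i u] by (auto simp: cand_def)
  next
    case False
    then show ?thesis unfolding winner_def eq open_cfgo by simp
  qed
  also have "\<dots> \<longleftrightarrow> u \<in> homed i \<and> g u = 0 \<and> c = cand k g s u \<and> \<not> killed g (cand k g s) u"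
    unfolding killed_def using nbD by (auto simp: unc_def)
  also have "\<dots> \<longleftrightarrow> u \<in> homed i \<and> g u = 0 \<and> settle g (cand k g s) u = Suc c"
    using homedV by (auto simp: settle_def)
  finally show ?thesis .
qed

lemma extends_settle: "extends g \<Longrightarrow> extends (settle g x)"
  by (auto simp: extends_def settle_def)

lemma decide_correct:
  assumes g: "valid g" "extends g" and g': "valid (settle g (cand k g s))"
  shows "reaches M X b [decide k] (\<lambda>i. insert (Seed s) (cfgo g i)) (cfgb (settle g (cand k g s)))"
proof (rule reaches_instr)
  let ?g = "settle g (cand k g s)"
  let ?s = "\<lambda>i. insert (Seed s) (cfgo g i)"
  have sg: "small g" "small ?g" by (rule valid_small[OF g(1)], rule valid_small[OF g'])
  have ex: "extends ?g" by (rule extends_settle[OF g(2)])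
  have mono: "g u \<noteq> 0 \<Longrightarrow> ?g u = g u" for u by (rule settle_colored)
  let ?T = "SIGMA u:{u \<in> unc g. ?g u \<noteq> 0}. {v \<in> nb u. v \<in> unc f0}"
  let ?t = "toks ?T (\<lambda>(u, v). home u) (\<lambda>(u, v). home v) (\<lambda>(u, v). BY v u (?g u - 1))"
  let ?A = "\<lambda>i. cfgb g i \<union> decided ?g i"
  have U: "u \<in> unc g \<Longrightarrow> u \<in> unc f0" for u using unc_sub[OF g(2)] by blast
  have hg: "u \<in> homed j \<and> g u = 0 \<longleftrightarrow> u \<in> unc g \<and> home u = j" for u j
    by (rule homed_unc[OF g(2)])
  show "decide k j (?s j) = keep ?A j \<union> ?t j" if "j < M" for j
  proof -
    have "{a \<in> ?s j. (\<forall>u v c. a \<noteq> BX u v c) \<and> (\<forall>q. a \<noteq> Seed q)} = cfgb g j"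
      using cfgb_iff(6,8) by (auto simp: cfgo_def offers_def)
    moreover have "cfgb g j \<union> {BC u c | u c. winner k (?s j) u c} = ?A j"
    proof -
      have "{BC u c | u c. winner k (?s j) u c} = {BC u (?g u - 1) | u. u \<in> homed j \<and> g u = 0 \<and> ?g u \<noteq> 0}"
        unfolding winner_iff[OF g(2)] by (auto simp: gr0_conv_Suc)
      moreover have "decided ?g j = {BC u (?g u - 1) | u. u \<in> homed j \<and> g u = 0 \<and> ?g u \<noteq> 0} \<union> decided g j"
        unfolding decided_def using mono by (auto simp: image_iff)
      moreover have "decided g j \<subseteq> cfgb g j" by (auto simp: cfgb_def)
      ultimately show ?thesis by auto
    qed
    moreover have "{(a, BY v u c) | u v a c. BN u v a \<in> ?s j \<and> winner k (?s j) u c} = ?t j"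
    proof -
      have "{(a, BY v u c) | u v a c. BN u v a \<in> ?s j \<and> winner k (?s j) u c}
         = {(home v, BY v u (?g u - 1)) | u v. (u \<in> homed j \<and> g u = 0) \<and> ?g u \<noteq> 0 \<and> v \<in> nb u \<and> v \<in> unc f0}"
        unfolding winner_iff[OF g(2)] insert_iff cfgo_iff by (auto simp: gr0_conv_Suc)
      then show ?thesis unfolding hg toks_def by (auto simp: image_iff)
    qed
    ultimately show ?thesis unfolding decide_def keep_def by simp
  qed
  have fT: "finite ?T" using fin_unc fin_nb by (intro finite_SigmaI) auto
  have RdQ: "R * dm \<le> Q" using sizes by (simp add: algebra_simps)
  have idx: "finite (SIGMA u:homed j. {v \<in> nb u. P v}) \<and> card (SIGMA u:homed j. {v \<in> nb u. P v}) \<le> R * dm" for P j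
    by (rule card_Sigma_homed) (intro card_nb_sub uncV)
  have fl: "flow_ok M X Q ?t"
  proof (rule flow_ok_toks[OF fT])
    show "card {t \<in> ?T. (case t of (u, v) \<Rightarrow> home u) = j} \<le> Q" for j
    proof -
      have "{t \<in> ?T. (case t of (u, v) \<Rightarrow> home u) = j} \<subseteq> (SIGMA u:homed j. {v \<in> nb u. v \<in> unc f0})"
        using U by (auto simp: homed_def)
      then show ?thesis using idx card_mono RdQ by (meson order_trans)
    qed
    show "card {t \<in> ?T. (case t of (u, v) \<Rightarrow> home v) = i} \<le> Q" for i
    proof -
      have "{t \<in> ?T. (case t of (u, v) \<Rightarrow> home v) = i} \<subseteq> prod.swap ` (SIGMA u:homed i. {v \<in> nb u. v \<in> unc g})"
        using nb_sym by (force simp: homed_def image_iff)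
      then have "card {t \<in> ?T. (case t of (u, v) \<Rightarrow> home v) = i} \<le> card (prod.swap ` (SIGMA u:homed i. {v \<in> nb u. v \<in> unc g}))"
        using idx by (intro card_mono) auto
      also have "\<dots> \<le> card (SIGMA u:homed i. {v \<in> nb u. v \<in> unc g})" using idx by (intro card_image_le) auto
      finally show ?thesis using idx RdQ by (meson order_trans)
    qed
    show "(case t of (u, v) \<Rightarrow> BY v u (?g u - 1)) \<in> bwords X" if tT: "t \<in> ?T" for t
    proof -
      obtain u v where t: "t = (u, v)" "u \<in> unc g" "v \<in> unc f0" using tT by auto
      then have V': "u \<in> V" "v \<in> V" using uncV by auto
      then have "?g u < X" "u < X" "v < X" using sg(2) VX(1) by (auto simp: small_def)
      then show ?thesis using t X by (simp add: bwords_def)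
    qed
  qed
  have "flow_ok M X (3 * Q + Q) (\<lambda>j. keep ?A j \<union> ?t j)"
  proof (rule flow_ok_Un[OF flow_ok_keep fl])
    fix j assume j: "j < M"
    have d: "decided ?g j \<subseteq> cfgb ?g j" by (auto simp: cfgb_def)
    have "card (decided ?g j) \<le> card {u \<in> homed j. ?g u \<noteq> 0}"
      unfolding decided_def using fin_homed by (intro card_image_le) simp
    also have "\<dots> \<le> card (homed j)" using fin_homed by (intro card_mono) auto
    finally have "card (decided ?g j) \<le> R" using card_homed[of j] by simp
    moreover have "R \<le> Q" using sizes by (simp add: algebra_simps)
    moreover have "card (?A j) \<le> card (cfgb g j) + card (decided ?g j)" by (rule card_Un_le)
    ultimately have "card (?A j) \<le> 3 * Q" using cfgb_bound[OF j sg(1)] sizes by linarith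
    then show "finite (?A j) \<and> card (?A j) \<le> 3 * Q \<and> ?A j \<subseteq> bwords X"
      using cfgb_bound[OF j sg(1)] cfgb_bound[OF j sg(2)] d finite_subset by auto
  qed
  then show "flow_ok M X b (\<lambda>j. keep ?A j \<union> ?t j)" by (rule flow_ok_mono) (use b in simp)
  show "deliver M (\<lambda>j. keep ?A j \<union> ?t j) i = cfgb ?g i" if i: "i < M" for i
  proof -
    have "deliver M ?t i = (\<lambda>(u, v). BY v u (?g u - 1)) ` {t \<in> ?T. (case t of (u, v) \<Rightarrow> home v) = i}"
      by (rule deliver_toks) (use home_less U in auto)
    also have "\<dots> = {BY v u (?g u - 1) | u v. u \<in> unc g \<and> ?g u \<noteq> 0 \<and> v \<in> homed i \<and> u \<in> nb v}"
      using nb_sym by (auto simp: image_iff homed_def)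
    finally have dt: "deliver M ?t i = {BY v u (?g u - 1) | u v. u \<in> unc g \<and> ?g u \<noteq> 0 \<and> v \<in> homed i \<and> u \<in> nb v}" .
    have "{BY v u (?g u - 1) | u v. u \<in> unc g \<and> ?g u \<noteq> 0 \<and> v \<in> homed i \<and> u \<in> nb v} \<union> used g i = used ?g i"
    proof (rule set_eqI)
      fix w
      show "w \<in> {BY v u (?g u - 1) | u v. u \<in> unc g \<and> ?g u \<noteq> 0 \<and> v \<in> homed i \<and> u \<in> nb v} \<union> used g i \<longleftrightarrow> w \<in> used ?g i"
      proof
        assume "w \<in> {BY v u (?g u - 1) | u v. u \<in> unc g \<and> ?g u \<noteq> 0 \<and> v \<in> homed i \<and> u \<in> nb v} \<union> used g i"
        then show "w \<in> used ?g i"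
        proof
          assume "w \<in> used g i"
          then obtain v u where "w = BY v u (g u - 1)" "v \<in> homed i" "u \<in> nb v" "g u \<noteq> 0" by (auto simp: used_def)
          then show ?thesis using mono[of u] by (auto simp: used_def image_iff)
        qed (auto simp: used_def image_iff)
      next
        assume "w \<in> used ?g i"
        then obtain v u where w: "w = BY v u (?g u - 1)" "v \<in> homed i" "u \<in> nb v" "?g u \<noteq> 0" by (auto simp: used_def)
        show "w \<in> {BY v u (?g u - 1) | u v. u \<in> unc g \<and> ?g u \<noteq> 0 \<and> v \<in> homed i \<and> u \<in> nb v} \<union> used g i"
        proof (cases "g u = 0")
          case True
          then have "u \<in> unc g" using nbD[OF w(3)] by (simp add: unc_def)
          then show ?thesis using w by blast
        next
          case False
          then have "w \<in> used g i" using w mono[OF False] by (auto simp: used_def image_iff)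
          then show ?thesis by blast
        qed
      qed
    qed
    then have u: "deliver M ?t i \<union> used g i = used ?g i" unfolding dt .
    have "decided g i \<subseteq> decided ?g i" unfolding decided_def using mono by (auto simp: image_iff)
    then show ?thesis unfolding deliver_Un deliver_keep[OF i] cfgb_def u[symmetric] by auto
  qed
qed

theorem pick_phase_correct:
  assumes g: "valid g" "extends g"
  shows "\<exists>g'. reaches M X b (pick_phase_prog F h D r k) (cfgb g) (cfgb g') \<and>
    valid g' \<and> extends g' \<and> 4 * card (unc g') \<le> 3 * card (unc g)"
proof -
  have sg: "small g" by (rule valid_small[OF g(1)])
  have "(\<Sum>s<D ^ r. \<Sum>i<M. pick_cost k i (cfgo g i) s) \<le> (\<Sum>s<D ^ r. 2 * card E * 2 ^ k)"
  proof (rule sum_mono)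
    fix s
    have "card (conflicts g (cand k g s)) \<le> 2 * card E"
      using card_mono[OF fin_half conflicts_sub] card_half by metis
    also have "\<dots> \<le> 2 * card E * 2 ^ k" by simp
    finally show "(\<Sum>i<M. pick_cost k i (cfgo g i) s) \<le> 2 * card E * 2 ^ k" unfolding pick_cost_eq[OF g(2)] .
  qed
  also have "\<dots> < X" using X(9) by simp
  finally have "(\<Sum>s<D ^ r. \<Sum>i<M. pick_cost k i (cfgo g i) s) < X" .
  then obtain s where s: "s < D ^ r" "reaches M X b (seed_search F h D r (pick_cost k)) (cfgo g) (\<lambda>i. insert (Seed s) (cfgo g i))"
    "(\<Sum>i<M. pick_cost k i (cfgo g i) s) * D ^ r \<le> (\<Sum>s<D ^ r. \<Sum>i<M. pick_cost k i (cfgo g i) s)"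
    using seed_search_correct[OF F M, where D = D and \<sigma> = "cfgo g" and a = "4 * Q" and X = X and r = r
        and c = "pick_cost k" and b = b] D X b cfgo_bound[OF _ sg] by auto
  let ?g = "settle g (cand k g s)"
  have ph: "valid ?g" "4 * card (unc ?g) \<le> 3 * card (unc g)"
    using pick_phase[OF VX(2) Ek(2) g(1), of s] s(3) unfolding pick_cost_eq[OF g(2)] Dr by auto
  have "reaches M X b (pick_phase_prog F h D r k) (cfgb g) (cfgb ?g)"
    using reaches_append[OF reaches_Cons[OF offer_correct[OF g] s(2)] decide_correct[OF g ph(1)]]
    by (simp add: pick_phase_prog_def)
  then show ?thesis using ph extends_settle[OF g(2)] by blast
qed

end

subsection \<open>Radix sort\<close>

type_synonym token = "nat \<times> nat \<times> nat \<times> nat"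

text \<open>A token consists of its kind (0: list entry, 1: half edge), the node by which it is sorted, a
  color or neighbor, and for half edges the machine on which the edge was placed by the input.\<close>

definition tok_node :: "token \<Rightarrow> nat" where
  "tok_node \<tau> = fst (snd \<tau>)"

definition tok_word :: "nat \<Rightarrow> token \<Rightarrow> w" where
  "tok_word p \<tau> = (case \<tau> of (\<kappa>, u, x, m) \<Rightarrow> Tk p \<kappa> u x m)"

definition digit_count :: "nat \<Rightarrow> nat \<Rightarrow> nat \<Rightarrow> w set \<Rightarrow> nat \<Rightarrow> nat \<Rightarrow> nat" where
  "digit_count D t i s key d = (if key = 0 \<and> d < D then card {\<tau>. (\<exists>p. tok_word p \<tau> \<in> s) \<and> digit D t (tok_node \<tau>) = d} else 0)"

text \<open>Stable counting sort: in front of a token come all tokens with a smaller digit, then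
  those with the same digit on earlier machines, then those with the same digit and a smaller
  position on this machine. The result is an exact rank, so division by \<open>Q\<close> balances
  the load.\<close>

definition new_pos :: "nat \<Rightarrow> nat \<Rightarrow> w set \<Rightarrow> nat \<Rightarrow> token \<Rightarrow> nat" where
  "new_pos D t s p \<tau> = (\<Sum>d<digit D t (tok_node \<tau>). vl (rd 0 s) 0 d) + vl (rd 2 s) 0 (digit D t (tok_node \<tau>)) +
     card {\<tau>'. \<exists>p'<p. tok_word p' \<tau>' \<in> s \<and> digit D t (tok_node \<tau>') = digit D t (tok_node \<tau>)}"

definition place :: "nat \<Rightarrow> nat \<Rightarrow> nat \<Rightarrow> instr" where
  "place Q D t i s = {(new_pos D t s p \<tau> div Q, tok_word (new_pos D t s p \<tau>) \<tau>) | p \<tau>. tok_word p \<tau> \<in> s}"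

definition radix_pass :: "nat \<Rightarrow> nat \<Rightarrow> nat \<Rightarrow> nat \<Rightarrow> nat \<Rightarrow> instr list" where
  "radix_pass F h Q D t = scan F h (digit_count D t) @ [place Q D t]"

lemma tok_word_inject [simp]: "tok_word p \<tau> = tok_word p' \<tau>' \<longleftrightarrow> p = p' \<and> \<tau> = \<tau>'"
  by (cases \<tau>; cases \<tau>') (auto simp: tok_word_def)

locale radix =
  fixes G :: "token set" and M Q F h D X b A :: nat
  assumes G: "finite G" "card G \<le> M * Q"
    and Q: "Q > 0" "Q \<le> A"
    and F: "F > 0" and M: "M = F ^ h" and D: "D > 0"
    and fields: "\<tau> \<in> G \<Longrightarrow> p < X \<Longrightarrow> tok_word p \<tau> \<in> bwords X"
    and X: "F < X" "D \<le> X" "20 \<le> X" "card G < X"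
    and b: "A + 2 * D + 3 * F * D \<le> b"
begin

definition "cfgt pos mach i = (\<lambda>\<tau>. tok_word (pos \<tau>) \<tau>) ` {\<tau> \<in> G. mach \<tau> = (i::nat)}"

text \<open>Positions are distinct and increase with the machine, but need not be consecutive:
  before the first pass no machine knows how many tokens the others hold. The bound \<open>A\<close>
  is the weaker load guarantee of the input.\<close>

definition "arranged pos mach \<longleftrightarrow> inj_on pos G \<and> (\<forall>\<tau>\<in>G. mach \<tau> < M \<and> pos \<tau> < X) \<and>
   (\<forall>\<tau>\<in>G. \<forall>\<tau>'\<in>G. mach \<tau> < (mach \<tau>' :: nat) \<longrightarrow> pos \<tau> < (pos \<tau>' :: nat)) \<and>
   (\<forall>i<M. card {\<tau> \<in> G. mach \<tau> = i} \<le> A)"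

definition "before t pos \<tau>' \<tau> \<longleftrightarrow> digit D t (tok_node \<tau>') < digit D t (tok_node \<tau>) \<or>
   (digit D t (tok_node \<tau>') = digit D t (tok_node \<tau>) \<and> pos \<tau>' < (pos \<tau> :: nat))"

definition "repos t pos \<tau> = card {\<tau>' \<in> G. before t pos \<tau>' \<tau>}"

definition "sorted_upto t pos \<longleftrightarrow> (\<forall>\<tau>\<in>G. \<forall>\<tau>'\<in>G. tok_node \<tau> mod D ^ t < tok_node \<tau>' mod D ^ t \<longrightarrow> pos \<tau> < (pos \<tau>' :: nat))"

lemma repos_mono:
  assumes "\<tau>' \<in> G" "\<tau> \<in> G" "before t pos \<tau>' \<tau>" shows "repos t pos \<tau>' < repos t pos \<tau>"
  unfolding repos_def
proof (rule psubset_card_mono)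
  have "before t pos \<tau>'' \<tau>' \<Longrightarrow> before t pos \<tau>'' \<tau>" for \<tau>'' using assms(3) by (auto simp: before_def)
  moreover have "\<not> before t pos \<tau>' \<tau>'" by (simp add: before_def)
  ultimately show "{\<tau>'' \<in> G. before t pos \<tau>'' \<tau>'} \<subset> {\<tau>'' \<in> G. before t pos \<tau>'' \<tau>}" using assms by blast
qed (use G in simp)

lemma repos_less: "\<tau> \<in> G \<Longrightarrow> repos t pos \<tau> < card G"
  unfolding repos_def using G by (intro psubset_card_mono) (auto simp: before_def)

lemma repos_inj: "inj_on pos G \<Longrightarrow> inj_on (repos t pos) G"
proof (rule inj_onI)
  fix \<tau> \<tau>' assume a: "inj_on pos G" "\<tau> \<in> G" "\<tau>' \<in> G" "repos t pos \<tau> = repos t pos \<tau>'"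
  show "\<tau> = \<tau>'"
  proof (rule ccontr)
    assume "\<tau> \<noteq> \<tau>'"
    then have "pos \<tau> \<noteq> pos \<tau>'" using a by (meson inj_onD)
    then have "before t pos \<tau> \<tau>' \<or> before t pos \<tau>' \<tau>" by (auto simp: before_def)
    then show False using repos_mono[of \<tau> \<tau>' t pos] repos_mono[of \<tau>' \<tau> t pos] a by auto
  qed
qed

lemma repos_load:
  assumes "inj_on pos G" shows "card {\<tau> \<in> G. repos t pos \<tau> div Q = i} \<le> Q"
proof -
  have "repos t pos ` {\<tau> \<in> G. repos t pos \<tau> div Q = i} \<subseteq> {i * Q..<i * Q + Q}"
    using div_times_less_eq_dividend[of _ Q] dividend_less_div_times[OF Q(1)] by (force simp: add.commute)
  moreover have "inj_on (repos t pos) {\<tau> \<in> G. repos t pos \<tau> div Q = i}"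
    using repos_inj[OF assms] by (rule inj_on_subset) auto
  ultimately show ?thesis
    using card_inj_on_le[of "repos t pos" _ "{i * Q..<i * Q + Q}"] by fastforce
qed

lemma arranged_repos:
  assumes "inj_on pos G" shows "arranged (repos t pos) (\<lambda>\<tau>. repos t pos \<tau> div Q)"
  unfolding arranged_def
proof (intro conjI ballI allI impI)
  show "inj_on (repos t pos) G" by (rule repos_inj[OF assms])
  fix \<tau> assume \<tau>: "\<tau> \<in> G"
  show "repos t pos \<tau> div Q < M" using repos_less[OF \<tau>, of t pos] G(2) by (intro less_mult_imp_div_less) simp
  show "repos t pos \<tau> < X" using repos_less[OF \<tau>, of t pos] X by simp
  fix \<tau>' assume "repos t pos \<tau> div Q < repos t pos \<tau>' div Q"
  then show "repos t pos \<tau> < repos t pos \<tau>'" by (meson div_le_mono not_less)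
next
  fix i
  show "card {\<tau> \<in> G. repos t pos \<tau> div Q = i} \<le> A"
    using repos_load[OF assms, of t i] Q(2) by simp
qed

text \<open>Modulo \<open>D ^ Suc t\<close> digit \<open>t\<close> is compared first; for equal
  digits the old order survives, as a pass is stable.\<close>

lemma sorted_repos:
  assumes "sorted_upto t pos" shows "sorted_upto (Suc t) (repos t pos)"
  unfolding sorted_upto_def
proof (intro ballI impI)
  fix \<tau> \<tau>' assume \<tau>: "\<tau> \<in> G" "\<tau>' \<in> G" and less: "tok_node \<tau> mod D ^ Suc t < tok_node \<tau>' mod D ^ Suc t"
  have e: "u mod D ^ Suc t = D ^ t * digit D t u + u mod D ^ t" for u
    unfolding power_Suc2 mod_mult2_eq digit_def ..
  have m: "u mod D ^ t < D ^ t" for u using D by simp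
  have "before t pos \<tau> \<tau>'"
  proof (rule ccontr)
    assume n: "\<not> before t pos \<tau> \<tau>'"
    then consider "digit D t (tok_node \<tau>') < digit D t (tok_node \<tau>)"
      | "digit D t (tok_node \<tau>) = digit D t (tok_node \<tau>')" "\<not> pos \<tau> < pos \<tau>'"
      unfolding before_def by linarith
    then show False
    proof cases
      case 1
      then have "D ^ t * (digit D t (tok_node \<tau>') + 1) \<le> D ^ t * digit D t (tok_node \<tau>)" by (intro mult_le_mono2) simp
      then show False using less m[of "tok_node \<tau>'"] unfolding e by simp
    next
      case 2
      then have "tok_node \<tau> mod D ^ t < tok_node \<tau>' mod D ^ t" using less unfolding e by simp
      then show False using assms \<tau> 2 by (auto simp: sorted_upto_def)
    qed
  qed
  then show "repos t pos \<tau> < repos t pos \<tau>'" by (rule repos_mono[OF \<tau>])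
qed

lemma tok_cfgt: "tok_word p \<tau> \<in> cfgt pos mach i \<longleftrightarrow> \<tau> \<in> G \<and> mach \<tau> = i \<and> p = pos \<tau>"
  by (auto simp: cfgt_def simp del: split_paired_Ex split_paired_All)

lemma cfgt_bound:
  assumes "arranged pos mach" "i < M"
  shows "finite (cfgt pos mach i) \<and> card (cfgt pos mach i) \<le> A \<and> cfgt pos mach i \<subseteq> bwords X \<and> nosw (cfgt pos mach i) = cfgt pos mach i"
proof -
  have "finite {\<tau> \<in> G. mach \<tau> = i}" using G by simp
  then have "card (cfgt pos mach i) \<le> card {\<tau> \<in> G. mach \<tau> = i}" unfolding cfgt_def by (rule card_image_le)
  also have "\<dots> \<le> A" using assms by (simp add: arranged_def)
  finally have "card (cfgt pos mach i) \<le> A" .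
  moreover have "finite (cfgt pos mach i)" using G(1) by (simp add: cfgt_def)
  moreover have "cfgt pos mach i \<subseteq> bwords X"
    unfolding cfgt_def using assms(1) fields by (intro image_subsetI) (simp add: arranged_def)
  moreover have "nosw (cfgt pos mach i) = cfgt pos mach i"
  proof -
    have "tok_word p \<tau> \<noteq> SW d1 d2 d3 d4 d5" for p \<tau> d1 d2 d3 d4 d5 by (cases \<tau>) (simp add: tok_word_def)
    then show ?thesis unfolding nosw_def cfgt_def by fast
  qed
  ultimately show ?thesis by simp
qed

lemma pass_correct:
  assumes arr: "arranged pos mach"
  shows "reaches M X b (radix_pass F h Q D t) (cfgt pos mach) (cfgt (repos t pos) (\<lambda>\<tau>. repos t pos \<tau> div Q))"
proof -
  let ?dg = "\<lambda>\<tau>. digit D t (tok_node \<tau>)"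
  have inj: "inj_on pos G" and mM: "\<And>\<tau>. \<tau> \<in> G \<Longrightarrow> mach \<tau> < M"
    and mono: "\<And>\<tau> \<tau>'. \<tau> \<in> G \<Longrightarrow> \<tau>' \<in> G \<Longrightarrow> mach \<tau> < mach \<tau>' \<Longrightarrow> pos \<tau> < pos \<tau>'"
    using arr by (auto simp: arranged_def)
  define y where "y j key d = (if key = 0 \<and> d < D then card {\<tau> \<in> {\<tau> \<in> G. ?dg \<tau> = d}. mach \<tau> = j} else 0)" for j and key d :: nat
  have g: "digit_count D t j (cfgt pos mach j) key d = y j key d" for j key d
  proof -
    have "{\<tau>. (\<exists>p. tok_word p \<tau> \<in> cfgt pos mach j) \<and> ?dg \<tau> = d} = {\<tau> \<in> {\<tau> \<in> G. ?dg \<tau> = d}. mach \<tau> = j}"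
      unfolding tok_cfgt by auto
    then show ?thesis unfolding digit_count_def y_def by (simp only:)
  qed
  have ys: "ysum y {..<i} 0 d = card {\<tau> \<in> G. ?dg \<tau> = d \<and> mach \<tau> < i}" if d: "d < D" for i d
  proof -
    have "ysum y {..<i} 0 d = (\<Sum>j<i. card {\<tau> \<in> {\<tau> \<in> G. ?dg \<tau> = d}. mach \<tau> = j})" using d by (simp add: ysum_def y_def)
    also have "\<dots> = card (\<Union>j<i. {\<tau> \<in> {\<tau> \<in> G. ?dg \<tau> = d}. mach \<tau> = j})"
      using G(1) by (intro card_UN_disjoint[symmetric]) auto
    also have "(\<Union>j<i. {\<tau> \<in> {\<tau> \<in> G. ?dg \<tau> = d}. mach \<tau> = j}) = {\<tau> \<in> G. ?dg \<tau> = d \<and> mach \<tau> < i}" by auto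
    finally show ?thesis .
  qed
  have y0: "ysum y J key d = 0" if "key \<noteq> 0 \<or> \<not> d < D" for J key d using that by (auto simp: ysum_def y_def)
  have "scan_setting F h M X b D A (digit_count D t) (cfgt pos mach) y"
  proof
    show "key < X \<and> d < D" if "j < M" "0 < y j key d" for j key d
      using that X by (auto simp: y_def split: if_splits)
    show "ysum y {..<M} key d < X" for key d
    proof (cases "key = 0 \<and> d < D")
      case True
      have "card {\<tau> \<in> G. ?dg \<tau> = d \<and> mach \<tau> < M} \<le> card G" using G by (intro card_mono) auto
      then show ?thesis using True ys[of d M] X by simp
    qed (use y0 X in auto)
  qed (use F M X b cfgt_bound[OF arr] g in auto)
  from scan_setting.scan_correct[OF this] obtain \<rho> where \<rho>: "reaches M X b (scan F h (digit_count D t)) (cfgt pos mach) \<rho>"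
    and n: "\<And>i. i < M \<Longrightarrow> nosw (\<rho> i) = cfgt pos mach i" and r0: "\<And>i. i < M \<Longrightarrow> rd 0 (\<rho> i) = runs (\<le>) y {..<M}"
    and r2: "\<And>i. i < M \<Longrightarrow> rd 2 (\<rho> i) = runs (\<ge>) y {..<i}" by blast
  have v0: "vl (runs (\<le>) y {..<M}) 0 d = ysum y {..<M} 0 d" for d by (rule vl_runs) simp
  have v2: "vl (runs (\<ge>) y {..<i}) 0 d = ysum y {..<i} 0 d" for i d
    by (rule vl_runs) (metis le_refl less_irrefl y0)
  have tok: "tok_word p \<tau> \<in> \<rho> i \<longleftrightarrow> \<tau> \<in> G \<and> mach \<tau> = i \<and> p = pos \<tau>" if "i < M" for p \<tau> i
  proof -
    have "tok_word p \<tau> \<in> \<rho> i \<longleftrightarrow> tok_word p \<tau> \<in> nosw (\<rho> i)" by (cases \<tau>) (auto simp: nosw_def tok_word_def)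
    then show ?thesis unfolding n[OF that] tok_cfgt .
  qed
  have np: "new_pos D t (\<rho> i) (pos \<tau>) \<tau> = repos t pos \<tau>" if i: "i < M" and \<tau>: "\<tau> \<in> G" "mach \<tau> = i" for i \<tau>
  proof -
    have dD: "?dg \<tau>' < D" for \<tau>' by (rule digit_less[OF D])
    have "(\<Sum>d<?dg \<tau>. vl (rd 0 (\<rho> i)) 0 d) = (\<Sum>d<?dg \<tau>. card {\<tau>' \<in> G. ?dg \<tau>' = d})"
    proof (rule sum.cong[OF refl])
      fix d assume "d \<in> {..<?dg \<tau>}"
      then have "d < D" using dD[of \<tau>] by simp
      moreover have "{\<tau>' \<in> G. ?dg \<tau>' = d \<and> mach \<tau>' < M} = {\<tau>' \<in> G. ?dg \<tau>' = d}" using mM by auto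
      ultimately show "vl (rd 0 (\<rho> i)) 0 d = card {\<tau>' \<in> G. ?dg \<tau>' = d}" unfolding r0[OF i] v0 using ys[of d M] by simp
    qed
    also have "\<dots> = card (\<Union>d<?dg \<tau>. {\<tau>' \<in> G. ?dg \<tau>' = d})"
      using G(1) by (intro card_UN_disjoint[symmetric]) auto
    also have "(\<Union>d<?dg \<tau>. {\<tau>' \<in> G. ?dg \<tau>' = d}) = {\<tau>' \<in> G. ?dg \<tau>' < ?dg \<tau>}" by auto
    finally have 1: "(\<Sum>d<?dg \<tau>. vl (rd 0 (\<rho> i)) 0 d) = card {\<tau>' \<in> G. ?dg \<tau>' < ?dg \<tau>}" .
    have 2: "vl (rd 2 (\<rho> i)) 0 (?dg \<tau>) = card {\<tau>' \<in> G. ?dg \<tau>' = ?dg \<tau> \<and> mach \<tau>' < i}"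
      unfolding r2[OF i] v2 using ys[OF dD] by simp
    have 3: "{\<tau>'. \<exists>p'<pos \<tau>. tok_word p' \<tau>' \<in> \<rho> i \<and> ?dg \<tau>' = ?dg \<tau>} = {\<tau>' \<in> G. ?dg \<tau>' = ?dg \<tau> \<and> mach \<tau>' = i \<and> pos \<tau>' < pos \<tau>}"
      unfolding tok[OF i] by auto
    have split: "{\<tau>' \<in> G. before t pos \<tau>' \<tau>} = {\<tau>' \<in> G. ?dg \<tau>' < ?dg \<tau>} \<union>
       ({\<tau>' \<in> G. ?dg \<tau>' = ?dg \<tau> \<and> mach \<tau>' < i} \<union> {\<tau>' \<in> G. ?dg \<tau>' = ?dg \<tau> \<and> mach \<tau>' = i \<and> pos \<tau>' < pos \<tau>})"
    proof -
      have "pos \<tau>' < pos \<tau> \<longleftrightarrow> mach \<tau>' < i \<or> mach \<tau>' = i \<and> pos \<tau>' < pos \<tau>" if "\<tau>' \<in> G" for \<tau>'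
        using mono[OF that \<tau>(1)] mono[OF \<tau>(1) that] \<tau>(2) by (cases "mach \<tau>'" i rule: linorder_cases) auto
      then show ?thesis unfolding before_def by auto
    qed
    have "repos t pos \<tau> = card {\<tau>' \<in> G. ?dg \<tau>' < ?dg \<tau>} +
       (card {\<tau>' \<in> G. ?dg \<tau>' = ?dg \<tau> \<and> mach \<tau>' < i} + card {\<tau>' \<in> G. ?dg \<tau>' = ?dg \<tau> \<and> mach \<tau>' = i \<and> pos \<tau>' < pos \<tau>})"
      unfolding repos_def split using G(1)
      by (subst card_Un_disjoint; (subst card_Un_disjoint)?) auto
    then show ?thesis unfolding new_pos_def 1 2 3 by simp
  qed
  let ?pos = "repos t pos" and ?mach = "\<lambda>\<tau>. repos t pos \<tau> div Q"
  have arr': "arranged ?pos ?mach" by (rule arranged_repos[OF inj])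
  have "reaches M X b [place Q D t] \<rho> (cfgt ?pos ?mach)"
  proof (rule reaches_instr)
    show "place Q D t j (\<rho> j) = toks G mach ?mach (\<lambda>\<tau>. tok_word (?pos \<tau>) \<tau>) j" if j: "j < M" for j
      unfolding place_def tok[OF j] toks_def using np[OF j] by (auto simp: image_iff)
    show "flow_ok M X b (toks G mach ?mach (\<lambda>\<tau>. tok_word (?pos \<tau>) \<tau>))"
    proof (rule flow_ok_mono[OF flow_ok_toks[OF G(1)]])
      show "card {\<tau> \<in> G. mach \<tau> = j} \<le> A" if "j < M" for j using arr that by (simp add: arranged_def)
      show "card {\<tau> \<in> G. ?mach \<tau> = j} \<le> A" if "j < M" for j using arr' that by (simp add: arranged_def)
      show "tok_word (?pos \<tau>) \<tau> \<in> bwords X" if "\<tau> \<in> G" for \<tau>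
        using fields[OF that] arr' that by (simp add: arranged_def)
    qed (use b in simp)
    show "deliver M (toks G mach ?mach (\<lambda>\<tau>. tok_word (?pos \<tau>) \<tau>)) i = cfgt ?pos ?mach i" for i
      unfolding cfgt_def by (rule deliver_toks) (rule mM)
  qed
  then show ?thesis unfolding radix_pass_def by (rule reaches_append[OF \<rho>])
qed

text \<open>The load drops from \<open>A\<close> to \<open>Q\<close> in the first pass, where
  positions become ranks; hence the condition \<open>J > 0\<close> on the last conclusion.\<close>

lemma sort_correct:
  assumes arr: "arranged pos mach"
  shows "\<exists>pos' mach'. reaches M X b (concat (map (radix_pass F h Q D) [0..<J])) (cfgt pos mach) (cfgt pos' mach') \<and>
    arranged pos' mach' \<and> sorted_upto J pos' \<and> (J > 0 \<longrightarrow> (\<forall>i. card {\<tau> \<in> G. mach' \<tau> = i} \<le> Q))"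
proof (induction J)
  case 0
  have "sorted_upto 0 pos" by (simp add: sorted_upto_def)
  then show ?case using arr reaches_Nil[of M X b "cfgt pos mach"] by (intro exI[of _ pos] exI[of _ mach]) simp
next
  case (Suc J)
  then obtain pos' mach' where p: "reaches M X b (concat (map (radix_pass F h Q D) [0..<J])) (cfgt pos mach) (cfgt pos' mach')"
    "arranged pos' mach'" "sorted_upto J pos'" by blast
  have inj: "inj_on pos' G" using p(2) by (simp add: arranged_def)
  have "reaches M X b (concat (map (radix_pass F h Q D) [0..<Suc J])) (cfgt pos mach)
     (cfgt (repos J pos') (\<lambda>\<tau>. repos J pos' \<tau> div Q))"
    using reaches_append[OF p(1) pass_correct[OF p(2), of J]] by simp
  then show ?case using arranged_repos[OF inj] sorted_repos[OF p(3)] repos_load[OF inj] by blast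
qed

end

subsection \<open>From the input to the block layout\<close>

definition toks_of :: "nat \<Rightarrow> w set \<Rightarrow> token set" where
  "toks_of i s = {(0, u, c, 0) | u c. IL u c \<in> s} \<union> {(1, u, v, i) | u v. IE u v \<in> s} \<union> {(1, v, u, i) | u v. IE u v \<in> s}"

definition numbering :: "token set \<Rightarrow> token \<Rightarrow> nat" where
  "numbering T = (SOME f. inj_on f T \<and> f ` T \<subseteq> {..<card T})"

text \<open>If \<open>Y\<close> exceeds the number of tokens on every machine, then the ranges
  starting at \<open>i * Y\<close> are disjoint, and all machines obtain globally distinct
  increasing positions without communication.\<close>

definition enter :: "nat \<Rightarrow> instr" where
  "enter Y i s = Pair i ` (\<lambda>\<tau>. tok_word (i * Y + numbering (toks_of i s) \<tau>) \<tau>) ` toks_of i s"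

text \<open>After sorting, the two halves of an edge lie on machines that do not know each other.
  Both still carry the machine where the input placed the edge; they report their new locations
  there and receive each other's in the next round.\<close>

definition rendezvous :: instr where
  "rendezvous i s = {(i, LI u c) | u c. \<exists>p m. Tk p 0 u c m \<in> s} \<union> {(m, Rv u v i) | u v m. \<exists>p. Tk p 1 u v m \<in> s}"

definition connect :: instr where
  "connect i s = Pair i ` {LI u c | u c. LI u c \<in> s} \<union> {(a, HE u v a') | u v a a'. Rv u v a \<in> s \<and> Rv v u a' \<in> s}"

definition start :: instr where
  "start i s = Pair i ` (s \<union> {NS u 0 0 | u. (\<exists>c. LI u c \<in> s) \<or> (\<exists>v a. HE u v a \<in> s)})"

definition degree_count :: "nat \<Rightarrow> w set \<Rightarrow> nat \<Rightarrow> nat \<Rightarrow> nat" where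
  "degree_count i s u e = (if e = 0 then card {v. \<exists>a. HE u v a \<in> s} else 0)"

definition publish :: instr where
  "publish i s = Pair i ` (stat s \<union> {NW u (block_sum degree_count i s u 0) 0 | u x f. NS u x f \<in> s})"

text \<open>Here the key of the scan is the degree itself, so the largest run over all machines,
  which register 1 holds everywhere, has the maximum degree as its key.\<close>

definition degree_occurs :: "nat \<Rightarrow> w set \<Rightarrow> nat \<Rightarrow> nat \<Rightarrow> nat" where
  "degree_occurs i s key e = (if e = 0 \<and> (\<exists>u. NW u key 0 \<in> s) then 1 else 0)"

definition top_key :: "w set \<Rightarrow> nat" where
  "top_key s = (THE key. \<exists>x v. (key, x, v) \<in> rd 1 s)"

text \<open>The setup ends with the registers still in memory, because the maximum degree is read
  from them when the setup is complete. Removing them is left to the second part of the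
  program.\<close>

definition forget :: instr where
  "forget i s = Pair i ` stat s"

definition setup_prog :: "nat \<Rightarrow> nat \<Rightarrow> nat \<Rightarrow> nat \<Rightarrow> nat \<Rightarrow> nat \<Rightarrow> instr list" where
  "setup_prog F h Q D J Y = enter Y # concat (map (radix_pass F h Q D) [0..<J]) @ [rendezvous, connect, start] @
     (scan F h degree_count @ publish # scan F h degree_occurs)"

lemma length_setup_prog: "length (setup_prog F h Q D J Y) = J * (h + 2) + 2 * h + 7"
proof -
  have "length (concat (map (radix_pass F h Q D) [0..<J])) = J * (h + 2)"
    by (simp add: length_concat comp_def radix_pass_def length_scan sum_list_triv)
  then show ?thesis by (simp add: setup_prog_def length_scan)
qed

context layout
begin

lemma s0_small: "small (\<lambda>_. 0)"
  using X by (simp add: small_def)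

lemma degree_correct:
  assumes V: "V \<noteq> {}" and MX: "M < X"
  shows "\<exists>\<tau>. reaches M X b (scan F h degree_count @ publish # scan F h degree_occurs) (cfg (\<lambda>_. 0) (\<lambda>_. 0)) \<tau> \<and>
    (\<forall>i<M. top_key (\<tau> i) = max_degree V E) \<and> reaches M X b [forget] \<tau> (cfg (\<lambda>_. 0) (\<lambda>_. 0))"
proof -
  let ?\<sigma> = "cfg (\<lambda>_. 0) (\<lambda>_. 0)"
  have s0: "small (\<lambda>_. 0)" using X by (simp add: small_def)
  have g: "degree_count j (?\<sigma> j) u e = (if e = 0 then card {v. (u, v) \<in> hes j \<and> True} else 0)" for j u e
    by (simp add: degree_count_def cfg_iff)
  have tot: "(\<Sum>j<M. degree_count j (?\<sigma> j) u e) = (if e = 0 \<and> u \<in> V then degree E u else 0)" for u e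
  proof (cases "u \<in> V")
    case True
    then show ?thesis unfolding g using node_sums(2)[OF True, of "\<lambda>_. True"] card_nb[of u] by simp
  next
    case False
    then have "(u, v) \<notin> hes j" for v j using heV by (auto simp: hes_def)
    then show ?thesis unfolding g using False by simp
  qed
  have dX: "degree E u < X" if "u \<in> V" for u
  proof -
    have "card (L u) \<le> C" using L[OF that] card_mono[of "{..<C}" "L u"] by simp
    then show ?thesis using L[OF that] X(6) by simp
  qed
  have "\<exists>\<tau>. reaches M X b (scan F h degree_count) ?\<sigma> \<tau> \<and> (\<forall>i<M. nosw (\<tau> i) = ?\<sigma> i \<and>
     (\<forall>u\<in>keys i. \<forall>e. block_sum degree_count i (\<tau> i) u e = (\<Sum>j<M. degree_count j (?\<sigma> j) u e)) \<and>
     (\<forall>u e. vl (rd 2 (\<tau> i)) u e > 0 \<longrightarrow> (\<exists>j<i. degree_count j (?\<sigma> j) u e > 0)) \<and>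
     (\<forall>u\<in>keys i. \<forall>e. vl (rd 2 (\<tau> i)) u e = (\<Sum>j<i. degree_count j (?\<sigma> j) u e)))"
  proof (rule block_scan)
    show "finite (?\<sigma> i) \<and> card (?\<sigma> i) \<le> 3 * Q \<and> ?\<sigma> i \<subseteq> bwords X \<and> nosw (?\<sigma> i) = ?\<sigma> i" if "i < M" for i
    proof -
      have "nosw (?\<sigma> i) = ?\<sigma> i" unfolding nosw_def using cfg_iff(6) by blast
      then show ?thesis using cfg_bound[OF that s0 s0] by auto
    qed
    show "u \<in> keys j \<and> e < 4" if p: "0 < degree_count j (?\<sigma> j) u e" for j u e
    proof -
      have "{v. (u, v) \<in> hes j \<and> True} \<noteq> {}" "e = 0" using p unfolding g by (auto split: if_splits simp: card_gt_0_iff)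
      then show ?thesis using hes_keys by auto
    qed
    show "(\<Sum>j<M. degree_count j (?\<sigma> j) u e) < X" for u e unfolding tot using dX X by auto
  qed
  then obtain \<tau> where \<tau>: "reaches M X b (scan F h degree_count) ?\<sigma> \<tau>" "\<And>i. i < M \<Longrightarrow> nosw (\<tau> i) = ?\<sigma> i"
     "\<And>i u. i < M \<Longrightarrow> u \<in> keys i \<Longrightarrow> block_sum degree_count i (\<tau> i) u 0 = (\<Sum>j<M. degree_count j (?\<sigma> j) u 0)" by blast
  let ?A = "\<lambda>i. ?\<sigma> i \<union> (\<lambda>u. NW u (degree E u) 0) ` keys i"
  have A: "finite (?A j) \<and> card (?A j) \<le> 3 * Q \<and> ?A j \<subseteq> bwords X \<and> nosw (?A j) = ?A j" if j: "j < M" for j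
  proof -
    have "card ((\<lambda>u. NW u (degree E u) 0) ` keys j) \<le> Q" using card_image_le[OF fin_keys] card_keys[OF j] by (rule order_trans)
    moreover have "(\<lambda>u. NW u (degree E u) 0) ` keys j \<subseteq> bwords X" using dX VX(1) keysV X by (auto simp: bwords_def)
    moreover have "nosw (?A j) = ?A j" using cfg_iff(6) by (auto simp: nosw_def)
    ultimately show ?thesis
      using cfg_bound[OF j s0 s0] fin_keys card_Un_le[of "?\<sigma> j" "(\<lambda>u. NW u (degree E u) 0) ` keys j"] by auto
  qed
  have st: "stat (?A j) = ?\<sigma> j" for j unfolding stat_cfg by (auto simp: stat_def)
  have pub: "reaches M X b [publish] \<tau> ?A"
  proof (rule reaches_instr)
    show "publish j (\<tau> j) = keep ?A j" if j: "j < M" for j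
    proof -
      have ns: "NS u y z \<in> \<tau> j \<longleftrightarrow> u \<in> keys j \<and> y = 0 \<and> z = 0" for u y z
        using \<tau>(2)[OF j] nosw_stat(4)[of u y z "\<tau> j"] by (simp add: cfg_iff)
      have "stat (\<tau> j) = ?\<sigma> j" using \<tau>(2)[OF j] nosw_stat(1)[of "\<tau> j"] stat_cfg[of "\<lambda>_. 0" "\<lambda>_. 0" j "{}"]
        by (simp add: stat_def)
      moreover have "{NW u (block_sum degree_count j (\<tau> j) u 0) 0 | u x f. NS u x f \<in> \<tau> j} = (\<lambda>u. NW u (degree E u) 0) ` keys j"
        unfolding ns using \<tau>(3)[OF j] keysV tot by (auto simp: image_iff)
      ultimately show ?thesis by (simp add: publish_def keep_def)
    qed
    show "flow_ok M X b (keep ?A)" by (rule flow_ok_mono[OF flow_ok_keep[of _ _ "3 * Q"]]) (use A b in auto)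
    show "deliver M (keep ?A) i = ?A i" if "i < M" for i by (rule deliver_keep[OF that])
  qed
  define y where "y j key e = (if e = 0 \<and> (\<exists>u\<in>keys j. degree E u = key) then 1 else 0 :: nat)" for j and key e :: nat
  have g2: "degree_occurs j (?A j) key e = y j key e" for j key e
    unfolding degree_occurs_def y_def using cfg_iff(5) by (auto simp: image_iff)
  have "scan_setting F h M X b D (3 * Q) degree_occurs ?A y"
  proof
    show "key < X \<and> e < D" if "j < M" "0 < y j key e" for j key e
      using that dX keysV D by (auto simp: y_def split: if_splits)
    show "ysum y {..<M} key e < X" for key e
    proof -
      have "ysum y {..<M} key e \<le> (\<Sum>j<M. 1)" unfolding ysum_def y_def by (intro sum_mono) auto
      then show ?thesis using MX by simp
    qed
  qed (use F M X b A g2 in auto)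
  from scan_setting.scan_correct[OF this] obtain \<rho> where all: "reaches M X b (scan F h degree_occurs) ?A \<rho> \<and> (\<forall>i<M. nosw (\<rho> i) = ?A i
     \<and> rd 0 (\<rho> i) = runs (\<le>) y {..<M} \<and> rd 1 (\<rho> i) = runs (\<ge>) y {..<M}
     \<and> rd 2 (\<rho> i) = runs (\<ge>) y {..<i} \<and> rd 3 (\<rho> i) = runs (\<le>) y {i<..<M})" ..
  then have \<rho>: "reaches M X b (scan F h degree_occurs) ?A \<rho>"
    and n: "\<And>i. i < M \<Longrightarrow> nosw (\<rho> i) = ?A i" and r1: "\<And>i. i < M \<Longrightarrow> rd 1 (\<rho> i) = runs (\<ge>) y {..<M}" by simp_all
  have pos: "ysum y {..<M} key e > 0 \<longleftrightarrow> e = 0 \<and> key \<in> degree E ` V" for key e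
  proof -
    have "ysum y {..<M} key e > 0 \<longleftrightarrow> (\<exists>j<M. y j key e > 0)" using ysum_pos[of "{..<M}" y key e] by auto
    also have "\<dots> \<longleftrightarrow> e = 0 \<and> (\<exists>j<M. \<exists>u\<in>keys j. degree E u = key)" by (auto simp: y_def)
    also have "(\<exists>j<M. \<exists>u\<in>keys j. degree E u = key) \<longleftrightarrow> key \<in> degree E ` V"
    proof
      assume "key \<in> degree E ` V"
      then obtain u where u: "u \<in> V" "degree E u = key" by auto
      then have "L u \<noteq> {}" using L[OF u(1)] by auto
      then obtain c where "c \<in> L u" by blast
      then show "\<exists>j<M. \<exists>u\<in>keys j. degree E u = key" using u lL[OF u(1)] by (auto simp: keys_def)
    qed (auto simp: keys_def)
    finally show ?thesis .
  qed
  have md: "max_degree V E = Max (degree E ` V)"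
    unfolding max_degree_def using V finV by (subst Max_insert) auto
  have md_in: "max_degree V E \<in> degree E ` V" unfolding md using V finV by (intro Max_in) auto
  have pmax: "0 < ysum y {..<M} (max_degree V E) 0" using pos[of "max_degree V E" 0] md_in by simp
  have "top_key (\<rho> i) = max_degree V E" if "i < M" for i
    unfolding top_key_def r1[OF that]
  proof (rule the_equality)
    have "(max_degree V E, 0, ysum y {..<M} (max_degree V E) 0) \<in> runs (\<ge>) y {..<M}"
      unfolding runs_def mem_Collect_eq prod.case
    proof (intro conjI allI impI refl)
      show "0 < ysum y {..<M} (max_degree V E) 0" by (rule pmax)
      fix k' x' assume "0 < ysum y {..<M} k' x'"
      then have "k' \<in> degree E ` V" using pos[of k' x'] by simp
      then show "max_degree V E \<ge> k'" using degree_le_max by blast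
    qed
    then show "\<exists>x v. (max_degree V E, x, v) \<in> runs (\<ge>) y {..<M}" by blast
    show "key = max_degree V E" if ex: "\<exists>x v. (key, x, v) \<in> runs (\<ge>) y {..<M}" for key
    proof -
      obtain x v where xv: "(key, x, v) \<in> runs (\<ge>) y {..<M}" using ex by blast
      have x: "ysum y {..<M} key x > 0" using xv unfolding runs_def mem_Collect_eq prod.case by simp
      have x2: "\<forall>k' x'. ysum y {..<M} k' x' > 0 \<longrightarrow> key \<ge> k'"
        using xv unfolding runs_def mem_Collect_eq prod.case by (elim conjE)
      have "max_degree V E \<le> key" using x2[rule_format, OF pmax] .
      moreover have "key \<in> degree E ` V" using x pos[of key x] by simp
      then have "key \<le> max_degree V E" using degree_le_max by blast
      ultimately show ?thesis by simp
    qed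
  qed
  moreover have "reaches M X b [forget] \<rho> ?\<sigma>"
  proof (rule reaches_instr)
    show "forget j (\<rho> j) = keep ?\<sigma> j" if "j < M" for j
      using n[OF that] nosw_stat(1)[of "\<rho> j"] st[of j] by (simp add: forget_def keep_def)
    show "flow_ok M X b (keep ?\<sigma>)" by (rule flow_ok_mono[OF flow_ok_keep[of _ _ "2 * Q"]]) (use cfg_bound[OF _ s0 s0] b in auto)
    show "deliver M (keep ?\<sigma>) i = ?\<sigma> i" if "i < M" for i by (rule deliver_keep[OF that])
  qed
  moreover have "reaches M X b (scan F h degree_count @ publish # scan F h degree_occurs) ?\<sigma> \<rho>"
    by (rule reaches_append[OF \<tau>(1) reaches_Cons[OF pub \<rho>]])
  ultimately show ?thesis by blast
qed

end

text \<open>Gives every edge and every list entry a unique machine, so that the machines chosen by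
  \<open>own\<close> and \<open>list_own\<close> are those that really hold the items.\<close>

lemma placed_once:
  assumes "distinct (map f (concat (map inp [0..<M])))" "i < M" "j < M"
    "x \<in> set (inp i)" "y \<in> set (inp j)" "f x = f y"
  shows "i = j \<and> x = y"
  using assms
proof (induction M arbitrary: i j x y)
  case (Suc M)
  have d: "distinct (map f (concat (map inp [0..<M])))" "inj_on f (set (inp M))"
    "f ` (\<Union>i<M. set (inp i)) \<inter> f ` set (inp M) = {}"
    using Suc.prems(1) by (auto simp: distinct_map atLeast0LessThan)
  consider "i < M" "j < M" | "i = M" "j = M" | "i < M" "j = M" | "i = M" "j < M" using Suc.prems by linarith
  then show ?case
  proof cases
    case 1
    then show ?thesis using Suc.IH[OF d(1)] Suc.prems by blast
  next
    case 2
    then show ?thesis using d(2) Suc.prems by (auto dest: inj_onD)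
  next
    case 3
    then have "f x \<in> f ` (\<Union>i<M. set (inp i))" "f x \<in> f ` set (inp M)" using Suc.prems(4-6) by (blast, metis imageI)
    then show ?thesis using d(3) by blast
  next
    case 4
    then have "f x \<in> f ` (\<Union>i<M. set (inp i))" "f x \<in> f ` set (inp M)" using Suc.prems(4-6) by (metis UN_I imageI lessThan_iff, blast)
    then show ?thesis using d(3) by blast
  qed
qed simp

lemma length_initial_memory: "length (initial_memory inp i) = 3 * length (inp i)"
proof -
  have "length (concat (map item_words its)) = 3 * length its" for its
  proof (induction its)
    case (Cons a its)
    then show ?case by (cases a) auto
  qed simp
  then show ?thesis by (simp add: initial_memory_def)
qed

lemma numbering:
  assumes "finite T" shows "inj_on (numbering T) T" "numbering T ` T \<subseteq> {..<card T}"
proof -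
  obtain f where "bij_betw f T {0..<card T}" using ex_bij_betw_finite_nat[OF assms] by blast
  then have "\<exists>f. inj_on f T \<and> f ` T \<subseteq> {..<card T}" by (auto simp: bij_betw_def atLeast0LessThan)
  from someI_ex[OF this] show "inj_on (numbering T) T" "numbering T ` T \<subseteq> {..<card T}"
    unfolding numbering_def by auto
qed

text \<open>An input item takes three words and an edge becomes two tokens, so a machine starts with
  at most \<open>2 * (S div 3)\<close> tokens, which \<open>A\<close> bounds. In total there are
  \<open>2 * card E + card V\<close> list entries and \<open>2 * card E\<close> half edges, hence
  the requirement on \<open>M * Q\<close>.\<close>

locale input_setting = coloring_instance V E L C
  for V E L C +
  fixes M Q F h D r k q X b A J S :: nat and inp :: "nat \<Rightarrow> item list"
  assumes inp: "input_placement V E L M S inp"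
    and F: "F > 0" and M: "M = F ^ h" and D: "D \<ge> 4" and Dr: "D ^ r = 2 ^ (4 * k)"
    and Cq: "C \<le> 2 ^ q"
    and X: "F < X" "D \<le> X" "D ^ r \<le> X" "20 \<le> X" "M < X" "C < X" "2 ^ q < X" "card V < X"
      "D ^ r * (2 * card E * 2 ^ k) < X" "4 * card E + card V < X" "M * Suc A < X"
    and VX: "u \<in> V \<Longrightarrow> u < X" "u \<in> V \<Longrightarrow> u < 2 ^ k"
    and Ek: "8 * q * card E \<le> 2 ^ k" "4 * card E \<le> 2 ^ k"
    and b: "Suc (4 * Q) + 2 * D + 3 * F * D \<le> b" "A + 2 * D + 3 * F * D \<le> b" "Q + A \<le> b"
    and Q: "Q > 0" "Q \<le> A" "4 * card E + card V \<le> M * Q"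
    and A: "2 * (S div 3) \<le> A"
    and J: "J > 0" "u \<in> V \<Longrightarrow> u < D ^ J"
begin

section \<open>The input as a set of tokens\<close>

definition "raw i = item_word ` set (inp i)"

definition "own e = (SOME i. i < M \<and> (\<exists>it\<in>set (inp i). item_content it = Inl e))"
definition "list_own u c = (SOME i. i < M \<and> ListItem u c \<in> set (inp i))"

definition list_toks :: "token set" where "list_toks = (\<lambda>(u, c). (0, u, c, 0)) ` Sigma V L"
definition half_toks :: "token set" where "half_toks = (\<lambda>(u, v). (1, u, v, own {u, v})) ` half_edges"
definition "G = list_toks \<union> half_toks"

definition "mach0 \<tau> = (case \<tau> of (\<kappa>, u, x, m) \<Rightarrow> if \<kappa> = (0::nat) then list_own u x else m)"

lemma content:
  "distinct (map item_content (concat (map inp [0..<M])))"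
  "(\<Union>i<M. item_content ` set (inp i)) = E <+> Sigma V L"
  "i < M \<Longrightarrow> length (initial_memory inp i) \<le> S"
  using inp unfolding input_placement_def Let_def by (auto simp: image_UN atLeast0LessThan)

lemma item_in: "i < M \<Longrightarrow> it \<in> set (inp i) \<Longrightarrow> item_content it \<in> E <+> Sigma V L"
  using content(2) by blast

lemma own: "e \<in> E \<Longrightarrow> own e < M \<and> (\<exists>it\<in>set (inp (own e)). item_content it = Inl e)"
proof -
  assume "e \<in> E"
  then have "Inl e \<in> (\<Union>i<M. item_content ` set (inp i))" unfolding content(2) by blast
  then have "\<exists>i. i < M \<and> (\<exists>it\<in>set (inp i). item_content it = Inl e)" by force
  from someI_ex[OF this] show ?thesis unfolding own_def .
qed

lemma list_own: "u \<in> V \<Longrightarrow> c \<in> L u \<Longrightarrow> list_own u c < M \<and> ListItem u c \<in> set (inp (list_own u c))"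
proof -
  assume "u \<in> V" "c \<in> L u"
  then have "Inr (u, c) \<in> (\<Union>i<M. item_content ` set (inp i))" unfolding content(2) by blast
  then obtain i it where "i < M" "it \<in> set (inp i)" "item_content it = Inr (u, c)" by force
  then have "\<exists>i. i < M \<and> ListItem u c \<in> set (inp i)" by (cases it) auto
  from someI_ex[OF this] show ?thesis unfolding list_own_def .
qed

lemma edge_item: "i < M \<Longrightarrow> EdgeItem u v \<in> set (inp i) \<Longrightarrow> {u, v} \<in> E \<and> own {u, v} = i"
proof -
  assume a: "i < M" "EdgeItem u v \<in> set (inp i)"
  then have e: "{u, v} \<in> E" using item_in[OF a] by auto
  obtain it where it: "own {u, v} < M" "it \<in> set (inp (own {u, v}))" "item_content it = Inl {u, v}" using own[OF e] by blast
  have "i = own {u, v}" using placed_once[OF content(1) a(1) it(1) a(2) it(2)] it(3) by simp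
  then show ?thesis using e by simp
qed

lemma list_item: "i < M \<Longrightarrow> ListItem u c \<in> set (inp i) \<Longrightarrow> u \<in> V \<and> c \<in> L u \<and> list_own u c = i"
proof -
  assume a: "i < M" "ListItem u c \<in> set (inp i)"
  then have e: "u \<in> V" "c \<in> L u" using item_in[OF a] by auto
  have l: "list_own u c < M" "ListItem u c \<in> set (inp (list_own u c))" using list_own[OF e] by auto
  have "i = list_own u c" using placed_once[OF content(1) a(1) l(1) a(2) l(2)] by simp
  then show ?thesis using e by simp
qed

lemma half_own: "(u, v) \<in> half_edges \<Longrightarrow> own {u, v} < M"
  using own[of "{u, v}"] by (auto simp: half_edges_def nb_def)

lemma toks_raw:
  assumes i: "i < M" shows "toks_of i (raw i) = {\<tau> \<in> G. mach0 \<tau> = i}"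
proof -
  have il: "IL u c \<in> raw i \<longleftrightarrow> ListItem u c \<in> set (inp i)" for u c
  proof
    assume "IL u c \<in> raw i"
    then obtain it where it: "it \<in> set (inp i)" "item_word it = IL u c" unfolding raw_def by fastforce
    have "it = ListItem u c" using it(2) by (cases it) simp_all
    then show "ListItem u c \<in> set (inp i)" using it by simp
  qed (force simp: raw_def)
  have ie: "IE u c \<in> raw i \<longleftrightarrow> EdgeItem u c \<in> set (inp i)" for u c
  proof
    assume "IE u c \<in> raw i"
    then obtain it where it: "it \<in> set (inp i)" "item_word it = IE u c" unfolding raw_def by fastforce
    have "it = EdgeItem u c" using it(2) by (cases it) simp_all
    then show "EdgeItem u c \<in> set (inp i)" using it by simp
  qed (force simp: raw_def)
  have l: "ListItem u c \<in> set (inp i) \<longleftrightarrow> u \<in> V \<and> c \<in> L u \<and> list_own u c = i" for u c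
    using list_item[OF i] list_own by blast
  have e: "EdgeItem u v \<in> set (inp i) \<or> EdgeItem v u \<in> set (inp i) \<longleftrightarrow> (u, v) \<in> half_edges \<and> own {u, v} = i" for u v
  proof
    assume "EdgeItem u v \<in> set (inp i) \<or> EdgeItem v u \<in> set (inp i)"
    then have "{u, v} \<in> E \<and> own {u, v} = i" using edge_item[OF i, of u v] edge_item[OF i, of v u] by (auto simp: insert_commute)
    moreover from this have "u \<in> V" using edge by blast
    ultimately show "(u, v) \<in> half_edges \<and> own {u, v} = i" by (simp add: half_edges_def nb_def)
  next
    assume a: "(u, v) \<in> half_edges \<and> own {u, v} = i"
    then have "{u, v} \<in> E" by (simp add: half_edges_def nb_def)
    then obtain it where it: "it \<in> set (inp i)" "item_content it = Inl {u, v}" using own a by blast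
    have "it = EdgeItem u v \<or> it = EdgeItem v u" using it(2) by (cases it) (auto simp: doubleton_eq_iff)
    then show "EdgeItem u v \<in> set (inp i) \<or> EdgeItem v u \<in> set (inp i)" using it(1) by blast
  qed
  have "toks_of i (raw i) = {(0, u, c, 0) | u c. u \<in> V \<and> c \<in> L u \<and> list_own u c = i} \<union>
     {(1, u, v, i) | u v. EdgeItem u v \<in> set (inp i) \<or> EdgeItem v u \<in> set (inp i)}"
    unfolding toks_of_def il ie l by blast
  also have "\<dots> = {\<tau> \<in> G. mach0 \<tau> = i}"
    unfolding e by (auto simp: G_def list_toks_def half_toks_def mach0_def image_iff)
  finally show ?thesis .
qed

lemma finG: "finite G"
  unfolding G_def list_toks_def half_toks_def using fin_half finV finL by auto

lemma card_G: "card G \<le> 4 * card E + card V"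
proof -
  have "card G \<le> card list_toks + card half_toks" unfolding G_def by (rule card_Un_le)
  also have "card list_toks \<le> card (Sigma V L)" unfolding list_toks_def using finV finL by (intro card_image_le) auto
  also have "card half_toks \<le> card half_edges" unfolding half_toks_def by (rule card_image_le[OF fin_half])
  also have "card (Sigma V L) = 2 * card E + card V" using finV finL sum_card_list by simp
  finally show ?thesis using card_half by simp
qed

lemma card_machine: "i < M \<Longrightarrow> card {\<tau> \<in> G. mach0 \<tau> = i} \<le> A"
proof -
  assume i: "i < M"
  define f :: "item \<Rightarrow> token set" where
    "f it = (case it of EdgeItem u v \<Rightarrow> {(1, u, v, i), (1, v, u, i)} | ListItem u c \<Rightarrow> {(0, u, c, 0)})" for it
  have "toks_of i (raw i) \<subseteq> (\<Union>it\<in>set (inp i). f it)"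
  proof
    fix t assume "t \<in> toks_of i (raw i)"
    then consider u c where "t = (0, u, c, 0)" "IL u c \<in> raw i" | u v where "t = (1, u, v, i) \<or> t = (1, v, u, i)" "IE u v \<in> raw i"
      unfolding toks_of_def by blast
    then show "t \<in> (\<Union>it\<in>set (inp i). f it)"
    proof cases
      case 1
      then obtain it where "it \<in> set (inp i)" "item_word it = IL u c" by (auto simp: raw_def)
      then show ?thesis using 1 by (intro UN_I[of it]) (cases it; auto simp: f_def)+
    next
      case 2
      then obtain it where "it \<in> set (inp i)" "item_word it = IE u v" by (auto simp: raw_def)
      then show ?thesis using 2 by (intro UN_I[of it]) (cases it; auto simp: f_def)+
    qed
  qed
  moreover have f2: "finite (f it) \<and> card (f it) \<le> 2" for it
  proof -
    have "finite {a, b} \<and> card {a, b} \<le> 2" "finite {a} \<and> card {a} \<le> 2" for a b :: token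
      using card_insert_le_m1[of 2 "{b}" a] by simp_all
    then show ?thesis by (cases it) (simp_all only: f_def item.case)
  qed
  ultimately have "card (toks_of i (raw i)) \<le> card (\<Union>it\<in>set (inp i). f it)" by (intro card_mono) auto
  also have "\<dots> \<le> (\<Sum>it\<in>set (inp i). card (f it))" by (rule card_UN_le) simp
  also have "\<dots> \<le> (\<Sum>it\<in>set (inp i). 2)" using f2 by (intro sum_mono) auto
  also have "\<dots> \<le> 2 * length (inp i)" using card_length[of "inp i"] by simp
  also have "\<dots> \<le> 2 * (S div 3)" using content(3)[OF i] length_initial_memory[of inp i] by simp
  finally show ?thesis using A toks_raw[OF i] by simp
qed

lemma G_cases:
  assumes "\<tau> \<in> G"
  obtains u c where "\<tau> = (0, u, c, 0)" "u \<in> V" "c \<in> L u" | u v where "\<tau> = (1, u, v, own {u, v})" "(u, v) \<in> half_edges"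
  using assms unfolding G_def list_toks_def half_toks_def by auto

lemma mach0_less: "\<tau> \<in> G \<Longrightarrow> mach0 \<tau> < M"
  by (elim G_cases) (auto simp: mach0_def list_own half_own)

lemma cX: "u \<in> V \<Longrightarrow> c \<in> L u \<Longrightarrow> c < X"
  using L X(6) by (meson lessThan_iff less_trans subsetD)

sublocale srt: radix G M Q F h D X b A
proof
  show "tok_word p \<tau> \<in> bwords X" if "\<tau> \<in> G" "p < X" for \<tau> p
    using that(1)
  proof (cases rule: G_cases)
    case (1 u c)
    then have "u < X" "c < X" using VX(1) cX by blast+
    then show ?thesis using 1 that(2) X by (simp add: tok_word_def bwords_def)
  next
    case (2 u v)
    then have "u \<in> V" "v \<in> V" using nbD by (auto simp: half_edges_def)
    then have "u < X" "v < X" "own {u, v} < X" using VX(1) half_own[OF 2(2)] X by auto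
    then show ?thesis using 2 that(2) X by (simp add: tok_word_def bwords_def)
  qed
qed (use finG card_G Q F M D X b in auto)

definition "pos0 \<tau> = mach0 \<tau> * Suc A + numbering {\<tau>' \<in> G. mach0 \<tau>' = mach0 \<tau>} \<tau>"

lemma arranged0: "srt.arranged pos0 mach0"
proof -
  let ?T = "\<lambda>i. {\<tau>' \<in> G. mach0 \<tau>' = i}"
  have num: "numbering (?T (mach0 \<tau>)) \<tau> < Suc A" if "\<tau> \<in> G" for \<tau>
    using numbering(2)[of "?T (mach0 \<tau>)"] card_machine[OF mach0_less[OF that]] that finG by fastforce
  have dv: "pos0 \<tau> div Suc A = mach0 \<tau>" if "\<tau> \<in> G" for \<tau>
  proof -
    have "(m * c + n) div c = m" if "n < c" for m n c :: nat using that by simp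
    then show ?thesis unfolding pos0_def using num[OF that] by blast
  qed
  show ?thesis unfolding srt.arranged_def
  proof (intro conjI ballI allI impI inj_onI)
    fix \<tau> \<tau>' assume \<tau>: "\<tau> \<in> G" "\<tau>' \<in> G" and eq: "pos0 \<tau> = pos0 \<tau>'"
    have m: "mach0 \<tau> = mach0 \<tau>'" using dv \<tau> eq by metis
    then have "numbering (?T (mach0 \<tau>)) \<tau> = numbering (?T (mach0 \<tau>)) \<tau>'" using eq by (simp add: pos0_def)
    moreover have "finite (?T (mach0 \<tau>))" using finG by simp
    moreover have "\<tau> \<in> ?T (mach0 \<tau>)" "\<tau>' \<in> ?T (mach0 \<tau>)" using \<tau> m by auto
    ultimately show "\<tau> = \<tau>'" using numbering(1)[of "?T (mach0 \<tau>)"] by (meson inj_onD)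
  next
    fix \<tau> assume \<tau>: "\<tau> \<in> G"
    show "mach0 \<tau> < M" by (rule mach0_less[OF \<tau>])
    have "pos0 \<tau> < (mach0 \<tau> + 1) * Suc A" using num[OF \<tau>] by (simp add: pos0_def)
    also have "\<dots> \<le> M * Suc A" using mach0_less[OF \<tau>] by (intro mult_le_mono1) simp
    finally show "pos0 \<tau> < X" using X(11) by linarith
  next
    fix \<tau> \<tau>' assume \<tau>: "\<tau> \<in> G" "\<tau>' \<in> G" and less: "mach0 \<tau> < mach0 \<tau>'"
    show "pos0 \<tau> < pos0 \<tau>'"
    proof (rule ccontr)
      assume "\<not> pos0 \<tau> < pos0 \<tau>'"
      then have "pos0 \<tau>' div Suc A \<le> pos0 \<tau> div Suc A" by (intro div_le_mono) simp
      then show False using dv \<tau> less by simp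
    qed
  qed (use card_machine in auto)
qed

lemma raw_bwords: "i < M \<Longrightarrow> raw i \<subseteq> bwords X"
proof
  fix a assume i: "i < M" and "a \<in> raw i"
  then obtain it where it: "it \<in> set (inp i)" "a = item_word it" by (auto simp: raw_def)
  show "a \<in> bwords X"
  proof (cases it)
    case (EdgeItem u v)
    then have "{u, v} \<in> E" using edge_item[OF i] it by blast
    then have "u \<in> V" "v \<in> V" using edge by blast+
    then show ?thesis using it EdgeItem VX(1) X by (simp add: bwords_def)
  next
    case (ListItem u c)
    then have "u \<in> V" "c \<in> L u" using list_item[OF i] it by blast+
    then show ?thesis using it ListItem VX(1) cX X by (simp add: bwords_def)
  qed
qed

lemma enter_correct: "reaches M X b [enter (Suc A)] raw (srt.cfgt pos0 mach0)"
proof (rule reaches_instr)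
  show "enter (Suc A) j (raw j) = keep (srt.cfgt pos0 mach0) j" if "j < M" for j
  proof -
    have "(\<lambda>\<tau>. tok_word (j * Suc A + numbering {\<tau> \<in> G. mach0 \<tau> = j} \<tau>) \<tau>) ` {\<tau> \<in> G. mach0 \<tau> = j} = srt.cfgt pos0 mach0 j"
      unfolding srt.cfgt_def by (rule image_cong) (auto simp: pos0_def)
    then show ?thesis unfolding enter_def toks_raw[OF that] keep_def by simp
  qed
  show "flow_ok M X b (keep (srt.cfgt pos0 mach0))"
    by (rule flow_ok_mono[OF flow_ok_keep[of _ _ A]]) (use srt.cfgt_bound[OF arranged0] b in auto)
  show "deliver M (keep (srt.cfgt pos0 mach0)) i = srt.cfgt pos0 mach0 i" if "i < M" for i by (rule deliver_keep[OF that])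
qed

end

section \<open>From sorted tokens to the layout and the maximum degree\<close>

context input_setting
begin

lemma layout_of_sort:
  assumes arr: "srt.arranged pos mach" and sorted: "srt.sorted_upto J pos"
    and ld: "\<And>i. card {\<tau> \<in> G. mach \<tau> = i} \<le> Q"
  shows "layout V E L C (\<lambda>u c. mach (0, u, c, 0)) (\<lambda>u v. mach (1, u, v, own {u, v})) M Q F h D r k q X b"
proof
  let ?lL = "\<lambda>u c. mach (0, u, c, 0)" and ?lH = "\<lambda>u v. mach (1, u, v, own {u, v})"
  have inL: "(0, u, c, 0) \<in> G" if "u \<in> V" "c \<in> L u" for u c
    using that by (auto simp: G_def list_toks_def)
  have inH: "(1, u, v, own {u, v}) \<in> G" if "(u, v) \<in> half_edges" for u v
    using that by (auto simp: G_def half_toks_def)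
  have less: "\<tau> \<in> G \<Longrightarrow> mach \<tau> < M" for \<tau> using arr by (simp add: srt.arranged_def)
  show "?lL u c < M" if "u \<in> V" "c \<in> L u" for u c by (rule less[OF inL[OF that]])
  show "?lH u v < M" if "(u, v) \<in> half_edges" for u v by (rule less[OF inH[OF that]])
  show "card {(u, c) \<in> Sigma V L. ?lL u c = i} + card {(u, v) \<in> half_edges. ?lH u v = i} \<le> Q" for i
  proof -
    let ?f = "\<lambda>(u, c). (0, u, c, 0) :: token" and ?g = "\<lambda>(u, v). (1, u, v, own {u, v}) :: token"
    let ?S = "{(u, c) \<in> Sigma V L. ?lL u c = i}" and ?H = "{(u, v) \<in> half_edges. ?lH u v = i}"
    have "card ?S = card (?f ` ?S)" "card ?H = card (?g ` ?H)"
      by (auto intro!: card_image[symmetric] inj_onI)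
    moreover have "finite (?f ` ?S)" "finite (?g ` ?H)"
      using finV finL fin_half by (auto intro!: finite_imageI intro: rev_finite_subset[of "Sigma V L"] rev_finite_subset[of half_edges])
    moreover have "?f ` ?S \<inter> ?g ` ?H = {}" by auto
    ultimately have "card ?S + card ?H = card (?f ` ?S \<union> ?g ` ?H)" by (simp add: card_Un_disjoint)
    also have "\<dots> \<le> card {\<tau> \<in> G. mach \<tau> = i}"
      using inL inH finG by (intro card_mono) auto
    finally show ?thesis using ld[of i] by simp
  qed
  fix i j u v
  assume ij: "i < j" and uv: "u \<in> V" "v \<in> V" "(\<exists>c\<in>L u. ?lL u c = i) \<or> (\<exists>w\<in>nb u. ?lH u w = i)"
    "(\<exists>c\<in>L v. ?lL v c = j) \<or> (\<exists>w\<in>nb v. ?lH v w = j)"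
  have tk: "\<exists>\<tau>\<in>G. tok_node \<tau> = u \<and> mach \<tau> = i" if u: "u \<in> V" and e: "(\<exists>c\<in>L u. ?lL u c = i) \<or> (\<exists>w\<in>nb u. ?lH u w = i)" for u i
    using e
  proof
    assume "\<exists>c\<in>L u. ?lL u c = i"
    then obtain c where "c \<in> L u" "?lL u c = i" by blast
    then show ?thesis using inL[OF u] by (intro bexI[of _ "(0, u, c, 0)"]) (auto simp: tok_node_def)
  next
    assume "\<exists>w\<in>nb u. ?lH u w = i"
    then obtain w where "w \<in> nb u" "?lH u w = i" by blast
    then show ?thesis using inH[of u w] u by (intro bexI[of _ "(1, u, w, own {u, w})"]) (auto simp: tok_node_def half_edges_def)
  qed
  obtain \<tau> \<tau>' where t: "\<tau> \<in> G" "tok_node \<tau> = u" "mach \<tau> = i" "\<tau>' \<in> G" "tok_node \<tau>' = v" "mach \<tau>' = j"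
    using tk[OF uv(1,3)] tk[OF uv(2,4)] by blast
  show "u \<le> v"
  proof (rule ccontr)
    assume "\<not> u \<le> v"
    \<comment> \<open>Identifiers have at most \<open>J\<close> digits in base \<open>D\<close>, so
      after \<open>J\<close> passes the order by residues is the order by identifiers.\<close>
    moreover have "u mod D ^ J = u" "v mod D ^ J = v" using J(2) uv by auto
    ultimately have "pos \<tau>' < pos \<tau>" using sorted t unfolding srt.sorted_upto_def by auto
    moreover have "pos \<tau> < pos \<tau>'" using arr t ij unfolding srt.arranged_def by blast
    ultimately show False by simp
  qed
qed (use F M D Dr Cq X VX Ek b in auto)

theorem setup_correct:
  assumes V: "V \<noteq> {}"
  obtains lL lH \<tau> where "layout V E L C lL lH M Q F h D r k q X b"
    "reaches M X b (setup_prog F h Q D J (Suc A)) raw \<tau>"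
    "\<And>i. i < M \<Longrightarrow> top_key (\<tau> i) = max_degree V E"
    "reaches M X b [forget] \<tau> (layout.cfg V E L lL lH (\<lambda>_. 0) (\<lambda>_. 0))"
proof -
  obtain pos mach where s: "reaches M X b (concat (map (radix_pass F h Q D) [0..<J])) (srt.cfgt pos0 mach0) (srt.cfgt pos mach)"
    "srt.arranged pos mach" "srt.sorted_upto J pos" and ld: "\<And>i. card {\<tau> \<in> G. mach \<tau> = i} \<le> Q"
    using srt.sort_correct[OF arranged0, of J] J(1) by auto
  define lL where "lL = (\<lambda>u c. mach (0, u, c, 0))"
  define lH where "lH = (\<lambda>u v. mach (1, u, v, own {u, v}))"
  have lay: "layout V E L C lL lH M Q F h D r k q X b"
    unfolding lL_def lH_def by (rule layout_of_sort[OF s(2,3) ld])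
  interpret lay: layout V E L C lL lH M Q F h D r k q X b by (rule lay)
  define lists where "lists i = (\<lambda>(u, c). LI u c) ` {(u, c) \<in> Sigma V L. lL u c = i}" for i
  define met where "met i = (\<lambda>(u, v). Rv u v (lH u v)) ` {(u, v) \<in> half_edges. own {u, v} = i}" for i
  have own_le: "card {t \<in> half_edges. (\<lambda>(u, v). own {u, v}) t = i} \<le> A" if "i < M" for i
  proof -
    let ?H = "{t \<in> half_edges. (\<lambda>(u, v). own {u, v}) t = i}"
    let ?g = "\<lambda>(u, v). (1, u, v, own {u, v}) :: token"
    have "card ?H = card (?g ` ?H)" by (auto intro!: card_image[symmetric] inj_onI)
    also have "\<dots> \<le> card {\<tau> \<in> G. mach0 \<tau> = i}"
      using finG by (intro card_mono) (auto simp: G_def half_toks_def mach0_def)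
    finally show ?thesis using card_machine[OF that] by simp
  qed
  have hes_le: "card {t \<in> half_edges. (\<lambda>(u, v). lH u v) t = i} \<le> Q" if "i < M" for i
    using lay.card_hes[OF that] by (simp add: lay.hes_def case_prod_unfold)
  have hes_le': "card {t \<in> half_edges. (\<lambda>(u, v). lH u v) t = i} \<le> A" if "i < M" for i
    using hes_le[OF that] Q(2) by simp
  have list_ok: "finite (lists j) \<and> card (lists j) \<le> Q \<and> lists j \<subseteq> bwords X" if "j < M" for j
  proof -
    have "lists j \<subseteq> lay.static j" by (auto simp: lists_def lay.static_def)
    then show ?thesis using lay.static_bound[OF that] card_mono[of "lay.static j" "lists j"] finite_subset by fastforce
  qed
  have tk0: "Tk p 0 u c m \<in> srt.cfgt pos mach j \<longleftrightarrow> u \<in> V \<and> c \<in> L u \<and> m = 0 \<and> lL u c = j \<and> p = pos (0, u, c, 0)" for p u c m j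
    using srt.tok_cfgt[of p "(0, u, c, m)" pos mach j] by (auto simp: tok_word_def G_def list_toks_def half_toks_def lL_def)
  have tk1: "Tk p 1 u v m \<in> srt.cfgt pos mach j \<longleftrightarrow> (u, v) \<in> half_edges \<and> m = own {u, v} \<and> lH u v = j \<and> p = pos (1, u, v, own {u, v})" for p u v m j
    using srt.tok_cfgt[of p "(1, u, v, m)" pos mach j] by (auto simp: tok_word_def G_def list_toks_def half_toks_def lH_def)
  have r1: "reaches M X b [rendezvous] (srt.cfgt pos mach) (\<lambda>i. lists i \<union> met i)"
  proof (rule reaches_instr)
    let ?t = "toks half_edges (\<lambda>(u, v). lH u v) (\<lambda>(u, v). own {u, v}) (\<lambda>(u, v). Rv u v (lH u v))"
    show "rendezvous j (srt.cfgt pos mach j) = keep lists j \<union> ?t j" for j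
    proof -
      have "{(j, LI u c) | u c. \<exists>p m. Tk p 0 u c m \<in> srt.cfgt pos mach j} = keep lists j"
        unfolding tk0 keep_def lists_def by auto
      moreover have "{(m, Rv u v j) | u v m. \<exists>p. Tk p 1 u v m \<in> srt.cfgt pos mach j} = ?t j"
        unfolding tk1 toks_def by (auto simp: image_iff)
      ultimately show ?thesis unfolding rendezvous_def by simp
    qed
    have "flow_ok M X A ?t"
    proof (rule flow_ok_toks[OF fin_half hes_le' own_le])
      show "(case t of (u, v) \<Rightarrow> Rv u v (lH u v)) \<in> bwords X" if "t \<in> half_edges" for t
      proof -
        obtain u v where t: "t = (u, v)" by (cases t)
        then have "u \<in> V" "v \<in> V" "lH u v < M" using that lay.heV lay.lH by auto
        then show ?thesis using t VX(1) X by (simp add: bwords_def)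
      qed
    qed
    then show "flow_ok M X b (\<lambda>j. keep lists j \<union> ?t j)"
      by (intro flow_ok_mono[OF flow_ok_Un[OF flow_ok_keep[of _ _ Q]]]) (use list_ok b in auto)
    show "deliver M (\<lambda>j. keep lists j \<union> ?t j) i = lists i \<union> met i" if i: "i < M" for i
    proof -
      have "deliver M ?t i = (\<lambda>(u, v). Rv u v (lH u v)) ` {t \<in> half_edges. (case t of (u, v) \<Rightarrow> own {u, v}) = i}"
        by (rule deliver_toks) (use lay.lH in auto)
      then show ?thesis unfolding deliver_Un deliver_keep[OF i] met_def by (simp add: case_prod_unfold)
    qed
  qed
  have r2: "reaches M X b [connect] (\<lambda>i. lists i \<union> met i) lay.static"
  proof (rule reaches_instr)
    let ?t = "toks half_edges (\<lambda>(u, v). own {u, v}) (\<lambda>(u, v). lH u v) (\<lambda>(u, v). HE u v (lH v u))"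
    show "connect j (lists j \<union> met j) = keep lists j \<union> ?t j" for j
    proof -
      have "{LI u c | u c. LI u c \<in> lists j \<union> met j} = lists j" by (auto simp: lists_def met_def)
      moreover have rv: "Rv u v a \<in> lists j \<union> met j \<longleftrightarrow> (u, v) \<in> half_edges \<and> own {u, v} = j \<and> a = lH u v" for u v a
        by (auto simp: lists_def met_def)
      have "{(a, HE u v a') | u v a a'. Rv u v a \<in> lists j \<union> met j \<and> Rv v u a' \<in> lists j \<union> met j} = ?t j"
        unfolding rv toks_def using lay.heV by (auto simp: image_iff insert_commute)
      ultimately show ?thesis unfolding connect_def keep_def by simp
    qed
    have "flow_ok M X A ?t"
    proof (rule flow_ok_toks[OF fin_half own_le hes_le'])
      show "(case t of (u, v) \<Rightarrow> HE u v (lH v u)) \<in> bwords X" if "t \<in> half_edges" for t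
      proof -
        obtain u v where t: "t = (u, v)" by (cases t)
        then have "u \<in> V" "v \<in> V" "lH v u < M" using that lay.heV lay.lH by auto
        then show ?thesis using t VX(1) X by (simp add: bwords_def)
      qed
    qed
    then show "flow_ok M X b (\<lambda>j. keep lists j \<union> ?t j)"
      by (intro flow_ok_mono[OF flow_ok_Un[OF flow_ok_keep[of _ _ Q]]]) (use list_ok b in auto)
    show "deliver M (\<lambda>j. keep lists j \<union> ?t j) i = lay.static i" if i: "i < M" for i
    proof -
      have "deliver M ?t i = (\<lambda>(u, v). HE u v (lH v u)) ` {t \<in> half_edges. (case t of (u, v) \<Rightarrow> lH u v) = i}"
        by (rule deliver_toks) (use half_own in auto)
      then show ?thesis unfolding deliver_Un deliver_keep[OF i] lay.static_def lay.hes_def lists_def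
        by (simp add: case_prod_unfold)
    qed
  qed
  have s0: "lay.small (\<lambda>_. 0)" by (rule lay.s0_small)
  have r3: "reaches M X b [start] lay.static (lay.cfg (\<lambda>_. 0) (\<lambda>_. 0))"
  proof (rule reaches_instr)
    show "start j (lay.static j) = keep (lay.cfg (\<lambda>_. 0) (\<lambda>_. 0)) j" for j
    proof -
      have "(\<exists>c. LI u c \<in> lay.static j) \<or> (\<exists>v a. HE u v a \<in> lay.static j) \<longleftrightarrow> u \<in> lay.keys j" for u
        unfolding lay.static_iff by (auto simp: lay.keys_def lay.hes_def half_edges_def)
      then show ?thesis unfolding start_def keep_def lay.cfg_def by (simp add: setcompr_eq_image)
    qed
    show "flow_ok M X b (keep (lay.cfg (\<lambda>_. 0) (\<lambda>_. 0)))"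
      by (rule flow_ok_mono[OF flow_ok_keep[of _ _ "2 * Q"]]) (use lay.cfg_bound[OF _ s0 s0] b in auto)
    show "deliver M (keep (lay.cfg (\<lambda>_. 0) (\<lambda>_. 0))) i = lay.cfg (\<lambda>_. 0) (\<lambda>_. 0) i" if "i < M" for i
      by (rule deliver_keep[OF that])
  qed
  obtain \<tau> where \<tau>: "reaches M X b (scan F h degree_count @ publish # scan F h degree_occurs) (lay.cfg (\<lambda>_. 0) (\<lambda>_. 0)) \<tau>"
    "\<And>i. i < M \<Longrightarrow> top_key (\<tau> i) = max_degree V E" "reaches M X b [forget] \<tau> (lay.cfg (\<lambda>_. 0) (\<lambda>_. 0))"
    using lay.degree_correct[OF V X(5)] by blast
  have "reaches M X b (setup_prog F h Q D J (Suc A)) raw \<tau>"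
    unfolding setup_prog_def
    by (rule reaches_Cons[OF enter_correct reaches_append[OF s(1) reaches_append[OF reaches_Cons[OF r1 reaches_Cons[OF r2 r3]] \<tau>(1)]]])
  then show thesis using that lay \<tau>(2,3) by blast
qed

end

subsection \<open>The complete algorithm\<close>

text \<open>The binary logarithm rounded up, with value 0 at 0.\<close>

definition nlog :: "nat \<Rightarrow> nat" where
  "nlog x = (LEAST l. x \<le> 2 ^ l)"

lemma nlog: "x \<le> 2 ^ nlog x" and nlog_le: "x \<le> 2 ^ l \<Longrightarrow> nlog x \<le> l"
proof -
  have "x \<le> 2 ^ x" using less_exp[of x] by simp
  then show "x \<le> 2 ^ nlog x" unfolding nlog_def by (rule LeastI[of "\<lambda>l. x \<le> 2 ^ l"])
  show "x \<le> 2 ^ l \<Longrightarrow> nlog x \<le> l" unfolding nlog_def by (rule Least_le)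
qed

lemma nlog_less: "nlog x \<le> x"
  using nlog_le[of x x] less_exp[of x] by simp

text \<open>Five phases shrink the uncolored set by a factor below 1/4, so
  \<open>5 * nlog (d + 2)\<close> of them leave at most one node in
  \<open>(d + 2) * (d + 2)\<close>, as many as the move to single machines can handle. Beyond the
  threshold the \<open>N\<close> phases color everything.\<close>

definition phases :: "nat \<Rightarrow> nat \<Rightarrow> nat \<Rightarrow> nat" where
  "phases D N d = (if d \<le> D then 5 * nlog (d + 2) else N)"

definition main_prog :: "nat \<Rightarrow> nat \<Rightarrow> nat \<Rightarrow> nat \<Rightarrow> nat \<Rightarrow> nat \<Rightarrow> nat \<Rightarrow> nat \<Rightarrow> nat \<Rightarrow> instr list" where
  "main_prog F h D r k q Q N d = forget # concat (replicate (phases D N d) (bit_phase_prog F h D r k q)) @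
     (if d \<le> D then spread_prog F h (Q div ((d + 2) * (d + 2))) @ concat (replicate N (pick_phase_prog F h D r k)) else [])"

definition results :: "w set \<Rightarrow> (nat \<times> nat) set" where
  "results s = {(u, c) | u c x. NS u x (Suc c) \<in> s} \<union> {(u, c) | u c. BC u c \<in> s}"

lemma length_main_prog:
  "length (main_prog F h D r k q Q N d) \<le>
     1 + phases D N d * (q * (5 + h + r * (h + 2)) + (3 + h)) + (if d \<le> D then 2 * h + 5 + N * (r * (h + 2) + 3) else 0)"
  by (simp add: main_prog_def length_concat sum_list_replicate length_bit_phase_prog length_spread_prog length_pick_phase_prog)

text \<open>From \<open>3 ^ 5 * 4 \<le> 4 ^ 5\<close>, that is, 972 against 1024.\<close>

lemma shrink_quarter:
  fixes u n :: nat
  assumes "4 ^ (5 * l) * u \<le> 3 ^ (5 * l) * n" shows "4 ^ l * u \<le> n"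
proof -
  have "3 ^ (5 * l) * 4 ^ l \<le> (4 :: nat) ^ (5 * l)"
    unfolding power_mult power_mult_distrib[symmetric] by (rule power_mono) simp_all
  then have "3 ^ (5 * l) * 4 ^ l * u \<le> 4 ^ (5 * l) * u" by (rule mult_le_mono1)
  from order_trans[OF this assms] have "3 ^ (5 * l) * (4 ^ l * u) \<le> 3 ^ (5 * l) * n" by (simp only: mult.assoc)
  then show ?thesis by simp
qed

text \<open>From \<open>3 ^ 3 * 2 \<le> 4 ^ 3\<close>: three phases at least halve the set, and a
  size below 1 is 0.\<close>

lemma shrink_zero:
  fixes u n :: nat
  assumes "4 ^ (3 * l) * u \<le> 3 ^ (3 * l) * n" "n < 2 ^ l" shows "u = 0"
proof -
  have "3 ^ (3 * l) * 2 ^ l \<le> (4 :: nat) ^ (3 * l)"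
    unfolding power_mult power_mult_distrib[symmetric] by (rule power_mono) simp_all
  then have "3 ^ (3 * l) * 2 ^ l * u \<le> 4 ^ (3 * l) * u" by (rule mult_le_mono1)
  from order_trans[OF this assms(1)] have "3 ^ (3 * l) * (2 ^ l * u) \<le> 3 ^ (3 * l) * n" by (simp only: mult.assoc)
  then have "2 ^ l * u \<le> n" by simp
  then have "2 ^ l * u < 2 ^ l * 1" using assms(2) by linarith
  then show ?thesis unfolding mult_less_cancel1 by simp
qed

context layout
begin

lemma bit_phases:
  assumes "valid f"
  shows "\<exists>f'. reaches M X b (concat (replicate t (bit_phase_prog F h D r k q))) (cfg f (\<lambda>_. 0)) (cfg f' (\<lambda>_. 0)) \<and>
    valid f' \<and> 4 ^ t * card (unc f') \<le> 3 ^ t * card (unc f)"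
proof (induction t)
  case 0
  then show ?case using assms reaches_Nil[of M X b "cfg f (\<lambda>_. 0)"] by (intro exI[of _ f]) simp
next
  case (Suc t)
  then obtain f1 where f1: "reaches M X b (concat (replicate t (bit_phase_prog F h D r k q))) (cfg f (\<lambda>_. 0)) (cfg f1 (\<lambda>_. 0))"
    "valid f1" "4 ^ t * card (unc f1) \<le> 3 ^ t * card (unc f)" by blast
  obtain f2 where f2: "reaches M X b (bit_phase_prog F h D r k q) (cfg f1 (\<lambda>_. 0)) (cfg f2 (\<lambda>_. 0))" "valid f2"
    "4 * card (unc f2) \<le> 3 * card (unc f1)" using bit_phase_correct[OF f1(2)] by blast
  have "4 ^ Suc t * card (unc f2) \<le> 4 ^ t * (3 * card (unc f1))"
    using mult_le_mono2[OF f2(3), of "4 ^ t"] by (simp add: ac_simps)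
  also have "\<dots> \<le> 3 ^ Suc t * card (unc f)" using mult_le_mono2[OF f1(3), of 3] by (simp add: ac_simps)
  finally have "4 ^ Suc t * card (unc f2) \<le> 3 ^ Suc t * card (unc f)" .
  moreover have "concat (replicate (Suc t) (bit_phase_prog F h D r k q)) = concat (replicate t (bit_phase_prog F h D r k q)) @ bit_phase_prog F h D r k q"
    by (simp add: replicate_append_same[symmetric])
  ultimately show ?case using reaches_append[OF f1(1) f2(1)] f2(2) by (intro exI[of _ f2]) simp
qed

end

context spread
begin

lemma pick_phases:
  "\<exists>g'. reaches M X b (concat (replicate t (pick_phase_prog F h D r k))) (cfgb f0) (cfgb g') \<and>
    valid g' \<and> extends g' \<and> 4 ^ t * card (unc g') \<le> 3 ^ t * card (unc f0)"
proof (induction t)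
  case 0
  have "extends f0" by (simp add: extends_def)
  then show ?case using f0 reaches_Nil[of M X b "cfgb f0"] by (intro exI[of _ f0]) simp
next
  case (Suc t)
  then obtain f1 where f1: "reaches M X b (concat (replicate t (pick_phase_prog F h D r k))) (cfgb f0) (cfgb f1)"
    "valid f1" "extends f1" "4 ^ t * card (unc f1) \<le> 3 ^ t * card (unc f0)" by blast
  obtain f2 where f2: "reaches M X b (pick_phase_prog F h D r k) (cfgb f1) (cfgb f2)" "valid f2" "extends f2"
    "4 * card (unc f2) \<le> 3 * card (unc f1)" using pick_phase_correct[OF f1(2,3)] by blast
  have "4 ^ Suc t * card (unc f2) \<le> 4 ^ t * (3 * card (unc f1))"
    using mult_le_mono2[OF f2(4), of "4 ^ t"] by (simp add: ac_simps)
  also have "\<dots> \<le> 3 ^ Suc t * card (unc f0)" using mult_le_mono2[OF f1(4), of 3] by (simp add: ac_simps)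
  finally have "4 ^ Suc t * card (unc f2) \<le> 3 ^ Suc t * card (unc f0)" .
  moreover have "concat (replicate (Suc t) (pick_phase_prog F h D r k)) = concat (replicate t (pick_phase_prog F h D r k)) @ pick_phase_prog F h D r k"
    by (simp add: replicate_append_same[symmetric])
  ultimately show ?case using reaches_append[OF f1(1) f2(1)] f2(2,3) by (intro exI[of _ f2]) simp
qed

lemma results_cfgb: "results (cfgb g i) = (\<lambda>u. (u, f0 u - 1)) ` {u \<in> keys i. f0 u \<noteq> 0} \<union> (\<lambda>u. (u, g u - 1)) ` {u \<in> homed i. g u \<noteq> 0}"
proof -
  have "{(u, c) | u c x. NS u x (Suc c) \<in> cfgb g i} = (\<lambda>u. (u, f0 u - 1)) ` {u \<in> keys i. f0 u \<noteq> 0}"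
    unfolding cfgb_iff by (auto simp: image_iff gr0_conv_Suc) arith+
  moreover have "{(u, c) | u c. BC u c \<in> cfgb g i} = (\<lambda>u. (u, g u - 1)) ` {u \<in> homed i. g u \<noteq> 0}"
    unfolding cfgb_iff by (auto simp: image_iff gr0_conv_Suc)
  ultimately show ?thesis by (simp add: results_def)
qed

lemma results_cfgb_size: "i < M \<Longrightarrow> finite (results (cfgb g i)) \<and> card (results (cfgb g i)) \<le> 2 * Q"
proof -
  assume i: "i < M"
  have f: "finite {u \<in> keys i. f0 u \<noteq> 0}" "finite {u \<in> homed i. g u \<noteq> 0}" using fin_keys fin_homed by auto
  have "card ((\<lambda>u. (u, f0 u - 1)) ` {u \<in> keys i. f0 u \<noteq> 0}) \<le> card (keys i)"
    by (rule order_trans[OF card_image_le[OF f(1)] card_mono[OF fin_keys]]) auto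
  moreover have "card ((\<lambda>u. (u, g u - 1)) ` {u \<in> homed i. g u \<noteq> 0}) \<le> card (homed i)"
    by (rule order_trans[OF card_image_le[OF f(2)] card_mono[OF fin_homed]]) auto
  moreover have "R \<le> Q" using sizes by (simp add: algebra_simps)
  ultimately have "card (results (cfgb g i)) \<le> 2 * Q"
    unfolding results_cfgb using card_keys[OF i] card_homed[of i]
      card_Un_le[of "(\<lambda>u. (u, f0 u - 1)) ` {u \<in> keys i. f0 u \<noteq> 0}" "(\<lambda>u. (u, g u - 1)) ` {u \<in> homed i. g u \<noteq> 0}"] by linarith
  then show ?thesis using f unfolding results_cfgb by simp
qed

lemma results_cfgb_all:
  assumes "extends g" "unc g = {}"
  shows "(\<Union>i<M. results (cfgb g i)) = {(u, g u - 1) | u. u \<in> V}"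
proof -
  have nz: "g u \<noteq> 0" if "u \<in> V" for u using assms(2) that by (auto simp: unc_def)
  have ext: "f0 u \<noteq> 0 \<Longrightarrow> g u = f0 u" for u using assms(1) by (auto simp: extends_def)
  show ?thesis
  proof (intro set_eqI iffI)
    fix p assume "p \<in> (\<Union>i<M. results (cfgb g i))"
    then show "p \<in> {(u, g u - 1) | u. u \<in> V}" unfolding results_cfgb using ext keysV homedV by fastforce
  next
    fix p assume "p \<in> {(u, g u - 1) | u. u \<in> V}"
    then obtain u where u: "p = (u, g u - 1)" "u \<in> V" by auto
    show "p \<in> (\<Union>i<M. results (cfgb g i))"
    proof (cases "f0 u = 0")
      case True
      then have "u \<in> unc f0" using u by (simp add: unc_def)
      then have "home u < M" "u \<in> homed (home u)" using home_less by (auto simp: homed_def)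
      then show ?thesis unfolding results_cfgb using u nz by (intro UN_I[of "home u"]) auto
    next
      case False
      obtain j where "j < M" "u \<in> keys j" using keys_ex[OF u(2)] by blast
      then show ?thesis unfolding results_cfgb using u False ext[OF False] by (intro UN_I[of j]) auto
    qed
  qed
qed

end

context layout
begin

lemma results_cfg: "results (cfg f (\<lambda>_. 0) i) = (\<lambda>u. (u, f u - 1)) ` {u \<in> keys i. f u \<noteq> 0}"
proof -
  have "BC u c \<notin> cfg f (\<lambda>_. 0) i" for u c by (auto simp: cfg_def static_def)
  then show ?thesis unfolding results_def cfg_iff by (auto simp: image_iff gr0_conv_Suc) arith+
qed

lemma results_cfg_size: "i < M \<Longrightarrow> finite (results (cfg f (\<lambda>_. 0) i)) \<and> card (results (cfg f (\<lambda>_. 0) i)) \<le> 2 * Q"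
proof -
  assume i: "i < M"
  have f: "finite {u \<in> keys i. f u \<noteq> 0}" using fin_keys by auto
  have "card ((\<lambda>u. (u, f u - 1)) ` {u \<in> keys i. f u \<noteq> 0}) \<le> card (keys i)"
    by (rule order_trans[OF card_image_le[OF f] card_mono[OF fin_keys]]) auto
  then show ?thesis using f card_keys[OF i] unfolding results_cfg by simp
qed

lemma results_cfg_all:
  assumes "unc f = {}"
  shows "(\<Union>i<M. results (cfg f (\<lambda>_. 0) i)) = {(u, f u - 1) | u. u \<in> V}"
proof (intro set_eqI iffI)
  fix p assume "p \<in> (\<Union>i<M. results (cfg f (\<lambda>_. 0) i))"
  then show "p \<in> {(u, f u - 1) | u. u \<in> V}" unfolding results_cfg using keysV by auto
next
  fix p assume "p \<in> {(u, f u - 1) | u. u \<in> V}"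
  then obtain u where u: "p = (u, f u - 1)" "u \<in> V" by auto
  then have nz: "f u \<noteq> 0" using assms by (auto simp: unc_def)
  have "L u \<noteq> {}" using L[OF u(2)] by auto
  then obtain c where "c \<in> L u" by blast
  then have "lL u c < M" "u \<in> keys (lL u c)" using lL u by (auto simp: keys_def)
  then show "p \<in> (\<Union>i<M. results (cfg f (\<lambda>_. 0) i))" unfolding results_cfg using u nz by (intro UN_I[of "lL u c"]) auto
qed

end

lemma reaches_exec: "reaches M X b P \<sigma> \<tau> \<Longrightarrow> exec_ok M X b P \<sigma>"
  by (simp add: reaches_def)

text \<open>\<open>DQ\<close> leaves room for at least one moved node per machine when the degree is
  at most \<open>D\<close>, \<open>VQ\<close> makes all machines together roomy enough for the moved
  nodes, and \<open>len\<close> keeps the program counter below \<open>X\<close>. \<open>QS\<close>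
  bounds the output: at most \<open>2 * Q\<close> pairs of two words.\<close>

locale run_setting = input_setting +
  fixes B N :: nat
  assumes ne: "V \<noteq> {}" and bS: "b + 1 \<le> S" and B: "X ^ 7 + 2 \<le> 2 ^ B" and QS: "4 * Q \<le> S"
    and N: "N = 3 * nlog (card V + 1)" and VQ: "2 * card V \<le> M * Q" and DQ: "(D + 2) * (D + 2) \<le> Q"
    and len: "length (setup_prog F h Q D J (Suc A)) + length (main_prog F h D r k q Q N (max_degree V E)) < X"
begin

definition "algorithm = compile X (setup_prog F h Q D J (Suc A)) (main_prog F h D r k q Q N) top_key results"

definition "rounds = length (setup_prog F h Q D J (Suc A)) + length (main_prog F h D r k q Q N (max_degree V E))"

lemma shrinks_to_zero:
  assumes "4 ^ N * u \<le> 3 ^ N * n" "n \<le> card V" shows "u = 0"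
proof (rule shrink_zero[of "nlog (card V + 1)"])
  show "4 ^ (3 * nlog (card V + 1)) * u \<le> 3 ^ (3 * nlog (card V + 1)) * n" using assms N by simp
  show "n < 2 ^ nlog (card V + 1)" using nlog[of "card V + 1"] assms(2) by linarith
qed

lemma main_correct:
  assumes lay: "layout V E L C lL lH M Q F h D r k q X b"
    and fg: "reaches M X b [forget] \<tau> (layout.cfg V E L lL lH (\<lambda>_. 0) (\<lambda>_. 0))"
  shows "\<exists>\<rho> f. reaches M X b (main_prog F h D r k q Q N (max_degree V E)) \<tau> \<rho> \<and> valid f \<and> unc f = {} \<and>
    (\<forall>i<M. finite (results (\<rho> i)) \<and> card (results (\<rho> i)) \<le> 2 * Q) \<and>
    (\<Union>i<M. results (\<rho> i)) = {(u, f u - 1) | u. u \<in> V}"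
proof -
  interpret lay: layout V E L C lL lH M Q F h D r k q X b by (rule lay)
  let ?d = "max_degree V E"
  obtain f0 where f0: "reaches M X b (concat (replicate (phases D N ?d) (bit_phase_prog F h D r k q))) (lay.cfg (\<lambda>_. 0) (\<lambda>_. 0)) (lay.cfg f0 (\<lambda>_. 0))"
    "valid f0" "4 ^ phases D N ?d * card (unc f0) \<le> 3 ^ phases D N ?d * card V"
    using lay.bit_phases[OF valid_0, of "phases D N ?d"] unc_0 by auto
  have r0: "reaches M X b (forget # concat (replicate (phases D N ?d) (bit_phase_prog F h D r k q))) \<tau> (lay.cfg f0 (\<lambda>_. 0))"
    by (rule reaches_Cons[OF fg f0(1)])
  show ?thesis
  proof (cases "?d \<le> D")
    case False
    then have "4 ^ N * card (unc f0) \<le> 3 ^ N * card V" using f0(3) by (simp add: phases_def)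
    then have "card (unc f0) = 0" by (rule shrinks_to_zero) simp
    then have u: "unc f0 = {}" using fin_unc by simp
    have "reaches M X b (main_prog F h D r k q Q N ?d) \<tau> (lay.cfg f0 (\<lambda>_. 0))"
      using r0 False by (simp add: main_prog_def)
    then show ?thesis using f0(2) u lay.results_cfg_size lay.results_cfg_all[OF u] by blast
  next
    case True
    define K where "K = (?d + 2) * (?d + 2)"
    define R where "R = Q div K"
    have KQ: "K \<le> Q" using True DQ mult_le_mono[of "?d + 2" "D + 2" "?d + 2" "D + 2"] unfolding K_def by linarith
    have K0: "K > 0" by (simp add: K_def)
    have R0: "R > 0" unfolding R_def using KQ K0 by (simp add: div_greater_zero_iff)
    have RK: "R * K \<le> Q" unfolding R_def by simp
    have "Q < K + R * K" unfolding R_def by (rule dividend_less_div_times[OF K0])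
    also have "\<dots> \<le> 2 * (R * K)" using R0 by simp
    finally have QR: "Q \<le> 2 * (R * K)" by simp
    \<comment> \<open>Rounding down in \<open>Q div K\<close> loses at most a factor 2, which the
      factor 2 in \<open>VQ\<close> makes up for. The phases before have left at most
      \<open>card V / K\<close> nodes.\<close>
    have few: "card (unc f0) \<le> M * R"
    proof -
      have "4 ^ (5 * nlog (?d + 2)) * card (unc f0) \<le> 3 ^ (5 * nlog (?d + 2)) * card V"
        using f0(3) True by (simp add: phases_def)
      then have "4 ^ nlog (?d + 2) * card (unc f0) \<le> card V" by (rule shrink_quarter)
      moreover have "K \<le> 4 ^ nlog (?d + 2)"
      proof -
        have "K \<le> 2 ^ nlog (?d + 2) * 2 ^ nlog (?d + 2)"
          unfolding K_def using nlog[of "?d + 2"] by (intro mult_le_mono) auto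
        then show ?thesis by (simp flip: power_mult_distrib)
      qed
      ultimately have "K * card (unc f0) \<le> card V" by (meson mult_le_mono1 order_trans)
      then have "2 * (K * card (unc f0)) \<le> M * Q" using VQ by linarith
      also have "\<dots> \<le> M * (2 * (R * K))" by (rule mult_le_mono2[OF QR])
      finally have "(2 * K) * card (unc f0) \<le> (2 * K) * (M * R)" by (simp add: ac_simps)
      then show ?thesis using K0 by simp
    qed
    interpret sp: spread V E L C lL lH M Q F h D r k q X b R ?d f0
      by standard (use R0 X(5) degree_le_max RK f0(2) few in \<open>auto simp: K_def\<close>)
    obtain g where g: "reaches M X b (concat (replicate N (pick_phase_prog F h D r k))) (sp.cfgb f0) (sp.cfgb g)"
      "valid g" "sp.extends g" "4 ^ N * card (unc g) \<le> 3 ^ N * card (unc f0)"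
      using sp.pick_phases by blast
    have "card (unc f0) \<le> card V" using finV by (intro card_mono) (auto simp: unc_def)
    then have "card (unc g) = 0" using shrinks_to_zero[OF g(4)] by simp
    then have u: "unc g = {}" using fin_unc by simp
    have "reaches M X b (main_prog F h D r k q Q N ?d) \<tau> (sp.cfgb g)"
      using reaches_append[OF r0 reaches_append[OF sp.spread_correct g(1)]] True
      by (simp add: main_prog_def R_def K_def)
    then show ?thesis using g(2) u sp.results_cfgb_size sp.results_cfgb_all[OF g(3) u] by blast
  qed
qed

theorem run_correct:
  "\<forall>t\<le>rounds. memory_ok M S B (mpc_run algorithm M (initial_memory inp) t)"
  "\<forall>t<rounds. traffic_ok algorithm M S B (mpc_run algorithm M (initial_memory inp) t)"
  "mpc_final algorithm V E L M S (mpc_run algorithm M (initial_memory inp) rounds)"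
proof -
  let ?su = "setup_prog F h Q D J (Suc A)" and ?d = "max_degree V E"
  let ?mn = "main_prog F h D r k q Q N"
  obtain lL lH \<tau> where lay: "layout V E L C lL lH M Q F h D r k q X b" and su: "reaches M X b ?su raw \<tau>"
    and top: "\<And>i. i < M \<Longrightarrow> top_key (\<tau> i) = ?d"
    and fg: "reaches M X b [forget] \<tau> (layout.cfg V E L lL lH (\<lambda>_. 0) (\<lambda>_. 0))"
    using setup_correct[OF ne] by blast
  obtain \<rho> f where \<rho>: "reaches M X b (?mn ?d) \<tau> \<rho>" and f: "valid f" "unc f = {}"
    and sz: "\<forall>i<M. finite (results (\<rho> i)) \<and> card (results (\<rho> i)) \<le> 2 * Q"
    and all: "(\<Union>i<M. results (\<rho> i)) = {(u, f u - 1) | u. u \<in> V}"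
    using main_correct[OF lay fg] by blast
  have run: "reaches M X b (?su @ ?mn ?d) raw \<rho>" by (rule reaches_append[OF su \<rho>])
  have dX: "?d < X"
  proof -
    have "?d = Max (degree E ` V)" unfolding max_degree_def using ne finV by (subst Max_insert) auto
    then have "?d \<in> degree E ` V" using ne finV by (simp add: Max_in)
    then obtain u where "u \<in> V" "?d = degree E u" by blast
    then have "?d < card (L u)" "card (L u) \<le> C" using L card_mono[of "{..<C}" "L u"] by auto
    then show ?thesis using X(6) by linarith
  qed
  interpret c: compiled_run M X b S B ?su ?mn top_key results ?d inp raw "?su @ ?mn ?d"
  proof
    show "?su \<noteq> []" by (simp add: setup_prog_def)
    show "exec_ok M X b (?su @ ?mn ?d) raw" by (rule reaches_exec[OF run])
    show "top_key (exec M ?su raw i) = ?d" if "i < M" for i using su top that by (simp add: reaches_def)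
    show "length (?su @ ?mn ?d) < X" using len by simp
    show "length (initial_memory inp i) \<le> S" if "i < M" for i using content(3)[OF that] .
  qed (use dX B bS raw_bwords in \<open>auto simp: raw_def\<close>)
  have alg: "c.alg = algorithm" by (simp add: c.alg_def algorithm_def)
  have T: "length (?su @ ?mn ?d) = rounds" by (simp add: rounds_def)
  have ex: "exec M (?su @ ?mn ?d) raw i = \<rho> i" if "i < M" for i using run that by (simp add: reaches_def)
  show "\<forall>t\<le>rounds. memory_ok M S B (mpc_run algorithm M (initial_memory inp) t)"
    using c.memory unfolding T c.run_def alg by blast
  show "\<forall>t<rounds. traffic_ok algorithm M S B (mpc_run algorithm M (initial_memory inp) t)"
    using c.traffic unfolding T c.run_def alg by blast
  have "mpc_final c.alg V E L M S (c.run (length (?su @ ?mn ?d)))"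
  proof (rule c.final[where \<phi> = "\<lambda>u. f u - 1"])
    show "finite (results (exec M (?su @ ?mn ?d) raw i)) \<and> 2 * card (results (exec M (?su @ ?mn ?d) raw i)) \<le> S" if "i < M" for i
    proof -
      have "finite (results (\<rho> i))" "card (results (\<rho> i)) \<le> 2 * Q" using sz that by auto
      then show ?thesis unfolding ex[OF that] using QS by linarith
    qed
    show "list_coloring V E L (\<lambda>u. f u - 1)" by (rule list_coloring_of_status[OF f])
    have "(\<Union>i<M. results (exec M (?su @ ?mn ?d) raw i)) = (\<Union>i<M. results (\<rho> i))" using ex by simp
    then show "(\<Union>i<M. results (exec M (?su @ ?mn ?d) raw i)) = {(v, f v - 1) | v. v \<in> V}" unfolding all .
  qed
  then show "mpc_final algorithm V E L M S (mpc_run algorithm M (initial_memory inp) rounds)"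
    unfolding T c.run_def alg .
qed

end

subsection \<open>Parameters\<close>

lemma nlog_pow: "2 ^ nlog x \<le> 2 * x + 1"
proof (cases "nlog x")
  case (Suc l)
  then have "\<not> x \<le> 2 ^ l" using nlog_le[of x l] by auto
  then show ?thesis using Suc by simp
qed simp

lemma lg_ge_1: "1 \<le> lg x"
  by (simp add: lg_def)

lemma nlog_lg: "real (nlog x) \<le> 2 * lg x"
proof (cases "nlog x")
  case 0
  then show ?thesis using lg_ge_1[of x] by simp
next
  case (Suc l)
  then have l: "2 ^ l < x" using nlog_le[of x l] by (metis Suc_n_not_le_n not_le)
  then have "(2 :: real) ^ l < real x" by (metis of_nat_less_iff of_nat_numeral of_nat_power)
  then have "real l \<le> log 2 (real x)" by (simp add: le_log_iff powr_realpow)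
  then show ?thesis using Suc by (simp add: lg_def)
qed

lemma nlog_add2: "nlog (x + 2) \<le> nlog x + 2"
proof (cases "x = 0")
  case True
  have "nlog 2 \<le> 1" by (rule nlog_le) simp
  then show ?thesis using True by (simp add: numeral_2_eq_2)
next
  case False
  have "x + 2 \<le> 2 ^ (nlog x + 2)" using nlog[of x] False by simp
  then show ?thesis by (rule nlog_le)
qed

lemma nlog_mono: "x \<le> y \<Longrightarrow> nlog x \<le> nlog y"
  by (rule nlog_le) (use nlog[of y] in linarith)

lemma nlog_add2_lg: "real (nlog (x + 2)) \<le> 4 * lg x"
  using nlog_add2[of x] nlog_lg[of x] lg_ge_1[of x] by linarith

lemma nlog_add1_lg: "real (nlog (x + 1)) \<le> 4 * lg x"
  using nlog_add2_lg[of x] nlog_mono[of "x + 1" "x + 2"] by simp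

lemma concat_chunks: "concat (map (\<lambda>i. take s (drop (i * s) xs)) [0..<M]) = take (M * s) xs"
  by (induction M) (simp_all add: take_add[symmetric] add.commute)

text \<open>The \<open>card E\<close> edges and \<open>2 * card E + card V\<close> list entries, in
  any order, are cut into chunks of \<open>S div 3\<close> items of three words. This shows that the
  claims about all placements are not vacuous.\<close>

lemma (in coloring_instance) placement_exists:
  assumes "3 * card E + card V \<le> M * (S div 3)"
  shows "\<exists>inp. input_placement V E L M S inp"
proof -
  have fin: "finite (E <+> Sigma V L)" using finE finV finL by simp
  then obtain ys where ys: "set ys = E <+> Sigma V L" "distinct ys" using finite_distinct_list by blast
  have "length ys = card (E <+> Sigma V L)" using ys distinct_card by metis
  also have "\<dots> = 3 * card E + card V" using finE finV finL sum_card_list by (simp add: card_Plus)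
  finally have len: "length ys \<le> M * (S div 3)" using assms by simp
  define it where "it = inv_into UNIV item_content"
  have it: "item_content (it y) = y" if y: "y \<in> set ys" for y
  proof -
    have "y \<in> range item_content"
    proof -
      consider e where "e \<in> E" "y = Inl e" | u c where "y = Inr (u, c)" using y ys(1) by auto
      then show ?thesis
      proof cases
        case 1
        then obtain u v where "e = {u, v}" using edge card_2_iff by metis
        then show ?thesis using 1 by (metis item_content.simps(1) rangeI)
      next
        case 2
        then show ?thesis by (metis item_content.simps(2) rangeI)
      qed
    qed
    then show ?thesis unfolding it_def by (rule f_inv_into_f)
  qed
  define inp where "inp i = take (S div 3) (drop (i * (S div 3)) (map it ys))" for i
  have "concat (map inp [0..<M]) = map it ys" unfolding inp_def concat_chunks using len by simp
  then have "map item_content (concat (map inp [0..<M])) = ys" using it by (simp add: map_idI)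
  moreover have "length (initial_memory inp i) \<le> S" for i
    unfolding length_initial_memory inp_def by simp
  ultimately show ?thesis using ys unfolding input_placement_def Let_def by (intro exI[of _ inp]) auto
qed

lemma (in coloring_instance) card_E_le: "card E \<le> card V * card V"
proof -
  have "half_edges \<subseteq> V \<times> V" unfolding half_edges_def using nbD by auto
  then have "card half_edges \<le> card (V \<times> V)" using finV by (intro card_mono) auto
  then show ?thesis using card_half by (simp add: card_cartesian_product)
qed

text \<open>All sizes are powers of \<open>D n = \<Theta>(n powr (\<alpha>/4))\<close>, with exponents depending only on \<open>\<alpha>\<close> and \<open>p\<close>.\<close>

locale sublinear =
  fixes \<alpha> :: real and p :: nat
  assumes alpha: "0 < \<alpha>" "\<alpha> < 1"
begin

text \<open>For \<open>n \<ge> 1\<close> the exponents are chosen such that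
  \<open>n \<le> D n ^ j\<close> and hence \<open>m \<le> D n ^ (2 * j)\<close>. Identifiers and
  colors stay below \<open>D n ^ J\<close>. A number \<open>F n m \<le> D n\<close> with
  \<open>h\<close> levels yields enough machines. The hash values have \<open>k = e * q0 n\<close>
  bits, so that \<open>2 ^ k = D n ^ e\<close> exceeds \<open>8 * nlog C * m\<close>, and a seed of
  \<open>4 * k\<close> bits has \<open>4 * e\<close> digits. \<open>D n ^ x\<close> bounds
  everything that a word must hold, including the program counter.\<close>

definition "j = nat \<lceil>4 / \<alpha>\<rceil>"
definition "J = p * (j + 2) + 1"
definition "h = 2 * j"
definition "e = J + 2 * j + 2"
definition "\<kappa> = 5 + h + 4 * e * (h + 2)"
definition "c0 = J * (h + 2) + 4 * h + 13 + 27 * \<kappa>"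
definition "x = 5 * e + 2 * j + h + J + c0 + 20"
text \<open>\<open>D n\<close> is a power of two so that the \<open>4 * k\<close> bits of a seed
  split exactly into digits in base \<open>D n\<close>. The summand 2 ensures
  \<open>4 \<le> D n\<close>.\<close>

definition q0 :: "nat \<Rightarrow> nat" where "q0 n = nat \<lceil>\<alpha> / 4 * log 2 (real n)\<rceil> + 2"
definition D :: "nat \<Rightarrow> nat" where "D n = 2 ^ q0 n"
text \<open>With \<open>Q = 2 * D n ^ 4\<close> the phases hold \<open>8 * D n ^ 4\<close> words
  plus the seed, the raw tokens take at most \<open>22 * D n ^ 4\<close>, and the overhead of a scan
  is below \<open>4 * D n ^ 4\<close>. The factor 32 leaves room for each combination that occurs
  and for the header.\<close>

definition S :: "nat \<Rightarrow> nat" where "S n = 32 * D n ^ 4"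
definition F :: "nat \<Rightarrow> nat \<Rightarrow> nat" where "F n m = (LEAST F. 64 * (m + n) \<le> F ^ h * S n)"
text \<open>Makes \<open>2 ^ B n\<close> equal to \<open>4 * X ^ 7\<close> for
  \<open>X = D n ^ x\<close>, enough for the codes below \<open>X ^ 7 + 2\<close>.\<close>

definition B :: "nat \<Rightarrow> nat" where "B n = 7 * (q0 n * x) + 2"
definition A where "A n m C = compile (D n ^ x) (setup_prog (F n m) h (2 * D n ^ 4) (D n) J (Suc (2 * (S n div 3))))
  (main_prog (F n m) h (D n) (4 * e) (e * q0 n) (nlog C) (2 * D n ^ 4) (3 * nlog (n + 1))) top_key results"

lemma j: "4 / \<alpha> \<le> real j" "j \<ge> 4"
proof -
  show 1: "4 / \<alpha> \<le> real j" unfolding j_def by linarith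
  have "4 \<le> 4 / \<alpha>" using alpha by (simp add: field_simps)
  then show "j \<ge> 4" using 1 by linarith
qed

lemma D_ge: "4 \<le> D n"
proof -
  have "(2 :: nat) ^ 2 \<le> 2 ^ q0 n" by (rule power_increasing) (simp_all add: q0_def)
  then show ?thesis by (simp add: D_def)
qed

lemma D_real: "real (D n) = 2 powr real (q0 n)"
  by (simp add: D_def powr_realpow)

context
  fixes n :: nat
  assumes n: "n \<ge> 1"
begin

lemma log_ge_0: "0 \<le> log 2 (real n)"
  using n by simp

lemma n_powr: "real n = 2 powr log 2 (real n)"
  using n by simp

lemma q0_bounds: "\<alpha> / 4 * log 2 (real n) \<le> real (q0 n)" "real (q0 n) \<le> \<alpha> / 4 * log 2 (real n) + 3"
proof -
  have "0 \<le> \<alpha> / 4 * log 2 (real n)" using alpha log_ge_0 by simp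
  then have "0 \<le> \<lceil>\<alpha> / 4 * log 2 (real n)\<rceil>" by linarith
  then have "real (q0 n) = of_int \<lceil>\<alpha> / 4 * log 2 (real n)\<rceil> + 2" by (simp add: q0_def)
  then show "\<alpha> / 4 * log 2 (real n) \<le> real (q0 n)" "real (q0 n) \<le> \<alpha> / 4 * log 2 (real n) + 3" by linarith+
qed

lemma D4: "real n powr \<alpha> \<le> real (D n) ^ 4" "real (D n) ^ 4 \<le> 4096 * real n powr \<alpha>"
proof -
  have d: "real (D n) ^ 4 = 2 powr (4 * real (q0 n))"
    by (simp add: D_real powr_powr mult.commute flip: powr_numeral)
  have a: "real n powr \<alpha> = 2 powr (\<alpha> * log 2 (real n))"
    by (subst n_powr) (simp add: powr_powr mult.commute)
  show "real n powr \<alpha> \<le> real (D n) ^ 4" unfolding a d using q0_bounds(1) by (intro powr_mono) auto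
  have "real (D n) ^ 4 \<le> 2 powr (12 + \<alpha> * log 2 (real n))"
    unfolding d using q0_bounds(2) by (intro powr_mono) auto
  also have "\<dots> = 4096 * real n powr \<alpha>" unfolding a powr_add by simp
  finally show "real (D n) ^ 4 \<le> 4096 * real n powr \<alpha>" .
qed

lemma log_le: "log 2 (real n) \<le> real j * real (q0 n)"
proof -
  have "log 2 (real n) = 4 / \<alpha> * (\<alpha> / 4 * log 2 (real n))" using alpha by simp
  also have "\<dots> \<le> real j * real (q0 n)"
    using j q0_bounds(1) alpha log_ge_0 by (intro mult_mono) auto
  finally show ?thesis .
qed

lemma n_le: "n \<le> D n ^ j"
proof -
  have "real n \<le> 2 powr (real j * real (q0 n))" using log_le by (subst n_powr) simp
  also have "\<dots> = real (D n ^ j)" by (simp add: D_real powr_powr mult.commute flip: powr_realpow)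
  finally show ?thesis by simp
qed

lemma q0_le: "real (q0 n) \<le> 4 * lg n"
proof -
  have "\<alpha> / 4 * log 2 (real n) \<le> 1 * log 2 (real n)" using alpha log_ge_0 by (intro mult_right_mono) auto
  then show ?thesis using q0_bounds(2) by (simp add: lg_def)
qed

lemma S_bounds: "real n powr \<alpha> \<le> real (S n)" "real (S n) \<le> 131072 * real n powr \<alpha>"
  using D4 by (simp_all add: S_def)

lemma S_le: "real (S n) \<le> 131072 * real n"
proof -
  have "real n powr \<alpha> \<le> real n powr 1" using n alpha by (intro powr_mono) auto
  then show ?thesis using S_bounds(2) n by simp
qed

lemma S_pos: "S n > 0"
  using D_ge[of n] by (simp add: S_def)

lemma F_enough: "64 * (m + n) \<le> F n m ^ h * S n"
proof -
  have "h > 0" using j by (simp add: h_def)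
  then have "64 * (m + n) \<le> (64 * (m + n)) ^ h" using n by (intro self_le_power) auto
  then have "64 * (m + n) * 1 \<le> (64 * (m + n)) ^ h * S n" using S_pos by (intro mult_le_mono) auto
  then have "64 * (m + n) \<le> (64 * (m + n)) ^ h * S n" by simp
  then show ?thesis unfolding F_def by (rule LeastI[of "\<lambda>F. 64 * (m + n) \<le> F ^ h * S n"])
qed

lemma F_pos: "F n m > 0"
proof (rule ccontr)
  assume "\<not> F n m > 0"
  moreover have "h > 0" using j by (simp add: h_def)
  ultimately show False using F_enough[of m] n by (simp add: power_0_left)
qed

lemma F_le: "64 * (m + n) \<le> G ^ h * S n \<Longrightarrow> F n m \<le> G"
  unfolding F_def by (rule Least_le)

text \<open>The lower bound is the condition that defines \<open>F\<close>. For the upper bound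
  minimality limits \<open>(F n m - 1) ^ h\<close>, and \<open>F n m \<le> 2 * (F n m - 1)\<close>
  costs a factor \<open>2 ^ h\<close>, a constant because \<open>h\<close> depends on \<alpha> only.
  A single machine is the exception: there the ratio \<open>(m + n) / S n\<close> is itself bounded
  below, as \<open>S n\<close> is at most \<open>131072 * n\<close>.\<close>

lemma M_bounds:
  "64 * (real (m + n) / real (S n)) \<le> real (F n m ^ h)"
  "real (F n m ^ h) \<le> (2 ^ h * 64 + 131072) * (real (m + n) / real (S n))"
proof -
  have "real (64 * (m + n)) \<le> real (F n m ^ h * S n)" using F_enough of_nat_le_iff by blast
  then show "64 * (real (m + n) / real (S n)) \<le> real (F n m ^ h)" using S_pos by (simp add: field_simps)
  have r: "0 \<le> real (m + n) / real (S n)" by simp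
  show "real (F n m ^ h) \<le> (2 ^ h * 64 + 131072) * (real (m + n) / real (S n))"
  proof (cases "F n m = 1")
    case True
    have "real (S n) \<le> 131072 * real (m + n)" using S_le by simp
    then have "1 \<le> 131072 * (real (m + n) / real (S n))" using S_pos by (simp add: field_simps)
    moreover have "0 \<le> (2 ^ h * 64) * (real (m + n) / real (S n))" using r by (intro mult_nonneg_nonneg) auto
    ultimately have "1 \<le> (2 ^ h * 64 + 131072) * (real (m + n) / real (S n))" unfolding distrib_right by linarith
    then show ?thesis using True by (simp only: power_one of_nat_1)
  next
    case False
    then have F2: "F n m \<le> 2 * (F n m - 1)" "F n m - 1 < F n m" using F_pos[of m] by auto
    then have "\<not> 64 * (m + n) \<le> (F n m - 1) ^ h * S n" using F_le[of m "F n m - 1"] by linarith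
    then have "real ((F n m - 1) ^ h * S n) \<le> real (64 * (m + n))" by (simp only: of_nat_le_iff)
    then have "real ((F n m - 1) ^ h) \<le> 64 * (real (m + n) / real (S n))" using S_pos by (simp add: field_simps)
    then have "2 ^ h * real ((F n m - 1) ^ h) \<le> 2 ^ h * (64 * (real (m + n) / real (S n)))" by (intro mult_left_mono) auto
    moreover have "F n m ^ h \<le> 2 ^ h * (F n m - 1) ^ h" using power_mono[OF F2(1), of h] by (simp add: power_mult_distrib)
    then have "real (F n m ^ h) \<le> real (2 ^ h * (F n m - 1) ^ h)" by (simp only: of_nat_le_iff)
    then have "real (F n m ^ h) \<le> 2 ^ h * real ((F n m - 1) ^ h)" by simp
    moreover have "(2 ^ h * 64 + 131072) * (real (m + n) / real (S n)) = 2 ^ h * (64 * (real (m + n) / real (S n))) + 131072 * (real (m + n) / real (S n))"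
      by (simp only: distrib_right mult.assoc)
    ultimately show ?thesis using r by linarith
  qed
qed

end

lemma resources: "sublinear_resources \<alpha> (\<lambda>n m. F n m ^ h) S B"
proof -
  have 1: "1 * real n powr \<alpha> \<le> real (S n) \<and> real (S n) \<le> 131072 * real n powr \<alpha>" if "n \<ge> 1" for n
    using S_bounds[OF that] by simp
  have 2: "64 * (real (m + n) / real (S n)) \<le> real (F n m ^ h) \<and>
    real (F n m ^ h) \<le> (2 ^ h * 64 + 131072) * (real (m + n) / real (S n))" if "n \<ge> 1" for n m
    using M_bounds[OF that] by blast
  have 3: "real (B n) \<le> (28 * real x + 2) * lg n" if "n \<ge> 1" for n
  proof -
    have "real (B n) = 7 * (real (q0 n) * real x) + 2" by (simp add: B_def)
    also have "\<dots> \<le> 7 * ((4 * lg n) * real x) + 2 * lg n"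
      using q0_le[OF that] lg_ge_1[of n] by (intro add_mono mult_left_mono mult_right_mono) auto
    also have "\<dots> = (28 * real x + 2) * lg n" by (simp add: algebra_simps)
    finally show ?thesis .
  qed
  show ?thesis unfolding sublinear_resources_def
  proof (intro conjI)
    show "\<exists>a>0. \<exists>b. \<forall>n\<ge>1. a * real n powr \<alpha> \<le> real (S n) \<and> real (S n) \<le> b * real n powr \<alpha>"
      using 1 by (intro exI[of _ "1 :: real"] conjI exI[of _ 131072]) auto
    show "\<exists>a>0. \<exists>b. \<forall>n\<ge>1. \<forall>m. a * (real (m + n) / real (S n)) \<le> real (F n m ^ h) \<and> real (F n m ^ h) \<le> b * (real (m + n) / real (S n))"
      using 2 by (intro exI[of _ "64 :: real"] conjI exI[of _ "2 ^ h * 64 + 131072"]) auto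
    show "\<exists>b. \<forall>n\<ge>1. real (B n) \<le> b * lg n" using 3 by blast
  qed
qed

lemma small: "a \<le> D n ^ y \<Longrightarrow> y < x \<Longrightarrow> a < D n ^ x"
  using D_ge[of n] power_strict_increasing[of y x "D n"] by linarith

lemma D_mono: "y \<le> z \<Longrightarrow> D n ^ y \<le> D n ^ z"
  using D_ge[of n] by (intro power_increasing) auto

lemma const_less: "c < D n ^ c"
proof -
  have "c < 2 ^ c" by (rule less_exp)
  also have "(2 :: nat) ^ c \<le> D n ^ c" using D_ge[of n] by (intro power_mono) auto
  finally show ?thesis .
qed

text \<open>Explains the exponent \<open>J\<close>: \<open>p \<le> D n ^ p\<close> and
  \<open>n + 1 \<le> D n ^ (j + 1)\<close> give \<open>D n ^ (p * (j + 2))\<close>, and one further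
  factor makes the bound strict.\<close>

lemma poly_less:
  assumes "n \<ge> 1" "poly_bounded p n y"
  shows "y < D n ^ J"
proof -
  have "n + 1 \<le> D n * D n ^ j" using n_le[OF assms(1)] mult_le_mono[OF D_ge[of n] n_le[OF assms(1)]] assms(1) by linarith
  then have "(n + 1) ^ p \<le> (D n ^ (j + 1)) ^ p" by (intro power_mono) (simp_all add: ac_simps)
  then have "p * (n + 1) ^ p \<le> D n ^ p * (D n ^ (j + 1)) ^ p"
    using const_less[of p n] by (intro mult_le_mono) auto
  also have "\<dots> = D n ^ (p * (j + 2))" by (simp add: power_add[symmetric] power_mult[symmetric] algebra_simps)
  also have "\<dots> < D n ^ J" using D_ge[of n] by (intro power_strict_increasing) (auto simp: J_def)
  finally show ?thesis using assms(2) by (simp add: poly_bounded_def)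
qed

end

section \<open>Feasibility of the parameters and the number of rounds\<close>

context sublinear
begin

lemma length_main_le:
  "length (main_prog F' h D' (4 * e) k' q Q' N d) \<le> 2 * h + 6 + (phases D' N d * (q + 1) + N) * \<kappa>"
proof -
  let ?\<kappa> = "5 + h + 4 * e * (h + 2)"
  have 1: "q * ?\<kappa> + (3 + h) \<le> (q + 1) * ?\<kappa>" by simp
  have 2: "4 * e * (h + 2) + 3 \<le> ?\<kappa>" by simp
  have "length (main_prog F' h D' (4 * e) k' q Q' N d) \<le> 1 + phases D' N d * ((q + 1) * ?\<kappa>) + (2 * h + 5 + N * ?\<kappa>)"
    using length_main_prog[of F' h D' "4 * e" k' q Q' N d] mult_le_mono2[OF 1, of "phases D' N d"] mult_le_mono2[OF 2, of N]
    by (cases "d \<le> D'"; simp only: if_True if_False; linarith)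
  also have "\<dots> = 2 * h + 6 + (phases D' N d * (q + 1) + N) * ?\<kappa>" by (simp add: algebra_simps)
  finally show ?thesis by (simp only: \<kappa>_def)
qed

lemma run_setting_parameters:
  assumes inst: "degree_plus_one_instance V E L C" and V: "V \<noteq> {}"
    and ids: "\<forall>v\<in>V. poly_bounded p (card V) v" and C: "poly_bounded p (card V) C"
    and inp: "input_placement V E L (F (card V) (card E) ^ h) (S (card V)) inp"
  shows "run_setting V E L C (F (card V) (card E) ^ h) (2 * D (card V) ^ 4) (F (card V) (card E)) h (D (card V)) (4 * e)
    (e * q0 (card V)) (nlog C) (D (card V) ^ x) (S (card V) - 1) (2 * (S (card V) div 3)) J (S (card V)) inp
    (B (card V)) (3 * nlog (card V + 1))"
proof -
  interpret ci: coloring_instance V E L C by standard (rule inst)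
  define n where "n = card V"
  define m where "m = card E"
  define d where "d = D n"
  have n1: "n \<ge> 1" using V ci.finV card_gt_0_iff[of V] by (simp add: n_def Suc_le_eq)
  have d4: "4 \<le> d" unfolding d_def by (rule D_ge)
  have nd: "n \<le> d ^ j" unfolding d_def by (rule n_le[OF n1])
  have pow: "y \<le> z \<Longrightarrow> d ^ y \<le> d ^ z" for y z unfolding d_def by (rule D_mono)
  have small': "a \<le> d ^ y \<Longrightarrow> y < x \<Longrightarrow> a < d ^ x" for a y unfolding d_def by (rule small)
  have md: "m \<le> d ^ (2 * j)"
  proof -
    have "m \<le> n * n" unfolding m_def n_def by (rule ci.card_E_le)
    also have "\<dots> \<le> d ^ j * d ^ j" using nd by (rule mult_le_mono[OF _ nd])
    also have "\<dots> = d ^ (2 * j)" by (simp add: mult_2 power_add)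
    finally show ?thesis .
  qed
  have nd2: "n \<le> d ^ (2 * j)" using nd pow[of j "2 * j"] by simp
  have S: "S n = 32 * d ^ 4" by (simp add: S_def d_def)
  have Fd: "F n m \<le> d"
  proof (rule F_le[OF n1])
    have "64 * (m + n) \<le> 128 * d ^ (2 * j)" using md nd2 by simp
    also have "\<dots> \<le> d ^ (2 * j) * (32 * d ^ 4)" using power_mono[OF d4, of 4] by simp
    finally show "64 * (m + n) \<le> d ^ h * S n" by (simp add: S h_def)
  qed
  have Fh: "F n m ^ h \<le> d ^ h" by (rule power_mono[OF Fd]) simp
  have en: "64 * (m + n) \<le> F n m ^ h * S n" by (rule F_enough[OF n1])
  have Cd: "C < d ^ J" unfolding d_def by (rule poly_less[OF n1]) (use C in \<open>simp add: n_def\<close>)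
  have uJ: "u < d ^ J" if "u \<in> V" for u
    unfolding d_def by (rule poly_less[OF n1]) (use ids that in \<open>simp add: n_def\<close>)
  have kd: "2 ^ (e * q0 n) = d ^ e" by (simp add: d_def D_def mult.commute flip: power_mult)
  have rd: "2 ^ (4 * (e * q0 n)) = d ^ (4 * e)" by (simp add: d_def D_def ac_simps flip: power_mult)
  have q: "nlog C < d ^ J" using nlog_less[of C] Cd by simp
  have d16: "16 \<le> d ^ 2" using power_mono[OF d4, of 2] by simp
  have d64: "64 \<le> d ^ 3" using power_mono[OF d4, of 3] by simp
  have dsq: "2 * d + 3 * (F n m * d) + 2 \<le> 4 * d ^ 4"
  proof -
    have "F n m * d \<le> d * d" using Fd by simp
    moreover have "d * 4 \<le> d * d" using d4 by simp
    moreover have "d * d * 16 \<le> d * d * (d * d)" using d16 by (intro mult_le_mono2) (simp add: power2_eq_square)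
    moreover have "d ^ 4 = d * d * (d * d)" by (simp add: eval_nat_numeral)
    ultimately show ?thesis using d4 by linarith
  qed
  have d1: "1 \<le> d ^ y" for y using d4 by simp
  have A: "2 * (S n div 3) \<le> 22 * d ^ 4" unfolding S by linarith
  have A': "20 * d ^ 4 \<le> 2 * (S n div 3)" unfolding S using d1[of 4] by linarith
  have phases: "phases d (3 * nlog (n + 1)) y \<le> 21 * d ^ (j + 1)" for y
  proof -
    have 1: "d \<le> d ^ (j + 1)" "n \<le> d ^ (j + 1)" using pow[of 1 "j + 1"] order_trans[OF nd pow[of j "j + 1"]] by simp_all
    have "nlog (y + 2) \<le> d + 2" if "y \<le> d" using nlog_mono[of "y + 2" "d + 2"] nlog_less[of "d + 2"] that by simp
    then have "phases d (3 * nlog (n + 1)) y \<le> 5 * (d + 2) + 3 * (n + 1)"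
      using nlog_less[of "n + 1"] by (auto simp: phases_def)
    moreover have "5 * (d + 2) + 3 * (n + 1) \<le> 21 * z" if "d \<le> z" "n \<le> z" "1 \<le> z" for z using that by simp
    ultimately show ?thesis using 1 d1[of "j + 1"] by (meson order_trans)
  qed
  have len: "J * (h + 2) + 2 * h + 7 + (2 * h + 6 + (phases d (3 * nlog (n + 1)) y * (nlog C + 1) + 3 * nlog (n + 1)) * \<kappa>) < d ^ x" for y
  proof -
    let ?Y = "d ^ (j + 1)" and ?Z = "d ^ J"
    have Y: "1 \<le> ?Y" "n \<le> ?Y" "1 \<le> ?Z" using order_trans[OF nd pow[of j "j + 1"]] by (simp_all only: d1)
    have YZ: "1 \<le> ?Y * ?Z" using mult_le_mono[OF Y(1,3)] by simp
    have "phases d (3 * nlog (n + 1)) y * (nlog C + 1) \<le> 21 * ?Y * ?Z"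
      using phases q by (intro mult_le_mono) auto
    moreover have "3 * nlog (n + 1) \<le> 6 * ?Y" using nlog_less[of "n + 1"] Y by linarith
    moreover have "?Y \<le> ?Y * ?Z" using Y(3) by simp
    ultimately have "phases d (3 * nlog (n + 1)) y * (nlog C + 1) + 3 * nlog (n + 1) \<le> 27 * (?Y * ?Z)" by linarith
    then have 1: "(phases d (3 * nlog (n + 1)) y * (nlog C + 1) + 3 * nlog (n + 1)) * \<kappa> \<le> 27 * (?Y * ?Z) * \<kappa>" by (rule mult_le_mono1)
    have 2: "(J * (h + 2) + 4 * h + 13) * 1 \<le> (J * (h + 2) + 4 * h + 13) * (?Y * ?Z)" by (rule mult_le_mono2[OF YZ])
    have "a + 2 * b + 7 + (2 * b + 6 + w) = (a + 4 * b + 13) * 1 + w" for a b w :: nat by simp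
    then have "J * (h + 2) + 2 * h + 7 + (2 * h + 6 + (phases d (3 * nlog (n + 1)) y * (nlog C + 1) + 3 * nlog (n + 1)) * \<kappa>)
      = (J * (h + 2) + 4 * h + 13) * 1 + (phases d (3 * nlog (n + 1)) y * (nlog C + 1) + 3 * nlog (n + 1)) * \<kappa>" .
    also note add_mono[OF 2 1]
    also have "(J * (h + 2) + 4 * h + 13) * (?Y * ?Z) + 27 * (?Y * ?Z) * \<kappa> = c0 * (?Y * ?Z)"
    proof -
      have "a * y + 27 * y * k = (a + 27 * k) * y" for a y k :: nat by (simp add: algebra_simps)
      then show ?thesis unfolding c0_def .
    qed
    also have "\<dots> \<le> d ^ c0 * (?Y * ?Z)" using const_less[of c0 n] by (intro mult_le_mono1) (simp add: d_def)
    also have "\<dots> = d ^ (c0 + (j + 1) + J)" by (simp add: power_add)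
    finally show ?thesis by (rule small') (simp add: x_def)
  qed
  show ?thesis
    unfolding n_def[symmetric] m_def[symmetric] d_def[symmetric]
  proof (unfold_locales, unfold n_def[symmetric] m_def[symmetric])
    show "input_placement V E L (F n m ^ h) (S n) inp" using inp by (simp add: n_def m_def)
    show "0 < F n m" by (rule F_pos[OF n1])
    show "d ^ (4 * e) = 2 ^ (4 * (e * q0 n))" using rd by simp
    show "C \<le> 2 ^ nlog C" by (rule nlog)
    show "F n m < d ^ x" using Fd by (intro small'[of _ 1]) (simp_all add: x_def)
    show "d \<le> d ^ x" using pow[of 1 x] by (simp add: x_def)
    show "d ^ (4 * e) \<le> d ^ x" by (rule pow) (simp add: x_def)
    show "20 \<le> d ^ x" using d64 pow[of 3 x] by (simp add: x_def)
    show "F n m ^ h < d ^ x" using Fh by (rule small') (simp add: x_def)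
    show "C < d ^ x" by (rule small'[of _ J]) (use Cd in \<open>simp_all add: x_def\<close>)
    show "2 ^ nlog C < d ^ x"
    proof (rule small'[of _ "J + 1"])
      have "2 ^ nlog C \<le> 2 * d ^ J" using nlog_pow[of C] Cd by linarith
      also have "\<dots> \<le> d * d ^ J" using d4 by simp
      finally show "2 ^ nlog C \<le> d ^ (J + 1)" by simp
    qed (simp add: x_def)
    show "n < d ^ x" using nd by (intro small'[of _ j]) (simp_all add: x_def n_def)
    show "d ^ (4 * e) * (2 * m * 2 ^ (e * q0 n)) < d ^ x"
    proof (rule small'[of _ "4 * e + (1 + 2 * j + e)"])
      have "2 * m * d ^ e \<le> d * d ^ (2 * j) * d ^ e" using md d4 by (intro mult_le_mono) auto
      then have "2 * m * d ^ e \<le> d ^ (1 + 2 * j + e)" by (simp add: power_add)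
      then show "d ^ (4 * e) * (2 * m * 2 ^ (e * q0 n)) \<le> d ^ (4 * e + (1 + 2 * j + e))"
        unfolding kd power_add[of d "4 * e"] by (rule mult_le_mono2)
    qed (simp add: x_def)
    show "4 * m + n < d ^ x"
    proof (rule small'[of _ "2 * j + 2"])
      have "4 * m + n \<le> 16 * d ^ (2 * j)" using md nd2 by simp
      also have "\<dots> \<le> d ^ 2 * d ^ (2 * j)" using d16 by simp
      finally show "4 * m + n \<le> d ^ (2 * j + 2)" unfolding power_add[of d "2 * j"] by (simp only: mult.commute)
    qed (simp add: x_def)
    show "F n m ^ h * Suc (2 * (S n div 3)) < d ^ x"
    proof (rule small'[of _ "h + (3 + 4)"])
      have "Suc (2 * (S n div 3)) \<le> 64 * d ^ 4" using A d1[of 4] by linarith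
      also have "\<dots> \<le> d ^ 3 * d ^ 4" by (rule mult_le_mono1[OF d64])
      finally show "F n m ^ h * Suc (2 * (S n div 3)) \<le> d ^ (h + (3 + 4))"
        unfolding power_add using Fh by (intro mult_le_mono)
    qed (simp add: x_def)
    show "u < d ^ x" if "u \<in> V" for u by (rule small'[of _ J]) (use uJ[OF that] in \<open>simp_all add: x_def\<close>)
    show "u < 2 ^ (e * q0 n)" if "u \<in> V" for u
      unfolding kd using uJ[OF that] pow[of J e] by (simp add: e_def)
    have big: "c * m \<le> d ^ e" if "c \<le> 16 * d ^ J" for c
    proof -
      have "c * m \<le> d ^ 2 * d ^ J * d ^ (2 * j)" using that d16 md
        by (intro mult_le_mono order_trans[OF that]) auto
      also have "\<dots> = d ^ e" by (simp add: e_def power_add power2_eq_square)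
      finally show ?thesis .
    qed
    show "8 * nlog C * m \<le> 2 ^ (e * q0 n)" unfolding kd using q by (intro big) simp
    show "4 * m \<le> 2 ^ (e * q0 n)" unfolding kd using d1[of J] by (intro big) simp
    show "Suc (4 * (2 * d ^ 4)) + 2 * d + 3 * F n m * d \<le> S n - 1" using dsq d1[of 4] unfolding S mult.assoc by linarith
    show "2 * (S n div 3) + 2 * d + 3 * F n m * d \<le> S n - 1" using A dsq d1[of 4] unfolding S mult.assoc by linarith
    show "2 * d ^ 4 + 2 * (S n div 3) \<le> S n - 1" using A d1[of 4] unfolding S by linarith
    show "2 * d ^ 4 > 0" using d4 by simp
    show "2 * d ^ 4 \<le> 2 * (S n div 3)" using A' by linarith
    have MQ: "4 * (m + n) \<le> F n m ^ h * (2 * d ^ 4)" using en unfolding S by (simp add: algebra_simps)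
    show "4 * m + n \<le> F n m ^ h * (2 * d ^ 4)" using MQ by (simp add: n_def)
    show "2 * n \<le> F n m ^ h * (2 * d ^ 4)" using MQ by (simp add: n_def)
    show "J > 0" by (simp add: J_def)
    show "u < d ^ J" if "u \<in> V" for u by (rule uJ[OF that])
    show "S n - 1 + 1 \<le> S n" using S d1[of 4] by simp
    show "4 * (2 * d ^ 4) \<le> S n" by (simp add: S)
    show "(d ^ x) ^ 7 + 2 \<le> 2 ^ B n"
    proof -
      have "2 ^ B n = 4 * (d ^ x) ^ 7" by (simp add: B_def d_def D_def power_add ac_simps flip: power_mult)
      moreover have "1 \<le> (d ^ x) ^ 7" using d4 by simp
      ultimately show ?thesis by linarith
    qed
    show "(d + 2) * (d + 2) \<le> 2 * d ^ 4"
    proof -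
      have "(d + 2) * (d + 2) \<le> (2 * d) * (2 * d)" using d4 by (intro mult_le_mono) auto
      also have "\<dots> = 4 * d ^ 2" by (simp add: power2_eq_square)
      also have "\<dots> \<le> 2 * (d ^ 2 * d ^ 2)" using mult_le_mono1[OF d16, of "d ^ 2"] by linarith
      also have "\<dots> = 2 * d ^ 4" by (simp flip: power_add)
      finally show ?thesis .
    qed
    show "length (setup_prog (F n m) h (2 * d ^ 4) d J (Suc (2 * (S n div 3)))) +
       length (main_prog (F n m) h d (4 * e) (e * q0 n) (nlog C) (2 * d ^ 4) (3 * nlog (n + 1)) (max_degree V E)) < d ^ x"
      using length_main_le[of "F n m" d "e * q0 n" "nlog C" "2 * d ^ 4" "3 * nlog (n + 1)" "max_degree V E"] len[of "max_degree V E"]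
      unfolding length_setup_prog by linarith
  qed (use V d4 inst in auto)
qed

definition "c_rounds = real (J * (h + 2) + 4 * h + 13) + (80 * real j + 12) * real \<kappa>"

lemma rounds_le:
  assumes n: "n \<ge> 1"
  shows "real (length (setup_prog F' h Q' D' J Y) + length (main_prog F' h (D n) (4 * e) k' (nlog C) Q' (3 * nlog (n + 1)) d))
    \<le> c_rounds * (lg d * lg C + lg n)"
proof -
  define ph where "ph = phases (D n) (3 * nlog (n + 1)) d"
  have g: "1 \<le> lg d" "1 \<le> lg C" "1 \<le> lg n" using lg_ge_1 by auto
  have N: "real (3 * nlog (n + 1)) \<le> 12 * lg n" using nlog_add1_lg[of n] by simp
  have j1: "1 \<le> real j" using j by linarith
  have ph: "real ph \<le> 20 * (real j * lg d)"
  proof (cases "d \<le> D n")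
    case True
    have "real ph \<le> 20 * lg d" using nlog_add2_lg[of d] True by (simp add: ph_def phases_def)
    also have "\<dots> \<le> 20 * (real j * lg d)" using j1 g(1) by simp
    finally show ?thesis .
  next
    case False
    \<comment> \<open>Beyond the threshold \<open>n \<le> D n ^ j \<le> d ^ j\<close>, so the number
      of phases, although chosen from \<open>n\<close>, is bounded by a multiple of
      \<open>real j * lg d\<close>.\<close>
    have "real n \<le> real (d ^ j)"
      using n_le[OF n] power_mono[of "D n" d j] False by (simp only: of_nat_le_iff) linarith
    then have "log 2 (real n) \<le> log 2 (real d ^ j)" using n False by (subst log_le_cancel_iff) auto
    also have "\<dots> = real j * log 2 (real d)" using False by (simp add: log_nat_power)
    also have "\<dots> \<le> real j * lg d" using j1 by (intro mult_left_mono) (auto simp: lg_def)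
    finally have "log 2 (real n) \<le> real j * lg d" .
    moreover have "1 \<le> real j * lg d" using mult_mono[OF j1 g(1)] j1 by simp
    ultimately have "lg n \<le> real j * lg d" by (simp add: lg_def)
    moreover have "ph = 3 * nlog (n + 1)" using False by (simp add: ph_def phases_def)
    ultimately show ?thesis using N g(1) j1 by linarith
  qed
  have q: "real (nlog C + 1) \<le> 3 * lg C" using nlog_lg[of C] g(2) by simp
  have "real (ph * (nlog C + 1)) \<le> 20 * (real j * lg d) * (3 * lg C)"
    unfolding of_nat_mult using ph q g(1) by (intro mult_mono) auto
  then have "real (ph * (nlog C + 1) + 3 * nlog (n + 1)) \<le> 60 * real j * (lg d * lg C) + 12 * lg n"
    using N by (simp add: algebra_simps)
  also have "\<dots> \<le> (80 * real j + 12) * (lg d * lg C + lg n)"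
  proof -
    have "0 \<le> lg d * lg C" "0 \<le> real j * (lg d * lg C)" "0 \<le> real j * lg n" using g by auto
    then show ?thesis by (simp add: algebra_simps)
  qed
  finally have 1: "real ((ph * (nlog C + 1) + 3 * nlog (n + 1)) * \<kappa>) \<le> (80 * real j + 12) * (lg d * lg C + lg n) * real \<kappa>"
    unfolding of_nat_mult by (rule mult_right_mono) simp
  have "1 \<le> lg d * lg C + lg n" using g(3) mult_nonneg_nonneg[of "lg d" "lg C"] g by linarith
  then have "real (J * (h + 2) + 4 * h + 13) * 1 \<le> real (J * (h + 2) + 4 * h + 13) * (lg d * lg C + lg n)"
    by (intro mult_left_mono) auto
  then have 2: "real (J * (h + 2) + 4 * h + 13) \<le> real (J * (h + 2) + 4 * h + 13) * (lg d * lg C + lg n)" by (simp only: mult_1_right)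
  have "length (setup_prog F' h Q' D' J Y) + length (main_prog F' h (D n) (4 * e) k' (nlog C) Q' (3 * nlog (n + 1)) d)
    \<le> (J * (h + 2) + 4 * h + 13) + (ph * (nlog C + 1) + 3 * nlog (n + 1)) * \<kappa>"
    using length_main_le[of F' "D n" k' "nlog C" Q' "3 * nlog (n + 1)" d] unfolding length_setup_prog ph_def by linarith
  then have "real (length (setup_prog F' h Q' D' J Y) + length (main_prog F' h (D n) (4 * e) k' (nlog C) Q' (3 * nlog (n + 1)) d))
    \<le> real (J * (h + 2) + 4 * h + 13) + real ((ph * (nlog C + 1) + 3 * nlog (n + 1)) * \<kappa>)"
    unfolding of_nat_add[symmetric] by (simp only: of_nat_le_iff)
  also note add_mono[OF 2 1]
  also have "real (J * (h + 2) + 4 * h + 13) * (lg d * lg C + lg n) + (80 * real j + 12) * (lg d * lg C + lg n) * real \<kappa>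
    = c_rounds * (lg d * lg C + lg n)"
  proof -
    have "a * y + b * y * k = (a + b * k) * y" for a b k y :: real by (simp add: algebra_simps)
    then show ?thesis unfolding c_rounds_def .
  qed
  finally show ?thesis .
qed

lemma c_rounds_nonneg: "0 \<le> c_rounds"
  by (simp add: c_rounds_def)

theorem colors_within:
  assumes inst: "degree_plus_one_instance V E L C"
    and ids: "\<forall>v\<in>V. poly_bounded p (card V) v" and C: "poly_bounded p (card V) C"
    and R: "c_rounds * (lg (max_degree V E) * lg C + lg (card V)) \<le> R"
  shows "mpc_colors_within A (\<lambda>n m. F n m ^ h) S B V E L C R"
  unfolding mpc_colors_within_def Let_def mpc_solves_within_def
proof (intro conjI allI impI)
  interpret ci: coloring_instance V E L C by standard (rule inst)
  let ?M = "F (card V) (card E) ^ h" and ?S = "S (card V)"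
  show "\<exists>inp. input_placement V E L ?M ?S inp"
  proof (rule ci.placement_exists)
    show "3 * card E + card V \<le> ?M * (?S div 3)"
    proof (cases "V = {}")
      case True
      then have "card E = 0" using ci.card_E_le by simp
      then show ?thesis using True by simp
    next
      case False
      then have "1 \<le> card V" using ci.finV by (simp add: Suc_le_eq card_gt_0_iff)
      then have "64 * (card E + card V) \<le> ?M * ?S" by (rule F_enough)
      also have "\<dots> \<le> ?M * (4 * (?S div 3))" using D_ge[of "card V"] self_le_power[of "D (card V)" 4]
        by (intro mult_le_mono2) (simp add: S_def)
      finally show ?thesis by simp
    qed
  qed
  fix inp assume inp: "input_placement V E L ?M ?S inp"
  show "\<exists>T. real T \<le> R \<and>
          (\<forall>t\<le>T. memory_ok ?M ?S (B (card V)) (mpc_run (A (card V) (card E) C) ?M (initial_memory inp) t)) \<and>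
          (\<forall>t<T. traffic_ok (A (card V) (card E) C) ?M ?S (B (card V)) (mpc_run (A (card V) (card E) C) ?M (initial_memory inp) t)) \<and>
          mpc_final (A (card V) (card E) C) V E L ?M ?S (mpc_run (A (card V) (card E) C) ?M (initial_memory inp) T)"
  proof (cases "V = {}")
    case True
    then have E: "E = {}" using ci.card_E_le ci.finE by simp
    \<comment> \<open>Without nodes the least \<open>F\<close> is 0, and as \<open>h > 0\<close>
      there are no machines at all: zero rounds solve the instance.\<close>
    have "F 0 0 = 0" unfolding F_def by (rule Least_equality) auto
    then have M: "?M = 0" using j True E by (simp add: h_def)
    have "0 \<le> lg (max_degree V E) * lg C + lg (card V)"
      using lg_ge_1[of "max_degree V E"] lg_ge_1[of C] lg_ge_1[of "card V"] by simp
    then have "0 \<le> R" using R mult_nonneg_nonneg[OF c_rounds_nonneg] by (meson order_trans)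
    then show ?thesis unfolding M
      by (intro exI[of _ 0]) (simp add: memory_ok_def mpc_final_def list_coloring_def True E)
  next
    case False
    interpret r: run_setting V E L C ?M "2 * D (card V) ^ 4" "F (card V) (card E)" h "D (card V)" "4 * e"
      "e * q0 (card V)" "nlog C" "D (card V) ^ x" "?S - 1" "2 * (?S div 3)" J ?S inp "B (card V)" "3 * nlog (card V + 1)"
      by (rule run_setting_parameters[OF inst False ids C inp])
    have alg: "r.algorithm = A (card V) (card E) C" by (simp only: r.algorithm_def A_def)
    have n1: "1 \<le> card V" using False ci.finV by (simp add: Suc_le_eq card_gt_0_iff)
    have "real r.rounds \<le> R" unfolding r.rounds_def by (rule order_trans[OF rounds_le[OF n1] R])
    then show ?thesis using r.run_correct unfolding alg by blast
  qed
qed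

end

text \<open>\<open>C\<close> is at most \<open>2 ^ q * (d + 1) ^ q\<close>. The logarithm of
  \<open>d + 1\<close> is at most \<open>2 * lg d\<close>, also for \<open>d = 0\<close>, because
  \<open>lg\<close> is at least 1; the factor \<open>2 ^ q\<close> contributes one more
  \<open>lg d\<close> per exponent.\<close>

lemma lg_poly:
  assumes "poly_bounded q d C"
  shows "lg C \<le> (3 * real q + 1) * lg d"
proof (cases "C \<le> 1")
  case True
  \<comment> \<open>Includes \<open>C = 0\<close>, where the convention \<open>ln 0 = 0\<close>
    applies.\<close>
  then have "log 2 (real C) \<le> 1" by (cases C) (auto simp: log_def)
  then have "lg C = 1" by (simp add: lg_def)
  moreover have "0 \<le> 3 * real q * lg d" using lg_ge_1[of d] by simp
  ultimately show ?thesis unfolding distrib_right using lg_ge_1[of d] by linarith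
next
  case False
  have q0: "q > 0" using assms False by (cases q) (auto simp: poly_bounded_def)
  have d: "log 2 (real (d + 1)) \<le> 2 * lg d"
  proof (cases "d = 0")
    case False
    then have "real (d + 1) \<le> 2 * real d" by simp
    then have "log 2 (real (d + 1)) \<le> log 2 (2 * real d)" by (subst log_le_cancel_iff) auto
    also have "\<dots> = 1 + log 2 (real d)" using False by (simp add: log_mult)
    finally show ?thesis by (simp add: lg_def)
  qed (use lg_ge_1[of d] in simp)
  have "real C \<le> real (2 ^ q * (d + 1) ^ q)"
  proof -
    have "q * (d + 1) ^ q \<le> 2 ^ q * (d + 1) ^ q" using less_exp[of q] by (intro mult_le_mono1) simp
    then have "C \<le> 2 ^ q * (d + 1) ^ q" using assms unfolding poly_bounded_def by (rule order_trans[rotated])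
    then show ?thesis by (simp only: of_nat_le_iff)
  qed
  then have "log 2 (real C) \<le> log 2 (2 ^ q * real (d + 1) ^ q)" using False by (simp add: add_pos_nonneg)
  also have "\<dots> = real q + real q * log 2 (real (d + 1))"
    by (simp add: log_mult log_nat_power add_pos_nonneg)
  also have "\<dots> \<le> real q * lg d + real q * (2 * lg d)" using d lg_ge_1[of d]
    by (intro add_mono mult_left_mono) (simp_all add: mult_le_cancel_left1)
  also have "\<dots> = 3 * real q * lg d" by (simp add: algebra_simps)
  finally have "log 2 (real C) \<le> 3 * real q * lg d" .
  moreover have "0 \<le> 3 * real q * lg d" using lg_ge_1[of d] by simp
  ultimately show ?thesis using lg_ge_1[of d] unfolding distrib_right lg_def[of C] by (intro max.boundedI; linarith)
qed

theorem theorem1p5: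
  fixes \<alpha> :: real and p :: nat
  assumes "0 < \<alpha>" and "\<alpha> < 1"
  shows "\<exists>A M S B. sublinear_resources \<alpha> M S B \<and>
    (\<exists>c. \<forall>V E L C.
       degree_plus_one_instance V E L C \<and>
       (\<forall>v\<in>V. poly_bounded p (card V) v) \<and> poly_bounded p (card V) C \<longrightarrow>
       mpc_colors_within A M S B V E L C
         (c * (lg (max_degree V E) * lg C + lg (card V)))) \<and>
    (\<forall>q. \<exists>c. \<forall>V E L C.
       degree_plus_one_instance V E L C \<and>
       (\<forall>v\<in>V. poly_bounded p (card V) v) \<and> poly_bounded p (card V) C \<and>
       poly_bounded q (max_degree V E) C \<longrightarrow>
       mpc_colors_within A M S B V E L C
         (c * ((lg (max_degree V E))\<^sup>2 + lg (card V))))"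
proof -
  interpret sl: sublinear \<alpha> p by standard (rule assms)+
  have 1: "\<exists>c. \<forall>V E L C.
       degree_plus_one_instance V E L C \<and>
       (\<forall>v\<in>V. poly_bounded p (card V) v) \<and> poly_bounded p (card V) C \<longrightarrow>
       mpc_colors_within sl.A (\<lambda>n m. sl.F n m ^ sl.h) sl.S sl.B V E L C
         (c * (lg (max_degree V E) * lg C + lg (card V)))"
    using sl.colors_within by (intro exI[of _ sl.c_rounds]) blast
  have 2: "\<exists>c. \<forall>V E L C.
       degree_plus_one_instance V E L C \<and>
       (\<forall>v\<in>V. poly_bounded p (card V) v) \<and> poly_bounded p (card V) C \<and>
       poly_bounded q (max_degree V E) C \<longrightarrow>
       mpc_colors_within sl.A (\<lambda>n m. sl.F n m ^ sl.h) sl.S sl.B V E L C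
         (c * ((lg (max_degree V E))\<^sup>2 + lg (card V)))" for q
  \<comment> \<open>By \<open>lg_poly\<close> the product of the two logarithms costs the factor
    \<open>3 * real q + 1\<close>; applying it to the second summand as well keeps a single
    constant.\<close>
  proof (intro exI[of _ "sl.c_rounds * (3 * real q + 1)"] allI impI, elim conjE)
    fix V E L C
    assume a: "degree_plus_one_instance V E L C" "\<forall>v\<in>V. poly_bounded p (card V) v" "poly_bounded p (card V) C"
      and q: "poly_bounded q (max_degree V E) C"
    define d where "d = max_degree V E"
    have "lg d * lg C \<le> lg d * ((3 * real q + 1) * lg d)"
      using lg_poly[OF q] lg_ge_1[of d] by (intro mult_left_mono) (simp_all add: d_def)
    moreover have "lg (card V) \<le> (3 * real q + 1) * lg (card V)" using lg_ge_1[of "card V"] by (simp add: distrib_right)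
    ultimately have "lg d * lg C + lg (card V) \<le> (3 * real q + 1) * ((lg d)\<^sup>2 + lg (card V))"
      by (simp add: algebra_simps power2_eq_square)
    then have "sl.c_rounds * (lg d * lg C + lg (card V)) \<le> sl.c_rounds * (3 * real q + 1) * ((lg d)\<^sup>2 + lg (card V))"
      using sl.c_rounds_nonneg by (metis mult.assoc mult_left_mono)
    then show "mpc_colors_within sl.A (\<lambda>n m. sl.F n m ^ sl.h) sl.S sl.B V E L C
         (sl.c_rounds * (3 * real q + 1) * ((lg (max_degree V E))\<^sup>2 + lg (card V)))"
      unfolding d_def by (rule sl.colors_within[OF a])
  qed
  show ?thesis
    using sl.resources 1 2 by (intro exI[of _ sl.A] exI[of _ "\<lambda>n m. sl.F n m ^ sl.h"] exI[of _ sl.S] exI[of _ sl.B]) blast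
qed

end
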